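(* Let $r\ge c>0$, $n_0,\dots,n_r>0$ and $m\ge 0$ be integers, $n:=n_0+\dots+n_r$, let $A=(a_0,\dots,a_r)$ be a complex $(c+1)\times(r+1)$ matrix of full rank with pairwise linearly independent columns, let $l_i=(l_{i1},\dots,l_{in_i})$, $i=0,\dots,r$, be tuples of positive integers and let $P_0$ be the $r\times(n+m)$ integer matrix whose $i$-th row ($1\le i\le r$) is $(-l_0,0,\dots,0,l_i,0,\dots,0,0,\dots,0)$ (the block $-l_0$ in the columns indexed by $(0,1),\dots,(0,n_0)$, the block $l_i$ in the columns indexed by $(i,1),\dots,(i,n_i)$, zeros elsewhere, in particular in the last $m$ columns). Let $$R(A,P_0):=\mathbb{C}[T_{ij},S_k]/\langle g_v;\ v\in\ker(A)\rangle,\qquad g_v:=v_0T_0^{l_0}+\dots+v_rT_r^{l_r},\quad T_i^{l_i}:=T_{i1}^{l_{i1}}\cdots T_{in_i}^{l_{in_i}},$$ graded by $K_0:=\mathbb{Z}^{n+m}/\operatorname{im}(P_0^* )$ via $\deg T_{ij}:=Q_0(e_{ij})$, $\deg S_k:=Q_0(e_k)$, where $Q_0\colon\mathbb{Z}^{n+m}\to K_0$ is the projection. Then $R(A,P_0)$ is an integral, normal, complete intersection ring with $$\dim R(A,P_0)=n+m-r+c,\qquad R(A,P_0)^*=\mathbb{C}^*,$$ and the $K_0$-grading is effective, pointed, factorial and of complexity $c$.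
   Context: Here $\mathbb{C}[T_{ij},S_k]$ is the polynomial ring in variables $T_{ij}$ ($0\le i\le r$, $1\le j\le n_i$) and $S_k$ ($1\le k\le m$), and $e_{ij}$, $e_k$ denote the corresponding canonical basis vectors of $\mathbb{Z}^{n+m}$. For a finitely generated abelian group $K$ and a $K$-graded $\mathbb{C}$-algebra $B=\bigoplus_{w\in K}B_w$: the grading is effective if the $w$ with $B_w\neq 0$ generate $K$; it is pointed if $B_w\ne 0\ne B_{-w}$ holds only for torsion elements $w$ and $B_0=\mathbb{C}$; $B$ is $K$-integral if it has no homogeneous zero divisors; a $K$-prime element is a nonzero homogeneous non-unit $f$ such that whenever $f$ divides a product of homogeneous elements it divides one of the factors; the grading is (K-)factorial if $B$ is $K$-integral and every nonzero homogeneous non-unit is a product of $K$-primes; the complexity of the grading is $\dim B-\operatorname{rk}K$. *)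

theory Defs
  imports Complex_Main "HOL-Library.Poly_Mapping" "HOL-Library.Function_Algebras"
begin

datatype var = T nat nat | S nat

type_synonym mpoly = "(var \<Rightarrow>\<^sub>0 nat) \<Rightarrow>\<^sub>0 complex"

definition vars :: "nat \<Rightarrow> (nat \<Rightarrow> nat) \<Rightarrow> nat \<Rightarrow> var set" where
  "vars r n m = {T i j | i j. i \<le> r \<and> 1 \<le> j \<and> j \<le> n i} \<union> {S k | k. 1 \<le> k \<and> k \<le> m}"

definition Pring :: "var set \<Rightarrow> mpoly set" where
  "Pring V = {f :: mpoly. \<forall>mon\<in>Poly_Mapping.keys f. Poly_Mapping.keys mon \<subseteq> V}"

definition const :: "complex \<Rightarrow> mpoly" where
  "const a = Poly_Mapping.single 0 a"

definition ideal_gen :: "var set \<Rightarrow> mpoly set \<Rightarrow> mpoly set" where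
  "ideal_gen V G = {f. \<exists>F c. finite F \<and> F \<subseteq> G \<and> (\<forall>g\<in>F. c g \<in> Pring V) \<and> f = (\<Sum>g\<in>F. c g * g)}"

definition is_ideal :: "var set \<Rightarrow> mpoly set \<Rightarrow> bool" where
  "is_ideal V J \<longleftrightarrow> J \<subseteq> Pring V \<and> 0 \<in> J \<and> (\<forall>a\<in>J. \<forall>b\<in>J. a + b \<in> J)
     \<and> (\<forall>a\<in>J. \<forall>s\<in>Pring V. s * a \<in> J)"

definition is_prime_ideal :: "var set \<Rightarrow> mpoly set \<Rightarrow> bool" where
  "is_prime_ideal V J \<longleftrightarrow> is_ideal V J \<and> 1 \<notin> J \<and>
     (\<forall>a\<in>Pring V. \<forall>b\<in>Pring V. a * b \<in> J \<longrightarrow> a \<in> J \<or> b \<in> J)"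

definition quot_integral :: "var set \<Rightarrow> mpoly set \<Rightarrow> bool" where
  "quot_integral V I \<longleftrightarrow> is_prime_ideal V I"

text \<open>R is normal: integrally closed in its field of fractions. An element a/b
 (b not in I) of the fraction field that satisfies a monic equation over R
 (multiplied through by b^d) lies in R.\<close>
definition quot_normal :: "var set \<Rightarrow> mpoly set \<Rightarrow> bool" where
  "quot_normal V I \<longleftrightarrow>
    (\<forall>a\<in>Pring V. \<forall>b\<in>Pring V. b \<notin> I \<longrightarrow>
      (\<exists>d::nat. \<exists>cs. d > 0 \<and> (\<forall>i<d. cs i \<in> Pring V) \<and>
          a ^ d + (\<Sum>i<d. cs i * a ^ i * b ^ (d - i)) \<in> I)
      \<longrightarrow> (\<exists>q\<in>Pring V. a - q * b \<in> I))"

definition prime_chain :: "var set \<Rightarrow> mpoly set \<Rightarrow> nat \<Rightarrow> bool" where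
  "prime_chain V I d \<longleftrightarrow> (\<exists>P :: nat \<Rightarrow> mpoly set.
      (\<forall>i\<le>d. is_prime_ideal V (P i) \<and> I \<subseteq> P i) \<and> (\<forall>i<d. P i \<subset> P (Suc i)))"

definition krull_dim :: "var set \<Rightarrow> mpoly set \<Rightarrow> nat" where
  "krull_dim V I = (GREATEST d. prime_chain V I d)"

text \<open>R = Pring V / I is a complete intersection: I is generated by
 height(I) = dim (Pring V) - dim R = card V - dim R elements.\<close>
definition quot_complete_intersection :: "var set \<Rightarrow> mpoly set \<Rightarrow> bool" where
  "quot_complete_intersection V I \<longleftrightarrow>
     (\<exists>gs. set gs \<subseteq> Pring V \<and> length gs = card V - krull_dim V I \<and> ideal_gen V (set gs) = I)"

definition quot_unit :: "var set \<Rightarrow> mpoly set \<Rightarrow> mpoly \<Rightarrow> bool" where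
  "quot_unit V I f \<longleftrightarrow> f \<in> Pring V \<and> (\<exists>g\<in>Pring V. f * g - 1 \<in> I)"

definition units_are_constants :: "var set \<Rightarrow> mpoly set \<Rightarrow> bool" where
  "units_are_constants V I \<longleftrightarrow>
     (\<forall>f\<in>Pring V. quot_unit V I f \<longleftrightarrow> (\<exists>a. a \<noteq> 0 \<and> f - const a \<in> I))"

definition quot_dvd :: "var set \<Rightarrow> mpoly set \<Rightarrow> mpoly \<Rightarrow> mpoly \<Rightarrow> bool" where
  "quot_dvd V I f g \<longleftrightarrow> (\<exists>q\<in>Pring V. g - q * f \<in> I)"

text \<open>Elements of Z^V: integer vectors supported on V. The grading group is
 K = Z^V / L for a subgroup L; w represents its class.\<close>
definition ZV :: "var set \<Rightarrow> (var \<Rightarrow> int) set" where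
  "ZV V = {w. \<forall>v. v \<notin> V \<longrightarrow> w v = 0}"

definition expvec :: "(var \<Rightarrow>\<^sub>0 nat) \<Rightarrow> var \<Rightarrow> int" where
  "expvec \<mu> = (\<lambda>v. int (Poly_Mapping.lookup \<mu> v))"

definition hom_of_deg :: "var set \<Rightarrow> (var \<Rightarrow> int) set \<Rightarrow> (var \<Rightarrow> int) \<Rightarrow> mpoly \<Rightarrow> bool" where
  "hom_of_deg V L w f \<longleftrightarrow> f \<in> Pring V \<and> (\<forall>\<mu>\<in>Poly_Mapping.keys f. expvec \<mu> - w \<in> L)"

definition homog :: "var set \<Rightarrow> (var \<Rightarrow> int) set \<Rightarrow> mpoly \<Rightarrow> bool" where
  "homog V L f \<longleftrightarrow> (\<exists>w\<in>ZV V. hom_of_deg V L w f)"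

definition deg_nonzero :: "var set \<Rightarrow> (var \<Rightarrow> int) set \<Rightarrow> mpoly set \<Rightarrow> (var \<Rightarrow> int) \<Rightarrow> bool" where
  "deg_nonzero V L I w \<longleftrightarrow> (\<exists>f. hom_of_deg V L w f \<and> f \<notin> I)"

definition grading_effective :: "var set \<Rightarrow> (var \<Rightarrow> int) set \<Rightarrow> mpoly set \<Rightarrow> bool" where
  "grading_effective V L I \<longleftrightarrow>
     (\<forall>u\<in>ZV V. \<exists>F z. finite F \<and> F \<subseteq> {w\<in>ZV V. deg_nonzero V L I w} \<and>
        u - (\<Sum>w\<in>F. (\<lambda>v. z w * w v)) \<in> L)"

definition K_torsion :: "(var \<Rightarrow> int) set \<Rightarrow> (var \<Rightarrow> int) \<Rightarrow> bool" where
  "K_torsion L w \<longleftrightarrow> (\<exists>k::int. k > 0 \<and> (\<lambda>v. k * w v) \<in> L)"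

definition grading_pointed :: "var set \<Rightarrow> (var \<Rightarrow> int) set \<Rightarrow> mpoly set \<Rightarrow> bool" where
  "grading_pointed V L I \<longleftrightarrow>
     (\<forall>w\<in>ZV V. deg_nonzero V L I w \<and> deg_nonzero V L I (- w) \<longrightarrow> K_torsion L w) \<and>
     (\<forall>f. hom_of_deg V L 0 f \<longrightarrow> (\<exists>a. f - const a \<in> I))"

definition K_integral :: "var set \<Rightarrow> (var \<Rightarrow> int) set \<Rightarrow> mpoly set \<Rightarrow> bool" where
  "K_integral V L I \<longleftrightarrow> 1 \<notin> I \<and>
     (\<forall>f g. homog V L f \<and> homog V L g \<and> f * g \<in> I \<longrightarrow> f \<in> I \<or> g \<in> I)"

definition K_prime :: "var set \<Rightarrow> (var \<Rightarrow> int) set \<Rightarrow> mpoly set \<Rightarrow> mpoly \<Rightarrow> bool" where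
  "K_prime V L I f \<longleftrightarrow> homog V L f \<and> f \<notin> I \<and> \<not> quot_unit V I f \<and>
     (\<forall>g h. homog V L g \<and> homog V L h \<and> quot_dvd V I f (g * h)
        \<longrightarrow> quot_dvd V I f g \<or> quot_dvd V I f h)"

definition K_factorial :: "var set \<Rightarrow> (var \<Rightarrow> int) set \<Rightarrow> mpoly set \<Rightarrow> bool" where
  "K_factorial V L I \<longleftrightarrow> K_integral V L I \<and>
     (\<forall>f. homog V L f \<and> f \<notin> I \<and> \<not> quot_unit V I f \<longrightarrow>
        (\<exists>ps. (\<forall>p\<in>set ps. K_prime V L I p) \<and> f - prod_list ps \<in> I))"

definition Z_indep :: "(var \<Rightarrow> int) set \<Rightarrow> bool" where
  "Z_indep B \<longleftrightarrow> finite B \<and>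
     (\<forall>z. (\<Sum>b\<in>B. (\<lambda>v. z b * b v)) = 0 \<longrightarrow> (\<forall>b\<in>B. z b = 0))"

definition K_rank :: "var set \<Rightarrow> (var \<Rightarrow> int) set \<Rightarrow> nat" where
  "K_rank V L = card V - (GREATEST k. \<exists>B. B \<subseteq> L \<and> Z_indep B \<and> card B = k)"

definition grading_complexity :: "var set \<Rightarrow> (var \<Rightarrow> int) set \<Rightarrow> mpoly set \<Rightarrow> int" where
  "grading_complexity V L I = int (krull_dim V I) - int (K_rank V L)"

definition Tmon :: "(nat \<Rightarrow> nat) \<Rightarrow> (nat \<Rightarrow> nat \<Rightarrow> nat) \<Rightarrow> nat \<Rightarrow> (var \<Rightarrow>\<^sub>0 nat)" where
  "Tmon n l i = (\<Sum>j\<in>{1..n i}. Poly_Mapping.single (T i j) (l i j))"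

definition gpoly :: "nat \<Rightarrow> (nat \<Rightarrow> nat) \<Rightarrow> (nat \<Rightarrow> nat \<Rightarrow> nat) \<Rightarrow> (nat \<Rightarrow> complex) \<Rightarrow> mpoly" where
  "gpoly r n l v = (\<Sum>i\<le>r. Poly_Mapping.single (Tmon n l i) (v i))"

definition kerA :: "nat \<Rightarrow> nat \<Rightarrow> (nat \<Rightarrow> nat \<Rightarrow> complex) \<Rightarrow> (nat \<Rightarrow> complex) set" where
  "kerA c r A = {v. (\<forall>j. j > r \<longrightarrow> v j = 0) \<and> (\<forall>i\<le>c. (\<Sum>j\<le>r. A i j * v j) = 0)}"

definition IAP :: "nat \<Rightarrow> nat \<Rightarrow> (nat \<Rightarrow> nat) \<Rightarrow> nat \<Rightarrow> (nat \<Rightarrow> nat \<Rightarrow> nat) \<Rightarrow> (nat \<Rightarrow> nat \<Rightarrow> complex) \<Rightarrow> mpoly set" where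
  "IAP c r n m l A = ideal_gen (vars r n m) {gpoly r n l v | v. v \<in> kerA c r A}"

definition P0row :: "(nat \<Rightarrow> nat) \<Rightarrow> (nat \<Rightarrow> nat \<Rightarrow> nat) \<Rightarrow> nat \<Rightarrow> var \<Rightarrow> int" where
  "P0row n l i = (\<lambda>x. case x of
      T a j \<Rightarrow> (if 1 \<le> j \<and> j \<le> n a then
                  (if a = 0 then - int (l 0 j) else if a = i then int (l i j) else 0) else 0)
    | S k \<Rightarrow> 0)"

definition imP0 :: "nat \<Rightarrow> (nat \<Rightarrow> nat) \<Rightarrow> (nat \<Rightarrow> nat \<Rightarrow> nat) \<Rightarrow> (var \<Rightarrow> int) set" where
  "imP0 r n l = {(\<Sum>i\<in>{1..r}. (\<lambda>v. z i * P0row n l i v)) | z. True}"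

end

theory Submission
  imports Defs "HOL-Complex_Analysis.Complex_Analysis"
begin

text \<open>Express the columns of \<open>A\<close> in a basis consisting of \<open>c + 1\<close> of them. Modulo the
  ideal, every \<open>T\<^sub>i\<^bsup>l\<^sub>i\<^esup>\<close> is then a linear form \<open>ell\<^sub>i\<close> in \<open>c + 1\<close> coordinates \<open>w\<^sub>j\<close>, and the
  \<open>ell\<^sub>i\<close> are pairwise non-proportional. Choose one variable \<open>T\<^bsub>i,J(i)\<^esub>\<close> in each block: the other
  variables and the \<open>w\<^sub>j\<close> can be prescribed freely, and the chosen variables are roots of functions
  of them. This gives a holomorphic chart of the variety. After inverting the monomial \<open>D\<^sub>J\<close> in the
  other variables, the ring is free over the polynomial ring in the chart coordinates, with basis the
  products \<open>\<Prod>\<^sub>i T\<^bsub>i,J(i)\<^esub>\<^bsup>\<kappa>\<^sub>i\<^esup>\<close>, \<open>\<kappa>\<^sub>i < l\<^bsub>i,J(i)\<^esub>\<close>; independence follows by comparing residues of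
  logarithmic derivatives. Hence the ideal consists of the polynomials vanishing on the chart, is
  prime by the identity theorem, and the dimension is the number of chart coordinates.

  A homogeneous element is a monomial times a form in the \<open>w\<^sub>j\<close>. So the variables and the
  irreducible forms other than the \<open>ell\<^sub>i\<close> are \<open>K\<^sub>0\<close>-prime, and unique factorization of forms gives
  factoriality.

  For normality, let \<open>a / b\<close> be almost integral. Averaging over roots of unity and comparing
  multiplicities of primes in the polynomial ring of a chart shows that \<open>D\<^sub>J\<^sup>M a / b\<close> lies in the ring
  for some \<open>M\<close>. Every variable is missing from some \<open>D\<^sub>J\<close>, and distinct variables form regular
  sequences, so the denominators cancel.\<close>

section \<open>Polynomials and substitutions\<close>

text \<open>The obstacle is primality of the ideal, which cannot be read off its generators. The
  identity theorem on the chart yields only a prime ideal containing \<open>I\<close>. For equality,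
  let \<open>f\<close> vanish on the chart. Then \<open>D\<^sub>J\<^sup>K f\<close> is congruent to
  a combination of the basis products, all coefficients vanish by independence, and
  \<open>D\<^sub>J\<^sup>K f\<close> lies in \<open>I\<close>. The factor
  \<open>D\<^sub>J\<^sup>K\<close> must be cancelled before primality is known; this is done with
  the grading: each \<open>K\<^sub>0\<close>-component is congruent to a monomial times a form, and
  such a product lies in \<open>I\<close> only if the form is zero.

  The chart gives only the lower bound for the dimension. The upper bound is combinatorial: a chain
  of length \<open>d\<close> yields \<open>d\<close> variables without relation in \<open>I\<close>,
  and they contain at most \<open>c + 1\<close> complete blocks.

  That the forms are pairwise non-proportional is used three times: it separates the branch points
  in the residue argument, it makes the variables prime, and it keeps the prime factors apart in the
  valuation argument for normality.\<close>

instantiation var :: linorder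
begin

text \<open>Some linear order on the variables is needed: it orders the exponents linearly, and
  through this order the type \<open>mpoly\<close> becomes an integral domain.\<close>

fun less_var :: "var \<Rightarrow> var \<Rightarrow> bool" where
  "less_var (T i j) (T i' j') \<longleftrightarrow> i < i' \<or> i = i' \<and> j < j'"
| "less_var (T i j) (S k) \<longleftrightarrow> True"
| "less_var (S k) (T i j) \<longleftrightarrow> False"
| "less_var (S k) (S k') \<longleftrightarrow> k < k'"

definition less_eq_var :: "var \<Rightarrow> var \<Rightarrow> bool" where
  "less_eq_var a b \<longleftrightarrow> a < b \<or> a = b"

instance
proof
  fix x y z :: var
  show "x < y \<longleftrightarrow> x \<le> y \<and> \<not> y \<le> x"
    by (cases x; cases y) (auto simp: less_eq_var_def)
  show "x \<le> x" by (simp add: less_eq_var_def)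
  show "x \<le> y \<Longrightarrow> y \<le> z \<Longrightarrow> x \<le> z"
    by (cases x; cases y; cases z) (auto simp: less_eq_var_def)
  show "x \<le> y \<Longrightarrow> y \<le> x \<Longrightarrow> x = y"
    by (cases x; cases y) (auto simp: less_eq_var_def)
  show "x \<le> y \<or> y \<le> x"
    by (cases x; cases y) (auto simp: less_eq_var_def)
qed

end


abbreviation lk :: "('a \<Rightarrow>\<^sub>0 'b::zero) \<Rightarrow> 'a \<Rightarrow> 'b" where
  "lk \<equiv> Poly_Mapping.lookup"

abbreviation ks :: "('a \<Rightarrow>\<^sub>0 'b::zero) \<Rightarrow> 'a set" where
  "ks \<equiv> Poly_Mapping.keys"

abbreviation sg :: "'a \<Rightarrow> 'b \<Rightarrow> ('a \<Rightarrow>\<^sub>0 'b::zero)" where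
  "sg \<equiv> Poly_Mapping.single"

definition Xv :: "var \<Rightarrow> mpoly" where
  "Xv v = sg (sg v 1) 1"

definition mon :: "(var \<Rightarrow> 'b::comm_monoid_mult) \<Rightarrow> (var \<Rightarrow>\<^sub>0 nat) \<Rightarrow> 'b" where
  "mon x \<mu> = (\<Prod>v\<in>ks \<mu>. x v ^ lk \<mu> v)"

definition ring_map :: "('a::comm_ring_1 \<Rightarrow> 'b::comm_ring_1) \<Rightarrow> bool" where
  "ring_map c \<longleftrightarrow> c 1 = 1 \<and> (\<forall>a b. c (a + b) = c a + c b) \<and> (\<forall>a b. c (a * b) = c a * c b)"

text \<open>The free coefficient map \<open>c\<close> lets one notion cover values at points
  (\<open>c\<close> the identity), substitution of polynomials (\<open>c = const\<close>) and
  passage to univariate polynomials over \<open>mpoly\<close>.\<close>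

definition ev :: "(complex \<Rightarrow> 'b::comm_ring_1) \<Rightarrow> (var \<Rightarrow> 'b) \<Rightarrow> mpoly \<Rightarrow> 'b" where
  "ev c x f = (\<Sum>\<mu>\<in>ks f. c (lk f \<mu>) * mon x \<mu>)"

lemma ring_mapI:
  assumes "c 1 = 1" "\<And>a b. c (a + b) = c a + c b" "\<And>a b. c (a * b) = c a * c b"
  shows "ring_map c"
  using assms by (simp add: ring_map_def)

lemma
  assumes "ring_map c"
  shows ring_map_1: "c 1 = 1"
    and ring_map_add: "c (a + b) = c a + c b"
    and ring_map_mult: "c (a * b) = c a * c b"
    and ring_map_0: "c 0 = 0"
    and ring_map_uminus: "c (- a) = - c a"
    and ring_map_diff: "c (a - b) = c a - c b"
    and ring_map_sum: "c (sum F A) = (\<Sum>x\<in>A. c (F x))"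
    and ring_map_prod: "c (prod F A) = (\<Prod>x\<in>A. c (F x))"
    and ring_map_power: "c (a ^ k) = c a ^ k"
proof -
  show 1: "c 1 = 1" and a: "\<And>a b. c (a + b) = c a + c b" and m: "\<And>a b. c (a * b) = c a * c b"
    using assms by (simp_all add: ring_map_def)
  show z: "c 0 = 0" using a[of 0 0] by simp
  show u: "c (- a) = - c a" for a using a[of a "- a"] z by (simp add: eq_neg_iff_add_eq_0 add.commute)
  show "c (a - b) = c a - c b" using a[of a "- b"] u by simp
  show "c (sum F A) = (\<Sum>x\<in>A. c (F x))"
    by (induction A rule: infinite_finite_induct) (simp_all add: z a)
  show "c (prod F A) = (\<Prod>x\<in>A. c (F x))"
    by (induction A rule: infinite_finite_induct) (simp_all add: 1 m)
  show "c (a ^ k) = c a ^ k" by (induction k) (simp_all add: 1 m)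
qed

lemma ring_map_id: "ring_map (\<lambda>x. x)"
  by (simp add: ring_map_def)

lemma ring_map_const: "ring_map const"
  by (simp add: ring_map_def const_def single_add mult_single flip: single_one)

lemmas const_simps = ring_map_1[OF ring_map_const] ring_map_0[OF ring_map_const]
lemmas const_hom = ring_map_add[OF ring_map_const] ring_map_mult[OF ring_map_const]
  ring_map_uminus[OF ring_map_const] ring_map_diff[OF ring_map_const] ring_map_power[OF ring_map_const]

declare const_simps [simp]

lemma const_eq_iff [simp]: "const a = const b \<longleftrightarrow> a = b"
  by (metis const_def lookup_single_eq)

lemma const_eq_0_iff [simp]: "const a = 0 \<longleftrightarrow> a = 0"
  by (metis const_eq_iff const_simps(2))

lemma mon_superset: "finite A \<Longrightarrow> ks \<mu> \<subseteq> A \<Longrightarrow> mon x \<mu> = (\<Prod>v\<in>A. x v ^ lk \<mu> v)"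
  unfolding mon_def by (intro prod.mono_neutral_left) (auto simp: in_keys_iff)

lemma mon_zero [simp]: "mon x 0 = 1"
  by (simp add: mon_def)

lemma mon_single [simp]: "mon x (sg v k) = x v ^ k"
  by (subst mon_superset[of "{v}"]) auto

lemma mon_add: "mon x (\<mu> + \<nu>) = mon x \<mu> * mon x \<nu>"
proof -
  have "ks (\<mu> + \<nu>) \<subseteq> ks \<mu> \<union> ks \<nu>" by (rule keys_add)
  then show ?thesis
    by (simp add: mon_superset[of "ks \<mu> \<union> ks \<nu>"] lookup_add power_add prod.distrib)
qed

lemma mon_sum: "finite A \<Longrightarrow> mon x (sum f A) = (\<Prod>a\<in>A. mon x (f a))"
  by (induction A rule: finite_induct) (simp_all add: mon_add)

lemma mon_cong: "(\<And>v. v \<in> ks \<mu> \<Longrightarrow> x v = y v) \<Longrightarrow> mon x \<mu> = mon y \<mu>"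
  by (simp add: mon_def)

lemma mon_mult_fun: "mon (\<lambda>v. x v * y v) \<mu> = mon x \<mu> * mon y \<mu>"
  by (simp add: mon_def power_mult_distrib prod.distrib)

lemma ring_map_mon: "ring_map c \<Longrightarrow> c (mon x \<mu>) = mon (\<lambda>v. c (x v)) \<mu>"
  by (simp add: mon_def ring_map_prod ring_map_power)

lemma sum_single_lk: "(\<Sum>\<mu>\<in>ks f. sg \<mu> (lk f \<mu>)) = f"
  by (rule poly_mapping_eqI)
     (auto simp: lookup_sum lookup_single when_def sum.delta not_in_keys_iff_lookup_eq_zero)

lemma mpoly_induct [case_names single add]:
  assumes "\<And>\<mu> a. P (sg \<mu> a)" "\<And>f g. P f \<Longrightarrow> P g \<Longrightarrow> P (f + g)"
  shows "P (f :: ('a \<Rightarrow>\<^sub>0 nat) \<Rightarrow>\<^sub>0 'b::comm_monoid_add)"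
proof -
  have "P (\<Sum>\<mu>\<in>A. sg \<mu> (lk f \<mu>))" if "finite A" for A
    using that
  proof (induction A rule: finite_induct)
    case empty
    show ?case using assms(1)[of 0 0] by simp
  qed (auto intro: assms)
  from this[of "ks f"] show ?thesis by (simp add: sum_single_lk)
qed

lemma monomial_induct [consumes 1, case_names zero add]:
  assumes "ks \<mu> \<subseteq> V" "P 0" "\<And>v \<nu>. v \<in> V \<Longrightarrow> ks \<nu> \<subseteq> V \<Longrightarrow> P \<nu> \<Longrightarrow> P (sg v 1 + \<nu>)"
  shows "P (\<mu> :: 'a \<Rightarrow>\<^sub>0 nat)"
  using assms(1)
proof (induction "\<Sum>v\<in>ks \<mu>. lk \<mu> v" arbitrary: \<mu> rule: less_induct)
  case less
  show ?case
  proof (cases "\<mu> = 0")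
    case False
    then obtain v where v: "v \<in> ks \<mu>" by (metis all_not_in_conv keys_eq_empty)
    define \<nu> where "\<nu> = \<mu> - sg v 1"
    have pos: "lk \<mu> v > 0" using v by (simp add: in_keys_iff)
    have eq: "\<mu> = sg v 1 + \<nu>"
      by (rule poly_mapping_eqI) (use pos in \<open>auto simp: \<nu>_def lookup_add lookup_minus lookup_single when_def\<close>)
    have ks: "ks \<nu> \<subseteq> ks \<mu>" by (auto simp: in_keys_iff \<nu>_def lookup_minus)
    have "(\<Sum>v\<in>ks \<nu>. lk \<nu> v) = (\<Sum>v\<in>ks \<mu>. lk \<nu> v)"
      by (rule sum.mono_neutral_left) (use ks in \<open>auto simp: in_keys_iff\<close>)
    also have "\<dots> < (\<Sum>v\<in>ks \<mu>. lk \<mu> v)"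
      by (rule sum_strict_mono_ex1)
         (use v pos in \<open>auto simp: \<nu>_def lookup_minus lookup_single intro!: bexI[of _ v]\<close>)
    finally have "P \<nu>" using less ks by blast
    then show ?thesis using assms(3)[of v \<nu>] less.prems ks v eq by auto
  qed (use assms in simp)
qed

lemma ev_superset:
  assumes "ring_map c" "finite A" "ks f \<subseteq> A"
  shows "ev c x f = (\<Sum>\<mu>\<in>A. c (lk f \<mu>) * mon x \<mu>)"
  unfolding ev_def using assms
  by (intro sum.mono_neutral_left) (auto simp: in_keys_iff ring_map_0)

lemma ev_single: "ring_map c \<Longrightarrow> ev c x (sg \<mu> a) = c a * mon x \<mu>"
  by (subst ev_superset[of c "{\<mu>}"]) auto

lemma ev_add: assumes "ring_map c" shows "ev c x (f + g) = ev c x f + ev c x g"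
proof -
  have "ks (f + g) \<subseteq> ks f \<union> ks g" by (rule keys_add)
  then show ?thesis
    by (simp add: ev_superset[OF assms, of "ks f \<union> ks g"] lookup_add ring_map_add[OF assms]
        distrib_right sum.distrib)
qed

lemma ev_mult: assumes "ring_map c" shows "ev c x (f * g) = ev c x f * ev c x g"
proof (induction f rule: mpoly_induct)
  case (single \<mu> a)
  show ?case
  proof (induction g rule: mpoly_induct)
    case (single \<nu> b)
    show ?case
      by (simp add: mult_single ev_single[OF assms] ring_map_mult[OF assms] mon_add mult_ac)
  qed (simp add: ev_add[OF assms] algebra_simps)
qed (simp add: ev_add[OF assms] algebra_simps)

lemma ev_const [simp]: "ring_map c \<Longrightarrow> ev c x (const a) = c a"
  by (simp add: const_def ev_single)

lemma ring_map_ev: assumes "ring_map c" shows "ring_map (ev c x)"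
  using ev_const[OF assms, of x 1]
  by (intro ring_mapI) (simp_all add: assms ev_add ev_mult ring_map_1)

lemmas ev_0 = ring_map_0[OF ring_map_ev]
lemmas ev_1 = ring_map_1[OF ring_map_ev]
lemmas ev_diff = ring_map_diff[OF ring_map_ev]
lemmas ev_uminus = ring_map_uminus[OF ring_map_ev]
lemmas ev_sum = ring_map_sum[OF ring_map_ev]
lemmas ev_prod = ring_map_prod[OF ring_map_ev]
lemmas ev_power = ring_map_power[OF ring_map_ev]
lemmas ev_hom = ev_0 ev_1 ev_add ev_mult ev_diff ev_uminus ev_sum ev_prod ev_power

lemma ev_Xv [simp]: "ring_map c \<Longrightarrow> ev c x (Xv v) = x v"
  by (simp add: Xv_def ev_single ring_map_1)

lemma mon_Xv: "mon Xv \<mu> = sg \<mu> 1"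
proof -
  have "ks \<mu> \<subseteq> UNIV" by simp
  then show ?thesis
  proof (induction \<mu> rule: monomial_induct)
    case (add v \<nu>)
    then show ?case by (simp add: mon_add Xv_def mult_single)
  qed simp
qed

lemma single_eq: "sg \<mu> a = const a * mon Xv \<mu>"
  by (simp add: mon_Xv const_def mult_single)

lemma ring_map_ev_comp:
  assumes "ring_map \<phi>" "ring_map c"
  shows "\<phi> (ev c x f) = ev (\<lambda>a. \<phi> (c a)) (\<lambda>v. \<phi> (x v)) f"
  unfolding ev_def by (simp add: ring_map_sum ring_map_mult ring_map_mon assms)

lemma ev_const_Xv [simp]: "ev const Xv f = f"
  by (simp add: ev_def flip: single_eq) (rule sum_single_lk)

lemma ev_cong:
  assumes "f \<in> Pring V" "\<And>v. v \<in> V \<Longrightarrow> x v = y v"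
  shows "ev c x f = ev c y f"
  unfolding ev_def
proof (rule sum.cong)
  fix \<mu> assume "\<mu> \<in> ks f"
  then have "ks \<mu> \<subseteq> V" using assms(1) by (auto simp: Pring_def)
  then show "c (lk f \<mu>) * mon x \<mu> = c (lk f \<mu>) * mon y \<mu>" 
    using assms(2) by (metis mon_cong subsetD)
qed simp

lemma Pring_0 [simp]: "0 \<in> Pring V" and Pring_1 [simp]: "1 \<in> Pring V"
  and Pring_const [simp]: "const a \<in> Pring V"
  by (auto simp: Pring_def const_def split: if_splits)

lemma Pring_Xv [simp]: "Xv v \<in> Pring V \<longleftrightarrow> v \<in> V"
  by (simp add: Pring_def Xv_def)

lemma Pring_single [intro]: "ks \<mu> \<subseteq> V \<Longrightarrow> sg \<mu> a \<in> Pring V"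
  by (auto simp: Pring_def split: if_splits)

lemma Pring_add [intro]: "f \<in> Pring V \<Longrightarrow> g \<in> Pring V \<Longrightarrow> f + g \<in> Pring V"
  using keys_add[of f g] by (auto simp: Pring_def)

lemma Pring_uminus [intro]: "f \<in> Pring V \<Longrightarrow> - f \<in> Pring V"
  by (auto simp: Pring_def in_keys_iff)

lemma Pring_diff [intro]: "f \<in> Pring V \<Longrightarrow> g \<in> Pring V \<Longrightarrow> f - g \<in> Pring V"
  using Pring_add[of f V "- g"] Pring_uminus by auto

lemma Pring_mult [intro]:
  assumes "f \<in> Pring V" "g \<in> Pring V" shows "f * g \<in> Pring V"
  unfolding Pring_def
proof (intro CollectI ballI)
  fix \<mu> assume "\<mu> \<in> ks (f * g)"
  then obtain a b where "\<mu> = a + b" "a \<in> ks f" "b \<in> ks g" using keys_mult[of f g] by blast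
  then show "ks \<mu> \<subseteq> V" using assms keys_add[of a b] by (fastforce simp: Pring_def)
qed

lemma Pring_sum [intro]: "(\<And>x. x \<in> A \<Longrightarrow> F x \<in> Pring V) \<Longrightarrow> sum F A \<in> Pring V"
  by (induction A rule: infinite_finite_induct) auto

lemma Pring_prod [intro]: "(\<And>x. x \<in> A \<Longrightarrow> F x \<in> Pring V) \<Longrightarrow> prod F A \<in> Pring V"
  by (induction A rule: infinite_finite_induct) auto

lemma Pring_power [intro]: "f \<in> Pring V \<Longrightarrow> f ^ k \<in> Pring V"
  by (induction k) auto

lemma Pring_mono: "f \<in> Pring V \<Longrightarrow> V \<subseteq> W \<Longrightarrow> f \<in> Pring W"
  by (auto simp: Pring_def)

lemma Pring_mon [intro]: "(\<And>v. v \<in> ks \<mu> \<Longrightarrow> x v \<in> Pring V) \<Longrightarrow> mon x \<mu> \<in> Pring V"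
  unfolding mon_def by (intro Pring_prod Pring_power)

lemma Pring_ev:
  assumes "f \<in> Pring V" "\<And>v. v \<in> V \<Longrightarrow> x v \<in> Pring W"
  shows "ev const x f \<in> Pring W"
  unfolding ev_def
proof (intro Pring_sum Pring_mult Pring_mon)
  fix \<mu> v assume "\<mu> \<in> ks f" "v \<in> ks \<mu>"
  then have "v \<in> V" using assms(1) by (auto simp: Pring_def)
  then show "x v \<in> Pring W" by (rule assms(2))
qed simp

lemma Pring_finite: "\<exists>V. finite V \<and> f \<in> Pring V"
  by (intro exI[of _ "\<Union>\<mu>\<in>ks f. ks \<mu>"]) (auto simp: Pring_def)

lemma Pring_induct [consumes 1, case_names const add Xv]:
  assumes f: "f \<in> Pring V"
    and c: "\<And>a. P (const a)"
    and p: "\<And>f g. f \<in> Pring V \<Longrightarrow> g \<in> Pring V \<Longrightarrow> P f \<Longrightarrow> P g \<Longrightarrow> P (f + g)"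
    and x: "\<And>v f. v \<in> V \<Longrightarrow> f \<in> Pring V \<Longrightarrow> P f \<Longrightarrow> P (Xv v * f)"
  shows "P f"
proof -
  have m: "P (const a * mon Xv \<mu>)" if "ks \<mu> \<subseteq> V" for \<mu> a
    using that
  proof (induction \<mu> rule: monomial_induct)
    case (add v \<nu>)
    have "mon Xv \<nu> \<in> Pring V" using add by (intro Pring_mon) auto
    then have "const a * mon Xv \<nu> \<in> Pring V" by (intro Pring_mult) simp
    then show ?case using x[of v "const a * mon Xv \<nu>"] add
      by (simp add: mon_add mult_ac)
  qed (use c in simp)
  have "A \<subseteq> ks f \<Longrightarrow> P (\<Sum>\<mu>\<in>A. const (lk f \<mu>) * mon Xv \<mu>)" if "finite A" for A
    using that
  proof (induction A rule: finite_induct)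
    case empty
    show ?case using c[of 0] by simp
  next
    case (insert \<mu> A)
    have k: "ks \<nu> \<subseteq> V" if "\<nu> \<in> ks f" for \<nu> using f that by (auto simp: Pring_def)
    have mem: "const (lk f \<nu>) * mon Xv \<nu> \<in> Pring V" if "\<nu> \<in> ks f" for \<nu>
      using k[OF that] by (auto intro!: Pring_mult Pring_mon)
    have "P ((const (lk f \<mu>) * mon Xv \<mu>) + (\<Sum>\<mu>\<in>A. const (lk f \<mu>) * mon Xv \<mu>))"
      using insert by (intro p m Pring_sum mem) (auto intro: k mem dest: k)
    then show ?case using insert by simp
  qed
  from this[of "ks f"] show ?thesis using ev_const_Xv[of f] by (simp add: ev_def)
qed

lemma lk_cmult: "lk (const a * f) \<mu> = a * lk f \<mu>" and lk_cmult': "lk (f * const a) \<mu> = lk f \<mu> * a"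
proof -
  show *: "lk (const a * f) \<mu> = a * lk f \<mu>" for f
    unfolding const_def mult_map_scale_conv_mult[symmetric] by (simp add: map.rep_eq when_def)
  show "lk (f * const a) \<mu> = lk f \<mu> * a" using *[of f] by (simp add: mult.commute)
qed

lemma keys_cmult: "a \<noteq> 0 \<Longrightarrow> ks (const a * f) = ks f"
  by (auto simp: in_keys_iff lk_cmult)

text \<open>Distinct monomials are distinct characters of the torus, hence linearly independent.\<close>

lemma mpoly_eq_0I:
  assumes "\<And>x :: var \<Rightarrow> complex. ev (\<lambda>a. a) x f = 0"
  shows "f = 0"
  using assms
proof (induction "card (ks f)" arbitrary: f rule: less_induct)
  case less
  show ?case
  proof (rule ccontr)
    assume "f \<noteq> 0"
    then obtain \<mu> where \<mu>: "\<mu> \<in> ks f" by (metis all_not_in_conv keys_eq_empty)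
    show False
    proof (cases "ks f = {\<mu>}")
      case True
      have "ev (\<lambda>a. a) (\<lambda>_. 1) f = lk f \<mu>" unfolding ev_def True by (simp add: mon_def)
      then show False using less.prems \<mu> by (simp add: in_keys_iff)
    next
      case False
      then obtain \<nu> where \<nu>: "\<nu> \<in> ks f" "\<nu> \<noteq> \<mu>" using \<mu> by blast
      then obtain v where v: "lk \<nu> v \<noteq> lk \<mu> v" by (metis poly_mapping_eqI)
      define y where "y = (\<lambda>u. if u = v then 2 else 1 :: complex)"
      have my: "mon y \<kappa> = 2 ^ lk \<kappa> v" for \<kappa>
        by (cases "v \<in> ks \<kappa>")
           (simp_all add: mon_def y_def if_distrib[of "\<lambda>t. t ^ _"] prod.If_cases in_keys_iff cong: if_cong)
      \<comment> \<open>Scaling the coordinate \<open>v\<close> by 2 multiplies each monomial by its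
        value at \<open>y\<close>. Subtracting the multiple of \<open>f\<close> belonging to
        \<open>\<mu>\<close> kills that term but keeps \<open>\<nu>\<close>.\<close>
      define g where "g = ev const (\<lambda>u. const (y u) * Xv u) f - const (mon y \<mu>) * f"
      have e: "ev const (\<lambda>u. const (y u) * Xv u) f = (\<Sum>\<kappa>\<in>ks f. sg \<kappa> (lk f \<kappa> * mon y \<kappa>))"
        unfolding ev_def by (simp add: mon_mult_fun single_eq const_hom mult_ac flip: ring_map_mon[OF ring_map_const])
      have lg: "lk g \<kappa> = lk f \<kappa> * (mon y \<kappa> - mon y \<mu>)" for \<kappa>
        unfolding g_def e
        by (auto simp: lookup_minus lookup_sum lk_cmult lk_cmult' lookup_single when_def algebra_simps in_keys_iff)
      have "ks g \<subset> ks f" using \<mu> by (auto simp: in_keys_iff lg)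
      then have c: "card (ks g) < card (ks f)" by (simp add: psubset_card_mono)
      have "ev (\<lambda>a. a) x g = 0" for x
      proof -
        have "ev (\<lambda>a. a) x (ev const (\<lambda>u. const (y u) * Xv u) f) = ev (\<lambda>a. a) (\<lambda>u. y u * x u) f"
          by (subst ring_map_ev_comp[OF ring_map_ev[OF ring_map_id] ring_map_const])
             (simp add: ring_map_id ev_mult)
        then show ?thesis unfolding g_def using less.prems by (simp add: ev_diff ev_mult ring_map_id)
      qed
      with less.hyps[OF c] have "g = 0" by blast
      then have "lk f \<nu> * (mon y \<nu> - mon y \<mu>) = 0" using lg[of \<nu>] by simp
      moreover have "(of_nat (2 ^ lk \<nu> v) :: complex) \<noteq> of_nat (2 ^ lk \<mu> v)"
        using v by (simp only: of_nat_eq_iff) simp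
      then have "mon y \<nu> \<noteq> mon y \<mu>" unfolding my by simp
      ultimately show False using \<nu> by (simp add: in_keys_iff)
    qed
  qed
qed

section \<open>Weights and unique factorization\<close>

definition wt :: "(var \<Rightarrow> nat) \<Rightarrow> (var \<Rightarrow>\<^sub>0 nat) \<Rightarrow> nat" where
  "wt \<omega> \<mu> = (\<Sum>v\<in>ks \<mu>. lk \<mu> v * \<omega> v)"

text \<open>The substitution \<open>X\<^sub>v \<mapsto> t\<^bsup>\<omega> v\<^esup> X\<^sub>v\<close>; the coefficient of \<open>t\<^sup>k\<close> is the
  homogeneous component of weight \<open>k\<close>.\<close>

definition hm :: "(var \<Rightarrow> nat) \<Rightarrow> mpoly \<Rightarrow> mpoly poly" where
  "hm \<omega> = ev (\<lambda>a. [:const a:]) (\<lambda>v. monom (Xv v) (\<omega> v))"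

text \<open>The total degree, read off as a degree in \<open>t\<close>, so that additivity on
  products is that of univariate degrees over a domain.\<close>

definition tdeg :: "mpoly \<Rightarrow> nat" where
  "tdeg f = Polynomial.degree (hm (\<lambda>_. 1) f)"

lemma ring_map_Cpoly: "ring_map (\<lambda>a. [:const a:])"
  by (intro ring_mapI) (simp_all add: const_hom)

lemma ring_map_poly: "ring_map (\<lambda>p. poly p (x::'a::comm_ring_1))"
  by (intro ring_mapI) simp_all

lemma ring_map_hm: "ring_map (hm \<omega>)"
  unfolding hm_def by (intro ring_map_ev ring_map_Cpoly)

lemma wt_superset: "finite A \<Longrightarrow> ks \<mu> \<subseteq> A \<Longrightarrow> wt \<omega> \<mu> = (\<Sum>v\<in>A. lk \<mu> v * \<omega> v)"
  unfolding wt_def by (intro sum.mono_neutral_left) (auto simp: in_keys_iff)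

lemma wt_add: "wt \<omega> (\<mu> + \<nu>) = wt \<omega> \<mu> + wt \<omega> \<nu>"
  using keys_add[of \<mu> \<nu>]
  by (simp add: wt_superset[of "ks \<mu> \<union> ks \<nu>"] lookup_add distrib_right sum.distrib)

lemma wt_zero [simp]: "wt \<omega> 0 = 0" and wt_single [simp]: "wt \<omega> (sg v k) = k * \<omega> v"
  by (simp_all add: wt_superset[of "{v}"] wt_superset[of "{}"])

lemma wt_eq_0:
  assumes "\<And>v. v \<in> ks \<mu> \<Longrightarrow> \<omega> v > 0" "wt \<omega> \<mu> = 0"
  shows "\<mu> = 0"
proof -
  have "v \<notin> ks \<mu>" for v
    using assms(1)[of v] assms(2) by (auto simp: wt_def in_keys_iff)
  then show ?thesis by (metis all_not_in_conv keys_eq_empty)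
qed

lemma prod_monom: "(\<Prod>v\<in>A. monom (a v) (k v)) = monom (\<Prod>v\<in>A. a v) (\<Sum>v\<in>A. k v)"
  by (induction A rule: infinite_finite_induct) (simp_all add: mult_monom)

lemma mon_monom: "mon (\<lambda>v. monom (Xv v) (\<omega> v)) \<mu> = monom (mon Xv \<mu>) (wt \<omega> \<mu>)"
  by (simp add: mon_def monom_power prod_monom wt_def mult.commute)

lemma lk_coeff_hm: "lk (coeff (hm \<omega> f) k) \<mu> = (if wt \<omega> \<mu> = k then lk f \<mu> else 0)"
proof -
  have "hm \<omega> f = (\<Sum>\<mu>\<in>ks f. monom (sg \<mu> (lk f \<mu>)) (wt \<omega> \<mu>))"
    unfolding hm_def ev_def by (simp add: mon_monom smult_monom single_eq)
  then have "coeff (hm \<omega> f) k = (\<Sum>\<mu>\<in>ks f. if wt \<omega> \<mu> = k then sg \<mu> (lk f \<mu>) else 0)"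
    by (simp add: coeff_sum)
  then have "lk (coeff (hm \<omega> f) k) \<mu> = (\<Sum>\<nu>\<in>ks f. if \<nu> = \<mu> then (if wt \<omega> \<nu> = k then lk f \<nu> else 0) else 0)"
    by (simp only: lookup_sum) (intro sum.cong, auto simp: lookup_single when_def)
  then show ?thesis by (auto simp: in_keys_iff)
qed

lemma poly_hm_1: "poly (hm \<omega> f) 1 = f"
  unfolding hm_def
  by (subst ring_map_ev_comp[OF ring_map_poly ring_map_Cpoly]) (simp add: poly_monom)

lemma hm_eq_0_iff [simp]: "hm \<omega> f = 0 \<longleftrightarrow> f = 0"
  by (metis poly_hm_1 ring_map_0[OF ring_map_hm] poly_0)

lemma tdeg_mult: "f \<noteq> 0 \<Longrightarrow> g \<noteq> 0 \<Longrightarrow> tdeg (f * g) = tdeg f + tdeg g"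
  by (simp add: tdeg_def ring_map_mult[OF ring_map_hm] degree_mult_eq)

lemma degree_hm_0:
  assumes "\<And>v. \<omega> v > 0" "Polynomial.degree (hm \<omega> f) = 0"
  shows "\<exists>a. f = const a"
proof
  have z: "lk f \<mu> = 0" if "\<mu> \<noteq> 0" for \<mu>
  proof -
    have "coeff (hm \<omega> f) (wt \<omega> \<mu>) = 0"
      using wt_eq_0[of \<mu> \<omega>] assms that by (intro coeff_eq_0) auto
    then show ?thesis using lk_coeff_hm[of \<omega> f "wt \<omega> \<mu>" \<mu>] by simp
  qed
  show "f = const (lk f 0)"
    by (rule poly_mapping_eqI) (use z in \<open>auto simp: const_def lookup_single when_def\<close>)
qed

lemma tdeg_eq_0_iff: "tdeg f = 0 \<longleftrightarrow> (\<exists>a. f = const a)"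
proof
  show "tdeg f = 0 \<Longrightarrow> \<exists>a. f = const a"
    unfolding tdeg_def by (rule degree_hm_0) simp_all
  show "\<exists>a. f = const a \<Longrightarrow> tdeg f = 0"
    by (auto simp: tdeg_def hm_def ring_map_Cpoly)
qed

lemma mpoly_unit_iff: "f dvd 1 \<longleftrightarrow> (\<exists>a. a \<noteq> 0 \<and> f = const a)" for f :: mpoly
proof
  assume "f dvd 1"
  then obtain g where g: "f * g = 1" by (metis dvd_def)
  then have "f \<noteq> 0" "g \<noteq> 0" by auto
  then have "tdeg f + tdeg g = tdeg 1" using g by (metis tdeg_mult)
  moreover have "tdeg 1 = 0" unfolding tdeg_eq_0_iff by (metis const_simps(1))
  ultimately show "\<exists>a. a \<noteq> 0 \<and> f = const a" using tdeg_eq_0_iff[of f] \<open>f \<noteq> 0\<close> by auto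
next
  assume "\<exists>a. a \<noteq> 0 \<and> f = const a"
  then obtain a where "a \<noteq> 0" "f = const a" by blast
  then have "f * const (inverse a) = 1" by (simp flip: const_hom)
  then show "f dvd 1" by (metis dvdI)
qed

lemma irreducible_factorization:
  fixes f :: mpoly
  assumes "f \<noteq> 0"
  shows "\<exists>a ps. a \<noteq> 0 \<and> (\<forall>p\<in>set ps. irreducible p) \<and> f = const a * prod_list ps"
  using assms
proof (induction "tdeg f" arbitrary: f rule: less_induct)
  case less
  consider "f dvd 1" | "irreducible f" | g h where "f = g * h" "\<not> g dvd 1" "\<not> h dvd 1"
    using less.prems by (auto simp: irreducible_def)
  then show ?case
  proof cases
    case 1
    then show ?thesis unfolding mpoly_unit_iff by (metis empty_iff mult.right_neutral prod_list.Nil set_empty)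
  next
    case 2
    then show ?thesis by (intro exI[of _ 1] exI[of _ "[f]"]) simp
  next
    case 3
    then have nz: "g \<noteq> 0" "h \<noteq> 0" using less.prems by auto
    then have "tdeg g \<noteq> 0" "tdeg h \<noteq> 0"
      using 3 unfolding mpoly_unit_iff tdeg_eq_0_iff by auto
    then have "tdeg g < tdeg f" "tdeg h < tdeg f" using tdeg_mult[OF nz] 3 by auto
    from less.hyps[OF this(1) nz(1)] less.hyps[OF this(2) nz(2)] obtain a ps b qs where
      "a \<noteq> 0" "\<forall>p\<in>set ps. irreducible p" "g = const a * prod_list ps"
      "b \<noteq> 0" "\<forall>p\<in>set qs. irreducible p" "h = const b * prod_list qs" by blast
    then show ?thesis using 3
      by (intro exI[of _ "a * b"] exI[of _ "ps @ qs"]) (auto simp: const_hom mult_ac)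
  qed
qed

section \<open>Gauss's lemma: irreducible polynomials are prime\<close>

definition up :: "var \<Rightarrow> mpoly \<Rightarrow> mpoly poly" where
  "up x = ev (\<lambda>a. [:const a:]) (\<lambda>v. if v = x then [:0, 1:] else [:Xv v:])"

lemma ring_map_up: "ring_map (up x)"
  unfolding up_def by (intro ring_map_ev ring_map_Cpoly)

lemma poly_up: "poly (up x f) (Xv x) = f"
proof -
  have "(\<lambda>v. poly (if v = x then [:0, 1:] else [:Xv v:]) (Xv x)) = Xv" by auto
  then show ?thesis
    unfolding up_def by (subst ring_map_ev_comp[OF ring_map_poly ring_map_Cpoly]) simp
qed

text \<open>The coefficients of \<open>up x f\<close> keep the type \<open>mpoly\<close>; membership
  in \<open>PV V\<close> with \<open>x\<close> outside \<open>V\<close> records that they are free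
  of \<open>x\<close>.\<close>

definition PV :: "var set \<Rightarrow> mpoly poly set" where
  "PV V = {p. \<forall>i. coeff p i \<in> Pring V}"

lemma up_Pring:
  assumes "f \<in> Pring V" "x \<notin> V" shows "up x f = [:f:]"
proof -
  have "up x f = ev (\<lambda>a. [:const a:]) (\<lambda>v. [:Xv v:]) f"
    unfolding up_def using assms by (intro ev_cong[of f V]) auto
  also have "\<dots> = [:f:]"
    using ring_map_ev_comp[of "\<lambda>a. [:a:]" const Xv f] ring_map_const
    by (simp add: ring_mapI)
  finally show ?thesis .
qed

lemma PV_add [intro]: "p \<in> PV V \<Longrightarrow> q \<in> PV V \<Longrightarrow> p + q \<in> PV V"
  and PV_diff [intro]: "p \<in> PV V \<Longrightarrow> q \<in> PV V \<Longrightarrow> p - q \<in> PV V"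
  and PV_mult [intro]: "p \<in> PV V \<Longrightarrow> q \<in> PV V \<Longrightarrow> p * q \<in> PV V"
  and PV_smult [intro]: "b \<in> Pring V \<Longrightarrow> q \<in> PV V \<Longrightarrow> smult b q \<in> PV V"
  and PV_monom [intro]: "b \<in> Pring V \<Longrightarrow> monom b k \<in> PV V"
  and PV_pCons [intro]: "b \<in> Pring V \<Longrightarrow> q \<in> PV V \<Longrightarrow> pCons b q \<in> PV V"
  and PV_0 [simp]: "0 \<in> PV V" and PV_1 [simp]: "1 \<in> PV V"
  by (auto simp: PV_def coeff_mult coeff_pCons split: nat.split)

lemma up_PV: "f \<in> Pring (insert x V) \<Longrightarrow> up x f \<in> PV V"
proof (induction f rule: Pring_induct)
  case (const a)
  have "up x (const a) = [:const a:]" by (rule up_Pring[of _ "{}"]) auto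
  then show ?case by auto
next
  case (Xv v f)
  have "up x (Xv v) = (if v = x then [:0, 1:] else [:Xv v:])"
    by (simp add: up_def ring_map_Cpoly)
  moreover have "[:0, 1:] \<in> PV V" by (intro PV_pCons) auto
  ultimately have "up x (Xv v) \<in> PV V" using Xv by auto
  then show ?case using Xv by (auto simp: ring_map_mult[OF ring_map_up])
qed (auto simp: ring_map_add[OF ring_map_up])

lemma up_poly:
  assumes "p \<in> PV V" "x \<notin> V" shows "up x (poly p (Xv x)) = p"
proof -
  have "up x (Xv x) = [:0, 1:]" by (simp add: up_def ring_map_Cpoly)
  then have "up x (poly p (Xv x)) = (\<Sum>i\<le>Polynomial.degree p. [:coeff p i:] * [:0, 1:] ^ i)"
    using assms by (simp add: poly_altdef ring_map_sum[OF ring_map_up] ring_map_mult[OF ring_map_up]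
        ring_map_power[OF ring_map_up] up_Pring[where V = V] PV_def)
  also have "\<dots> = (\<Sum>i\<le>Polynomial.degree p. monom (coeff p i) i)"
    by (simp add: monom_altdef)
  finally show ?thesis by (simp add: poly_as_sum_of_monoms)
qed

lemma up_eq_0_iff [simp]: "up x f = 0 \<longleftrightarrow> f = 0"
  by (metis poly_up ring_map_0[OF ring_map_up] poly_0)

text \<open>In a variable outside \<open>V\<close> the product has degree 0. Degrees add up, so the
  factor has degree 0 there too.\<close>

lemma Pring_factor:
  assumes "f * g \<in> Pring V" "f * g \<noteq> 0" shows "f \<in> Pring V"
proof -
  have "f \<in> Pring (- {x})" if "x \<notin> V" for x
  proof -
    have "up x f * up x g = [:f * g:]"
      using up_Pring[OF assms(1) that] by (simp add: ring_map_mult[OF ring_map_up])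
    then have "Polynomial.degree (up x f) = 0"
      using assms(2) degree_mult_eq[of "up x f" "up x g"] by auto
    then obtain c where c: "up x f = [:c:]" by (metis degree_0_id)
    have "f \<in> Pring (insert x (- {x}))" by (auto simp: Pring_def)
    from up_PV[OF this] have "c \<in> Pring (- {x})" using c by (auto simp: PV_def dest: spec[of _ 0])
    then show ?thesis using poly_up[of x f] c by simp
  qed
  then show ?thesis by (auto simp: Pring_def)
qed

text \<open>Unique factorization for the variables \<open>V\<close>, in the form carried through the
  induction on the number of variables. Irreducibility may refer to all of \<open>mpoly\<close>,
  since factors stay in \<open>Pring V\<close> by \<open>Pring_factor\<close>.\<close>

definition irred_prime :: "var set \<Rightarrow> bool" where
  "irred_prime V \<longleftrightarrow> (\<forall>p\<in>Pring V. irreducible p \<longrightarrow>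
     (\<forall>g\<in>Pring V. \<forall>h\<in>Pring V. p dvd g * h \<longrightarrow> p dvd g \<or> p dvd h))"

text \<open>Take the lowest indices at which the coefficients of \<open>g\<close> and
  \<open>h\<close> escape \<open>p\<close>. In the coefficient of the product at their sum, all
  terms but one are divisible by \<open>p\<close>.\<close>

lemma irreducible_dvd_coeffs_mult:
  assumes V: "irred_prime V" and p: "p \<in> Pring V" "irreducible p"
    and gh: "g \<in> PV V" "h \<in> PV V" and d: "[:p:] dvd g * h"
  shows "[:p:] dvd g \<or> [:p:] dvd h"
proof (rule ccontr)
  assume "\<not> ?thesis"
  then have ex: "\<exists>i. \<not> p dvd coeff g i" "\<exists>i. \<not> p dvd coeff h i" unfolding const_poly_dvd_iff by blast+
  define i where "i = (LEAST i. \<not> p dvd coeff g i)"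
  define j where "j = (LEAST i. \<not> p dvd coeff h i)"
  have i: "\<not> p dvd coeff g i" and i': "\<And>k. k < i \<Longrightarrow> p dvd coeff g k"
    unfolding i_def using LeastI_ex[OF ex(1)] not_less_Least[of _ "\<lambda>i. \<not> p dvd coeff g i"] by blast+
  have j: "\<not> p dvd coeff h j" and j': "\<And>k. k < j \<Longrightarrow> p dvd coeff h k"
    unfolding j_def using LeastI_ex[OF ex(2)] not_less_Least[of _ "\<lambda>i. \<not> p dvd coeff h i"] by blast+
  define R where "R = (\<Sum>k\<in>{..i + j} - {i}. coeff g k * coeff h (i + j - k))"
  have "coeff (g * h) (i + j) = (\<Sum>k\<le>i + j. coeff g k * coeff h (i + j - k))"
    by (rule coeff_mult)
  also have "\<dots> = coeff g i * coeff h (i + j - i) + R"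
    unfolding R_def by (rule sum.remove) auto
  finally have eq: "coeff (g * h) (i + j) = coeff g i * coeff h j + R" by simp
  have R: "p dvd R"
    unfolding R_def
  proof (rule dvd_sum)
    fix k assume k: "k \<in> {..i + j} - {i}"
    show "p dvd coeff g k * coeff h (i + j - k)"
    proof (cases "k < i")
      case False
      then have "i + j - k < j" using k by auto
      then show ?thesis using j' by (intro dvd_mult) blast
    next
      case True
      then show ?thesis using i' by (intro dvd_mult2) blast
    qed
  qed
  have "p dvd coeff (g * h) (i + j)" using d unfolding const_poly_dvd_iff by blast
  then have "p dvd coeff g i * coeff h j" unfolding eq using dvd_add_left_iff[OF R] by blast
  moreover have "coeff g i \<in> Pring V" "coeff h j \<in> Pring V" using gh by (simp_all add: PV_def)
  ultimately show False using V p i j unfolding irred_prime_def by blast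
qed

lemma pseudo_division:
  assumes d: "d \<in> PV V" "d \<noteq> 0"
  shows "f \<in> PV V \<Longrightarrow> \<exists>k. \<exists>q\<in>PV V. \<exists>s\<in>PV V. smult (lead_coeff d ^ k) f = q * d + s \<and>
    (s = 0 \<or> Polynomial.degree s < Polynomial.degree d)"
\<comment> \<open>The measure puts the zero polynomial below the nonzero constants, which have the
  same \<open>degree\<close>.\<close>
proof (induction "if f = 0 then 0 else Suc (Polynomial.degree f)" arbitrary: f rule: less_induct)
  case less
  show ?case
  proof (cases "f = 0 \<or> Polynomial.degree f < Polynomial.degree d")
    case True
    then show ?thesis using less.prems by (intro exI[of _ 0] bexI[of _ 0] bexI[of _ f]) auto
  next
    case False
    define mm where "mm = monom (lead_coeff f) (Polynomial.degree f - Polynomial.degree d)"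
    define f' where "f' = smult (lead_coeff d) f - mm * d"
    have mm: "mm \<in> PV V" unfolding mm_def using less.prems by (auto simp: PV_def)
    have ld: "lead_coeff d \<in> Pring V" using d by (auto simp: PV_def)
    have f': "f' \<in> PV V" unfolding f'_def using mm d less.prems ld by (intro PV_diff PV_smult PV_mult)
    have dm: "Polynomial.degree (mm * d) \<le> Polynomial.degree f"
      using degree_mult_le[of mm d] degree_monom_le[of "lead_coeff f" "Polynomial.degree f - Polynomial.degree d"] False
      unfolding mm_def by linarith
    have le: "Polynomial.degree f' \<le> Polynomial.degree f"
      unfolding f'_def using dm degree_smult_le[of "lead_coeff d" f]
      by (intro degree_diff_le) auto
    have "coeff (mm * d) (Polynomial.degree f) = lead_coeff f * lead_coeff d"
      using coeff_monom_mult[of "lead_coeff f" "Polynomial.degree f - Polynomial.degree d" d "Polynomial.degree f"] False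
      unfolding mm_def by simp
    then have "coeff f' (Polynomial.degree f) = 0"
      unfolding f'_def by simp
    then have "f' = 0 \<or> Polynomial.degree f' < Polynomial.degree f"
      using le by (metis leading_coeff_0_iff le_neq_implies_less)
    then have "(if f' = 0 then 0 else Suc (Polynomial.degree f')) < (if f = 0 then 0 else Suc (Polynomial.degree f))"
      using False by auto
    from less.hyps[OF this f'] obtain k q s where *: "q \<in> PV V" "s \<in> PV V"
      "smult (lead_coeff d ^ k) f' = q * d + s" "s = 0 \<or> Polynomial.degree s < Polynomial.degree d" by blast
    have "smult (lead_coeff d ^ Suc k) f = (q + smult (lead_coeff d ^ k) mm) * d + s"
      using *(3) unfolding f'_def by (simp add: smult_diff_right algebra_simps)
    moreover have "q + smult (lead_coeff d ^ k) mm \<in> PV V" using * mm ld by auto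
    ultimately show ?thesis using * by blast
  qed
qed

lemma PV_factor_const:
  assumes "[:p:] * q \<in> PV V" "p \<noteq> 0" shows "q \<in> PV V"
proof -
  have "coeff q i \<in> Pring V" for i
  proof (cases "coeff q i = 0")
    case False
    have "coeff q i * p \<in> Pring V" using assms by (simp add: PV_def mult.commute)
    then show ?thesis using False assms(2) Pring_factor[of "coeff q i" p V] by simp
  qed simp
  then show ?thesis by (simp add: PV_def)
qed

text \<open>Turns a factorization with denominator \<open>\<beta>\<close> into one over the
  coefficient ring. Each irreducible factor of \<open>\<beta>\<close> divides all coefficients of
  \<open>q\<close> or all of \<open>d\<close> and is cancelled there; \<open>\<gamma>\<close> and
  \<open>\<delta>\<close> collect what was removed.\<close>

lemma gauss_cancel:
  assumes V: "irred_prime V" and f: "f \<in> PV V"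
  shows "\<beta> \<in> Pring V \<Longrightarrow> \<beta> \<noteq> 0 \<Longrightarrow> q \<in> PV V \<Longrightarrow> d \<in> PV V \<Longrightarrow> smult \<beta> f = q * d \<Longrightarrow>
    \<exists>q'\<in>PV V. \<exists>d'\<in>PV V. \<exists>\<gamma>\<in>Pring V. \<exists>\<delta>\<in>Pring V. \<gamma> \<noteq> 0 \<and> \<delta> \<noteq> 0 \<and>
      f = q' * d' \<and> q = smult \<gamma> q' \<and> d = smult \<delta> d'"
proof (induction "tdeg \<beta>" arbitrary: \<beta> q d rule: less_induct)
  case less
  show ?case
  proof (cases "\<beta> dvd 1")
    case True
    then obtain a where a: "a \<noteq> 0" "\<beta> = const a" by (auto simp: mpoly_unit_iff)
    then have 1: "const a * const (1 / a) = 1" by (simp flip: const_hom)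
    then have "f = smult (const (1 / a)) (smult \<beta> f)" using a by (simp add: mult.commute)
    then have "f = smult (const (1 / a)) q * d" using less.prems by simp
    moreover have "q = smult (const a) (smult (const (1 / a)) q)" using 1 by simp
    ultimately show ?thesis using less.prems a
      by (intro bexI[of _ "smult (const (1 / a)) q"] bexI[of _ d] bexI[of _ "const a"] bexI[of _ 1])
         auto
  next
    case False
    obtain a ps where ps: "a \<noteq> 0" "\<forall>p\<in>set ps. irreducible p" "\<beta> = const a * prod_list ps"
      using irreducible_factorization[OF less.prems(2)] by blast
    have "ps \<noteq> []" using False ps by (auto simp: mpoly_unit_iff)
    then obtain p ps' where p': "ps = p # ps'" by (cases ps) auto
    define \<beta>' where "\<beta>' = const a * prod_list ps'"
    have \<beta>: "\<beta> = p * \<beta>'" using ps p' by (simp add: \<beta>'_def mult_ac)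
    have p: "irreducible p" "p \<noteq> 0" "\<not> p dvd 1" using ps p' by (auto simp: irreducible_def)
    have nz: "\<beta>' \<noteq> 0" using less.prems \<beta> by auto
    have mem: "p \<in> Pring V" "\<beta>' \<in> Pring V"
      using Pring_factor[of p \<beta>'] Pring_factor[of \<beta>' p] less.prems \<beta> by (auto simp: mult.commute)
    have "tdeg p > 0" using p by (auto simp: mpoly_unit_iff tdeg_eq_0_iff neq0_conv[symmetric])
    then have lt: "tdeg \<beta>' < tdeg \<beta>" using tdeg_mult[of p \<beta>'] \<beta> nz p by auto
    have eq: "q * d = [:p:] * smult \<beta>' f" using less.prems(5) \<beta> by (simp add: mult.commute)
    then have "[:p:] dvd q * d" by (metis dvdI)
    then consider q1 where "q = [:p:] * q1" | d1 where "d = [:p:] * d1"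
      using irreducible_dvd_coeffs_mult[OF V mem(1) p(1)] less.prems by (metis dvd_def)
    then show ?thesis
    proof cases
      case 1
      then have "[:p:] * smult \<beta>' f = [:p:] * (q1 * d)" using eq by (simp only: mult_ac)
      then have "smult \<beta>' f = q1 * d" using p(2) by (metis mult_cancel_left pCons_eq_0_iff)
      moreover have "q1 \<in> PV V"
        using less.prems(3) 1 p PV_factor_const by blast
      ultimately obtain q' d' \<gamma> \<delta> where "q'\<in>PV V" "d'\<in>PV V" "\<gamma>\<in>Pring V" "\<delta>\<in>Pring V"
        "\<gamma> \<noteq> 0" "\<delta> \<noteq> 0" "f = q' * d'" "q1 = smult \<gamma> q'" "d = smult \<delta> d'"
        using less.hyps[OF lt mem(2) nz, of q1 d] less.prems by blast
      moreover have "\<gamma> * p \<in> Pring V" "\<gamma> * p \<noteq> 0" "q = smult (\<gamma> * p) q'"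
        using calculation 1 mem p by (auto simp: mult.commute)
      ultimately show ?thesis by blast
    next
      case 2
      then have "[:p:] * smult \<beta>' f = [:p:] * (q * d1)" using eq by (simp only: mult_ac)
      then have "smult \<beta>' f = q * d1" using p(2) by (metis mult_cancel_left pCons_eq_0_iff)
      moreover have "d1 \<in> PV V"
        using less.prems(4) 2 p PV_factor_const by blast
      ultimately obtain q' d' \<gamma> \<delta> where "q'\<in>PV V" "d'\<in>PV V" "\<gamma>\<in>Pring V" "\<delta>\<in>Pring V"
        "\<gamma> \<noteq> 0" "\<delta> \<noteq> 0" "f = q' * d'" "q = smult \<gamma> q'" "d1 = smult \<delta> d'"
        using less.hyps[OF lt mem(2) nz, of q d1] less.prems by blast
      moreover have "p * \<delta> \<in> Pring V" "p * \<delta> \<noteq> 0" "d = smult (p * \<delta>) d'"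
        using calculation 2 mem p by (auto simp: mult.commute)
      ultimately show ?thesis by blast
    qed
  qed
qed

lemma up_unit:
  assumes "p \<in> PV V" "x \<notin> V" "poly p (Xv x) dvd 1"
  shows "Polynomial.degree p = 0"
proof -
  obtain a where "poly p (Xv x) = const a" using assms by (auto simp: mpoly_unit_iff)
  then have "p = [:const a:]"
    using up_poly[OF assms(1,2)] up_Pring[of "const a" "{}" x] by simp
  then show ?thesis by simp
qed

lemma unit_mult_dvd: "u dvd 1 \<Longrightarrow> u * a dvd (a :: 'a :: comm_ring_1)"
  by (metis dvd_def mult.assoc mult.commute mult.right_neutral)

text \<open>If \<open>F\<close> involves \<open>x\<close>, let \<open>d\<close> be nonzero of least
  degree in the ideal \<open>(f, g)\<close>; up to coefficients it divides both \<open>f\<close> and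
  \<open>g\<close>. As \<open>F\<close> is irreducible, there are two cases. If the cofactor of
  \<open>d\<close> in \<open>f\<close> is a unit, \<open>F\<close> divides \<open>G\<close>.
  Otherwise \<open>d\<close> is a nonzero coefficient lying in \<open>(f, g)\<close>, and
  multiplying it by \<open>h\<close> shows that \<open>F\<close> divides \<open>H\<close>.\<close>

lemma irred_prime_insert:
  assumes V: "irred_prime V" and x: "x \<notin> V"
  shows "irred_prime (insert x V)"
  unfolding irred_prime_def
proof (intro ballI impI)
  fix F G H
  assume F: "F \<in> Pring (insert x V)" "irreducible F"
    and G: "G \<in> Pring (insert x V)" and H: "H \<in> Pring (insert x V)" and FGH: "F dvd G * H"
  show "F dvd G \<or> F dvd H"
  proof (cases "G * H = 0")
    case False
    obtain K where K: "G * H = F * K" using FGH by (metis dvd_def)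
    have KP: "K \<in> Pring (insert x V)"
      using Pring_factor[of K F "insert x V"] Pring_mult[OF G H] False K by (simp add: mult.commute)
    define f g h k where defs: "f = up x F" "g = up x G" "h = up x H" "k = up x K"
    have P: "f \<in> PV V" "g \<in> PV V" "h \<in> PV V" "k \<in> PV V"
      unfolding defs using F G H KP up_PV by auto
    have eq: "g * h = f * k" unfolding defs using K by (metis ring_map_mult[OF ring_map_up])
    have th: "F = poly f (Xv x)" "G = poly g (Xv x)" "H = poly h (Xv x)"
      unfolding defs by (simp_all add: poly_up)
    have nz: "f \<noteq> 0" "g \<noteq> 0" "h \<noteq> 0" using False F by (auto simp: defs irreducible_def)
    show ?thesis
    proof (cases "Polynomial.degree f = 0")
      case True
      then obtain c where c: "f = [:c:]" by (metis degree_0_id)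
      then have "F = c" using th by simp
      moreover have "c \<in> Pring V" using P c by (auto simp: PV_def dest: spec[of _ 0])
      ultimately have "[:c:] dvd g \<or> [:c:] dvd h"
        using irreducible_dvd_coeffs_mult[OF V _ _ P(2,3)] F eq c by (metis dvdI)
      then show ?thesis
      proof
        assume "[:c:] dvd g"
        then show ?thesis using \<open>F = c\<close> th by (auto simp: dvd_def)
      next
        assume "[:c:] dvd h"
        then show ?thesis using \<open>F = c\<close> th by (auto simp: dvd_def)
      qed
    next
      case deg: False
      text \<open>\<open>d\<close> generates the ideal \<open>(f, g)\<close> up to elements of the coefficient ring.\<close>
      define J where "J = {u * f + v * g | u v. u \<in> PV V \<and> v \<in> PV V}"
      have fJ: "f \<in> J" unfolding J_def by (rule CollectI, rule exI[of _ 1], rule exI[of _ 0]) simp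
      have gJ: "g \<in> J" unfolding J_def by (rule CollectI, rule exI[of _ 0], rule exI[of _ 1]) simp
      define N where "N = (LEAST N. \<exists>d\<in>J. d \<noteq> 0 \<and> Polynomial.degree d = N)"
      have "\<exists>N. \<exists>d\<in>J. d \<noteq> 0 \<and> Polynomial.degree d = N" using fJ nz by auto
      then have "\<exists>d\<in>J. d \<noteq> 0 \<and> Polynomial.degree d = N" unfolding N_def by (rule LeastI_ex)
      then obtain d where d: "d \<in> J" "d \<noteq> 0" "Polynomial.degree d = N" by blast
      have min: "s = 0" if "s \<in> J" "s = 0 \<or> Polynomial.degree s < Polynomial.degree d" for s
      proof (rule ccontr)
        assume "s \<noteq> 0"
        then have "Polynomial.degree s < N" using that d by auto
        from not_less_Least[OF this[unfolded N_def]] show False using that \<open>s \<noteq> 0\<close> by blast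
      qed
      obtain u v where uv: "u \<in> PV V" "v \<in> PV V" "d = u * f + v * g" using d by (auto simp: J_def)
      have dP: "d \<in> PV V" using uv P by auto
      have ld: "lead_coeff d ^ i \<in> Pring V" "lead_coeff d ^ i \<noteq> 0" for i
        using dP d by (auto simp: PV_def)
      have div: "\<exists>\<beta>\<in>Pring V. \<exists>q\<in>PV V. \<beta> \<noteq> 0 \<and> smult \<beta> w = q * d" if wJ: "w \<in> PV V" "w \<in> J" for w
      proof -
        obtain i q s where q: "q \<in> PV V" "s \<in> PV V" "smult (lead_coeff d ^ i) w = q * d + s"
          "s = 0 \<or> Polynomial.degree s < Polynomial.degree d"
          using pseudo_division[OF dP d(2) wJ(1)] by blast
        obtain u' v' where w: "u' \<in> PV V" "v' \<in> PV V" "w = u' * f + v' * g" using wJ by (auto simp: J_def)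
        have "s = (smult (lead_coeff d ^ i) u' - q * u) * f + (smult (lead_coeff d ^ i) v' - q * v) * g"
        proof -
          have "s = smult (lead_coeff d ^ i) w - q * d" using q by simp
          also have "\<dots> = smult (lead_coeff d ^ i) (u' * f + v' * g) - q * (u * f + v * g)"
            using w uv by simp
          also have "\<dots> = (smult (lead_coeff d ^ i) u' - q * u) * f + (smult (lead_coeff d ^ i) v' - q * v) * g"
            by (simp add: smult_add_right algebra_simps)
          finally show ?thesis .
        qed
        moreover have "smult (lead_coeff d ^ i) u' - q * u \<in> PV V" "smult (lead_coeff d ^ i) v' - q * v \<in> PV V"
          using w uv q ld by auto
        ultimately have "s \<in> J" unfolding J_def by blast
        then show ?thesis using q min ld by (intro bexI[of _ "lead_coeff d ^ i"] bexI[of _ q]) auto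
      qed
      obtain \<beta> q where \<beta>: "\<beta> \<in> Pring V" "\<beta> \<noteq> 0" "q \<in> PV V" "smult \<beta> f = q * d"
        using div[OF P(1) fJ] by blast
      obtain q1 d1 \<gamma> \<delta> where 1: "q1 \<in> PV V" "d1 \<in> PV V" "\<gamma> \<in> Pring V" "\<delta> \<in> Pring V" "\<gamma> \<noteq> 0" "\<delta> \<noteq> 0"
        "f = q1 * d1" "q = smult \<gamma> q1" "d = smult \<delta> d1"
        using gauss_cancel[OF V P(1) \<beta>(1,2,3) dP \<beta>(4)] by blast
      have F1: "F = poly q1 (Xv x) * poly d1 (Xv x)" using th 1 by simp
      then consider "poly q1 (Xv x) dvd 1" | "poly d1 (Xv x) dvd 1"
        using irreducibleD[OF F(2) F1] by blast
      then show ?thesis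
      proof cases
        case q1: 1
        then obtain a where a: "a \<noteq> 0" "poly q1 (Xv x) = const a" by (auto simp: mpoly_unit_iff)
        obtain \<beta>' q' where \<beta>': "\<beta>' \<in> Pring V" "\<beta>' \<noteq> 0" "q' \<in> PV V" "smult \<beta>' g = q' * d"
          using div[OF P(2) gJ] by blast
        have "smult \<beta>' g = smult \<delta> q' * d1" using \<beta>' 1 by simp
        moreover have "smult \<delta> q' \<in> PV V" using \<beta>' 1 by auto
        ultimately obtain q2 d2 \<delta>3 where 2: "d2 \<in> PV V" "\<delta>3 \<noteq> 0" "g = q2 * d2" "d1 = smult \<delta>3 d2"
          using gauss_cancel[OF V P(2) \<beta>'(1,2) _ 1(2)] by blast
        have F2: "F = (const a * \<delta>3) * poly d2 (Xv x)" using F1 a 2 by simp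
        then consider "const a * \<delta>3 dvd 1" | "poly d2 (Xv x) dvd 1"
          using irreducibleD[OF F(2) F2] by blast
        then show ?thesis
        proof cases
          case u: 1
          have "F dvd poly d2 (Xv x)" unfolding F2 by (rule unit_mult_dvd[OF u])
          then show ?thesis using th 2 by auto
        next
          case u: 2
          have "Polynomial.degree d1 = 0" using up_unit[OF 2(1) x u] 2 by simp
          then have "Polynomial.degree f = 0"
            using up_unit[OF 1(1) x q1] degree_mult_le[of q1 d1] 1 by simp
          then show ?thesis using deg by simp
        qed
      next
        case d1: 2
        have "Polynomial.degree d = 0" using up_unit[OF 1(2) x d1] 1 by simp
        then obtain e where e: "d = [:e:]" by (metis degree_0_id)
        have e': "e \<in> Pring V" "e \<noteq> 0" using e d dP by (auto simp: PV_def dest: spec[of _ 0])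
        have "smult e h = d * h" using e by simp
        also have "\<dots> = (u * h + v * k) * f" using uv eq by (simp add: algebra_simps)
        finally have "smult e h = (u * h + v * k) * f" .
        moreover have "u * h + v * k \<in> PV V" using uv P by auto
        ultimately obtain q3 f3 \<delta>4 where 3: "f3 \<in> PV V" "\<delta>4 \<noteq> 0" "h = q3 * f3" "f = smult \<delta>4 f3"
          using gauss_cancel[OF V P(3) e' _ P(1)] by blast
        have F3: "F = \<delta>4 * poly f3 (Xv x)" using th 3 by simp
        then consider "\<delta>4 dvd 1" | "poly f3 (Xv x) dvd 1"
          using irreducibleD[OF F(2) F3] by blast
        then show ?thesis
        proof cases
          case u: 1
          have "F dvd poly f3 (Xv x)" unfolding F3 by (rule unit_mult_dvd[OF u])
          then have "F dvd H" using th 3 by (metis dvd_mult poly_mult)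
          then show ?thesis ..
        next
          case u: 2
          then show ?thesis using up_unit[OF 3(1) x u] 3 deg by simp
        qed
      qed
    qed
  qed auto
qed

lemma irred_prime_finite: "finite V \<Longrightarrow> irred_prime V"
proof (induction V rule: finite_induct)
  case empty
  have "\<exists>a. p = const a" if "p \<in> Pring {}" for p
    using that
  proof (induction p rule: Pring_induct)
    case (add f g)
    then show ?case by (metis const_hom(1))
  qed auto
  then show ?case
    unfolding irred_prime_def irreducible_def mpoly_unit_iff by (metis const_eq_0_iff)
qed (rule irred_prime_insert)

lemma irreducible_imp_prime:
  fixes p :: mpoly
  assumes "irreducible p" shows "prime_elem p"
proof (rule prime_elemI)
  show "p \<noteq> 0" "\<not> p dvd 1" using assms by (auto simp: irreducible_def)
  fix g h assume d: "p dvd g * h"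
  obtain V1 V2 V3 where "finite V1" "p \<in> Pring V1" "finite V2" "g \<in> Pring V2" "finite V3" "h \<in> Pring V3"
    using Pring_finite by metis
  then have "finite (V1 \<union> V2 \<union> V3)" "p \<in> Pring (V1 \<union> V2 \<union> V3)" "g \<in> Pring (V1 \<union> V2 \<union> V3)"
    "h \<in> Pring (V1 \<union> V2 \<union> V3)"
    by (simp, blast intro: Pring_mono[of _ V1], blast intro: Pring_mono[of _ V2], blast intro: Pring_mono[of _ V3])
  then show "p dvd g \<or> p dvd h"
    using irred_prime_finite[of "V1 \<union> V2 \<union> V3"] assms d by (auto simp: irred_prime_def)
qed

section \<open>Ideals and linear dependence\<close>

definition subring_set :: "'a::comm_ring_1 set \<Rightarrow> bool" where
  "subring_set A \<longleftrightarrow> 1 \<in> A \<and> (\<forall>a\<in>A. \<forall>b\<in>A. a - b \<in> A \<and> a * b \<in> A)"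

lemma
  assumes "subring_set A"
  shows subring_1: "1 \<in> A" and subring_0: "0 \<in> A"
    and subring_diff: "a \<in> A \<Longrightarrow> b \<in> A \<Longrightarrow> a - b \<in> A"
    and subring_add: "a \<in> A \<Longrightarrow> b \<in> A \<Longrightarrow> a + b \<in> A"
    and subring_uminus: "a \<in> A \<Longrightarrow> - a \<in> A"
    and subring_mult: "a \<in> A \<Longrightarrow> b \<in> A \<Longrightarrow> a * b \<in> A"
    and subring_sum: "(\<And>x. x \<in> B \<Longrightarrow> F x \<in> A) \<Longrightarrow> sum F B \<in> A"
    and subring_power: "a \<in> A \<Longrightarrow> a ^ k \<in> A"
proof -
  have 1: "1 \<in> A" and d: "\<And>a b. a \<in> A \<Longrightarrow> b \<in> A \<Longrightarrow> a - b \<in> A"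
    and m: "\<And>a b. a \<in> A \<Longrightarrow> b \<in> A \<Longrightarrow> a * b \<in> A"
    using assms by (auto simp: subring_set_def)
  have 0: "0 \<in> A" using d[OF 1 1] by simp
  have u: "- a \<in> A" if "a \<in> A" for a using d[OF 0 that] by simp
  have p: "a + b \<in> A" if "a \<in> A" "b \<in> A" for a b using d[OF that(1) u[OF that(2)]] by simp
  show "1 \<in> A" "0 \<in> A" by fact+
  show "a \<in> A \<Longrightarrow> b \<in> A \<Longrightarrow> a - b \<in> A" "a \<in> A \<Longrightarrow> b \<in> A \<Longrightarrow> a + b \<in> A" "a \<in> A \<Longrightarrow> - a \<in> A"
    "a \<in> A \<Longrightarrow> b \<in> A \<Longrightarrow> a * b \<in> A" using d p u m by auto
  show "(\<And>x. x \<in> B \<Longrightarrow> F x \<in> A) \<Longrightarrow> sum F B \<in> A"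
    by (induction B rule: infinite_finite_induct) (auto intro: 0 p)
  show "a \<in> A \<Longrightarrow> a ^ k \<in> A" by (induction k) (auto intro: 1 m)
qed

lemma subring_Pring: "subring_set (Pring V)"
  by (auto simp: subring_set_def)

lemma subring_UNIV: "subring_set UNIV"
  by (auto simp: subring_set_def)

text \<open>Fraction-free elimination: multiplying through by the pivot instead of dividing keeps
  the solution inside the subring \<open>A\<close>.\<close>

lemma homogeneous_system:
  fixes M :: "'r \<Rightarrow> 'c \<Rightarrow> 'a::idom"
  assumes A: "subring_set A"
  shows "finite R \<Longrightarrow> finite C \<Longrightarrow> card R < card C \<Longrightarrow> (\<And>r c. r \<in> R \<Longrightarrow> c \<in> C \<Longrightarrow> M r c \<in> A) \<Longrightarrow>
    \<exists>x. (\<forall>c\<in>C. x c \<in> A) \<and> (\<exists>c\<in>C. x c \<noteq> 0) \<and> (\<forall>r\<in>R. (\<Sum>c\<in>C. M r c * x c) = 0)"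
proof (induction R arbitrary: C M rule: finite_induct)
  case empty
  then have "C \<noteq> {}" by auto
  then show ?case using subring_1[OF A] by (intro exI[of _ "\<lambda>_. 1"]) auto
next
  case (insert r R)
  show ?case
  proof (cases "\<forall>c\<in>C. M r c = 0")
    case True
    have "card R < card C" using insert by auto
    then obtain x where "\<forall>c\<in>C. x c \<in> A" "\<exists>c\<in>C. x c \<noteq> 0" "\<forall>r\<in>R. (\<Sum>c\<in>C. M r c * x c) = 0"
      using insert.IH[of C M] insert.prems by blast
    then show ?thesis using True by (intro exI[of _ x]) auto
  next
    case False
    then obtain c0 where c0: "c0 \<in> C" "M r c0 \<noteq> 0" by blast
    define C' where "C' = C - {c0}"
    define p where "p = M r c0"
    have C: "C = insert c0 C'" "c0 \<notin> C'" "finite C'" using c0 insert by (auto simp: C'_def)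
    have "card R < card C'" using insert C by simp
    moreover have "p * M r' c - M r' c0 * M r c \<in> A" if "r' \<in> R" "c \<in> C'" for r' c
      unfolding p_def using insert.prems(3) that c0 by (intro subring_diff subring_mult A) (auto simp: C'_def)
    ultimately obtain x where x: "\<forall>c\<in>C'. x c \<in> A" "\<exists>c\<in>C'. x c \<noteq> 0"
      "\<forall>r'\<in>R. (\<Sum>c\<in>C'. (p * M r' c - M r' c0 * M r c) * x c) = 0"
      using insert.IH[OF C(3), of "\<lambda>r' c. p * M r' c - M r' c0 * M r c"] by blast
    \<comment> \<open>The entry at \<open>c0\<close> is dictated by row \<open>r\<close>; scaling
      the other entries by the pivot avoids a division.\<close>
    define y where "y = (\<lambda>c. if c = c0 then - (\<Sum>c\<in>C'. M r c * x c) else p * x c)"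
    have y: "y c = p * x c" if "c \<in> C'" for c using that C by (auto simp: y_def)
    have s: "(\<Sum>c\<in>C. N c * y c) = (\<Sum>c\<in>C'. (p * N c - N c0 * M r c) * x c)" for N
    proof -
      have "(\<Sum>c\<in>C. N c * y c) = N c0 * y c0 + (\<Sum>c\<in>C'. N c * (p * x c))"
        using C y by simp
      also have "y c0 = - (\<Sum>c\<in>C'. M r c * x c)" by (simp add: y_def)
      finally show ?thesis by (simp add: algebra_simps sum_subtractf sum_distrib_left)
    qed
    have "\<forall>c\<in>C. y c \<in> A"
    proof
      fix c assume c: "c \<in> C"
      show "y c \<in> A"
        unfolding y_def p_def using x c c0 insert.prems(3) C
        by (auto intro!: subring_uminus[OF A] subring_sum[OF A] subring_mult[OF A])
    qed
    moreover have "\<exists>c\<in>C. y c \<noteq> 0" using x c0 C y by (auto simp: p_def)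
    moreover have "(\<Sum>c\<in>C. M r c * y c) = 0" unfolding s by (simp add: p_def)
    moreover have "(\<Sum>c\<in>C. M r' c * y c) = 0" if "r' \<in> R" for r' unfolding s using x that by simp
    ultimately show ?thesis by blast
  qed
qed

lemma
  assumes "is_ideal V P"
  shows ideal_sub: "f \<in> P \<Longrightarrow> f \<in> Pring V"
    and ideal_0: "0 \<in> P"
    and ideal_add: "f \<in> P \<Longrightarrow> g \<in> P \<Longrightarrow> f + g \<in> P"
    and ideal_mult: "f \<in> P \<Longrightarrow> s \<in> Pring V \<Longrightarrow> s * f \<in> P"
    and ideal_mult': "f \<in> P \<Longrightarrow> s \<in> Pring V \<Longrightarrow> f * s \<in> P"
    and ideal_uminus: "f \<in> P \<Longrightarrow> - f \<in> P"
    and ideal_diff: "f \<in> P \<Longrightarrow> g \<in> P \<Longrightarrow> f - g \<in> P"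
    and ideal_sum: "(\<And>x. x \<in> B \<Longrightarrow> F x \<in> P) \<Longrightarrow> sum F B \<in> P"
proof -
  have sub: "\<And>f. f \<in> P \<Longrightarrow> f \<in> Pring V" and 0: "0 \<in> P" and a: "\<And>f g. f \<in> P \<Longrightarrow> g \<in> P \<Longrightarrow> f + g \<in> P"
    and m: "\<And>f s. f \<in> P \<Longrightarrow> s \<in> Pring V \<Longrightarrow> s * f \<in> P"
    using assms by (auto simp: is_ideal_def)
  have u: "- f \<in> P" if "f \<in> P" for f using m[OF that, of "- 1"] Pring_uminus[OF Pring_1] by simp
  show "f \<in> P \<Longrightarrow> f \<in> Pring V" "0 \<in> P" "f \<in> P \<Longrightarrow> g \<in> P \<Longrightarrow> f + g \<in> P"
    "f \<in> P \<Longrightarrow> s \<in> Pring V \<Longrightarrow> s * f \<in> P" "f \<in> P \<Longrightarrow> s \<in> Pring V \<Longrightarrow> f * s \<in> P" "f \<in> P \<Longrightarrow> - f \<in> P"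
    using sub 0 a m u by (auto simp: mult.commute)
  show "f \<in> P \<Longrightarrow> g \<in> P \<Longrightarrow> f - g \<in> P" using a[of f "- g"] u by simp
  show "(\<And>x. x \<in> B \<Longrightarrow> F x \<in> P) \<Longrightarrow> sum F B \<in> P"
    by (induction B rule: infinite_finite_induct) (auto intro: 0 a)
qed

lemma
  assumes "is_prime_ideal V P"
  shows prime_ideal: "is_ideal V P" and prime_1: "1 \<notin> P"
    and prime_cases: "a \<in> Pring V \<Longrightarrow> b \<in> Pring V \<Longrightarrow> a * b \<in> P \<Longrightarrow> a \<in> P \<or> b \<in> P"
    and prime_power: "a \<in> Pring V \<Longrightarrow> a ^ k \<in> P \<Longrightarrow> a \<in> P"
proof -
  show 1: "is_ideal V P" and 2: "1 \<notin> P"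
    and 3: "a \<in> Pring V \<Longrightarrow> b \<in> Pring V \<Longrightarrow> a * b \<in> P \<Longrightarrow> a \<in> P \<or> b \<in> P" for a b
    using assms by (auto simp: is_prime_ideal_def)
  show "a \<in> Pring V \<Longrightarrow> a ^ k \<in> P \<Longrightarrow> a \<in> P"
    by (induction k) (use 2 in \<open>auto dest: 3[rotated 2]\<close>)
qed

definition spn :: "mpoly set \<Rightarrow> mpoly set \<Rightarrow> 'k set \<Rightarrow> ('k \<Rightarrow> mpoly) \<Rightarrow> mpoly set" where
  "spn P A B m = {f. \<exists>h. (\<forall>k\<in>B. h k \<in> A) \<and> f - (\<Sum>k\<in>B. h k * m k) \<in> P}"

lemma spn_add:
  assumes "is_ideal V P" "subring_set A" "f \<in> spn P A B m" "g \<in> spn P A B m"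
  shows "f + g \<in> spn P A B m"
proof -
  obtain h h' where "\<forall>k\<in>B. h k \<in> A" "f - (\<Sum>k\<in>B. h k * m k) \<in> P"
    "\<forall>k\<in>B. h' k \<in> A" "g - (\<Sum>k\<in>B. h' k * m k) \<in> P" using assms by (auto simp: spn_def)
  moreover from this have "(f - (\<Sum>k\<in>B. h k * m k)) + (g - (\<Sum>k\<in>B. h' k * m k)) \<in> P"
    using ideal_add[OF assms(1)] by blast
  then have "(f + g) - (\<Sum>k\<in>B. (h k + h' k) * m k) \<in> P" by (simp add: sum.distrib algebra_simps)
  ultimately show ?thesis
    unfolding spn_def using subring_add[OF assms(2)] by (intro CollectI exI[of _ "\<lambda>k. h k + h' k"]) blast
qed

lemma spn_mult:
  assumes "is_ideal V P" "subring_set A" "A \<subseteq> Pring V" "f \<in> spn P A B m" "a \<in> A"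
  shows "a * f \<in> spn P A B m"
proof -
  obtain h where h: "\<forall>k\<in>B. h k \<in> A" "f - (\<Sum>k\<in>B. h k * m k) \<in> P" using assms by (auto simp: spn_def)
  then have "a * (f - (\<Sum>k\<in>B. h k * m k)) \<in> P" using ideal_mult[OF assms(1)] assms by blast
  then have "a * f - (\<Sum>k\<in>B. (a * h k) * m k) \<in> P" by (simp add: algebra_simps sum_distrib_left)
  then show ?thesis
    unfolding spn_def using subring_mult[OF assms(2,5)] h by (intro CollectI exI[of _ "\<lambda>k. a * h k"]) blast
qed

lemma spn_ideal: "is_ideal V P \<Longrightarrow> subring_set A \<Longrightarrow> f \<in> P \<Longrightarrow> f \<in> spn P A B m"
  unfolding spn_def by (intro CollectI exI[of _ "\<lambda>_. 0"]) (auto intro: subring_0)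

lemma spn_sum:
  assumes "is_ideal V P" "subring_set A" "\<And>x. x \<in> C \<Longrightarrow> F x \<in> spn P A B m"
  shows "sum F C \<in> spn P A B m"
  using assms(3)
  by (induction C rule: infinite_finite_induct)
     (auto intro: spn_add[OF assms(1,2)] spn_ideal[OF assms(1,2)] ideal_0[OF assms(1)])

text \<open>Each multiplication by a variable costs one factor \<open>b\<close>, so a high power of
  \<open>b\<close> carries any polynomial into the span. In other words, the span becomes the whole
  ring once \<open>b\<close> is inverted.\<close>

lemma spn_absorb:
  assumes P: "is_ideal V P" and A: "subring_set A" "A \<subseteq> Pring V" "\<And>a. const a \<in> A"
    and b: "b \<in> A"
    and one: "1 \<in> spn P A B m"
    and X: "\<And>v k. v \<in> V \<Longrightarrow> k \<in> B \<Longrightarrow> b * Xv v * m k \<in> spn P A B m"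
    and f: "f \<in> Pring V"
  shows "\<exists>K. b ^ K * f \<in> spn P A B m"
  using f
proof (induction f rule: Pring_induct)
  case (const a)
  show ?case using spn_mult[OF P A(1,2) one A(3)[of a]] by (intro exI[of _ 0]) simp
next
  case (add f g)
  then obtain K L where "b ^ K * f \<in> spn P A B m" "b ^ L * g \<in> spn P A B m" by blast
  then have "b ^ L * (b ^ K * f) \<in> spn P A B m" "b ^ K * (b ^ L * g) \<in> spn P A B m"
    by (auto intro!: spn_mult[OF P A(1,2)] subring_power[OF A(1) b])
  then have "b ^ L * (b ^ K * f) + b ^ K * (b ^ L * g) \<in> spn P A B m"
    by (rule spn_add[OF P A(1)])
  then show ?case by (intro exI[of _ "K + L"]) (simp add: power_add algebra_simps)
next
  case (Xv v f)
  then obtain K where "b ^ K * f \<in> spn P A B m" by blast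
  then obtain h where h: "\<forall>k\<in>B. h k \<in> A" "b ^ K * f - (\<Sum>k\<in>B. h k * m k) \<in> P" by (auto simp: spn_def)
  have "b * Xv v * (b ^ K * f - (\<Sum>k\<in>B. h k * m k)) \<in> P"
    using h Xv b A by (intro ideal_mult[OF P]) auto
  moreover have "(\<Sum>k\<in>B. h k * (b * Xv v * m k)) \<in> spn P A B m"
    using h spn_mult[OF P A(1,2) X[OF Xv(1)]] by (intro spn_sum[OF P A(1)]) blast
  ultimately have "b * Xv v * (b ^ K * f - (\<Sum>k\<in>B. h k * m k)) + (\<Sum>k\<in>B. h k * (b * Xv v * m k)) \<in> spn P A B m"
    using spn_add[OF P A(1) spn_ideal[OF P A(1)]] by blast
  then have "b ^ Suc K * (Xv v * f) \<in> spn P A B m"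
    by (simp add: algebra_simps sum_distrib_left)
  then show ?case by blast
qed

text \<open>The powers of \<open>f\<close>, cleared of denominators, are linearly dependent over \<open>A\<close>.\<close>

lemma algebraic_multiple:
  assumes P: "is_prime_ideal V P" and A: "subring_set A" "A \<subseteq> Pring V" "\<And>a. const a \<in> A"
    and b: "b \<in> A" "b \<noteq> 0"
    and one: "1 \<in> spn P A B m"
    and X: "\<And>v k. v \<in> V \<Longrightarrow> k \<in> B \<Longrightarrow> b * Xv v * m k \<in> spn P A B m"
    and B: "finite B" "\<And>k. k \<in> B \<Longrightarrow> m k \<in> Pring V"
    and f: "f \<in> Pring V" "f \<notin> P"
  shows "\<exists>a\<in>A. a \<noteq> 0 \<and> (\<exists>f'\<in>Pring V. f * f' - a \<in> P)"
proof -
  note I = prime_ideal[OF P]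
  have "\<exists>K h. (\<forall>k\<in>B. h k \<in> A) \<and> b ^ K * f ^ i - (\<Sum>k\<in>B. h k * m k) \<in> P" for i
    using spn_absorb[OF I A b(1) one X Pring_power[OF f(1)], of i] by (auto simp: spn_def)
  then obtain K h where h: "\<And>i k. k \<in> B \<Longrightarrow> h i k \<in> A"
    "\<And>i. b ^ K i * f ^ i - (\<Sum>k\<in>B. h i k * m k) \<in> P" by metis
  define N where "N = card B"
  define L where "L = (\<Sum>i\<le>N. K i)"
  have KL: "K i \<le> L" if "i \<le> N" for i unfolding L_def using that by (intro member_le_sum) auto
  define M where "M = (\<lambda>k i. b ^ (L - K i) * h i k)"
  have "\<exists>x. (\<forall>i\<in>{..N}. x i \<in> A) \<and> (\<exists>i\<in>{..N}. x i \<noteq> 0) \<and> (\<forall>k\<in>B. (\<Sum>i\<in>{..N}. M k i * x i) = 0)"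
    by (rule homogeneous_system[OF A(1) B(1)])
       (auto simp: N_def M_def intro: subring_mult[OF A(1)] subring_power[OF A(1)] b h)
  then obtain x where x: "\<And>i. i \<le> N \<Longrightarrow> x i \<in> A" "\<exists>i\<le>N. x i \<noteq> 0"
    "\<And>k. k \<in> B \<Longrightarrow> (\<Sum>i\<le>N. M k i * x i) = 0" by auto
  have "(\<Sum>i\<le>N. x i * b ^ (L - K i) * (b ^ K i * f ^ i - (\<Sum>k\<in>B. h i k * m k))) \<in> P"
    using x(1) A(2) b(1) by (intro ideal_sum[OF I] ideal_mult[OF I] h(2) Pring_mult Pring_power) auto
  also have "(\<Sum>i\<le>N. x i * b ^ (L - K i) * (b ^ K i * f ^ i - (\<Sum>k\<in>B. h i k * m k))) =
      (\<Sum>i\<le>N. x i * b ^ L * f ^ i) - (\<Sum>i\<le>N. \<Sum>k\<in>B. x i * M k i * m k)"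
    unfolding sum_subtractf[symmetric]
  proof (rule sum.cong)
    fix i assume "i \<in> {..N}"
    then have "b ^ L = b ^ (L - K i) * b ^ K i" using KL[of i] by (simp flip: power_add)
    then show "x i * b ^ (L - K i) * (b ^ K i * f ^ i - (\<Sum>k\<in>B. h i k * m k)) =
        x i * b ^ L * f ^ i - (\<Sum>k\<in>B. x i * M k i * m k)"
      by (simp add: M_def right_diff_distrib sum_distrib_left mult_ac)
  qed simp
  also have "(\<Sum>i\<le>N. \<Sum>k\<in>B. x i * M k i * m k) = (\<Sum>k\<in>B. (\<Sum>i\<le>N. M k i * x i) * m k)"
    by (subst sum.swap) (simp add: sum_distrib_left sum_distrib_right mult_ac)
  also have "\<dots> = 0" by (simp add: x)
  finally have rel: "(\<Sum>i\<le>N. x i * b ^ L * f ^ i) \<in> P" by simp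
  \<comment> \<open>Start at the lowest nonzero coefficient of the relation. Since \<open>P\<close>
    is prime and \<open>f\<close> lies outside it, \<open>f ^ i0\<close> can be cancelled, which
    leaves \<open>a + f * s\<close> in \<open>P\<close> with \<open>a\<close> nonzero.\<close>
  define i0 where "i0 = (LEAST i. i \<le> N \<and> x i \<noteq> 0)"
  have i0: "i0 \<le> N" "x i0 \<noteq> 0" using LeastI_ex[of "\<lambda>i. i \<le> N \<and> x i \<noteq> 0"] x(2) by (auto simp: i0_def)
  have below: "x i = 0" if "i < i0" for i
    using not_less_Least[of i "\<lambda>i. i \<le> N \<and> x i \<noteq> 0"] that i0 by (auto simp: i0_def)
  define a where "a = x i0 * b ^ L"
  define s where "s = (\<Sum>i\<in>{i0<..N}. x i * b ^ L * f ^ (i - Suc i0))"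
  have aA: "a \<in> A" unfolding a_def using x i0 b by (intro subring_mult[OF A(1)] subring_power[OF A(1)]) auto
  have sP: "s \<in> Pring V" unfolding s_def using x A b f by (intro Pring_sum Pring_mult Pring_power) auto
  have "(\<Sum>i\<le>N. x i * b ^ L * f ^ i) = (\<Sum>i\<in>insert i0 {i0<..N}. x i * b ^ L * f ^ i)"
    by (rule sum.mono_neutral_right) (use i0 below in \<open>auto simp: not_le not_less\<close>)
  also have "\<dots> = a * f ^ i0 + (\<Sum>i\<in>{i0<..N}. f ^ Suc i0 * (x i * b ^ L * f ^ (i - Suc i0)))"
  proof -
    have "f ^ i = f ^ Suc i0 * f ^ (i - Suc i0)" if "i \<in> {i0<..N}" for i
      using that by (simp only: flip: power_add) simp
    then have "(\<Sum>i\<in>{i0<..N}. x i * b ^ L * f ^ i) = (\<Sum>i\<in>{i0<..N}. f ^ Suc i0 * (x i * b ^ L * f ^ (i - Suc i0)))"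
      by (intro sum.cong) (simp_all add: mult_ac)
    then show ?thesis by (simp add: a_def)
  qed
  also have "\<dots> = f ^ i0 * (a + f * s)"
    unfolding sum_distrib_left[symmetric] s_def[symmetric] by (simp add: algebra_simps)
  finally have "f ^ i0 * (a + f * s) \<in> P" using rel by simp
  moreover have "f ^ i0 \<notin> P" using prime_power[OF P f(1)] f(2) by blast
  ultimately have "a + f * s \<in> P" using prime_cases[OF P] f sP aA A by blast
  moreover have "- (a + f * s) = f * (- s) - a" by (simp add: algebra_simps)
  ultimately have "f * (- s) - a \<in> P" using ideal_uminus[OF I] by metis
  moreover have "a \<noteq> 0" using i0 b by (simp add: a_def)
  ultimately show ?thesis using aA sP by blast
qed

section \<open>Chains of prime ideals\<close>

lemma spn_gen:
  assumes "is_ideal V P" "subring_set A" "finite B" "k \<in> B"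
  shows "m k \<in> spn P A B m"
proof -
  have "(\<Sum>j\<in>B. (if j = k then 1 else 0) * m j) = (\<Sum>j\<in>B. if j = k then m j else 0)"
    by (intro sum.cong) auto
  then have "m k - (\<Sum>j\<in>B. (if j = k then 1 else 0) * m j) \<in> P"
    using assms ideal_0[OF assms(1)] by simp
  then show ?thesis
    unfolding spn_def using subring_0[OF assms(2)] subring_1[OF assms(2)]
    by (intro CollectI exI[of _ "\<lambda>j. if j = k then 1 else 0"]) auto
qed

text \<open>If every further variable were algebraic over \<open>Pring Y\<close> modulo
  \<open>P\<close>, then so would be every polynomial. An element of \<open>Q\<close> outside
  \<open>P\<close> would have a nonzero multiple in \<open>Pring Y\<close> modulo \<open>P\<close>,
  and that multiple would lie in \<open>Q\<close>. So descending by one prime frees at least one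
  more variable.\<close>

lemma independent_step:
  assumes V: "finite V" "Y \<subseteq> V" and P: "is_prime_ideal V P" and Q: "is_prime_ideal V Q"
    and PQ: "P \<subset> Q" and Y: "Pring Y \<inter> Q \<subseteq> {0}"
  shows "\<exists>v\<in>V - Y. Pring (insert v Y) \<inter> P \<subseteq> {0}"
proof (rule ccontr)
  note I = prime_ideal[OF P]
  assume "\<not> ?thesis"
  then have "\<forall>v\<in>V - Y. \<exists>F. F \<in> Pring (insert v Y) \<and> F \<in> P \<and> F \<noteq> 0" by blast
  then obtain F where F: "\<And>v. v \<in> V - Y \<Longrightarrow> F v \<in> Pring (insert v Y)"
    "\<And>v. v \<in> V - Y \<Longrightarrow> F v \<in> P" "\<And>v. v \<in> V - Y \<Longrightarrow> F v \<noteq> 0" by metis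
  define p where "p = (\<lambda>v. up v (F v))"
  define e where "e = (\<lambda>v. Polynomial.degree (p v))"
  have pP: "coeff (p v) i \<in> Pring Y" if "v \<in> V - Y" for v i
    using up_PV[OF F(1)[OF that]] by (simp add: p_def PV_def)
  have pF: "F v = (\<Sum>i<e v. coeff (p v) i * Xv v ^ i) + lead_coeff (p v) * Xv v ^ e v" for v
    using poly_up[of v "F v"] unfolding p_def e_def
    by (simp add: poly_altdef lessThan_Suc_atMost[symmetric])
  have lc: "lead_coeff (p v) \<noteq> 0" if "v \<in> V - Y" for v using F(3)[OF that] by (simp add: p_def)
  have e: "e v > 0" if v: "v \<in> V - Y" for v
  proof (rule ccontr)
    assume "\<not> e v > 0"
    then have "F v = coeff (p v) 0" using pF[of v] by (simp add: e_def)
    then have "F v \<in> Pring Y \<inter> Q" using pP[OF v] F(2)[OF v] PQ by auto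
    then show False using Y F(3)[OF v] by blast
  qed
  define B where "B = PiE (V - Y) (\<lambda>v. {..<e v})"
  define m where "m = (\<lambda>\<kappa>. \<Prod>v\<in>V - Y. Xv v ^ \<kappa> v)"
  \<comment> \<open>The product of all leading coefficients is one denominator that serves every
    reduction of a top power.\<close>
  define b where "b = (\<Prod>v\<in>V - Y. lead_coeff (p v))"
  define A where "A = Pring Y"
  have fin: "finite B" unfolding B_def using V by (intro finite_PiE) auto
  have A: "subring_set A" "A \<subseteq> Pring V" "\<And>a. const a \<in> A"
    using subring_Pring Pring_mono[OF _ V(2)] by (auto simp: A_def)
  have bA: "b \<in> A" unfolding A_def b_def using pP by auto
  have b0: "b \<noteq> 0" unfolding b_def using lc V by (subst prod_zero_iff) auto
  have "1 = m (restrict (\<lambda>_. 0) (V - Y))" by (simp add: m_def)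
  also have "\<dots> \<in> spn P A B m"
    using e by (intro spn_gen[OF I A(1) fin]) (auto simp only: B_def restrict_PiE_iff lessThan_iff)
  finally have one: "1 \<in> spn P A B m" .
  have mV: "m \<kappa> \<in> Pring V" for \<kappa> unfolding m_def by (intro Pring_prod Pring_power) simp
  have mupd: "m (\<kappa>(v := i)) = Xv v ^ i * (\<Prod>u\<in>V - Y - {v}. Xv u ^ \<kappa> u)" if "v \<in> V - Y" for \<kappa> v i
  proof -
    have "m (\<kappa>(v := i)) = Xv v ^ i * (\<Prod>u\<in>V - Y - {v}. Xv u ^ (\<kappa>(v := i)) u)"
      unfolding m_def using V that by (subst prod.remove[of _ v]) auto
    then show ?thesis by simp
  qed
  have X: "b * Xv v * m \<kappa> \<in> spn P A B m" if v: "v \<in> V" and \<kappa>: "\<kappa> \<in> B" for v \<kappa>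
  proof (cases "v \<in> Y")
    case True
    then have "b * Xv v \<in> A" using bA by (auto simp: A_def)
    then show ?thesis by (intro spn_mult[OF I A(1,2)] spn_gen[OF I A(1) fin \<kappa>])
  next
    case False
    then have vV: "v \<in> V - Y" using v by simp
    define R where "R = (\<Prod>u\<in>V - Y - {v}. Xv u ^ \<kappa> u)"
    have m\<kappa>: "m \<kappa> = Xv v ^ \<kappa> v * R" using mupd[OF vV, of \<kappa> "\<kappa> v"] by (simp add: R_def)
    have mem: "\<kappa>(v := i) \<in> B" if "i < e v" for i
      using \<kappa> vV that unfolding B_def by (auto simp: PiE_iff extensional_def)
    have kv: "\<kappa> v < e v" using \<kappa> vV by (auto simp: B_def)
    show ?thesis
    proof (cases "Suc (\<kappa> v) < e v")
      case True
      have "Xv v * m \<kappa> = m (\<kappa>(v := Suc (\<kappa> v)))" using mupd[OF vV] m\<kappa> by (simp add: R_def mult_ac)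
      then have "Xv v * m \<kappa> \<in> spn P A B m" using spn_gen[OF I A(1) fin mem[OF True]] by metis
      from spn_mult[OF I A(1,2) this bA] show ?thesis by (simp add: mult_ac)
    next
      case False
      then have ev: "e v = Suc (\<kappa> v)" using kv by simp
      define b' where "b' = (\<Prod>u\<in>V - Y - {v}. lead_coeff (p u))"
      have b': "b = lead_coeff (p v) * b'" unfolding b_def b'_def using V vV by (subst prod.remove[of _ v]) auto
      have b'A: "b' \<in> A" unfolding A_def b'_def using pP by auto
      have "b * Xv v * m \<kappa> = (lead_coeff (p v) * Xv v ^ e v) * (b' * R)"
        unfolding m\<kappa> b' ev by (simp add: mult_ac)
      also have "lead_coeff (p v) * Xv v ^ e v = F v - (\<Sum>i<e v. coeff (p v) i * Xv v ^ i)"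
        unfolding pF[of v] by simp
      also have "\<dots> * (b' * R) = F v * (b' * R) + (\<Sum>i<e v. - (b' * coeff (p v) i) * m (\<kappa>(v := i)))"
        unfolding mupd[OF vV] R_def[symmetric]
        by (simp add: right_diff_distrib left_diff_distrib sum_distrib_left sum_distrib_right sum_negf mult_ac)
      also have "\<dots> \<in> spn P A B m"
      proof (intro spn_add[OF I A(1)] spn_sum[OF I A(1)])
        have "R \<in> Pring V" unfolding R_def by (intro Pring_prod Pring_power) simp
        then show "F v * (b' * R) \<in> spn P A B m"
          using F(2)[OF vV] b'A A(2) by (intro spn_ideal[OF I A(1)] ideal_mult'[OF I]) auto
        fix i assume "i \<in> {..<e v}"
        then show "- (b' * coeff (p v) i) * m (\<kappa>(v := i)) \<in> spn P A B m"
          using pP[OF vV, of i] b'A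
          by (intro spn_mult[OF I A(1,2)] spn_gen[OF I A(1) fin mem]) (auto simp: A_def)
      qed
      finally show ?thesis .
    qed
  qed
  obtain f where f: "f \<in> Q" "f \<notin> P" using PQ by blast
  then have fV: "f \<in> Pring V" using ideal_sub[OF prime_ideal[OF Q]] by blast
  obtain a f' where a: "a \<in> A" "a \<noteq> 0" "f' \<in> Pring V" "f * f' - a \<in> P"
    using algebraic_multiple[OF P A bA b0 one X fin mV fV f(2)] by blast
  have "f * f' - (f * f' - a) \<in> Q"
    using ideal_diff[OF prime_ideal[OF Q] ideal_mult'[OF prime_ideal[OF Q] f(1) a(3)]] a(4) PQ by blast
  then have "a \<in> Pring Y \<inter> Q" using a by (simp add: A_def)
  then have "a \<in> {0}" by (rule subsetD[OF Y])
  then show False using a(2) by simp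
qed

lemma const_of_Pring_empty: "f \<in> Pring {} \<Longrightarrow> \<exists>a. f = const a"
proof (induction f rule: Pring_induct)
  case (add f g)
  then obtain a b where "f = const a" "g = const b" by blast
  then have "f + g = const (a + b)" by (simp only: const_hom(1))
  then show ?case ..
qed auto

text \<open>Descends the chain from its top prime, where the empty set of variables is independent,
  by \<open>independent_step\<close>. This replaces transcendence degrees in the upper bound for the
  dimension.\<close>

lemma prime_chain_independent:
  assumes V: "finite V" and ch: "prime_chain V I d"
  shows "\<exists>Y\<subseteq>V. card Y = d \<and> Pring Y \<inter> I \<subseteq> {0}"
proof -
  obtain P where P: "\<And>i. i \<le> d \<Longrightarrow> is_prime_ideal V (P i)" "\<And>i. i \<le> d \<Longrightarrow> I \<subseteq> P i"
    "\<And>i. i < d \<Longrightarrow> P i \<subset> P (Suc i)" using ch unfolding prime_chain_def by blast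
  have "k \<le> d \<Longrightarrow> \<exists>Y\<subseteq>V. card Y = k \<and> Pring Y \<inter> P (d - k) \<subseteq> {0}" for k
  proof (induction k)
    case 0
    have "Pring {} \<inter> P d \<subseteq> {0}"
    proof
      fix f assume "f \<in> Pring {} \<inter> P d"
      then have f: "f \<in> Pring {}" "f \<in> P d" by auto
      obtain a where a: "f = const a" using const_of_Pring_empty f(1) by blast
      have "a = 0"
      proof (rule ccontr)
        assume "a \<noteq> 0"
        then have "const (inverse a * a) = 1" by simp
        then have "const (inverse a) * f = 1" unfolding a const_hom(2) .
        then have "1 \<in> P d"
          using ideal_mult[OF prime_ideal[OF P(1)[OF order_refl]] f(2) Pring_const[of "inverse a"]] by simp
        then show False using prime_1[OF P(1)[OF order_refl]] by simp
      qed
      then show "f \<in> {0}" using a by simp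
    qed
    then show ?case by (intro exI[of _ "{}"]) simp
  next
    case (Suc k)
    then obtain Y where Y: "Y \<subseteq> V" "card Y = k" "Pring Y \<inter> P (d - k) \<subseteq> {0}" by auto
    have "d - k = Suc (d - Suc k)" using Suc.prems by simp
    then have "P (d - Suc k) \<subset> P (d - k)" using P(3)[of "d - Suc k"] Suc.prems by simp
    from independent_step[OF V Y(1) P(1)[OF diff_le_self] P(1)[OF diff_le_self] this Y(3)]
    obtain v where v: "v \<in> V - Y" "Pring (insert v Y) \<inter> P (d - Suc k) \<subseteq> {0}" by blast
    have "card (insert v Y) = Suc k" "insert v Y \<subseteq> V" using v Y V by (simp_all add: finite_subset)
    then show ?case using v(2) by blast
  qed
  from this[of d] obtain Y where "Y \<subseteq> V" "card Y = d" "Pring Y \<inter> P 0 \<subseteq> {0}" by auto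
  moreover have "I \<subseteq> P 0" by (rule P(2)) simp
  ultimately show ?thesis by blast
qed

section \<open>Independence of radicals\<close>

text \<open>With \<open>x\<close> a local parameter, \<open>x\<close> times the derivative keeps the
  factor \<open>x ^ b\<close> and turns the order of vanishing \<open>b\<close> into a
  coefficient.\<close>

lemma x_pderiv_power:
  fixes v :: "complex poly"
  assumes "pderiv x = 1"
  shows "x * pderiv (x ^ b * v) = x ^ b * (x * pderiv v + smult (of_nat b) v)"
proof (cases b)
  case (Suc k)
  show ?thesis unfolding Suc
    by (simp only: pderiv_mult pderiv_power_Suc assms) (simp add: algebra_simps smult_add_left smult_add_right)
qed simp

text \<open>Differentiating \<open>X i ^ e i\<close> gives the logarithmic derivative of
  \<open>X i\<close>, namely \<open>\<beta> i / e i\<close> over the linear polynomial of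
  \<open>X i\<close>. Multiplying by all linear polynomials at once clears the denominators.\<close>

lemma log_deriv_prod:
  fixes X :: "nat \<Rightarrow> complex fps"
  assumes "finite J" "\<And>i. i \<in> J \<Longrightarrow> e i > 0" "\<And>i. i \<in> J \<Longrightarrow> \<beta> i \<noteq> 0"
    and X: "\<And>i. i \<in> J \<Longrightarrow> X i ^ e i = fps_of_poly [:- (t i * \<beta> i), \<beta> i:]"
  shows "fps_of_poly (\<Prod>i\<in>J. [:- (t i * \<beta> i), \<beta> i:]) * fps_deriv (\<Prod>i\<in>J. X i ^ \<kappa> i) =
    fps_of_poly (\<Sum>i\<in>J. smult (of_nat (\<kappa> i) * \<beta> i / of_nat (e i)) (\<Prod>j\<in>J - {i}. [:- (t j * \<beta> j), \<beta> j:])) *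
      (\<Prod>i\<in>J. X i ^ \<kappa> i)"
  using assms
proof (induction J rule: finite_induct)
  case (insert k J)
  define L where "L = (\<lambda>j. [:- (t j * \<beta> j), \<beta> j:])"
  define P where "P = (\<Prod>i\<in>J. L i)"
  define E where "E = (\<Prod>i\<in>J. X i ^ \<kappa> i)"
  define c where "c = (\<Sum>i\<in>J. smult (of_nat (\<kappa> i) * \<beta> i / of_nat (e i)) (\<Prod>j\<in>J - {i}. L j))"
  have IH: "fps_of_poly P * fps_deriv E = fps_of_poly c * E"
    unfolding P_def E_def c_def L_def using insert by auto
  have Xk: "X k ^ e k = fps_of_poly (L k)" and ek: "e k > 0" and bk: "\<beta> k \<noteq> 0"
    using insert.prems by (auto simp: L_def)
  have "fps_deriv (X k ^ e k) = fps_const (\<beta> k)"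
    unfolding Xk L_def by (simp add: fps_of_poly_pderiv[symmetric] pderiv_pCons fps_of_poly_const)
  then have "fps_const (of_nat (e k)) * fps_deriv (X k) * X k ^ (e k - 1) = fps_const (\<beta> k)"
    by (simp add: fps_deriv_power)
  then have 1: "fps_const (of_nat (e k)) * fps_deriv (X k) * (X k ^ (e k - 1) * X k) = fps_const (\<beta> k) * X k"
    by (metis mult.assoc)
  have 2: "fps_of_poly (L k) = X k ^ (e k - 1) * X k" using ek Xk by (metis power_minus_mult)
  have "fps_const (of_nat (e k)) * (fps_of_poly (L k) * fps_deriv (X k)) = fps_const (\<beta> k) * X k"
    unfolding 1[symmetric] unfolding 2 by (simp only: mult_ac)
  then have "fps_const (1 / of_nat (e k)) * (fps_const (of_nat (e k)) * (fps_of_poly (L k) * fps_deriv (X k))) =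
      fps_const (1 / of_nat (e k)) * (fps_const (\<beta> k) * X k)" by simp
  then have LX: "fps_of_poly (L k) * fps_deriv (X k) = fps_const (\<beta> k / of_nat (e k)) * X k"
    unfolding mult.assoc[symmetric] fps_const_mult using ek by simp
  have DX: "fps_of_poly (L k) * fps_deriv (X k ^ \<kappa> k) = fps_const (of_nat (\<kappa> k) * \<beta> k / of_nat (e k)) * X k ^ \<kappa> k"
  proof (cases "\<kappa> k")
    case (Suc q)
    have "fps_of_poly (L k) * fps_deriv (X k ^ \<kappa> k) = 
       fps_const (of_nat (\<kappa> k)) * (fps_of_poly (L k) * fps_deriv (X k)) * X k ^ q"
      unfolding fps_deriv_power Suc by (simp only: diff_Suc_1 mult_ac)
    also have "\<dots> = fps_const (of_nat (\<kappa> k)) * fps_const (\<beta> k / of_nat (e k)) * (X k * X k ^ q)"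
      unfolding LX by (simp only: mult.assoc)
    finally show ?thesis by (simp add: Suc mult.assoc)
  qed simp
  have "(\<Sum>i\<in>J. smult (of_nat (\<kappa> i) * \<beta> i / of_nat (e i)) (\<Prod>j\<in>insert k J - {i}. L j)) = L k * c"
    unfolding c_def sum_distrib_left
  proof (rule sum.cong)
    fix i assume i: "i \<in> J"
    then have "insert k J - {i} = insert k (J - {i})" using insert by auto
    then have "(\<Prod>j\<in>insert k J - {i}. L j) = L k * (\<Prod>j\<in>J - {i}. L j)" using insert by simp
    then show "smult (of_nat (\<kappa> i) * \<beta> i / of_nat (e i)) (\<Prod>j\<in>insert k J - {i}. L j) =
      L k * smult (of_nat (\<kappa> i) * \<beta> i / of_nat (e i)) (\<Prod>j\<in>J - {i}. L j)" by simp
  qed simp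
  moreover have "insert k J - {k} = J" using insert by auto
  ultimately have c': "(\<Sum>i\<in>insert k J. smult (of_nat (\<kappa> i) * \<beta> i / of_nat (e i)) (\<Prod>j\<in>insert k J - {i}. L j)) =
      smult (of_nat (\<kappa> k) * \<beta> k / of_nat (e k)) P + L k * c"
    using insert.hyps by (simp add: P_def)
  have "fps_of_poly (L k * P) * fps_deriv (X k ^ \<kappa> k * E) =
    (fps_of_poly (L k) * fps_deriv (X k ^ \<kappa> k)) * fps_of_poly P * E +
    fps_of_poly (L k) * X k ^ \<kappa> k * (fps_of_poly P * fps_deriv E)"
    by (simp add: fps_of_poly_mult algebra_simps)
  also have "\<dots> = fps_of_poly (smult (of_nat (\<kappa> k) * \<beta> k / of_nat (e k)) P + L k * c) * (X k ^ \<kappa> k * E)"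
    unfolding IH DX by (simp add: fps_of_poly_mult fps_of_poly_add fps_of_poly_smult algebra_simps)
  finally show ?case
    using insert.hyps c' unfolding L_def P_def E_def by simp
qed simp

text \<open>Kummer independence, by descent on the length of a relation: differentiating and eliminating
  one term produces a shorter relation, so two terms must have proportional logarithmic
  derivatives, and the residues at the points \<open>t i\<close> identify the exponents.\<close>

lemma kummer_independence:
  fixes X :: "nat \<Rightarrow> complex fps" and H :: "(nat \<Rightarrow> nat) \<Rightarrow> complex poly"
  assumes fin: "finite J" "finite C"
    and e: "\<And>i. i \<in> J \<Longrightarrow> e i > 0" and \<beta>: "\<And>i. i \<in> J \<Longrightarrow> \<beta> i \<noteq> 0"
    and X: "\<And>i. i \<in> J \<Longrightarrow> X i ^ e i = fps_of_poly [:- (t i * \<beta> i), \<beta> i:]"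
    and inj: "inj_on t J"
    and C: "\<And>\<kappa> i. \<kappa> \<in> C \<Longrightarrow> i \<in> J \<Longrightarrow> \<kappa> i < e i"
    and ext: "\<And>\<kappa> \<kappa>'. \<kappa> \<in> C \<Longrightarrow> \<kappa>' \<in> C \<Longrightarrow> (\<forall>i\<in>J. \<kappa> i = \<kappa>' i) \<Longrightarrow> \<kappa> = \<kappa>'"
    and rel: "(\<Sum>\<kappa>\<in>C. fps_of_poly (H \<kappa>) * (\<Prod>i\<in>J. X i ^ \<kappa> i)) = 0"
  shows "\<forall>\<kappa>\<in>C. H \<kappa> = 0"
  using rel
proof (induction "card {\<kappa> \<in> C. H \<kappa> \<noteq> 0}" arbitrary: H rule: less_induct)
  case less
  define L where "L = (\<lambda>j. [:- (t j * \<beta> j), \<beta> j:])"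
  define P where "P = (\<Prod>i\<in>J. L i)"
  define E where "E = (\<lambda>\<kappa>. \<Prod>i\<in>J. X i ^ \<kappa> i)"
  define c where "c = (\<lambda>\<kappa>. \<Sum>i\<in>J. smult (of_nat (\<kappa> i) * \<beta> i / of_nat (e i)) (\<Prod>j\<in>J - {i}. L j))"
  have dE: "fps_of_poly P * fps_deriv (E \<kappa>) = fps_of_poly (c \<kappa>) * E \<kappa>" for \<kappa>
    unfolding P_def E_def c_def L_def by (rule log_deriv_prod[OF fin(1) e \<beta> X])
  have X0: "X i \<noteq> 0" if "i \<in> J" for i
    using X[OF that] \<beta>[OF that] e[OF that] by (auto simp: zero_power)
  have E0: "E \<kappa> \<noteq> 0" for \<kappa> unfolding E_def using X0 fin by auto
  show ?case
  proof (rule ccontr)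
    assume "\<not> ?thesis"
    then obtain a where a: "a \<in> C" "H a \<noteq> 0" by blast
    have "\<exists>b\<in>C. H b \<noteq> 0 \<and> b \<noteq> a"
    proof (rule ccontr)
      assume "\<not> ?thesis"
      then have "(\<Sum>\<kappa>\<in>C. fps_of_poly (H \<kappa>) * E \<kappa>) = (\<Sum>\<kappa>\<in>C. if \<kappa> = a then fps_of_poly (H a) * E a else 0)"
        by (intro sum.cong) auto
      then have "fps_of_poly (H a) * E a = 0"
        using less.prems a fin by (simp add: E_def)
      then show False using E0 a by simp
    qed
    then obtain b where b: "b \<in> C" "H b \<noteq> 0" "b \<noteq> a" by blast
    \<comment> \<open>\<open>P\<close> clears the denominators of all logarithmic derivatives. Hence
      \<open>P\<close> times the derivative of the relation is again a relation, with coefficients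
      \<open>K\<close>.\<close>
    define K where "K = (\<lambda>\<kappa>. P * pderiv (H \<kappa>) + H \<kappa> * c \<kappa>)"
    have "0 = fps_of_poly P * fps_deriv (\<Sum>\<kappa>\<in>C. fps_of_poly (H \<kappa>) * E \<kappa>)"
      using less.prems by (simp add: E_def)
    also have "\<dots> = (\<Sum>\<kappa>\<in>C. fps_of_poly P * fps_of_poly (pderiv (H \<kappa>)) * E \<kappa> +
        fps_of_poly (H \<kappa>) * (fps_of_poly P * fps_deriv (E \<kappa>)))"
      by (simp add: fps_deriv_sum sum_distrib_left fps_of_poly_pderiv algebra_simps)
    also have "\<dots> = (\<Sum>\<kappa>\<in>C. fps_of_poly (K \<kappa>) * E \<kappa>)"
      unfolding dE K_def by (simp add: fps_of_poly_add fps_of_poly_mult algebra_simps)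
    finally have Krel: "(\<Sum>\<kappa>\<in>C. fps_of_poly (K \<kappa>) * E \<kappa>) = 0" by simp
    define H' where "H' = (\<lambda>\<kappa>. H a * K \<kappa> - K a * H \<kappa>)"
    have "(\<Sum>\<kappa>\<in>C. fps_of_poly (H' \<kappa>) * E \<kappa>) =
        fps_of_poly (H a) * (\<Sum>\<kappa>\<in>C. fps_of_poly (K \<kappa>) * E \<kappa>) -
        fps_of_poly (K a) * (\<Sum>\<kappa>\<in>C. fps_of_poly (H \<kappa>) * E \<kappa>)"
      by (simp add: H'_def fps_of_poly_diff fps_of_poly_mult sum_distrib_left sum_subtractf algebra_simps)
    also have "\<dots> = 0" using Krel less.prems by (simp add: E_def)
    finally have rel': "(\<Sum>\<kappa>\<in>C. fps_of_poly (H' \<kappa>) * (\<Prod>i\<in>J. X i ^ \<kappa> i)) = 0" by (simp add: E_def)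
    have "H' a = 0" "\<And>\<kappa>. H \<kappa> = 0 \<Longrightarrow> H' \<kappa> = 0" by (simp_all add: H'_def K_def)
    then have "{\<kappa> \<in> C. H' \<kappa> \<noteq> 0} \<subset> {\<kappa> \<in> C. H \<kappa> \<noteq> 0}" using a by blast
    then have "card {\<kappa> \<in> C. H' \<kappa> \<noteq> 0} < card {\<kappa> \<in> C. H \<kappa> \<noteq> 0}"
      using fin by (intro psubset_card_mono) auto
    from less.hyps[OF this rel'] have "H' b = 0" using b by blast
    \<comment> \<open>With cleared denominators, this says that the terms \<open>a\<close> and
      \<open>b\<close> of the relation have equal logarithmic derivatives.\<close>
    then have eq: "P * (H a * pderiv (H b) - pderiv (H a) * H b) + H a * H b * (c b - c a) = 0"
      by (simp add: H'_def K_def algebra_simps)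
    obtain i where i: "i \<in> J" "a i \<noteq> b i" using ext[OF a(1) b(1)] b(3) by blast
    define x where "x = [:- t i, 1:]"
    obtain u where u: "H a = x ^ order (t i) (H a) * u" "\<not> x dvd u"
      using order_decomp[OF a(2), of "t i"] by (auto simp: x_def)
    obtain v where v: "H b = x ^ order (t i) (H b) * v" "\<not> x dvd v"
      using order_decomp[OF b(2), of "t i"] by (auto simp: x_def)
    define p q where "p = order (t i) (H a)" and "q = order (t i) (H b)"
    have ha: "H a = x ^ p * u" and hb: "H b = x ^ q * v" using u v by (simp_all add: p_def q_def)
    have uv: "poly u (t i) \<noteq> 0" "poly v (t i) \<noteq> 0" using u v by (simp_all add: poly_eq_0_iff_dvd x_def)
    define R where "R = (\<Prod>j\<in>J - {i}. L j)"
    have "L i = smult (\<beta> i) x" by (simp add: L_def x_def mult.commute)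
    then have P: "P = smult (\<beta> i) (x * R)" unfolding P_def R_def using fin i by (simp add: prod.remove[of J i])
    have xa: "x * pderiv (H a) = x ^ p * (x * pderiv u + smult (of_nat p) u)"
      and xb: "x * pderiv (H b) = x ^ q * (x * pderiv v + smult (of_nat q) v)"
      unfolding ha hb by (rule x_pderiv_power, simp add: x_def pderiv_pCons)+
    \<comment> \<open>\<open>Z\<close> is the left side of the equation divided by the zeros
      \<open>x ^ p\<close> and \<open>x ^ q\<close> of \<open>H a\<close> and \<open>H b\<close> at
      \<open>t i\<close>; its value there compares the residues.\<close>
    define Z where "Z = smult (\<beta> i) R * (u * (x * pderiv v + smult (of_nat q) v) -
        v * (x * pderiv u + smult (of_nat p) u)) + u * v * (c b - c a)"
    have "P * (H a * pderiv (H b) - pderiv (H a) * H b) =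
       smult (\<beta> i) R * (H a * (x * pderiv (H b)) - (x * pderiv (H a)) * H b)"
      unfolding P by (simp add: algebra_simps)
    also have "\<dots> = smult (\<beta> i) R * (x ^ p * u * (x ^ q * (x * pderiv v + smult (of_nat q) v)) -
        x ^ p * (x * pderiv u + smult (of_nat p) u) * (x ^ q * v))"
      unfolding xa xb unfolding ha hb ..
    finally have "x ^ p * x ^ q * Z = P * (H a * pderiv (H b) - pderiv (H a) * H b) + H a * H b * (c b - c a)"
      unfolding Z_def ha hb by (simp add: algebra_simps)
    then have "x ^ p * x ^ q * Z = 0" using eq by simp
    moreover have "x \<noteq> 0" by (simp add: x_def)
    ultimately have "Z = 0" by simp
    have cR: "poly (c \<kappa>) (t i) = of_nat (\<kappa> i) * \<beta> i / of_nat (e i) * poly R (t i)" for \<kappa>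
    proof -
      have z: "poly (\<Prod>k\<in>J - {j}. L k) (t i) = 0" if "j \<in> J - {i}" for j
        unfolding poly_prod using that i fin by (intro prod_zero) (auto simp: L_def intro!: bexI[of _ i])
      have "poly (c \<kappa>) (t i) = of_nat (\<kappa> i) * \<beta> i / of_nat (e i) * poly R (t i) +
          (\<Sum>j\<in>J - {i}. of_nat (\<kappa> j) * \<beta> j / of_nat (e j) * poly (\<Prod>k\<in>J - {j}. L k) (t i))"
        unfolding c_def R_def poly_sum poly_smult using fin i by (intro sum.remove) auto
      also have "(\<Sum>j\<in>J - {i}. of_nat (\<kappa> j) * \<beta> j / of_nat (e j) * poly (\<Prod>k\<in>J - {j}. L k) (t i)) = 0"
        using z by (intro sum.neutral) auto
      finally show ?thesis by simp
    qed
    have "poly (L j) (t i) \<noteq> 0" if "j \<in> J - {i}" for j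
    proof -
      have "t i \<noteq> t j" using inj i that by (auto simp: inj_on_def)
      moreover have "poly (L j) (t i) = \<beta> j * (t i - t j)" by (simp add: L_def algebra_simps)
      ultimately show ?thesis using \<beta> that by simp
    qed
    then have R0: "poly R (t i) \<noteq> 0" unfolding R_def poly_prod using fin by simp
    have "poly Z (t i) = 0" using \<open>Z = 0\<close> by simp
    moreover have "poly x (t i) = 0" by (simp add: x_def)
    ultimately have "\<beta> i * poly R (t i) * (poly u (t i) * poly v (t i)) * (of_nat q - of_nat p) +
        (poly u (t i) * poly v (t i)) * ((of_nat (b i) * \<beta> i / of_nat (e i)) * poly R (t i) -
          (of_nat (a i) * \<beta> i / of_nat (e i)) * poly R (t i)) = 0"
      unfolding Z_def by (simp add: cR algebra_simps)
    then have "(\<beta> i * poly R (t i) * (poly u (t i) * poly v (t i))) *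
        ((of_nat q - of_nat p) + (of_nat (b i) - of_nat (a i)) / of_nat (e i)) = 0"
      by (simp add: algebra_simps diff_divide_distrib)
    then have "(of_nat q - of_nat p) + (of_nat (b i) - of_nat (a i)) / of_nat (e i) = (0::complex)"
      using R0 uv \<beta>[OF i(1)] by auto
    then have "(of_nat q - of_nat p) * of_nat (e i) + (of_nat (b i) - of_nat (a i)) = (0::complex)"
      using e[OF i(1)] by (simp add: field_simps)
    then have "of_int ((int q - int p) * int (e i) + (int (b i) - int (a i))) = (0::complex)" by simp
    \<comment> \<open>A multiple of \<open>e i\<close> equals the difference of two exponents below
      \<open>e i\<close>, so it is 0 and the exponents agree, against the choice of
      \<open>i\<close>.\<close>
    then have z: "(int q - int p) * int (e i) = int (a i) - int (b i)" by (simp only: of_int_eq_0_iff)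
    have "\<bar>int (a i) - int (b i)\<bar> < int (e i)" using C[OF a(1) i(1)] C[OF b(1) i(1)] by linarith
    then have "\<bar>int q - int p\<bar> * int (e i) < 1 * int (e i)"
      unfolding z[symmetric] abs_mult by simp
    then have "\<bar>int q - int p\<bar> < 1" using e[OF i(1)] by (simp only: mult_less_cancel_right_pos of_nat_0_less_iff)
    then have "int q - int p = 0" by simp
    then show False using z i by simp
  qed
qed

section \<open>The defining ideal\<close>

lemma ideal_gen_is_ideal:
  assumes G: "G \<subseteq> Pring V"
  shows "is_ideal V (ideal_gen V G)"
  unfolding is_ideal_def
proof (intro conjI ballI)
  show "ideal_gen V G \<subseteq> Pring V" using G by (fastforce simp: ideal_gen_def)
  show "0 \<in> ideal_gen V G" unfolding ideal_gen_def
    by (rule CollectI, rule exI[of _ "{}"], rule exI[of _ "\<lambda>_. 0"]) simp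
next
  fix a b assume "a \<in> ideal_gen V G" "b \<in> ideal_gen V G"
  then obtain F c F' c' where a: "finite F" "F \<subseteq> G" "\<forall>g\<in>F. c g \<in> Pring V" "a = (\<Sum>g\<in>F. c g * g)"
    and b: "finite F'" "F' \<subseteq> G" "\<forall>g\<in>F'. c' g \<in> Pring V" "b = (\<Sum>g\<in>F'. c' g * g)"
    unfolding ideal_gen_def by blast
  define d where "d = (\<lambda>g. (if g \<in> F then c g else 0) + (if g \<in> F' then c' g else 0))"
  have "(\<Sum>g\<in>F \<union> F'. (if g \<in> F then c g else 0) * g) = a"
    unfolding a(4) using a b by (intro sum.mono_neutral_cong_right) auto
  moreover have "(\<Sum>g\<in>F \<union> F'. (if g \<in> F' then c' g else 0) * g) = b"
    unfolding b(4) using a b by (intro sum.mono_neutral_cong_right) auto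
  ultimately have "a + b = (\<Sum>g\<in>F \<union> F'. d g * g)" by (simp add: d_def distrib_right sum.distrib)
  moreover have "\<forall>g\<in>F \<union> F'. d g \<in> Pring V" using a b by (auto simp: d_def)
  ultimately show "a + b \<in> ideal_gen V G" unfolding ideal_gen_def using a b
    by (intro CollectI exI[of _ "F \<union> F'"] exI[of _ d]) simp
next
  fix a s assume "a \<in> ideal_gen V G" "s \<in> Pring V"
  then obtain F c where a: "finite F" "F \<subseteq> G" "\<forall>g\<in>F. c g \<in> Pring V" "a = (\<Sum>g\<in>F. c g * g)"
    unfolding ideal_gen_def by blast
  then show "s * a \<in> ideal_gen V G" unfolding ideal_gen_def using \<open>s \<in> Pring V\<close>
    by (intro CollectI exI[of _ F] exI[of _ "\<lambda>g. s * c g"]) (auto simp: sum_distrib_left mult_ac)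
qed

lemma ideal_gen_base: "g \<in> G \<Longrightarrow> g \<in> ideal_gen V G"
  unfolding ideal_gen_def by (intro CollectI exI[of _ "{g}"] exI[of _ "\<lambda>_. 1"]) simp

lemma ideal_gen_minimal: "is_ideal V P \<Longrightarrow> G \<subseteq> P \<Longrightarrow> ideal_gen V G \<subseteq> P"
  unfolding ideal_gen_def by (auto intro!: ideal_sum ideal_mult)

abbreviation evc :: "(var \<Rightarrow> complex) \<Rightarrow> mpoly \<Rightarrow> complex" where
  "evc \<equiv> ev (\<lambda>a. a)"

lemmas evc_hom = ev_hom[OF ring_map_id] ev_Xv[OF ring_map_id] ev_const[OF ring_map_id] ev_single[OF ring_map_id]

lemma mon_Tmon: "mon x (Tmon n l i) = (\<Prod>j\<in>{1..n i}. x (T i j) ^ l i j)"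
  by (simp add: Tmon_def mon_sum)

lemma lk_Tmon: "lk (Tmon n l i) v = (case v of T a j \<Rightarrow> if a = i \<and> 1 \<le> j \<and> j \<le> n i then l i j else 0 | S k \<Rightarrow> 0)"
proof (cases v)
  case (T a j)
  have "lk (Tmon n l i) v = (\<Sum>k\<in>{1..n i}. if k = j then (if a = i then l i j else 0) else 0)"
    unfolding Tmon_def lookup_sum T by (intro sum.cong) (auto simp: lookup_single when_def)
  then show ?thesis by (simp add: T)
next
  case (S k)
  then show ?thesis by (simp add: Tmon_def lookup_sum lookup_single)
qed

text \<open>The set \<open>Jc\<close> indexes columns of \<open>A\<close> forming a basis, and \<open>lam i j\<close> are the coordinates of
  the \<open>i\<close>-th column in this basis.\<close>

locale arrangement =
  fixes r m :: nat and n :: "nat \<Rightarrow> nat" and l :: "nat \<Rightarrow> nat \<Rightarrow> nat"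
    and Jc :: "nat set" and lam :: "nat \<Rightarrow> nat \<Rightarrow> complex"
  assumes Jc: "Jc \<subseteq> {..r}" and Jc2: "card Jc \<ge> 2"
    and n_pos: "\<And>i. i \<le> r \<Longrightarrow> 0 < n i"
    and l_pos: "\<And>i j. i \<le> r \<Longrightarrow> 1 \<le> j \<Longrightarrow> j \<le> n i \<Longrightarrow> 0 < l i j"
    and lam_delta: "\<And>i j. i \<in> Jc \<Longrightarrow> j \<in> Jc \<Longrightarrow> lam i j = (if i = j then 1 else 0)"
    and lam_indep: "\<And>i k \<alpha> \<beta>. i \<le> r \<Longrightarrow> k \<le> r \<Longrightarrow> i \<noteq> k \<Longrightarrow>
      (\<forall>j\<in>Jc. \<alpha> * lam i j + \<beta> * lam k j = 0) \<Longrightarrow> \<alpha> = 0 \<and> \<beta> = 0"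
begin

abbreviation V :: "var set" where "V \<equiv> vars r n m"

text \<open>The kernel in terms of the coordinates \<open>lam\<close>, which keeps the matrix
  \<open>A\<close> out of the locale; the main theorem identifies it with
  \<open>kerA\<close>.\<close>

definition kerL :: "(nat \<Rightarrow> complex) set" where
  "kerL = {v. (\<forall>j. j > r \<longrightarrow> v j = 0) \<and> (\<forall>j\<in>Jc. (\<Sum>i\<le>r. v i * lam i j) = 0)}"

definition I :: "mpoly set" where
  "I = ideal_gen V {Defs.gpoly r n l v | v. v \<in> kerL}"

definition Tp :: "nat \<Rightarrow> mpoly" where
  "Tp i = mon Xv (Tmon n l i)"

text \<open>The variables \<open>T j 0\<close>, which do not occur in \<open>V\<close>, serve as coordinates \<open>w\<^sub>j\<close> (\<open>j \<in> Jc\<close>)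
  on the row space of \<open>A\<close>; \<open>eps\<close> substitutes the monomials \<open>T\<^sub>j\<^bsup>l\<^sub>j\<^esup>\<close> for them.\<close>

definition ell :: "nat \<Rightarrow> mpoly" where
  "ell i = (\<Sum>j\<in>Jc. const (lam i j) * Xv (T j 0))"

definition eps :: "mpoly \<Rightarrow> mpoly" where
  "eps = ev const (\<lambda>v. case v of T i j \<Rightarrow> if j = 0 then Tp i else Xv v | S k \<Rightarrow> Xv v)"

definition elv :: "nat \<Rightarrow> (var \<Rightarrow> complex) \<Rightarrow> complex" where
  "elv i z = (\<Sum>j\<in>Jc. lam i j * z (T j 0))"

definition W :: "var set" where
  "W = {T j 0 | j. j \<in> Jc}"

text \<open>Points of the zero set of \<open>I\<close>, described by a parameter: the monomials of
  the blocks take the values of the forms \<open>ell i\<close> at some \<open>z\<close>.\<close>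

definition onX :: "(var \<Rightarrow> complex) \<Rightarrow> bool" where
  "onX x \<longleftrightarrow> (\<exists>z. \<forall>i\<le>r. mon x (Tmon n l i) = elv i z)"

lemma finite_V: "finite V"
proof -
  have "V \<subseteq> (\<lambda>(i, j). T i j) ` ({..r} \<times> {..Max (n ` {..r})}) \<union> S ` {..m}"
  proof
    fix v assume "v \<in> V"
    then consider i j where "v = T i j" "i \<le> r" "j \<le> n i" | k where "v = S k" "k \<le> m"
      by (auto simp: vars_def)
    then show "v \<in> (\<lambda>(i, j). T i j) ` ({..r} \<times> {..Max (n ` {..r})}) \<union> S ` {..m}"
    proof cases
      case 1
      have "n i \<le> Max (n ` {..r})" using 1 by (intro Max_ge) auto
      then have "j \<le> Max (n ` {..r})" using 1(3) by (rule le_trans[rotated])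
      then show ?thesis using 1 by (intro UnI1 image_eqI[of _ _ "(i, j)"]) simp_all
    qed auto
  qed
  then show ?thesis by (rule finite_subset) simp
qed

lemma T_in_V [simp]: "T i j \<in> V \<longleftrightarrow> i \<le> r \<and> 1 \<le> j \<and> j \<le> n i"
  and S_in_V [simp]: "S k \<in> V \<longleftrightarrow> 1 \<le> k \<and> k \<le> m"
  by (auto simp: vars_def)

lemma finite_Jc: "finite Jc" using Jc finite_subset by blast

lemma r_pos: "0 < r"
proof (rule ccontr)
  assume "\<not> 0 < r"
  then have "card Jc \<le> card {0::nat}" using Jc by (intro card_mono) auto
  then show False using Jc2 by simp
qed

lemma Tp_Pring: "i \<le> r \<Longrightarrow> Tp i \<in> Pring V"
  unfolding Tp_def mon_Tmon by (intro Pring_prod Pring_power) auto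

lemma gpoly_eq: "Defs.gpoly r n l v = (\<Sum>i\<le>r. const (v i) * Tp i)"
  by (simp add: Defs.gpoly_def Tp_def single_eq)

lemma ideal_I: "is_ideal V I"
  unfolding I_def by (rule ideal_gen_is_ideal) (auto simp: gpoly_eq intro!: Pring_sum Pring_mult Tp_Pring)

lemmas I_simps = ideal_0[OF ideal_I]
lemmas I_intros = ideal_add[OF ideal_I] ideal_diff[OF ideal_I] ideal_uminus[OF ideal_I]
  ideal_mult[OF ideal_I] ideal_mult'[OF ideal_I] ideal_sum[OF ideal_I]

lemma ring_map_eps: "ring_map eps"
  unfolding eps_def by (intro ring_map_ev ring_map_const)

lemmas eps_hom = ring_map_1[OF ring_map_eps] ring_map_0[OF ring_map_eps] ring_map_add[OF ring_map_eps]
  ring_map_mult[OF ring_map_eps] ring_map_diff[OF ring_map_eps] ring_map_uminus[OF ring_map_eps]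
  ring_map_sum[OF ring_map_eps] ring_map_prod[OF ring_map_eps] ring_map_power[OF ring_map_eps]

lemma eps_const [simp]: "eps (const a) = const a"
  by (simp add: eps_def ring_map_const)

lemma eps_Xv: "eps (Xv v) = (case v of T i j \<Rightarrow> if j = 0 then Tp i else Xv v | S k \<Rightarrow> Xv v)"
  by (simp add: eps_def ring_map_const)

lemma eps_Xv_V: "v \<in> V \<Longrightarrow> eps (Xv v) = Xv v"
  by (cases v) (auto simp: eps_Xv)

lemma eps_Pring: "h \<in> Pring (W \<union> V) \<Longrightarrow> eps h \<in> Pring V"
  unfolding eps_def by (rule Pring_ev) (use Jc Tp_Pring in \<open>auto simp: W_def split: var.splits\<close>)

lemma eps_ell: "eps (ell i) = (\<Sum>j\<in>Jc. const (lam i j) * Tp j)"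
  by (simp add: ell_def eps_hom eps_Xv)

lemma ell_Pring: "ell i \<in> Pring W"
  unfolding ell_def W_def by (intro Pring_sum Pring_mult) auto

lemma Tp_ell:
  assumes i: "i \<le> r"
  shows "Tp i - eps (ell i) \<in> I"
proof -
  \<comment> \<open>The relation expressing column \<open>i\<close> through the basis columns; it
    lies in the kernel because basis columns have unit vectors as coordinates.\<close>
  define v where "v = (\<lambda>k. (if k = i then 1 else 0) - (if k \<in> Jc then lam i k else 0))"
  have "(\<Sum>k\<le>r. v k * lam k j) = 0" if j: "j \<in> Jc" for j
  proof -
    have "(\<Sum>k\<le>r. v k * lam k j) = (\<Sum>k\<le>r. if k = i then lam i j else 0) - (\<Sum>k\<le>r. if k \<in> Jc then lam i k * lam k j else 0)"
      unfolding sum_subtractf[symmetric] by (intro sum.cong) (auto simp: v_def algebra_simps)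
    also have "(\<Sum>k\<le>r. if k \<in> Jc then lam i k * lam k j else 0) = (\<Sum>k\<in>Jc. lam i k * lam k j)"
      using Jc by (intro sum.mono_neutral_cong_right) auto
    also have "\<dots> = (\<Sum>k\<in>Jc. if k = j then lam i j else 0)"
      using j by (intro sum.cong) (auto simp: lam_delta)
    finally show ?thesis using i j finite_Jc by simp
  qed
  then have "v \<in> kerL" using i Jc by (auto simp: kerL_def v_def)
  then have "Defs.gpoly r n l v \<in> I" unfolding I_def by (intro ideal_gen_base) blast
  also have "Defs.gpoly r n l v = (\<Sum>k\<le>r. if k = i then Tp i else 0) - (\<Sum>k\<le>r. if k \<in> Jc then const (lam i k) * Tp k else 0)"
    unfolding gpoly_eq sum_subtractf[symmetric]
    by (intro sum.cong) (auto simp: v_def const_hom algebra_simps)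
  also have "(\<Sum>k\<le>r. if k \<in> Jc then const (lam i k) * Tp k else 0) = eps (ell i)"
    unfolding eps_ell using Jc by (intro sum.mono_neutral_cong_right) auto
  finally show ?thesis using i by simp
qed

lemma evc_Tp: "evc x (Tp i) = mon x (Tmon n l i)"
  by (simp add: Tp_def ring_map_mon[OF ring_map_ev] evc_hom ring_map_id)

lemma evc_ell: "evc z (ell i) = elv i z"
  by (simp add: ell_def elv_def evc_hom)

lemma evc_I:
  assumes "onX x" "f \<in> I"
  shows "evc x f = 0"
proof -
  obtain z where z: "\<forall>i\<le>r. mon x (Tmon n l i) = elv i z" using assms by (auto simp: onX_def)
  obtain F c where F: "finite F" "F \<subseteq> {Defs.gpoly r n l v | v. v \<in> kerL}" "f = (\<Sum>g\<in>F. c g * g)"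
    using assms unfolding I_def ideal_gen_def by blast
  have "evc x g = 0" if gF: "g \<in> F" for g
  proof -
    obtain v where v: "v \<in> kerL" "g = Defs.gpoly r n l v" using F(2) gF by blast
    have "evc x g = (\<Sum>i\<le>r. v i * elv i z)" unfolding v gpoly_eq by (simp add: evc_hom evc_Tp z)
    also have "\<dots> = (\<Sum>j\<in>Jc. (\<Sum>i\<le>r. v i * lam i j) * z (T j 0))"
      unfolding elv_def sum_distrib_left sum_distrib_right by (subst sum.swap) (simp add: mult_ac)
    also have "\<dots> = 0" using v by (simp add: kerL_def)
    finally show ?thesis .
  qed
  then show ?thesis unfolding F(3) by (simp add: evc_hom)
qed

lemma evc_eps:
  "evc x (eps h) = evc (\<lambda>v. case v of T i j \<Rightarrow> if j = 0 then mon x (Tmon n l i) else x v | S k \<Rightarrow> x v) h"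
proof -
  have "evc x (eps h) = ev (\<lambda>a. evc x (const a)) (\<lambda>v. evc x (case v of T i j \<Rightarrow> if j = 0 then Tp i else Xv v | S k \<Rightarrow> Xv v)) h"
    unfolding eps_def by (rule ring_map_ev_comp[OF ring_map_ev[OF ring_map_id] ring_map_const])
  also have "\<dots> = evc (\<lambda>v. case v of T i j \<Rightarrow> if j = 0 then mon x (Tmon n l i) else x v | S k \<Rightarrow> x v) h"
    by (rule arg_cong2[of _ _ _ _ "\<lambda>c y. ev c y h"]) (auto simp: evc_hom evc_Tp fun_eq_iff split: var.splits)
  finally show ?thesis .
qed

lemma elv_Jc: "j \<in> Jc \<Longrightarrow> elv j z = z (T j 0)"
proof -
  assume j: "j \<in> Jc"
  have "elv j z = (\<Sum>k\<in>Jc. if k = j then z (T j 0) else 0)"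
    unfolding elv_def using j by (intro sum.cong) (auto simp: lam_delta)
  then show ?thesis using j finite_Jc by simp
qed

lemma evc_eps_onX:
  assumes "\<forall>i\<le>r. mon x (Tmon n l i) = elv i z" "h \<in> Pring (W \<union> Y)" "Y \<inter> {T i 0 | i. True} = {}"
    and "\<And>v. v \<in> Y \<Longrightarrow> x v = z v"
  shows "evc x (eps h) = evc z h"
  unfolding evc_eps
proof (rule ev_cong[OF assms(2)])
  fix v assume v: "v \<in> W \<union> Y"
  show "(case v of T i j \<Rightarrow> if j = 0 then mon x (Tmon n l i) else x v | S k \<Rightarrow> x v) = z v"
  proof (cases "v \<in> W")
    case True
    then show ?thesis using assms(1) Jc elv_Jc by (auto simp: W_def)
  next
    case False
    then show ?thesis using v assms by (cases v) auto
  qed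
qed

lemma ex_other: "i \<le> r \<Longrightarrow> \<exists>k\<le>r. k \<noteq> i"
  using r_pos by (cases "i = 0") auto

lemma lam_nonzero: assumes "i \<le> r" shows "\<exists>j\<in>Jc. lam i j \<noteq> 0"
proof (rule ccontr)
  assume a: "\<not> ?thesis"
  obtain k where "k \<le> r" "k \<noteq> i" using ex_other assms by blast
  then show False using lam_indep[of i k 1 0] a assms by auto
qed

lemma evc_ell_unit: "j \<in> Jc \<Longrightarrow> elv i (\<lambda>v. if v = T j 0 then 1 else 0) = lam i j"
  by (simp add: elv_def finite_Jc if_distrib cong: if_cong)

lemma ell_comb_nonzero:
  assumes "i \<le> r" "k \<le> r" "i \<noteq> k" "\<alpha> \<noteq> 0 \<or> \<beta> \<noteq> 0"
  shows "const \<alpha> * ell i + const \<beta> * ell k \<noteq> 0"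
proof
  assume z: "const \<alpha> * ell i + const \<beta> * ell k = 0"
  have "\<alpha> * lam i j + \<beta> * lam k j = 0" if j: "j \<in> Jc" for j
    using arg_cong[OF z, of "evc (\<lambda>v. if v = T j 0 then 1 else 0)"] j
    by (simp add: evc_hom evc_ell evc_ell_unit)
  then show False using lam_indep[OF assms(1-3)] assms(4) by blast
qed

lemma ell_nonzero: "i \<le> r \<Longrightarrow> ell i \<noteq> 0"
  using ex_other[of i] ell_comb_nonzero[of i _ 1 0] by auto

text \<open>Base point of the chart. Dividing \<open>elv i z\<close> by its nonzero value at
  \<open>z0\<close> gives 1 at the base point, so that the principal logarithm is available near it;
  the coordinates 1 serve the same purpose for the variables.\<close>

definition z0 :: "var \<Rightarrow> complex" where
  "z0 = (SOME z. (\<forall>i\<le>r. elv i z \<noteq> 0) \<and> (\<forall>i j. j \<noteq> 0 \<longrightarrow> z (T i j) = 1) \<and> (\<forall>k. z (S k) = 1))"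

lemma z0: "i \<le> r \<Longrightarrow> elv i z0 \<noteq> 0" "j \<noteq> 0 \<Longrightarrow> z0 (T i j) = 1" "z0 (S k) = 1"
proof -
  have "(\<Prod>i\<le>r. ell i) \<noteq> 0" using ell_nonzero by simp
  then obtain z where "evc z (\<Prod>i\<le>r. ell i) \<noteq> 0" using mpoly_eq_0I by blast
  then have z: "\<forall>i\<le>r. elv i z \<noteq> 0" by (simp add: evc_hom evc_ell)
  define z' where "z' = (\<lambda>v. case v of T i j \<Rightarrow> if j = 0 then z v else 1 | S k \<Rightarrow> 1)"
  have "\<exists>z. (\<forall>i\<le>r. elv i z \<noteq> 0) \<and> (\<forall>i j. j \<noteq> 0 \<longrightarrow> z (T i j) = 1) \<and> (\<forall>k. z (S k) = 1)"
    by (rule exI[of _ z']) (use z in \<open>auto simp: z'_def elv_def\<close>)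
  from someI_ex[OF this] show "i \<le> r \<Longrightarrow> elv i z0 \<noteq> 0" "j \<noteq> 0 \<Longrightarrow> z0 (T i j) = 1" "z0 (S k) = 1"
    unfolding z0_def[symmetric] by blast+
qed

end

section \<open>A chart of the variety\<close>

lemma fps_expansion_unique:
  fixes f :: "complex \<Rightarrow> complex"
  assumes "f has_fps_expansion F" "f has_fps_expansion G"
  shows "F = G"
  by (rule fps_ext) (simp add: fps_nth_fps_expansion[OF assms(1)] fps_nth_fps_expansion[OF assms(2)])

lemma has_fps_expansion_of_poly: "poly p has_fps_expansion fps_of_poly (p :: complex poly)"
proof -
  have "eval_fps (fps_of_poly p) has_fps_expansion fps_of_poly p"
    by (rule eval_fps_has_fps_expansion) simp
  moreover have "eval_fps (fps_of_poly p) = poly p" by (rule ext) simp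
  ultimately show ?thesis by simp
qed

lemma poly_eq_0_of_open:
  assumes "open D" "a \<in> D" "\<And>t. t \<in> D \<Longrightarrow> poly p t = (0::complex)"
  shows "p = 0"
proof (rule ccontr)
  assume "p \<noteq> 0"
  then have "finite {t. poly p t = 0}" by (rule poly_roots_finite)
  moreover have "D \<subseteq> {t. poly p t = 0}" using assms by auto
  ultimately have "finite D" by (metis finite_subset)
  then show False using assms by (metis finite_imp_not_open empty_iff)
qed

definition line :: "(var \<Rightarrow> complex) \<Rightarrow> (var \<Rightarrow> complex) \<Rightarrow> complex \<Rightarrow> var \<Rightarrow> complex" where
  "line a b s = (\<lambda>v. a v + s * b v)"

definition linepoly :: "(var \<Rightarrow> complex) \<Rightarrow> (var \<Rightarrow> complex) \<Rightarrow> mpoly \<Rightarrow> complex poly" where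
  "linepoly a b = ev (\<lambda>c. [:c:]) (\<lambda>v. [:a v, b v:])"

lemma poly_linepoly: "poly (linepoly a b f) s = evc (line a b s) f"
proof -
  have "ring_map (\<lambda>c. [:c::complex:])" by (rule ring_mapI) simp_all
  then show ?thesis unfolding linepoly_def line_def
    by (subst ring_map_ev_comp[OF ring_map_poly]) simp_all
qed

locale selection = arrangement +
  fixes J :: "nat \<Rightarrow> nat"
  assumes J: "\<And>i. i \<le> r \<Longrightarrow> 1 \<le> J i \<and> J i \<le> n i"
begin

definition e :: "nat \<Rightarrow> nat" where
  "e i = l i (J i)"

definition EJ :: "var set" where
  "EJ = W \<union> (V - {T i (J i) | i. True})"

text \<open>Half-planes instead of slit planes: the logarithm is holomorphic on them, and the part
  of any complex line inside \<open>U\<close> is convex, hence connected, as the identity theorem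
  requires.\<close>

definition U :: "(var \<Rightarrow> complex) set" where
  "U = {z. (\<forall>i\<le>r. 0 < Re (elv i z / elv i z0)) \<and>
    (\<forall>i\<le>r. \<forall>j\<in>{1..n i}. 0 < Re (z (T i j)))}"

text \<open>A holomorphic chart of the zero set of \<open>I\<close>: the variables \<open>T i (J i)\<close> are
  expressed by the remaining ones and the \<open>w\<^sub>j\<close> through branches of roots.\<close>

definition pt :: "(var \<Rightarrow> complex) \<Rightarrow> var \<Rightarrow> complex" where
  "pt z v = (case v of T i j \<Rightarrow> if i \<le> r \<and> j = J i
      then exp (Ln (elv i z0) / of_nat (e i)) * exp ((Ln (elv i z / elv i z0) -
        (\<Sum>j\<in>{1..n i} - {J i}. of_nat (l i j) * Ln (z (T i j)))) / of_nat (e i))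
      else z v | S k \<Rightarrow> z v)"

lemma e_pos: "i \<le> r \<Longrightarrow> 0 < e i"
  using J l_pos by (simp add: e_def)

lemma finite_EJ: "finite EJ"
proof -
  have "W = (\<lambda>j. T j 0) ` Jc" by (auto simp: W_def)
  then show ?thesis using finite_V finite_Jc by (simp add: EJ_def)
qed

lemma EJ_sub: "EJ \<subseteq> W \<union> V"
  by (auto simp: EJ_def)

lemma exp_power: "exp (x / of_nat k) ^ k = exp x" if "0 < k" for x :: complex
  using that by (simp flip: exp_of_nat_mult)

lemma U_nonzero: "z \<in> U \<Longrightarrow> i \<le> r \<Longrightarrow> 1 \<le> j \<Longrightarrow> j \<le> n i \<Longrightarrow> z (T i j) \<noteq> 0"
proof -
  assume "z \<in> U" "i \<le> r" "1 \<le> j" "j \<le> n i"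
  then have "0 < Re (z (T i j))" by (simp add: U_def)
  then show ?thesis by auto
qed

lemma pt_mon:
  assumes z: "z \<in> U" and i: "i \<le> r"
  shows "mon (pt z) (Tmon n l i) = elv i z"
proof -
  have Jin: "J i \<in> {1..n i}" using J[OF i] by simp
  have nz: "z (T i j) \<noteq> 0" if "j \<in> {1..n i}" for j
    using U_nonzero[OF z i] that by simp
  have q: "elv i z / elv i z0 \<noteq> 0" using z i by (auto simp: U_def)
  have "mon (pt z) (Tmon n l i) = pt z (T i (J i)) ^ e i * (\<Prod>j\<in>{1..n i} - {J i}. pt z (T i j) ^ l i j)"
    unfolding mon_Tmon e_def using Jin by (intro prod.remove) auto
  also have "pt z (T i (J i)) ^ e i = elv i z0 * (elv i z / elv i z0 /
      exp (\<Sum>j\<in>{1..n i} - {J i}. of_nat (l i j) * Ln (z (T i j))))"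
    using i q z0(1)[OF i] by (simp add: pt_def power_mult_distrib exp_power[OF e_pos[OF i]] exp_diff)
  also have "exp (\<Sum>j\<in>{1..n i} - {J i}. of_nat (l i j) * Ln (z (T i j))) = (\<Prod>j\<in>{1..n i} - {J i}. z (T i j) ^ l i j)"
    unfolding exp_sum[OF finite_Diff[OF finite_atLeastAtMost]]
    by (intro prod.cong) (use nz in \<open>auto simp: exp_of_nat_mult\<close>)
  also have "(\<Prod>j\<in>{1..n i} - {J i}. pt z (T i j) ^ l i j) = (\<Prod>j\<in>{1..n i} - {J i}. z (T i j) ^ l i j)"
    by (intro prod.cong) (auto simp: pt_def)
  also have "elv i z0 * (elv i z / elv i z0 / (\<Prod>j\<in>{1..n i} - {J i}. z (T i j) ^ l i j)) * (\<Prod>j\<in>{1..n i} - {J i}. z (T i j) ^ l i j) = elv i z"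
    using z0(1)[OF i] nz by (simp add: prod_zero_iff)
  finally show ?thesis .
qed

lemma pt_nonzero: "z \<in> U \<Longrightarrow> i \<le> r \<Longrightarrow> 1 \<le> j \<Longrightarrow> j \<le> n i \<Longrightarrow> pt z (T i j) \<noteq> 0"
  using U_nonzero by (simp add: pt_def)

lemma onX_pt: "z \<in> U \<Longrightarrow> onX (pt z)"
  unfolding onX_def by (intro exI[of _ z]) (simp add: pt_mon)

lemma pt_other: "v \<in> V - {T i (J i) | i. True} \<Longrightarrow> pt z v = z v"
  by (cases v) (auto simp: pt_def)

lemma evc_eps_pt:
  assumes "z \<in> U" "h \<in> Pring EJ"
  shows "evc (pt z) (eps h) = evc z h"
proof (rule evc_eps_onX)
  show "\<forall>i\<le>r. mon (pt z) (Tmon n l i) = elv i z" using pt_mon assms by blast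
  show "h \<in> Pring (W \<union> (V - {T i (J i) | i. True}))" using assms by (simp add: EJ_def)
qed (auto simp: pt_other vars_def)

lemma elv_line: "elv i (line a b s) = elv i a + s * elv i b"
  by (simp add: elv_def line_def algebra_simps sum.distrib sum_distrib_left)

lemma z0_U: "z0 \<in> U"
  using z0 by (auto simp: U_def)

lemma line_U:
  "{s. line a b s \<in> U} = (\<Inter>i\<in>{..r}. {s. 0 < Re ((elv i a + s * elv i b) / elv i z0)}) \<inter>
    (\<Inter>i\<in>{..r}. \<Inter>j\<in>{1..n i}. {s. 0 < Re (a (T i j) + s * b (T i j))})"
proof -
  have "line a b s (T i j) = a (T i j) + s * b (T i j)" for s i j by (simp add: line_def)
  then show ?thesis by (auto simp: U_def elv_line)
qed

lemma open_line_U: "open {s. line a b s \<in> U}"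
  unfolding line_U
  by (intro open_Int open_INT ballI open_Collect_less continuous_intros finite_atMost finite_atLeastAtMost)
     (use z0(1) in auto)

lemma convex_halfplane: "convex {s. 0 < Re ((a + s * b) / c)}"
proof (rule convexI)
  fix x y :: complex and u v :: real
  assume a: "x \<in> {s. 0 < Re ((a + s * b) / c)}" "y \<in> {s. 0 < Re ((a + s * b) / c)}" "0 \<le> u" "0 \<le> v" "u + v = 1"
  have "(a + (u *\<^sub>R x + v *\<^sub>R y) * b) / c = of_real (u + v) * (a / c) + (u *\<^sub>R x + v *\<^sub>R y) * b / c"
    using a by (simp add: add_divide_distrib)
  also have "\<dots> = u *\<^sub>R ((a + x * b) / c) + v *\<^sub>R ((a + y * b) / c)"
    by (simp add: scaleR_conv_of_real algebra_simps add_divide_distrib)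
  finally have "Re ((a + (u *\<^sub>R x + v *\<^sub>R y) * b) / c) = u * Re ((a + x * b) / c) + v * Re ((a + y * b) / c)"
    by simp
  moreover have "u * Re ((a + x * b) / c) + v * Re ((a + y * b) / c) > 0"
  proof (cases "u = 0")
    case False
    then have "0 < u * Re ((a + x * b) / c)" using a by auto
    moreover have "0 \<le> v * Re ((a + y * b) / c)" using a by auto
    ultimately show ?thesis by simp
  qed (use a in auto)
  ultimately show "u *\<^sub>R x + v *\<^sub>R y \<in> {s. 0 < Re ((a + s * b) / c)}" by simp
qed

lemma convex_line_U: "convex {s. line a b s \<in> U}"
proof -
  have "convex {s. 0 < Re (a v + s * b v)}" for v using convex_halfplane[of "a v" "b v" 1] by simp
  then show ?thesis
    unfolding line_U by (intro convex_Int convex_INT ballI convex_halfplane) 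
qed

lemma nonpos_Re: "0 < Re x \<Longrightarrow> x \<notin> \<real>\<^sub>\<le>\<^sub>0"
  by (auto simp: complex_nonpos_Reals_iff)

lemma pt_line_holomorphic: "(\<lambda>s. pt (line a b s) v) holomorphic_on {s. line a b s \<in> U}"
proof -
  let ?D = "{s. line a b s \<in> U}"
  have lin: "(\<lambda>s. line a b s v) holomorphic_on ?D" for v
    unfolding line_def by (intro holomorphic_intros)
  have elin: "(\<lambda>s. elv i (line a b s)) holomorphic_on ?D" for i
    unfolding elv_line by (intro holomorphic_intros)
  have 1: "elv i (line a b s) / elv i z0 \<notin> \<real>\<^sub>\<le>\<^sub>0" if "s \<in> ?D" "i \<le> r" for s i
    using that by (intro nonpos_Re) (auto simp: U_def)
  have 2: "line a b s (T i j) \<notin> \<real>\<^sub>\<le>\<^sub>0" if "s \<in> ?D" "i \<le> r" "j \<in> {1..n i}" for s i j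
    using that by (intro nonpos_Re) (auto simp: U_def)
  show ?thesis
  proof (cases "\<exists>i\<le>r. v = T i (J i)")
    case True
    then obtain i where i: "i \<le> r" "v = T i (J i)" by blast
    show ?thesis
      unfolding i(2) pt_def using i(1) z0(1)[OF i(1)] e_pos[OF i(1)]
      by (simp, intro holomorphic_intros elin lin 1 2) auto
  next
    case False
    then have "pt z v = z v" for z by (auto simp: pt_def split: var.splits)
    then show ?thesis using lin by simp
  qed
qed

lemma evc_pt_line_holomorphic: "(\<lambda>s. evc (pt (line a b s)) f) holomorphic_on {s. line a b s \<in> U}"
  unfolding ev_def mon_def by (intro holomorphic_intros pt_line_holomorphic)

text \<open>On the line from \<open>z0\<close> to any point the polynomial vanishes on a nonempty
  open set, hence everywhere.\<close>

lemma vanish_on_U: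
  assumes "\<And>z. z \<in> U \<Longrightarrow> evc z p = 0"
  shows "p = 0"
proof (rule mpoly_eq_0I)
  fix z
  have "linepoly z0 (\<lambda>v. z v - z0 v) p = 0"
  proof (rule poly_eq_0_of_open[OF open_line_U])
    show "0 \<in> {s. line z0 (\<lambda>v. z v - z0 v) s \<in> U}" using z0_U by (simp add: line_def)
  qed (simp add: poly_linepoly assms)
  then have "evc (line z0 (\<lambda>v. z v - z0 v) 1) p = 0" by (simp flip: poly_linepoly)
  then show "evc z p = 0" by (simp add: line_def)
qed

text \<open>Polynomials vanishing on a coordinate slice of the chart form a prime ideal, by the
  identity theorem along lines.\<close>

definition slice_ideal :: "var set \<Rightarrow> mpoly set" where
  "slice_ideal X = {f \<in> Pring V. \<forall>z\<in>U. (\<forall>v. v \<notin> X \<longrightarrow> z v = z0 v) \<longrightarrow> evc (pt z) f = 0}"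

lemma slice_ideal_prime: "is_prime_ideal V (slice_ideal X)"
  unfolding is_prime_ideal_def
proof (intro conjI ballI impI)
  show "is_ideal V (slice_ideal X)"
    by (auto simp: is_ideal_def slice_ideal_def evc_hom)
  show "1 \<notin> slice_ideal X" using z0_U by (auto simp: slice_ideal_def evc_hom)
  fix f g assume f: "f \<in> Pring V" and g: "g \<in> Pring V" and fg: "f * g \<in> slice_ideal X"
  show "f \<in> slice_ideal X \<or> g \<in> slice_ideal X"
  proof (rule ccontr)
    assume "\<not> ?thesis"
    then obtain z1 z2 where z1: "z1 \<in> U" "\<forall>v. v \<notin> X \<longrightarrow> z1 v = z0 v" "evc (pt z1) f \<noteq> 0"
      and z2: "z2 \<in> U" "\<forall>v. v \<notin> X \<longrightarrow> z2 v = z0 v" "evc (pt z2) g \<noteq> 0"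
      using f g by (auto simp: slice_ideal_def)
    \<comment> \<open>The line through the two witnesses stays in the slice. If the first function
      is nonzero at \<open>z1\<close>, the second vanishes near \<open>z1\<close>, hence also at
      \<open>z2\<close>.\<close>
    define b where "b = (\<lambda>v. z2 v - z1 v)"
    define D where "D = {s. line z1 b s \<in> U}"
    define F where "F = (\<lambda>s. evc (pt (line z1 b s)) f)"
    define G where "G = (\<lambda>s. evc (pt (line z1 b s)) g)"
    have l01: "line z1 b 0 = z1" "line z1 b 1 = z2" by (simp_all add: line_def b_def)
    have D: "open D" "connected D" "0 \<in> D" "1 \<in> D"
      using open_line_U convex_connected[OF convex_line_U] z1 z2 l01 by (simp_all add: D_def)
    have hol: "F holomorphic_on D" "G holomorphic_on D"
      unfolding F_def G_def D_def by (rule evc_pt_line_holomorphic)+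
    have FG: "F s * G s = 0" if "s \<in> D" for s
    proof -
      have "\<forall>v. v \<notin> X \<longrightarrow> line z1 b s v = z0 v" using z1 z2 by (simp add: line_def b_def)
      then show ?thesis using fg that by (simp add: slice_ideal_def F_def G_def D_def evc_hom)
    qed
    define D' where "D' = {s \<in> D. F s \<noteq> 0}"
    have "continuous_on D F" using hol by (intro holomorphic_on_imp_continuous_on)
    then have "open (D \<inter> F -` (- {0}))" using D by (intro continuous_open_preimage) auto
    also have "D \<inter> F -` (- {0}) = D'" by (auto simp: D'_def)
    finally have "open D'" .
    moreover have "0 \<in> D'" using D z1 l01 by (simp add: D'_def F_def)
    moreover have "G s = 0" if "s \<in> D'" for s using FG that by (auto simp: D'_def)
    ultimately have "G 1 = 0"
      using analytic_continuation_open[of D' D G "\<lambda>_. 0" 1] D hol by (auto simp: D'_def)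
    then show False using z2 l01 by (simp add: G_def)
  qed
qed

lemma I_sub_slice: "I \<subseteq> slice_ideal X"
  using evc_I[OF onX_pt] ideal_sub[OF ideal_I] by (auto simp: slice_ideal_def)

lemma eps_EJ: "h \<in> Pring EJ \<Longrightarrow> eps h \<in> Pring V"
  using eps_Pring Pring_mono[OF _ EJ_sub] by blast

text \<open>The polynomial representing \<open>v\<close> minus its base value vanishes once
  \<open>v\<close> is frozen, whereas on the larger slice \<open>v\<close> runs through an open
  set.\<close>

lemma slice_ideal_strict:
  assumes v: "v \<in> EJ" "v \<in> X"
  shows "slice_ideal X \<subset> slice_ideal (X - {v})"
proof (rule psubsetI)
  show "slice_ideal X \<subseteq> slice_ideal (X - {v})" by (auto simp: slice_ideal_def)
  define f where "f = eps (Xv v - const (z0 v))"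
  have hE: "Xv v - const (z0 v) \<in> Pring EJ" using v by auto
  have val: "evc (pt z) f = z v - z0 v" if "z \<in> U" for z
    unfolding f_def using evc_eps_pt[OF that hE] by (simp add: evc_hom)
  have "f \<in> slice_ideal (X - {v})"
    using eps_EJ[OF hE] val by (simp add: slice_ideal_def f_def)
  moreover have "f \<notin> slice_ideal X"
  proof
    assume f: "f \<in> slice_ideal X"
    define b where "b = (\<lambda>u. if u = v then 1 else 0 :: complex)"
    have "s = 0" if "line z0 b s \<in> U" for s
    proof -
      have "\<forall>u. u \<notin> X \<longrightarrow> line z0 b s u = z0 u" using v by (auto simp: line_def b_def)
      then have "evc (pt (line z0 b s)) f = 0" using f that by (simp add: slice_ideal_def)
      then show ?thesis unfolding val[OF that] by (simp add: line_def b_def)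
    qed
    then have "{s. line z0 b s \<in> U} = {0}" using z0_U by (auto simp: line_def)
    then show False using open_line_U[of z0 b] not_open_singleton by metis
  qed
  ultimately show "slice_ideal X \<noteq> slice_ideal (X - {v})" by blast
qed

text \<open>Freezing the chart coordinates one after the other enlarges the vanishing ideal at each
  step; the chain starts above \<open>I\<close> with all of them free.\<close>

lemma prime_chain_EJ: "prime_chain V I (card EJ)"
proof -
  obtain vs where vs: "set vs = EJ" "distinct vs" using finite_distinct_list[OF finite_EJ] by blast
  have len: "length vs = card EJ" using vs distinct_card by metis
  define P where "P = (\<lambda>i. slice_ideal (set (drop i vs)))"
  have "P i \<subset> P (Suc i)" if "i < card EJ" for i
  proof -
    have i: "i < length vs" using that len by simp
    then have d: "drop i vs = vs ! i # drop (Suc i) vs" by (simp add: Cons_nth_drop_Suc)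
    have "distinct (drop i vs)" using vs by simp
    then have "set (drop (Suc i) vs) = set (drop i vs) - {vs ! i}" unfolding d by auto
    moreover have "vs ! i \<in> EJ" using i vs(1) nth_mem by blast
    moreover have "vs ! i \<in> set (drop i vs)" unfolding d by simp
    ultimately show ?thesis unfolding P_def by (simp only: slice_ideal_strict)
  qed
  then show ?thesis unfolding prime_chain_def
    using slice_ideal_prime I_sub_slice by (intro exI[of _ P]) (simp add: P_def)
qed

section \<open>Independence of the basis products on the chart\<close>

definition Box :: "(nat \<Rightarrow> nat) set" where
  "Box = PiE {..r} (\<lambda>i. {..<e i})"

definition TJ :: "(nat \<Rightarrow> nat) \<Rightarrow> mpoly" where
  "TJ \<kappa> = (\<Prod>i\<le>r. Xv (T i (J i)) ^ \<kappa> i)"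

lemma finite_Box: "finite Box"
  unfolding Box_def by (intro finite_PiE) auto

lemma TJ_V: "TJ \<kappa> \<in> Pring V"
  unfolding TJ_def using J by (intro Pring_prod Pring_power) simp

text \<open>On the line used in \<open>chart_independence\<close>, where each \<open>elv i\<close>
  grows by \<open>elv i z0\<close>, the form \<open>ell i\<close> has the root
  \<open>- elv i z / elv i z0\<close>. Two roots coincide only where a linear combination of two
  forms vanishes, and this combination is nonzero because the forms are not proportional.
  \<open>G\<close> is the product of these combinations.\<close>

lemma ex_generic: "\<exists>G. G \<noteq> 0 \<and> (\<forall>z. evc z G \<noteq> 0 \<longrightarrow> inj_on (\<lambda>i. - (elv i z / elv i z0)) {..r})"
proof -
  define G where "G = (\<Prod>i\<le>r. \<Prod>k\<in>{..r} - {i}. const (elv k z0) * ell i + const (- elv i z0) * ell k)"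
  have "const (elv k z0) * ell i + const (- elv i z0) * ell k \<noteq> 0" if "i \<le> r" "k \<in> {..r} - {i}" for i k
    using that z0(1) by (intro ell_comb_nonzero) auto
  then have "G \<noteq> 0" unfolding G_def by (subst prod_zero_iff, simp, subst prod_zero_iff) auto
  moreover have "inj_on (\<lambda>i. - (elv i z / elv i z0)) {..r}" if z: "evc z G \<noteq> 0" for z
  proof (rule inj_onI, rule ccontr)
    fix i k assume ik: "i \<in> {..r}" "k \<in> {..r}" "- (elv i z / elv i z0) = - (elv k z / elv k z0)" "i \<noteq> k"
    then have "elv k z0 * elv i z - elv i z0 * elv k z = 0"
      using z0(1)[of i] z0(1)[of k] by (simp add: field_simps)
    then have "evc z (const (elv k z0) * ell i + const (- elv i z0) * ell k) = 0"
      by (simp add: evc_hom evc_ell)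
    then have "\<exists>k\<in>{..r} - {i}. evc z (const (elv k z0) * ell i + const (- elv i z0) * ell k) = 0"
      using ik by blast
    from prod_zero[OF _ this]
    have "\<exists>i\<in>{..r}. (\<Prod>k\<in>{..r} - {i}. evc z (const (elv k z0) * ell i + const (- elv i z0) * ell k)) = 0"
      using ik(1) by blast
    from prod_zero[OF _ this] have "evc z G = 0" unfolding G_def ev_prod[OF ring_map_id] by simp
    then show False using z by simp
  qed
  ultimately show ?thesis by blast
qed

text \<open>At points where \<open>G\<close> does not vanish, Kummer independence applies to the
  Taylor series along a line and kills the coefficients. So \<open>h \<kappa> * G\<close> vanishes
  on \<open>U\<close>, and \<open>G\<close> can be cancelled.\<close>

lemma chart_independence:
  assumes h: "\<And>\<kappa>. \<kappa> \<in> Box \<Longrightarrow> h \<kappa> \<in> Pring EJ"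
    and rel: "\<And>z. z \<in> U \<Longrightarrow> (\<Sum>\<kappa>\<in>Box. evc z (h \<kappa>) * (\<Prod>i\<le>r. pt z (T i (J i)) ^ \<kappa> i)) = 0"
  shows "\<forall>\<kappa>\<in>Box. h \<kappa> = 0"
proof
  fix \<kappa>0 assume \<kappa>0: "\<kappa>0 \<in> Box"
  obtain G where G: "G \<noteq> 0" "\<And>z. evc z G \<noteq> 0 \<Longrightarrow> inj_on (\<lambda>i. - (elv i z / elv i z0)) {..r}"
    using ex_generic by blast
  have "evc z (h \<kappa>0 * G) = 0" if z: "z \<in> U" for z
  proof (cases "evc z G = 0")
    case False
    \<comment> \<open>Only the coordinates \<open>w\<close> move. The unselected variables stay
      fixed and contribute the constants \<open>c i\<close>, so \<open>X i ^ e i\<close> is linear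
      in \<open>s\<close> with root \<open>t i\<close>.\<close>
    define b where "b = (\<lambda>v. case v of T j k \<Rightarrow> if k = 0 then z0 v else 0 | S k \<Rightarrow> 0)"
    define D where "D = {s. line z b s \<in> U}"
    have D: "open D" "0 \<in> D" using open_line_U z by (simp_all add: D_def line_def)
    have elb: "elv i b = elv i z0" for i by (simp add: elv_def b_def)
    have bT: "j \<noteq> 0 \<Longrightarrow> line z b s (T i j) = z (T i j)" for s i j by (simp add: line_def b_def)
    define c where "c = (\<lambda>i. \<Prod>j\<in>{1..n i} - {J i}. z (T i j) ^ l i j)"
    have c0: "c i \<noteq> 0" if "i \<le> r" for i unfolding c_def using U_nonzero[OF z that] by simp
    define \<beta> where "\<beta> = (\<lambda>i. elv i z0 / c i)"
    define t where "t = (\<lambda>i. - (elv i z / elv i z0))"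
    define X where "X = (\<lambda>i s. pt (line z b s) (T i (J i)))"
    define F where "F = (\<lambda>i. fps_expansion (X i) 0)"
    have XF: "X i has_fps_expansion F i" for i
      unfolding X_def F_def by (rule has_fps_expansion_fps_expansion[OF D]) (unfold D_def, rule pt_line_holomorphic)
    have pw: "X i s ^ e i = poly [:- (t i * \<beta> i), \<beta> i:] s" if "s \<in> D" "i \<le> r" for i s
    proof -
      have "elv i (line z b s) = mon (pt (line z b s)) (Tmon n l i)" using pt_mon that by (simp add: D_def)
      also have "\<dots> = X i s ^ e i * (\<Prod>j\<in>{1..n i} - {J i}. pt (line z b s) (T i j) ^ l i j)"
        unfolding mon_Tmon e_def X_def using J[OF that(2)] by (intro prod.remove) auto
      also have "(\<Prod>j\<in>{1..n i} - {J i}. pt (line z b s) (T i j) ^ l i j) = c i"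
        unfolding c_def by (intro prod.cong) (auto simp: pt_def bT)
      finally have "X i s ^ e i * c i = elv i z + s * elv i z0" unfolding elv_line elb by simp
      then show ?thesis using c0[OF that(2)] z0(1)[OF that(2)] by (simp add: t_def \<beta>_def field_simps)
    qed
    have ev: "eventually (\<lambda>s. s \<in> D) (nhds 0)" using D by (intro eventually_nhds_in_open)
    have Fe: "F i ^ e i = fps_of_poly [:- (t i * \<beta> i), \<beta> i:]" if "i \<le> r" for i
    proof (rule fps_expansion_unique)
      show "(\<lambda>s. X i s ^ e i) has_fps_expansion F i ^ e i"
        by (intro has_fps_expansion_power XF)
      have E: "eventually (\<lambda>s. X i s ^ e i = poly [:- (t i * \<beta> i), \<beta> i:] s) (nhds 0)"
        using ev by eventually_elim (use pw that in blast)
      show "(\<lambda>s. X i s ^ e i) has_fps_expansion fps_of_poly [:- (t i * \<beta> i), \<beta> i:]"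
        unfolding has_fps_expansion_cong[OF E refl] by (rule has_fps_expansion_of_poly)
    qed
    define H where "H = (\<lambda>\<kappa>. linepoly z b (h \<kappa>))"
    have "(\<Sum>\<kappa>\<in>Box. fps_of_poly (H \<kappa>) * (\<Prod>i\<le>r. F i ^ \<kappa> i)) = 0"
    proof (rule fps_expansion_unique)
      show "(\<lambda>s. \<Sum>\<kappa>\<in>Box. poly (H \<kappa>) s * (\<Prod>i\<le>r. X i s ^ \<kappa> i)) has_fps_expansion
          (\<Sum>\<kappa>\<in>Box. fps_of_poly (H \<kappa>) * (\<Prod>i\<le>r. F i ^ \<kappa> i))"
        by (intro has_fps_expansion_sum has_fps_expansion_mult has_fps_expansion_prod
            has_fps_expansion_power XF has_fps_expansion_of_poly)
      have "eventually (\<lambda>s. (\<Sum>\<kappa>\<in>Box. poly (H \<kappa>) s * (\<Prod>i\<le>r. X i s ^ \<kappa> i)) = 0) (nhds 0)"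
        using ev by eventually_elim (use rel in \<open>simp add: H_def poly_linepoly X_def D_def\<close>)
      then show "(\<lambda>s. \<Sum>\<kappa>\<in>Box. poly (H \<kappa>) s * (\<Prod>i\<le>r. X i s ^ \<kappa> i)) has_fps_expansion 0"
        by (simp add: has_fps_expansion_0_iff)
    qed
    then have "\<forall>\<kappa>\<in>Box. H \<kappa> = 0"
    proof (intro kummer_independence[where t = t and \<beta> = \<beta> and X = F and e = e and J = "{..r}"])
      show "inj_on t {..r}" using G(2)[OF False] by (simp add: t_def)
      show "\<kappa> = \<kappa>'" if "\<kappa> \<in> Box" "\<kappa>' \<in> Box" "\<forall>i\<in>{..r}. \<kappa> i = \<kappa>' i" for \<kappa> \<kappa>'
        using that by (auto simp: Box_def intro: PiE_ext)
    qed (use finite_Box e_pos z0(1) c0 Fe in \<open>auto simp: \<beta>_def Box_def\<close>)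
    then have "poly (H \<kappa>0) 0 = 0" using \<kappa>0 by simp
    then have "evc z (h \<kappa>0) = 0" by (simp add: H_def poly_linepoly line_def)
    then show ?thesis by (simp add: evc_hom)
  qed (simp add: evc_hom)
  then have "h \<kappa>0 * G = 0" by (rule vanish_on_U)
  then show "h \<kappa>0 = 0" using G by simp
qed

end

section \<open>Homogeneous elements and primality\<close>

text \<open>Applied to a class of exponents, this is the projection to a homogeneous
  component.\<close>

definition rs :: "((var \<Rightarrow>\<^sub>0 nat) \<Rightarrow> bool) \<Rightarrow> mpoly \<Rightarrow> mpoly" where
  "rs P f = (\<Sum>\<mu>\<in>{\<mu> \<in> ks f. P \<mu>}. sg \<mu> (lk f \<mu>))"

lemma lk_rs: "lk (rs P f) \<mu> = (if P \<mu> then lk f \<mu> else 0)"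
proof -
  have "lk (rs P f) \<mu> = (\<Sum>\<nu>\<in>{\<nu> \<in> ks f. P \<nu>}. if \<nu> = \<mu> then lk f \<mu> else 0)"
    unfolding rs_def lookup_sum by (intro sum.cong) (auto simp: lookup_single when_def)
  then show ?thesis by (auto simp: in_keys_iff)
qed

lemma ks_rs: "ks (rs P f) = {\<mu> \<in> ks f. P \<mu>}"
  by (auto simp: in_keys_iff lk_rs split: if_splits)

lemma rs_add: "rs P (f + g) = rs P f + rs P g"
  and rs_diff: "rs P (f - g) = rs P f - rs P g"
  and rs_0 [simp]: "rs P 0 = 0"
  and rs_single: "rs P (sg \<mu> a) = (if P \<mu> then sg \<mu> a else 0)"
  by (auto intro!: poly_mapping_eqI simp: lk_rs lookup_add lookup_minus lookup_single when_def)

lemma rs_sum: "rs P (sum F A) = (\<Sum>x\<in>A. rs P (F x))"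
  by (induction A rule: infinite_finite_induct) (simp_all add: rs_add)

lemma rs_all: "(\<And>\<mu>. \<mu> \<in> ks f \<Longrightarrow> P \<mu>) \<Longrightarrow> rs P f = f"
  by (rule poly_mapping_eqI) (auto simp: lk_rs in_keys_iff)

lemma rs_Pring: "f \<in> Pring V \<Longrightarrow> rs P f \<in> Pring V"
  by (auto simp: Pring_def ks_rs)

lemma rs_shift:
  assumes "\<And>\<mu>. P \<mu> \<longleftrightarrow> Q (\<nu> + \<mu>)"
  shows "rs Q (sg \<nu> a * f) = sg \<nu> a * rs P f"
  by (induction f rule: mpoly_induct) (simp_all add: mult_single rs_single assms rs_add distrib_left)

lemma sum_rs_classes: "(\<Sum>\<kappa>\<in>c ` ks f. rs (\<lambda>\<mu>. c \<mu> = \<kappa>) f) = f"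
proof (rule poly_mapping_eqI)
  fix \<mu>
  have "lk (\<Sum>\<kappa>\<in>c ` ks f. rs (\<lambda>\<mu>. c \<mu> = \<kappa>) f) \<mu> = (\<Sum>\<kappa>\<in>c ` ks f. if \<kappa> = c \<mu> then lk f \<mu> else 0)"
    unfolding lookup_sum lk_rs by (intro sum.cong) auto
  then show "lk (\<Sum>\<kappa>\<in>c ` ks f. rs (\<lambda>\<mu>. c \<mu> = \<kappa>) f) \<mu> = lk f \<mu>"
    by (auto simp: in_keys_iff)
qed

text \<open>Phrased through \<open>hm\<close>, so that products become products of monomials in
  \<open>t\<close>, and factors can be examined by degree and order in \<open>t\<close>.\<close>

definition homogeneous :: "nat \<Rightarrow> mpoly \<Rightarrow> bool" where
  "homogeneous d h \<longleftrightarrow> hm (\<lambda>_. 1) h = monom h d"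

lemma homogeneous_const: "homogeneous 0 (const a)"
  by (simp add: homogeneous_def hm_def ring_map_Cpoly monom_0)

lemma homogeneous_Xv: "homogeneous 1 (Xv v)"
  by (simp add: homogeneous_def hm_def ring_map_Cpoly)

lemma homogeneous_mult: "homogeneous d f \<Longrightarrow> homogeneous e g \<Longrightarrow> homogeneous (d + e) (f * g)"
  by (simp add: homogeneous_def ring_map_mult[OF ring_map_hm] mult_monom)

lemma homogeneous_add: "homogeneous d f \<Longrightarrow> homogeneous d g \<Longrightarrow> homogeneous d (f + g)"
  by (simp add: homogeneous_def ring_map_add[OF ring_map_hm] add_monom)

lemma homogeneous_sum: "(\<And>x. x \<in> A \<Longrightarrow> homogeneous d (F x)) \<Longrightarrow> homogeneous d (sum F A)"
proof (induction A rule: infinite_finite_induct)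
  case (insert x A)
  then show ?case by (simp add: homogeneous_add)
qed (simp_all add: homogeneous_def)

lemma homogeneous_power: "homogeneous d f \<Longrightarrow> homogeneous (d * k) (f ^ k)"
  by (simp add: homogeneous_def ring_map_power[OF ring_map_hm] monom_power)

lemma homogeneous_prod: "finite A \<Longrightarrow> (\<And>x. x \<in> A \<Longrightarrow> homogeneous (d x) (F x)) \<Longrightarrow>
    homogeneous (\<Sum>x\<in>A. d x) (prod F A)"
proof (induction A rule: finite_induct)
  case empty
  show ?case using homogeneous_const[of 1] by simp
qed (simp add: homogeneous_mult)

lemma sum_fun: "(\<Sum>x\<in>A. F x) v = (\<Sum>x\<in>A. F x v :: int)" for F :: "'b \<Rightarrow> 'c \<Rightarrow> int"
  by (induction A rule: infinite_finite_induct) simp_all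

context arrangement
begin

text \<open>Congruence modulo \<open>I\<close>. Both sides are kept in \<open>Pring V\<close>
  because \<open>I\<close> absorbs only factors from there, which is what compatibility with
  products needs.\<close>

definition cg :: "mpoly \<Rightarrow> mpoly \<Rightarrow> bool" where
  "cg a b \<longleftrightarrow> a \<in> Pring V \<and> b \<in> Pring V \<and> a - b \<in> I"

lemma cg_refl: "a \<in> Pring V \<Longrightarrow> cg a a"
  by (simp add: cg_def I_simps)

lemma cg_sym: "cg a b \<Longrightarrow> cg b a"
  using ideal_uminus[OF ideal_I, of "a - b"] by (simp add: cg_def)

lemma cg_trans: "cg a b \<Longrightarrow> cg b c \<Longrightarrow> cg a c"
  using ideal_add[OF ideal_I, of "a - b" "b - c"] by (simp add: cg_def)

lemma cg_add: "cg a b \<Longrightarrow> cg c d \<Longrightarrow> cg (a + c) (b + d)"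
  using ideal_add[OF ideal_I, of "a - b" "c - d"] by (auto simp: cg_def algebra_simps)

lemma cg_mult: "cg a b \<Longrightarrow> cg c d \<Longrightarrow> cg (a * c) (b * d)"
proof -
  assume a: "cg a b" "cg c d"
  then have "(a - b) * c + b * (c - d) \<in> I"
    unfolding cg_def by (blast intro: I_intros)
  then show ?thesis using a by (auto simp: cg_def algebra_simps)
qed

lemma cg_power: "cg a b \<Longrightarrow> cg (a ^ k) (b ^ k)"
  by (induction k) (auto intro: cg_mult cg_refl)

lemma cg_prod: "(\<And>x. x \<in> A \<Longrightarrow> cg (F x) (G x)) \<Longrightarrow> cg (prod F A) (prod G A)"
  by (induction A rule: infinite_finite_induct) (auto intro: cg_mult cg_refl)

lemma cg_sum: "(\<And>x. x \<in> A \<Longrightarrow> cg (F x) (G x)) \<Longrightarrow> cg (sum F A) (sum G A)"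
  by (induction A rule: infinite_finite_induct) (auto intro: cg_add cg_refl)

lemma cg_0_iff: "a \<in> Pring V \<Longrightarrow> cg a 0 \<longleftrightarrow> a \<in> I"
  by (simp add: cg_def)

lemma cg_in_I: "cg a b \<Longrightarrow> a \<in> I \<longleftrightarrow> b \<in> I"
  by (metis cg_0_iff cg_def cg_sym cg_trans)

lemma cg_Tp: "i \<le> r \<Longrightarrow> cg (Tp i) (eps (ell i))"
  using Tp_ell Tp_Pring eps_Pring[of "ell i"] Pring_mono[OF ell_Pring, of "W \<union> V"] by (auto simp: cg_def)

text \<open>A translation-invariant classification of exponents that puts the monomials of all
  blocks into one class makes the generators homogeneous, so \<open>I\<close> contains the
  components of its elements. It is used for the \<open>K\<^sub>0\<close>-degree and for the weight
  \<open>omega\<close>.\<close>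

lemma rs_I:
  fixes c :: "(var \<Rightarrow>\<^sub>0 nat) \<Rightarrow> 'k"
  assumes c: "\<And>\<mu> \<mu>' \<nu>. c \<mu> = c \<mu>' \<Longrightarrow> c (\<nu> + \<mu>) = c (\<nu> + \<mu>')"
    and cT: "\<And>i. i \<le> r \<Longrightarrow> c (Tmon n l i) = c (Tmon n l 0)"
    and f: "f \<in> I"
  shows "rs (\<lambda>\<mu>. c \<mu> = \<kappa>) f \<in> I"
proof -
  obtain F a where F: "finite F" "F \<subseteq> {Defs.gpoly r n l v | v. v \<in> kerL}" "\<forall>g\<in>F. a g \<in> Pring V"
    "f = (\<Sum>g\<in>F. a g * g)"
    using f unfolding I_def ideal_gen_def by blast
  have "rs (\<lambda>\<mu>. c \<mu> = \<kappa>) (a g * g) \<in> I" if gF: "g \<in> F" for g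
  proof -
    obtain v where v: "v \<in> kerL" "g = Defs.gpoly r n l v" using F(2) gF by blast
    have gI: "g \<in> I" unfolding I_def using v by (intro ideal_gen_base) blast
    have s: "rs (\<lambda>\<mu>. c \<mu> = \<kappa>) (sg \<nu> x * g) \<in> I" if "ks \<nu> \<subseteq> V" for \<nu> x
    proof -
      have e: "sg \<nu> x * g = (\<Sum>i\<le>r. sg (\<nu> + Tmon n l i) (x * v i))"
        unfolding v(2) Defs.gpoly_def by (simp add: sum_distrib_left mult_single)
      have "rs (\<lambda>\<mu>. c \<mu> = \<kappa>) (sg \<nu> x * g) =
          (\<Sum>i\<le>r. if c (\<nu> + Tmon n l 0) = \<kappa> then sg (\<nu> + Tmon n l i) (x * v i) else 0)"
        unfolding e rs_sum rs_single
      proof (rule sum.cong)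
        fix i assume "i \<in> {..r}"
        then have "c (\<nu> + Tmon n l i) = c (\<nu> + Tmon n l 0)" by (intro c[OF cT]) simp
        then show "(if c (\<nu> + Tmon n l i) = \<kappa> then sg (\<nu> + Tmon n l i) (x * v i) else 0) =
            (if c (\<nu> + Tmon n l 0) = \<kappa> then sg (\<nu> + Tmon n l i) (x * v i) else 0)" by simp
      qed simp
      then have "rs (\<lambda>\<mu>. c \<mu> = \<kappa>) (sg \<nu> x * g) = (if c (\<nu> + Tmon n l 0) = \<kappa> then sg \<nu> x * g else 0)"
        by (simp add: e)
      moreover have "sg \<nu> x * g \<in> I" using gI that by (intro I_intros Pring_single)
      ultimately show ?thesis by (simp add: I_simps)
    qed
    have "a g * g = (\<Sum>\<nu>\<in>ks (a g). sg \<nu> (lk (a g) \<nu>) * g)"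
      by (simp add: sum_single_lk flip: sum_distrib_right)
    moreover have "ks \<nu> \<subseteq> V" if "\<nu> \<in> ks (a g)" for \<nu> using F(3) gF that by (auto simp: Pring_def)
    ultimately show ?thesis by (simp only: rs_sum) (intro ideal_sum[OF ideal_I] s)
  qed
  then show ?thesis unfolding F(4) rs_sum by (intro ideal_sum[OF ideal_I])
qed

text \<open>A symmetric parametrization of the row space of \<open>P\<^sub>0\<close>: block
  \<open>a\<close> is scaled by \<open>z a\<close>, and the \<open>z a\<close> sum to 0 (see
  \<open>L_eq\<close>). Block 0 thereby loses its special role.\<close>

definition lat :: "(nat \<Rightarrow> int) \<Rightarrow> var \<Rightarrow> int" where
  "lat z = (\<lambda>v. case v of T a j \<Rightarrow> if a \<le> r \<and> 1 \<le> j \<and> j \<le> n a then z a * int (l a j) else 0 | S k \<Rightarrow> 0)"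

abbreviation L :: "(var \<Rightarrow> int) set" where "L \<equiv> imP0 r n l"

lemma P0row_sum: "(\<Sum>i\<in>{1..r}. (\<lambda>v. z i * P0row n l i v)) = lat (\<lambda>i. if i = 0 then - (\<Sum>i\<in>{1..r}. z i) else z i)"
proof
  fix v
  show "(\<Sum>i\<in>{1..r}. (\<lambda>v. z i * P0row n l i v)) v = lat (\<lambda>i. if i = 0 then - (\<Sum>i\<in>{1..r}. z i) else z i) v"
  proof (cases v)
    case (T a j)
    have "(\<Sum>i\<in>{1..r}. z i * P0row n l i v) = (\<Sum>i\<in>{1..r}. if 1 \<le> j \<and> j \<le> n a then
        (if a = 0 then - z i * int (l 0 j) else if i = a then z a * int (l a j) else 0) else 0)"
      by (intro sum.cong) (auto simp: P0row_def T)
    also have "\<dots> = (if 1 \<le> j \<and> j \<le> n a then (if a = 0 then - (\<Sum>i\<in>{1..r}. z i) * int (l 0 j)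
          else if a \<le> r then z a * int (l a j) else 0) else 0)"
      by (auto simp: sum_distrib_right sum_negf)
    finally have "(\<Sum>i\<in>{1..r}. z i * P0row n l i v) = \<dots>" .
    then show ?thesis unfolding sum_fun T by (auto simp: lat_def)
  next
    case (S k)
    then show ?thesis by (simp add: sum_fun lat_def P0row_def)
  qed
qed

lemma L_eq: "L = {lat z | z. (\<Sum>i\<le>r. z i) = 0}"
proof -
  have sp: "(\<Sum>i\<le>r. z i) = z 0 + (\<Sum>i\<in>{1..r}. z i)" for z :: "nat \<Rightarrow> int"
    using sum.atMost_shift[of z r] by (simp add: sum.atLeast1_atMost_eq lessThan_Suc_atMost sum.lessThan_Suc_shift)
  have "lat z = (\<Sum>i\<in>{1..r}. (\<lambda>v. z i * P0row n l i v))" if "(\<Sum>i\<le>r. z i) = 0" for z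
  proof -
    have "(\<lambda>i. if i = 0 then - (\<Sum>i\<in>{1..r}. z i) else z i) = z" using that sp[of z] by auto
    then show ?thesis unfolding P0row_sum by simp
  qed
  moreover have "(\<Sum>i\<le>r. if i = 0 then - (\<Sum>i\<in>{1..r}. z i) else z i) = 0" for z :: "nat \<Rightarrow> int"
    unfolding sp by simp
  ultimately show ?thesis unfolding imP0_def P0row_sum by blast
qed

lemma lat_add: "lat z + lat z' = lat (\<lambda>i. z i + z' i)" and lat_uminus: "- lat z = lat (\<lambda>i. - z i)"
  by (auto simp: lat_def fun_eq_iff algebra_simps split: var.splits)

lemma L_0: "0 \<in> L"
  unfolding L_eq by (rule CollectI, rule exI[of _ "\<lambda>_. 0"]) (auto simp: lat_def fun_eq_iff split: var.splits)

lemma L_add: "x \<in> L \<Longrightarrow> y \<in> L \<Longrightarrow> x + y \<in> L"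
proof -
  assume "x \<in> L" "y \<in> L"
  then obtain z z' where "x = lat z" "y = lat z'" "(\<Sum>i\<le>r. z i) = 0" "(\<Sum>i\<le>r. z' i) = 0"
    unfolding L_eq by blast
  then have "x + y = lat (\<lambda>i. z i + z' i)" "(\<Sum>i\<le>r. z i + z' i) = 0"
    by (simp_all add: lat_add sum.distrib)
  then show ?thesis unfolding L_eq by blast
qed

lemma L_uminus: "x \<in> L \<Longrightarrow> - x \<in> L"
proof -
  assume "x \<in> L"
  then obtain z where "x = lat z" "(\<Sum>i\<le>r. z i) = 0" unfolding L_eq by blast
  then have "- x = lat (\<lambda>i. - z i)" "(\<Sum>i\<le>r. - z i) = 0" by (simp_all add: lat_uminus sum_negf)
  then show ?thesis unfolding L_eq by blast
qed

lemma L_diff: "x \<in> L \<Longrightarrow> y \<in> L \<Longrightarrow> x - y \<in> L"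
  using L_add[of x "- y"] L_uminus by simp

lemma expvec_add: "expvec (\<mu> + \<nu>) = expvec \<mu> + expvec \<nu>"
  by (simp add: expvec_def fun_eq_iff lookup_add)

definition kt :: "(nat \<Rightarrow> nat) \<Rightarrow> (var \<Rightarrow>\<^sub>0 nat)" where
  "kt k = (\<Sum>i\<le>r. \<Sum>j\<in>{1..n i}. sg (T i j) (k i * l i j))"

lemma lk_kt: "lk (kt k) v = (case v of T a j \<Rightarrow> if a \<le> r \<and> 1 \<le> j \<and> j \<le> n a then k a * l a j else 0 | S k \<Rightarrow> 0)"
proof (cases v)
  case (T a j)
  have "lk (kt k) v = (\<Sum>i\<le>r. \<Sum>j'\<in>{1..n i}. if j' = j then (if i = a then k a * l a j else 0) else 0)"
    unfolding kt_def lookup_sum T by (intro sum.cong) (auto simp: lookup_single when_def)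
  also have "\<dots> = (\<Sum>i\<le>r. if i = a then (if 1 \<le> j \<and> j \<le> n a then k a * l a j else 0) else 0)"
    by (intro sum.cong) auto
  finally show ?thesis by (auto simp: T)
next
  case (S k)
  then show ?thesis by (simp add: kt_def lookup_sum lookup_single)
qed

lemma mon_kt: "mon x (kt k) = (\<Prod>i\<le>r. mon x (Tmon n l i) ^ k i)"
  for x :: "var \<Rightarrow> 'b::comm_semiring_1"
  by (simp add: kt_def mon_sum mon_Tmon prod_power_distrib power_mult[symmetric] mult.commute)

text \<open>Take as many full copies of each \<open>Tmon n l i\<close> out of \<open>\<mu>\<close>
  as possible and let \<open>\<rho>\<close> be the rest. Another exponent \<open>\<nu>\<close> of
  the same degree differs by a vector \<open>lat z\<close>. Looking at a variable where the minimum
  \<open>a i\<close> is attained, nonnegativity of \<open>\<nu>\<close> forces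
  \<open>a i + z i \<ge> 0\<close>, so the same \<open>\<rho>\<close> is left over. As the
  \<open>z i\<close> sum to 0, the number \<open>d\<close> of copies is the same too.\<close>

lemma kt_representation:
  assumes \<mu>: "ks \<mu> \<subseteq> V"
  shows "\<exists>\<rho> d. ks \<rho> \<subseteq> V \<and> (\<forall>\<nu>. expvec \<nu> - expvec \<mu> \<in> L \<longrightarrow> (\<exists>k. \<nu> = \<rho> + kt k \<and> (\<Sum>i\<le>r. k i) = d))"
proof -
  define a where "a = (\<lambda>i. Min ((\<lambda>j. lk \<mu> (T i j) div l i j) ` {1..n i}))"
  have a_le: "a i * l i j \<le> lk \<mu> (T i j)" if "i \<le> r" "1 \<le> j" "j \<le> n i" for i j
  proof -
    have "a i \<le> lk \<mu> (T i j) div l i j" unfolding a_def using that by (intro Min_le) auto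
    then have "a i * l i j \<le> (lk \<mu> (T i j) div l i j) * l i j" by (rule mult_le_mono1)
    then show ?thesis using div_times_less_eq_dividend le_trans by blast
  qed
  have a_att: "\<exists>j\<in>{1..n i}. lk \<mu> (T i j) < (a i + 1) * l i j" if "i \<le> r" for i
  proof -
    have "a i \<in> (\<lambda>j. lk \<mu> (T i j) div l i j) ` {1..n i}"
      unfolding a_def using n_pos[OF that] by (intro Min_in) auto
    then obtain j where j: "j \<in> {1..n i}" "a i = lk \<mu> (T i j) div l i j" by blast
    have "0 < l i j" using j l_pos that by simp
    then have "lk \<mu> (T i j) < (lk \<mu> (T i j) div l i j + 1) * l i j"
      by (metis Suc_eq_plus1 dividend_less_div_times add.commute mult_Suc)
    then show ?thesis using j by (intro bexI[of _ j]) auto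
  qed
  define \<rho> where "\<rho> = \<mu> - kt a"
  have \<mu>eq: "\<mu> = \<rho> + kt a"
    by (rule poly_mapping_eqI) (use a_le in \<open>auto simp: \<rho>_def lookup_add lookup_minus lk_kt split: var.splits\<close>)
  have "ks \<rho> \<subseteq> V" using \<mu> by (auto simp: \<rho>_def in_keys_iff lookup_minus)
  moreover have "\<exists>k. \<nu> = \<rho> + kt k \<and> (\<Sum>i\<le>r. k i) = (\<Sum>i\<le>r. a i)" if \<nu>: "expvec \<nu> - expvec \<mu> \<in> L" for \<nu>
  proof -
    obtain z where z: "expvec \<nu> - expvec \<mu> = lat z" "(\<Sum>i\<le>r. z i) = 0" using \<nu> unfolding L_eq by blast
    have zv: "int (lk \<nu> v) = int (lk \<mu> v) + lat z v" for v
      using fun_cong[OF z(1), of v] by (simp add: expvec_def)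
    have pos: "0 \<le> int (a i) + z i" if i: "i \<le> r" for i
    proof -
      obtain j where j: "j \<in> {1..n i}" "lk \<mu> (T i j) < (a i + 1) * l i j" using a_att[OF i] by blast
      have "0 \<le> int (lk \<mu> (T i j)) + z i * int (l i j)"
        using zv[of "T i j"] i j by (simp add: lat_def)
      also have "int (lk \<mu> (T i j)) < (int (a i) + 1) * int (l i j)"
        using j(2) by (metis of_nat_1 of_nat_add of_nat_less_iff of_nat_mult)
      finally have "0 < (int (a i) + 1 + z i) * int (l i j)" by (simp add: algebra_simps)
      then show ?thesis by (simp add: zero_less_mult_iff)
    qed
    define k where "k = (\<lambda>i. nat (int (a i) + z i))"
    have "\<nu> = \<rho> + kt k"
    proof (rule poly_mapping_eqI)
      fix v
      have "int (lk \<nu> v) = int (lk (\<rho> + kt k) v)"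
      proof (cases v)
        case (T i j)
        show ?thesis
        proof (cases "i \<le> r \<and> 1 \<le> j \<and> j \<le> n i")
          case True
          then have "int (k i) = int (a i) + z i" using pos by (simp add: k_def)
          moreover have "lat z v = z i * int (l i j)" using True by (simp add: lat_def T)
          moreover have "lk (kt k) v = k i * l i j" "lk (kt a) v = a i * l i j" using True by (simp_all add: lk_kt T)
          moreover have "int (lk \<mu> v) = int (lk \<rho> v) + int (lk (kt a) v)" by (subst \<mu>eq) (simp add: lookup_add)
          ultimately show ?thesis using zv[of v] by (simp add: lookup_add algebra_simps)
        next
          case False
          then have "lat z v = 0" "lk (kt k) v = 0" "lk (kt a) v = 0" by (auto simp: lat_def lk_kt T)
          moreover have "int (lk \<mu> v) = int (lk \<rho> v) + int (lk (kt a) v)" by (subst \<mu>eq) (simp add: lookup_add)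
          ultimately show ?thesis using zv[of v] by (simp add: lookup_add)
        qed
      next
        case (S q)
        then have "lat z v = 0" "lk (kt k) v = 0" "lk (kt a) v = 0" by (auto simp: lat_def lk_kt)
        moreover have "int (lk \<mu> v) = int (lk \<rho> v) + int (lk (kt a) v)" by (subst \<mu>eq) (simp add: lookup_add)
        ultimately show ?thesis using zv[of v] by (simp add: lookup_add)
      qed
      then show "lk \<nu> v = lk (\<rho> + kt k) v" by simp
    qed
    moreover have "(\<Sum>i\<le>r. k i) = (\<Sum>i\<le>r. a i)"
    proof -
      have "int (\<Sum>i\<le>r. k i) = (\<Sum>i\<le>r. int (a i) + z i)" using pos by (simp add: k_def)
      then have "int (\<Sum>i\<le>r. k i) = int (\<Sum>i\<le>r. a i)" using z by (simp add: sum.distrib)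
      then show ?thesis by linarith
    qed
    ultimately show ?thesis by blast
  qed
  ultimately show ?thesis by blast
qed

lemma homogeneous_ell: "homogeneous 1 (ell i)"
  unfolding ell_def using homogeneous_mult[OF homogeneous_const homogeneous_Xv]
  by (intro homogeneous_sum) simp

lemma W_V: "h \<in> Pring W \<Longrightarrow> eps h \<in> Pring V"
  using eps_Pring Pring_mono[of h W "W \<union> V"] by blast

text \<open>All monomials of \<open>f\<close> share the remainder \<open>\<rho>\<close> and have
  \<open>d\<close> full blocks by \<open>kt_representation\<close>. Replacing each full block
  \<open>Tp i\<close> by \<open>ell i\<close> turns the rest into a form of degree
  \<open>d\<close>.\<close>

lemma homogeneous_form:
  assumes f: "f \<in> Pring V" "f \<noteq> 0" "\<And>\<mu>. \<mu> \<in> ks f \<Longrightarrow> expvec \<mu> - w \<in> L"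
  shows "\<exists>\<rho> h d. ks \<rho> \<subseteq> V \<and> h \<in> Pring W \<and> homogeneous d h \<and> cg f (mon Xv \<rho> * eps h)"
proof -
  obtain \<mu>0 where \<mu>0: "\<mu>0 \<in> ks f" using f(2) by (metis all_not_in_conv keys_eq_empty)
  then have "ks \<mu>0 \<subseteq> V" using f(1) by (auto simp: Pring_def)
  then obtain \<rho> d where \<rho>: "ks \<rho> \<subseteq> V"
    "\<And>\<nu>. expvec \<nu> - expvec \<mu>0 \<in> L \<Longrightarrow> \<exists>k. \<nu> = \<rho> + kt k \<and> (\<Sum>i\<le>r. k i) = d"
    using kt_representation by blast
  have "\<exists>k. \<nu> = \<rho> + kt k \<and> (\<Sum>i\<le>r. k i) = d" if "\<nu> \<in> ks f" for \<nu>
  proof (rule \<rho>(2))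
    have "(expvec \<nu> - w) - (expvec \<mu>0 - w) \<in> L" by (intro L_diff f(3) that \<mu>0)
    then show "expvec \<nu> - expvec \<mu>0 \<in> L" by simp
  qed
  then obtain k where k: "\<And>\<nu>. \<nu> \<in> ks f \<Longrightarrow> \<nu> = \<rho> + kt (k \<nu>)" "\<And>\<nu>. \<nu> \<in> ks f \<Longrightarrow> (\<Sum>i\<le>r. k \<nu> i) = d"
    by metis
  define h where "h = (\<Sum>\<nu>\<in>ks f. const (lk f \<nu>) * (\<Prod>i\<le>r. ell i ^ k \<nu> i))"
  have hW: "h \<in> Pring W" unfolding h_def by (intro Pring_sum Pring_mult Pring_prod Pring_power ell_Pring) simp
  have hd: "homogeneous d h" unfolding h_def
  proof (rule homogeneous_sum)
    fix \<nu> assume "\<nu> \<in> ks f"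
    have "homogeneous (\<Sum>i\<le>r. 1 * k \<nu> i) (\<Prod>i\<le>r. ell i ^ k \<nu> i)"
      by (intro homogeneous_prod homogeneous_power homogeneous_ell) simp
    then show "homogeneous d (const (lk f \<nu>) * (\<Prod>i\<le>r. ell i ^ k \<nu> i))"
      using homogeneous_mult[OF homogeneous_const] k(2)[OF \<open>\<nu> \<in> ks f\<close>] by fastforce
  qed
  have \<rho>V: "mon Xv \<rho> \<in> Pring V" using \<rho>(1) by (intro Pring_mon) auto
  have "f = (\<Sum>\<nu>\<in>ks f. const (lk f \<nu>) * mon Xv \<nu>)" using ev_const_Xv[of f] by (simp add: ev_def)
  also have "\<dots> = (\<Sum>\<nu>\<in>ks f. mon Xv \<rho> * (const (lk f \<nu>) * (\<Prod>i\<le>r. Tp i ^ k \<nu> i)))"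
  proof (rule sum.cong)
    fix \<nu> assume \<nu>: "\<nu> \<in> ks f"
    have "mon Xv \<nu> = mon Xv \<rho> * (\<Prod>i\<le>r. Tp i ^ k \<nu> i)"
      by (subst k(1)[OF \<nu>]) (simp add: mon_add mon_kt Tp_def)
    then show "const (lk f \<nu>) * mon Xv \<nu> = mon Xv \<rho> * (const (lk f \<nu>) * (\<Prod>i\<le>r. Tp i ^ k \<nu> i))" by simp
  qed simp
  finally have fe: "f = \<dots>" .
  have "cg f (\<Sum>\<nu>\<in>ks f. mon Xv \<rho> * (const (lk f \<nu>) * (\<Prod>i\<le>r. eps (ell i) ^ k \<nu> i)))"
    by (subst fe) (intro cg_sum cg_mult cg_refl cg_prod cg_power cg_Tp \<rho>V, auto)
  also have "(\<Sum>\<nu>\<in>ks f. mon Xv \<rho> * (const (lk f \<nu>) * (\<Prod>i\<le>r. eps (ell i) ^ k \<nu> i))) = mon Xv \<rho> * eps h"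
    by (simp add: h_def eps_hom sum_distrib_left)
  finally show ?thesis using \<rho> hW hd by blast
qed

interpretation one: selection r m n l Jc lam "\<lambda>_. 1"
  by unfold_locales (use n_pos in \<open>simp add: Suc_le_eq\<close>)

text \<open>At suitable chart points no variable vanishes, so \<open>eps h\<close> vanishes there,
  and its value is that of \<open>h\<close>.\<close>

lemma mon_eps_in_I:
  assumes \<mu>: "ks \<mu> \<subseteq> V" and h: "h \<in> Pring W" and I: "mon Xv \<mu> * eps h \<in> I"
  shows "h = 0"
proof (rule one.vanish_on_U)
  fix z assume z: "z \<in> one.U"
  \<comment> \<open>\<open>U\<close> leaves the variables \<open>S k\<close> free. Setting them to 1
    keeps the monomial nonzero and does not affect \<open>h\<close>.\<close>
  define z' where "z' = (\<lambda>v. case v of T i j \<Rightarrow> z v | S k \<Rightarrow> 1)"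
  have z': "z' \<in> one.U" using z by (simp add: one.U_def z'_def elv_def)
  have "one.pt z' v \<noteq> 0" if "v \<in> V" for v
  proof (cases v)
    case (T i j)
    then show ?thesis using that one.pt_nonzero[OF z'] by simp
  next
    case (S k)
    then have "one.pt z' v = 1" unfolding one.pt_def z'_def by simp
    then show ?thesis by simp
  qed
  then have "mon (one.pt z') \<mu> \<noteq> 0" using \<mu> by (auto simp: mon_def prod_zero_iff)
  moreover have "evc (one.pt z') (mon Xv \<mu>) = mon (one.pt z') \<mu>"
    by (simp add: ring_map_mon[OF ring_map_ev[OF ring_map_id]] evc_hom)
  moreover have "W \<subseteq> one.EJ" unfolding one.EJ_def by blast
  then have "h \<in> Pring one.EJ" by (rule Pring_mono[OF h])
  then have "evc (one.pt z') (eps h) = evc z' h" by (rule one.evc_eps_pt[OF z'])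
  ultimately have "evc z' h = 0" using evc_I[OF one.onX_pt[OF z'] I] by (simp add: evc_hom)
  also have "evc z' h = evc z h" by (rule ev_cong[OF h]) (auto simp: W_def z'_def)
  finally show "evc z h = 0" .
qed

text \<open>The \<open>K\<^sub>0\<close>-degree of a monomial as a coset of \<open>L\<close>, so
  that equality of degrees is equality of sets.\<close>

definition kc :: "(var \<Rightarrow>\<^sub>0 nat) \<Rightarrow> (var \<Rightarrow> int) set" where
  "kc \<mu> = {x. x - expvec \<mu> \<in> L}"

lemma kc_eq: "kc \<mu> = kc \<nu> \<longleftrightarrow> expvec \<mu> - expvec \<nu> \<in> L"
proof
  have "expvec \<mu> \<in> kc \<mu>" by (simp add: kc_def L_0)
  then show "kc \<mu> = kc \<nu> \<Longrightarrow> expvec \<mu> - expvec \<nu> \<in> L" by (simp add: kc_def)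
next
  assume a: "expvec \<mu> - expvec \<nu> \<in> L"
  have "x - expvec \<mu> \<in> L \<longleftrightarrow> x - expvec \<nu> \<in> L" for x
    using L_add[OF _ a, of "x - expvec \<mu>"] L_diff[OF _ a, of "x - expvec \<nu>"] by auto
  then show "kc \<mu> = kc \<nu>" by (simp add: kc_def)
qed

lemma kc_add: "kc (\<nu> + \<mu>) = kc (\<nu> + \<mu>') \<longleftrightarrow> kc \<mu> = kc \<mu>'"
  by (simp add: kc_eq expvec_add)

lemma kc_Tmon: assumes "i \<le> r" shows "kc (Tmon n l i) = kc (Tmon n l 0)"
  unfolding kc_eq L_eq
proof (rule CollectI, rule exI[of _ "\<lambda>a. (if a = i then 1 else 0) - (if a = 0 then 1 else 0)"], rule conjI)
  show "expvec (Tmon n l i) - expvec (Tmon n l 0) = lat (\<lambda>a. (if a = i then 1 else 0) - (if a = 0 then 1 else 0))"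
    using assms by (auto simp: fun_eq_iff expvec_def lk_Tmon lat_def split: var.splits)
  show "(\<Sum>a\<le>r. (if a = i then 1 else 0) - (if a = 0 then 1 else 0) :: int) = 0"
    using assms by (simp add: sum_subtractf)
qed

lemma rs_kc_I: "f \<in> I \<Longrightarrow> rs (\<lambda>\<mu>. kc \<mu> = \<kappa>) f \<in> I"
  by (rule rs_I[of kc]) (simp_all only: kc_add, rule kc_Tmon)

lemma rs_kc_form:
  assumes "f \<in> Pring V"
  shows "\<exists>\<rho> h d. ks \<rho> \<subseteq> V \<and> h \<in> Pring W \<and> homogeneous d h \<and> cg (rs (\<lambda>\<mu>. kc \<mu> = \<kappa>) f) (mon Xv \<rho> * eps h)"
proof (cases "rs (\<lambda>\<mu>. kc \<mu> = \<kappa>) f = 0")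
  case True
  have "homogeneous 0 0" by (simp add: homogeneous_def)
  then show ?thesis unfolding True using cg_refl[of 0]
    by (intro exI[of _ 0] exI[of _ "0::mpoly"]) (simp add: eps_hom)
next
  case False
  then obtain \<mu> where "\<mu> \<in> ks (rs (\<lambda>\<mu>. kc \<mu> = \<kappa>) f)" by (metis all_not_in_conv keys_eq_empty)
  then show ?thesis
    by (intro homogeneous_form[of _ "expvec \<mu>"] rs_Pring assms False) (auto simp: ks_rs simp flip: kc_eq)
qed

lemma I_if_components:
  assumes "\<And>\<kappa>. rs (\<lambda>\<mu>. kc \<mu> = \<kappa>) f \<in> I" shows "f \<in> I"
proof -
  have "(\<Sum>\<kappa>\<in>kc ` ks f. rs (\<lambda>\<mu>. kc \<mu> = \<kappa>) f) \<in> I" by (intro ideal_sum[OF ideal_I] assms)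
  then show ?thesis by (simp only: sum_rs_classes)
qed

text \<open>A monomial factor shifts all degrees by the same amount, so the claim may be checked on
  components, where \<open>homogeneous_form\<close> and \<open>mon_eps_in_I\<close> apply. It is
  proved before primality of \<open>I\<close>, which rests on it.\<close>

lemma mon_cancel_I:
  assumes \<nu>: "ks \<nu> \<subseteq> V" and f: "f \<in> Pring V" and I: "mon Xv \<nu> * f \<in> I"
  shows "f \<in> I"
proof (rule I_if_components)
  fix \<kappa>
  let ?f = "rs (\<lambda>\<mu>. kc \<mu> = \<kappa>) f"
  show "?f \<in> I"
  proof (cases "?f = 0")
    case False
    then obtain \<mu>0 where "\<mu>0 \<in> ks ?f" by (metis all_not_in_conv keys_eq_empty)
    then have \<kappa>: "\<kappa> = kc \<mu>0" by (auto simp: ks_rs)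
    have "rs (\<lambda>\<mu>. kc \<mu> = kc (\<nu> + \<mu>0)) (sg \<nu> 1 * f) = sg \<nu> 1 * ?f"
      by (rule rs_shift) (simp add: \<kappa> kc_add)
    then have 1: "mon Xv \<nu> * ?f \<in> I" using rs_kc_I[OF I, of "kc (\<nu> + \<mu>0)"] by (simp only: mon_Xv)
    obtain \<rho> h d where h: "ks \<rho> \<subseteq> V" "h \<in> Pring W" "cg ?f (mon Xv \<rho> * eps h)"
      using rs_kc_form[OF f] by blast
    have "mon Xv \<nu> \<in> Pring V" using \<nu> by (intro Pring_mon) auto
    then have "cg (mon Xv \<nu> * ?f) (mon Xv \<nu> * (mon Xv \<rho> * eps h))" by (intro cg_mult cg_refl h)
    then have "mon Xv \<nu> * (mon Xv \<rho> * eps h) \<in> I" using 1 cg_in_I by blast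
    then have "mon Xv (\<nu> + \<rho>) * eps h \<in> I" by (simp add: mon_add mult.assoc)
    moreover have "ks (\<nu> + \<rho>) \<subseteq> V" using \<nu> h(1) keys_add[of \<nu> \<rho>] by blast
    ultimately have "h = 0" using mon_eps_in_I h(2) by blast
    then show ?thesis using h(3) f by (simp add: eps_hom cg_0_iff rs_Pring)
  qed (simp add: I_simps)
qed

end

section \<open>The quotient as a module over the ring of a chart\<close>

context selection
begin

definition DJ :: "var \<Rightarrow>\<^sub>0 nat" where
  "DJ = (\<Sum>i\<le>r. \<Sum>j\<in>{1..n i} - {J i}. sg (T i j) (l i j))"

lemma mon_DJ: "mon x DJ = (\<Prod>i\<le>r. \<Prod>j\<in>{1..n i} - {J i}. x (T i j) ^ l i j)"
  by (simp add: DJ_def mon_sum)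

lemma mon_DJ_EJ: "mon Xv DJ \<in> Pring EJ"
  unfolding mon_DJ by (intro Pring_prod Pring_power) (auto simp: EJ_def)

lemma eps_mon: "ks \<mu> \<subseteq> V \<Longrightarrow> eps (mon Xv \<mu>) = mon Xv \<mu>"
  unfolding ring_map_mon[OF ring_map_eps] by (intro mon_cong eps_Xv_V) auto

lemma ks_DJ: "ks DJ \<subseteq> V"
  unfolding DJ_def
  by (intro order_trans[OF keys_sum] UN_least) (auto split: if_splits)

definition A :: "mpoly set" where
  "A = eps ` Pring EJ"

lemma subring_A: "subring_set A"
proof -
  have "1 \<in> A" unfolding A_def by (rule image_eqI[of _ _ 1]) (simp_all add: eps_hom)
  moreover have "eps x - eps y \<in> A" "eps x * eps y \<in> A" if "x \<in> Pring EJ" "y \<in> Pring EJ" for x y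
    unfolding A_def using that
    by (intro image_eqI[of _ _ "x - y"] image_eqI[of _ _ "x * y"]; auto simp: eps_hom)+
  ultimately show ?thesis unfolding subring_set_def A_def by blast
qed

lemma A_V: "A \<subseteq> Pring V"
  by (auto simp: A_def eps_EJ)

lemma A_const: "const a \<in> A"
  unfolding A_def by (rule image_eqI[of _ _ "const a"]) simp_all

lemma A_DJ: "mon Xv DJ \<in> A"
  unfolding A_def by (rule image_eqI[of _ _ "mon Xv DJ"]) (simp_all add: eps_mon ks_DJ mon_DJ_EJ)

lemma spn_one: "1 \<in> spn I A Box TJ"
proof -
  have "1 = TJ (restrict (\<lambda>_. 0) {..r})" by (simp add: TJ_def)
  also have "\<dots> \<in> spn I A Box TJ"
    by (intro spn_gen[OF ideal_I subring_A finite_Box]) (auto simp only: Box_def restrict_PiE_iff lessThan_iff atMost_iff e_pos)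
  finally show ?thesis .
qed

text \<open>Only an overflow of the exponent to \<open>e i\<close> needs an argument. The factor
  \<open>mon Xv DJ\<close> supplies the other variables of the block, and together with
  \<open>Xv v ^ e i\<close> they form \<open>Tp i\<close>, which is congruent to
  \<open>eps (ell i)\<close>.\<close>

lemma spn_step:
  assumes v: "v \<in> V" and \<kappa>: "\<kappa> \<in> Box"
  shows "mon Xv DJ * Xv v * TJ \<kappa> \<in> spn I A Box TJ"
proof (cases "v \<in> EJ")
  case True
  then have "Xv v \<in> A" unfolding A_def using v by (intro image_eqI[of _ _ "Xv v"]) (simp_all add: eps_Xv_V)
  then have "mon Xv DJ * Xv v \<in> A" using A_DJ subring_mult[OF subring_A] by blast
  then show ?thesis
    using spn_mult[OF ideal_I subring_A A_V spn_gen[OF ideal_I subring_A finite_Box \<kappa>]] by blast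
next
  case False
  then obtain i where i: "v = T i (J i)" using v by (auto simp: EJ_def)
  then have ir: "i \<le> r" using v by simp
  define R where "R = (\<Prod>k\<in>{..r} - {i}. Xv (T k (J k)) ^ \<kappa> k)"
  have TJu: "TJ (\<kappa>(i := a)) = Xv v ^ a * R" for a
  proof -
    have "TJ (\<kappa>(i := a)) = Xv v ^ a * (\<Prod>k\<in>{..r} - {i}. Xv (T k (J k)) ^ (\<kappa>(i := a)) k)"
      unfolding TJ_def i using ir by (subst prod.remove[of _ i]) auto
    then show ?thesis by (simp add: R_def)
  qed
  have TJ\<kappa>: "TJ \<kappa> = Xv v ^ \<kappa> i * R" using TJu[of "\<kappa> i"] by simp
  have mem: "\<kappa>(i := a) \<in> Box" if "a < e i" for a
    using \<kappa> ir that unfolding Box_def by (auto simp: PiE_iff extensional_def)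
  have ki: "\<kappa> i < e i" using \<kappa> ir by (auto simp: Box_def)
  show ?thesis
  proof (cases "Suc (\<kappa> i) < e i")
    case True
    have "Xv v * TJ \<kappa> = TJ (\<kappa>(i := Suc (\<kappa> i)))" unfolding TJu TJ\<kappa> by simp
    then have "Xv v * TJ \<kappa> \<in> spn I A Box TJ"
      using spn_gen[OF ideal_I subring_A finite_Box mem[OF True]] by metis
    from spn_mult[OF ideal_I subring_A A_V this A_DJ] show ?thesis by (simp add: mult_ac)
  next
    case False
    then have ei: "e i = Suc (\<kappa> i)" using ki by simp
    define Di where "Di = (\<Prod>j\<in>{1..n i} - {J i}. Xv (T i j) ^ l i j)"
    define D' where "D' = (\<Prod>k\<in>{..r} - {i}. \<Prod>j\<in>{1..n k} - {J k}. Xv (T k j) ^ l k j)"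
    have D: "mon Xv DJ = Di * D'" unfolding mon_DJ Di_def D'_def using ir by (intro prod.remove) auto
    have D'EJ: "D' \<in> Pring EJ" unfolding D'_def by (intro Pring_prod Pring_power) (auto simp: EJ_def)
    have D'V: "D' \<in> Pring V" unfolding D'_def by (intro Pring_prod Pring_power) auto
    have epsD': "eps D' = D'" unfolding D'_def eps_hom by (intro prod.cong) (auto simp: eps_Xv)
    have RV: "R \<in> Pring V" unfolding R_def using J by (intro Pring_prod Pring_power) simp
    have Tpi: "Tp i = Xv v ^ e i * Di"
      unfolding Tp_def mon_Tmon Di_def e_def i using J[OF ir] by (intro prod.remove) auto
    have "mon Xv DJ * Xv v * TJ \<kappa> = Tp i * (D' * R)"
      unfolding D TJ\<kappa> Tpi ei by (simp add: mult_ac)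
    also have "\<dots> = (Tp i - eps (ell i)) * (D' * R) + eps (ell i * D') * TJ (\<kappa>(i := 0))"
      unfolding TJu eps_hom epsD' by (simp add: algebra_simps)
    also have "\<dots> \<in> spn I A Box TJ"
    proof (rule spn_add[OF ideal_I subring_A])
      show "(Tp i - eps (ell i)) * (D' * R) \<in> spn I A Box TJ"
        using D'V RV by (intro spn_ideal[OF ideal_I subring_A] ideal_mult'[OF ideal_I] Tp_ell ir) auto
      have "ell i \<in> Pring EJ" using Pring_mono[OF ell_Pring] by (simp add: EJ_def)
      then have "eps (ell i * D') \<in> A" unfolding A_def using D'EJ by auto
      then show "eps (ell i * D') * TJ (\<kappa>(i := 0)) \<in> spn I A Box TJ"
        by (intro spn_mult[OF ideal_I subring_A A_V spn_gen[OF ideal_I subring_A finite_Box mem]] e_pos ir)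
    qed
    finally show ?thesis .
  qed
qed

lemma decomposition:
  assumes "f \<in> Pring V"
  shows "\<exists>K h. (\<forall>\<kappa>\<in>Box. h \<kappa> \<in> Pring EJ) \<and> cg (mon Xv DJ ^ K * f) (\<Sum>\<kappa>\<in>Box. eps (h \<kappa>) * TJ \<kappa>)"
proof -
  obtain K where "mon Xv DJ ^ K * f \<in> spn I A Box TJ"
    using spn_absorb[OF ideal_I subring_A A_V A_const A_DJ spn_one spn_step assms] by blast
  then obtain a where a: "\<forall>\<kappa>\<in>Box. a \<kappa> \<in> A" "mon Xv DJ ^ K * f - (\<Sum>\<kappa>\<in>Box. a \<kappa> * TJ \<kappa>) \<in> I"
    unfolding spn_def by blast
  then have "\<forall>\<kappa>\<in>Box. \<exists>h\<in>Pring EJ. a \<kappa> = eps h" unfolding A_def by blast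
  then obtain h where h: "\<And>\<kappa>. \<kappa> \<in> Box \<Longrightarrow> h \<kappa> \<in> Pring EJ" "\<And>\<kappa>. \<kappa> \<in> Box \<Longrightarrow> a \<kappa> = eps (h \<kappa>)" by metis
  have "mon Xv DJ ^ K * f \<in> Pring V" by (intro Pring_mult Pring_power subsetD[OF A_V A_DJ] assms)
  moreover have "(\<Sum>\<kappa>\<in>Box. eps (h \<kappa>) * TJ \<kappa>) \<in> Pring V"
    by (intro Pring_sum Pring_mult eps_EJ TJ_V h)
  moreover have "(\<Sum>\<kappa>\<in>Box. a \<kappa> * TJ \<kappa>) = (\<Sum>\<kappa>\<in>Box. eps (h \<kappa>) * TJ \<kappa>)"
    by (intro sum.cong) (simp_all add: h)
  ultimately have "cg (mon Xv DJ ^ K * f) (\<Sum>\<kappa>\<in>Box. eps (h \<kappa>) * TJ \<kappa>)"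
    using a(2) by (simp add: cg_def)
  then show ?thesis using h(1) by blast
qed

lemma independence:
  assumes h: "\<And>\<kappa>. \<kappa> \<in> Box \<Longrightarrow> h \<kappa> \<in> Pring EJ"
    and s: "(\<Sum>\<kappa>\<in>Box. eps (h \<kappa>) * TJ \<kappa>) \<in> slice_ideal UNIV"
  shows "\<forall>\<kappa>\<in>Box. h \<kappa> = 0"
proof (rule chart_independence[OF h])
  fix z assume z: "z \<in> U"
  have "evc (pt z) (\<Sum>\<kappa>\<in>Box. eps (h \<kappa>) * TJ \<kappa>) = 0" using s z by (simp add: slice_ideal_def)
  then show "(\<Sum>\<kappa>\<in>Box. evc z (h \<kappa>) * (\<Prod>i\<le>r. pt z (T i (J i)) ^ \<kappa> i)) = 0"
    using evc_eps_pt[OF z h] by (simp add: evc_hom TJ_def)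
qed

lemma I_eq_slice: "I = slice_ideal UNIV"
proof (rule antisym[OF I_sub_slice], rule subsetI)
  fix f assume f: "f \<in> slice_ideal UNIV"
  then have fV: "f \<in> Pring V" by (simp add: slice_ideal_def)
  from decomposition[OF fV] obtain K h where hE: "\<forall>\<kappa>\<in>Box. h \<kappa> \<in> Pring EJ"
    and hc: "cg (mon Xv DJ ^ K * f) (\<Sum>\<kappa>\<in>Box. eps (h \<kappa>) * TJ \<kappa>)" by (elim exE conjE)
  note S = prime_ideal[OF slice_ideal_prime, of UNIV]
  have DV: "mon Xv DJ ^ K \<in> Pring V" by (intro Pring_power subsetD[OF A_V A_DJ])
  have "mon Xv DJ ^ K * f - (\<Sum>\<kappa>\<in>Box. eps (h \<kappa>) * TJ \<kappa>) \<in> slice_ideal UNIV"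
    using hc unfolding cg_def by (intro subsetD[OF I_sub_slice]) simp
  from ideal_diff[OF S ideal_mult[OF S f DV] this]
  have "(\<Sum>\<kappa>\<in>Box. eps (h \<kappa>) * TJ \<kappa>) \<in> slice_ideal UNIV" by simp
  from independence[of h, OF bspec[OF hE] this] have h0: "\<forall>\<kappa>\<in>Box. h \<kappa> = 0" .
  have "cg (mon Xv DJ ^ K * f) 0" using hc h0 by (simp add: eps_hom)
  then have DI: "mon Xv DJ ^ K * f \<in> I" by (simp add: cg_def)
  have cancel: "mon Xv DJ ^ K * g \<in> I \<Longrightarrow> g \<in> Pring V \<Longrightarrow> g \<in> I" for K g
  proof (induction K)
    case (Suc K)
    have 1: "mon Xv DJ * (mon Xv DJ ^ K * g) \<in> I" using Suc.prems by (simp add: mult.assoc)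
    have 2: "mon Xv DJ ^ K * g \<in> Pring V"
      by (intro Pring_mult Pring_power subsetD[OF A_V A_DJ] Suc.prems(2))
    show ?case by (rule Suc.IH[OF mon_cancel_I[OF ks_DJ 2 1] Suc.prems(2)])
  qed simp
  show "f \<in> I" using cancel[OF DI fV] .
qed

end

context arrangement
begin

lemma prime_I: "is_prime_ideal V I"
proof -
  interpret one: selection r m n l Jc lam "\<lambda>_. 1"
    by unfold_locales (use n_pos in \<open>simp add: Suc_le_eq\<close>)
  show ?thesis using one.slice_ideal_prime[of UNIV] one.I_eq_slice by simp
qed

end

section \<open>Dimension, grading group and units\<close>

context arrangement
begin

lemma card_V: "card V = (\<Sum>i\<le>r. n i) + m"
proof -
  have V: "V = (\<Union>i\<in>{..r}. T i ` {1..n i}) \<union> S ` {1..m}" by (auto simp: vars_def)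
  have "card (\<Union>i\<in>{..r}. T i ` {1..n i}) = (\<Sum>i\<le>r. card (T i ` {1..n i}))"
    by (rule card_UN_disjoint) auto
  also have "\<dots> = (\<Sum>i\<le>r. n i)" by (intro sum.cong) (simp_all add: card_image inj_on_def)
  finally show ?thesis
    unfolding V by (subst card_Un_disjoint) (auto simp: card_image inj_on_def)
qed

lemma card_V_ge: "r + 1 \<le> card V"
proof -
  have "r + 1 = (\<Sum>i\<le>r. 1)" by simp
  also have "\<dots> \<le> (\<Sum>i\<le>r. n i)" by (rule sum_mono) (use n_pos in \<open>simp add: Suc_le_eq\<close>)
  finally show ?thesis unfolding card_V by simp
qed

lemma card_Jc_le: "card Jc \<le> r + 1"
  using card_mono[OF _ Jc] by simp

lemma Tmon_eq_iff: assumes "i \<le> r" "k \<le> r" shows "Tmon n l i = Tmon n l k \<longleftrightarrow> i = k"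
proof
  assume "Tmon n l i = Tmon n l k"
  then have "lk (Tmon n l i) (T i 1) = lk (Tmon n l k) (T i 1)" by simp
  then show "i = k" using n_pos[OF assms(1)] l_pos[OF assms(1), of 1]
    by (auto simp: lk_Tmon split: if_splits)
qed simp

text \<open>Consider the blocks whose variables all belong to the independent set \<open>Y\<close>.
  More than \<open>card Jc\<close> of them would support a nonzero kernel vector, that is, a nonzero
  relation in \<open>I\<close> among the variables \<open>Y\<close>. Every other block misses at
  least one variable of \<open>Y\<close>.\<close>

lemma prime_chain_bound:
  assumes "prime_chain V I d"
  shows "d \<le> card V - (r + 1) + card Jc"
proof -
  obtain Y where Y: "Y \<subseteq> V" "card Y = d" "Pring Y \<inter> I \<subseteq> {0}"
    using prime_chain_independent[OF finite_V assms] by blast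
  define Full where "Full = {i. i \<le> r \<and> (\<forall>j\<in>{1..n i}. T i j \<in> Y)}"
  have finF: "finite Full" "Full \<subseteq> {..r}" by (auto simp: Full_def)
  have "card Full \<le> card Jc"
  proof (rule ccontr)
    assume "\<not> card Full \<le> card Jc"
    then obtain x where x: "\<exists>i\<in>Full. x i \<noteq> 0" "\<forall>j\<in>Jc. (\<Sum>i\<in>Full. lam i j * x i) = 0"
      using homogeneous_system[OF subring_UNIV finite_Jc finF(1), of "\<lambda>j i. lam i j"] by auto
    define v where "v = (\<lambda>i. if i \<in> Full then x i else 0)"
    have "(\<Sum>i\<le>r. v i * lam i j) = (\<Sum>i\<in>Full. lam i j * x i)" for j
      using finF by (intro sum.mono_neutral_cong_right) (auto simp: v_def)
    then have "v \<in> kerL" using x finF by (auto simp: kerL_def v_def)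
    then have gI: "Defs.gpoly r n l v \<in> I" unfolding I_def by (intro ideal_gen_base) blast
    have "Tp i \<in> Pring Y" if "i \<in> Full" for i
      unfolding Tp_def mon_Tmon using that by (intro Pring_prod Pring_power) (simp add: Full_def)
    then have "const (v i) * Tp i \<in> Pring Y" for i by (cases "i \<in> Full") (auto simp: v_def)
    then have "Defs.gpoly r n l v \<in> Pring Y" unfolding gpoly_eq by (intro Pring_sum)
    then have g0: "Defs.gpoly r n l v = 0" using gI Y(3) by blast
    obtain i where i: "i \<in> Full" "x i \<noteq> 0" using x by blast
    have "lk (Defs.gpoly r n l v) (Tmon n l i) = (\<Sum>k\<le>r. if k = i then v i else 0)"
      unfolding Defs.gpoly_def lookup_sum
      by (intro sum.cong) (use i finF in \<open>auto simp: lookup_single when_def Tmon_eq_iff Full_def\<close>)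
    then show False using g0 i finF by (auto simp: v_def split: if_splits)
  qed
  have "\<forall>i\<in>{..r} - Full. \<exists>j\<in>{1..n i}. T i j \<notin> Y" by (auto simp: Full_def)
  then obtain j where j: "\<And>i. i \<in> {..r} - Full \<Longrightarrow> j i \<in> {1..n i} \<and> T i (j i) \<notin> Y" by metis
  have "card ({..r} - Full) = card ((\<lambda>i. T i (j i)) ` ({..r} - Full))"
    by (rule card_image[symmetric]) (auto simp: inj_on_def)
  also have "\<dots> \<le> card (V - Y)"
    using j finite_V by (intro card_mono) auto
  also have "\<dots> = card V - d" using Y finite_V by (simp add: card_Diff_subset finite_subset)
  finally have "r + 1 - card Full \<le> card V - d" using finF by (simp add: card_Diff_subset)
  moreover have "d \<le> card V" using Y finite_V card_mono by blast
  ultimately show ?thesis using \<open>card Full \<le> card Jc\<close> card_V_ge by linarith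
qed

lemma prime_chain_exists: "prime_chain V I (card V - (r + 1) + card Jc)"
proof -
  interpret one: selection r m n l Jc lam "\<lambda>_. 1"
    by unfold_locales (use n_pos in \<open>simp add: Suc_le_eq\<close>)
  have B: "{T i 1 | i. True} \<inter> V = (\<lambda>i. T i 1) ` {..r}" using n_pos by (force simp: vars_def Suc_le_eq)
  have "V - {T i 1 | i. True} = V - (\<lambda>i. T i 1) ` {..r}" using B by blast
  moreover have "(\<lambda>i. T i 1) ` {..r} \<subseteq> V" using B by blast
  ultimately have "card (V - {T i 1 | i. True}) = card V - card ((\<lambda>i. T i 1) ` {..r})"
    by (simp add: card_Diff_subset)
  moreover have "card ((\<lambda>i. T i 1) ` {..r}) = r + 1" by (subst card_image) (auto simp: inj_on_def)
  moreover have "card W = card Jc"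
  proof -
    have "W = (\<lambda>j. T j 0) ` Jc" by (auto simp: W_def)
    then show ?thesis by (simp add: card_image inj_on_def)
  qed
  moreover have "card (W \<union> (V - {T i 1 | i. True})) = card W + card (V - {T i 1 | i. True})"
    using finite_V finite_Jc by (intro card_Un_disjoint) (auto simp: W_def)
  ultimately have "card one.EJ = card V - (r + 1) + card Jc" unfolding one.EJ_def by simp
  then show ?thesis using one.prime_chain_EJ by simp
qed

lemma krull_dim_I: "krull_dim V I = card V - (r + 1) + card Jc"
  unfolding krull_dim_def
  by (rule Greatest_equality) (use prime_chain_exists prime_chain_bound in blast)+

text \<open>The relations \<open>Tp i - eps (ell i)\<close> with \<open>i\<close> outside
  \<open>Jc\<close> are as many as the codimension. A generator belonging to a kernel vector is the
  combination of them with the same coefficients, because its \<open>ell\<close> parts cancel and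
  the relations inside \<open>Jc\<close> are trivial.\<close>

lemma complete_intersection_I: "quot_complete_intersection V I"
proof -
  define gs where "gs = map (\<lambda>i. Tp i - eps (ell i)) (sorted_list_of_set ({..r} - Jc))"
  have set_gs: "set gs = (\<lambda>i. Tp i - eps (ell i)) ` ({..r} - Jc)" by (simp add: gs_def)
  have gV: "set gs \<subseteq> Pring V"
    unfolding set_gs using Tp_Pring W_V[OF ell_Pring] by auto
  have "length gs = card ({..r} - Jc)" by (simp add: gs_def)
  also have "\<dots> = r + 1 - card Jc" using Jc finite_Jc by (simp add: card_Diff_subset)
  also have "\<dots> = card V - krull_dim V I" unfolding krull_dim_I using card_V_ge card_Jc_le by linarith
  finally have len: "length gs = card V - krull_dim V I" .
  have "ideal_gen V (set gs) = I"
  proof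
    show "ideal_gen V (set gs) \<subseteq> I"
      unfolding set_gs by (rule ideal_gen_minimal[OF ideal_I]) (auto intro: Tp_ell)
    note Ig = ideal_gen_is_ideal[OF gV]
    show "I \<subseteq> ideal_gen V (set gs)"
      unfolding I_def
    proof (rule ideal_gen_minimal[OF Ig], rule subsetI)
      fix g assume "g \<in> {Defs.gpoly r n l v | v. v \<in> kerL}"
      then obtain v where v: "v \<in> kerL" "g = Defs.gpoly r n l v" by blast
      have epsJ: "eps (ell i) = Tp i" if "i \<in> Jc" for i
      proof -
        have "eps (ell i) = (\<Sum>j\<in>Jc. if j = i then Tp i else 0)"
          unfolding eps_ell using that by (intro sum.cong) (auto simp: lam_delta)
        then show ?thesis using that finite_Jc by simp
      qed
      have "(\<Sum>i\<le>r. const (v i) * eps (ell i)) = (\<Sum>j\<in>Jc. const (\<Sum>i\<le>r. v i * lam i j) * Tp j)"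
        unfolding eps_ell ring_map_sum[OF ring_map_const] const_hom sum_distrib_left sum_distrib_right
        by (subst sum.swap) (simp add: mult_ac)
      also have "\<dots> = 0" using v by (simp add: kerL_def)
      finally have "g = (\<Sum>i\<le>r. const (v i) * (Tp i - eps (ell i)))"
        unfolding v(2) gpoly_eq by (simp add: right_diff_distrib sum_subtractf)
      also have "\<dots> = (\<Sum>i\<in>{..r} - Jc. const (v i) * (Tp i - eps (ell i)))"
        by (intro sum.mono_neutral_right) (auto simp: epsJ)
      also have "\<dots> \<in> ideal_gen V (set gs)"
        by (intro ideal_sum[OF Ig] ideal_mult[OF Ig] ideal_gen_base) (auto simp: set_gs)
      finally show "g \<in> ideal_gen V (set gs)" .
    qed
  qed
  then show ?thesis unfolding quot_complete_intersection_def using gV len by blast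
qed

section \<open>Effectivity, pointedness, rank and units\<close>

lemma Xv_not_I: "v \<in> V \<Longrightarrow> Xv v \<notin> I"
proof
  assume v: "v \<in> V" "Xv v \<in> I"
  have "mon Xv (sg v 1) * eps 1 \<in> I" using v by (simp add: eps_hom)
  then have "(1::mpoly) = 0" using mon_eps_in_I[of "sg v 1" 1] v by simp
  then show False by simp
qed

lemma effective_I: "grading_effective V L I"
  unfolding grading_effective_def
proof
  fix u assume u: "u \<in> ZV V"
  define b where "b = (\<lambda>v. expvec (sg v 1))"
  have b: "b v x = (if x = v then 1 else 0)" for v x by (auto simp: b_def expvec_def lookup_single when_def)
  have inj: "inj_on b V" by (rule inj_onI) (metis b zero_neq_one)
  have mon_denominator: "b v \<in> ZV V \<and> deg_nonzero V L I (b v)" if "v \<in> V" for v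
  proof
    show "b v \<in> ZV V" using that by (auto simp: ZV_def b)
    have "hom_of_deg V L (b v) (Xv v)"
      using that L_0 by (simp add: hom_of_deg_def b_def, simp add: Xv_def)
    then show "deg_nonzero V L I (b v)" unfolding deg_nonzero_def using Xv_not_I[OF that] by blast
  qed
  \<comment> \<open>The coefficients must be a function of the vectors. Pairing with
    \<open>u\<close> returns \<open>u v\<close> on the unit vector \<open>b v\<close>.\<close>
  define z where "z = (\<lambda>w. \<Sum>v\<in>V. u v * w v)"
  have zb: "z (b v) = u v" if "v \<in> V" for v
  proof -
    have "z (b v) = (\<Sum>x\<in>V. if x = v then u v else 0)" unfolding z_def b by (intro sum.cong) auto
    then show ?thesis using that finite_V by simp
  qed
  have "(\<Sum>w\<in>b ` V. (\<lambda>x. z w * w x)) = u"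
  proof
    fix x
    have "(\<Sum>w\<in>b ` V. (\<lambda>x. z w * w x)) x = (\<Sum>v\<in>V. z (b v) * b v x)"
      unfolding sum_fun by (subst sum.reindex[OF inj]) simp
    also have "\<dots> = (\<Sum>v\<in>V. if v = x then u x else 0)" by (intro sum.cong) (auto simp: zb b)
    also have "\<dots> = u x" using u finite_V by (auto simp: ZV_def)
    finally show "(\<Sum>w\<in>b ` V. (\<lambda>x. z w * w x)) x = u x" .
  qed
  then have "u - (\<Sum>w\<in>b ` V. (\<lambda>x. z w * w x)) \<in> L" using L_0 by simp
  moreover have "b ` V \<subseteq> {w \<in> ZV V. deg_nonzero V L I w}" using mon_denominator by blast
  ultimately show "\<exists>F z. finite F \<and> F \<subseteq> {w \<in> ZV V. deg_nonzero V L I w} \<and>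
      u - (\<Sum>w\<in>F. (\<lambda>v. z w * w v)) \<in> L"
    using finite_V by (intro exI[of _ "b ` V"] exI[of _ z]) simp
qed

text \<open>The \<open>z i\<close> are nonnegative with sum 0. Hence distinct monomials of degree 0
  do not exist, and opposite degrees cannot both occur unless they are 0 in
  \<open>K\<^sub>0\<close>.\<close>

lemma L_nonneg:
  assumes x: "x \<in> L" and pos: "\<And>v. 0 \<le> x v"
  shows "x = 0"
proof -
  obtain z where z: "x = lat z" "(\<Sum>i\<le>r. z i) = 0" using x unfolding L_eq by blast
  have nonneg: "0 \<le> z i" if "i \<le> r" for i
  proof -
    have "0 \<le> z i * int (l i 1)"
      using pos[of "T i 1"] n_pos[OF that] that by (simp add: z lat_def Suc_le_eq)
    moreover have "0 < l i 1" using l_pos[OF that, of 1] n_pos[OF that] by simp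
    ultimately show ?thesis by (simp add: zero_le_mult_iff)
  qed
  then have "\<forall>i\<in>{..r}. z i = 0" using z(2) sum_nonneg_eq_0_iff[of "{..r}" z] by simp
  then show ?thesis unfolding z(1) by (auto simp: lat_def fun_eq_iff split: var.splits)
qed

lemma expvec_eq_0: "expvec \<mu> = 0 \<longleftrightarrow> \<mu> = 0"
  by (auto simp: expvec_def fun_eq_iff poly_mapping_eq_iff)

lemma pointed_I: "grading_pointed V L I"
  unfolding grading_pointed_def
proof (intro conjI ballI impI allI)
  fix w assume "w \<in> ZV V" "deg_nonzero V L I w \<and> deg_nonzero V L I (- w)"
  then obtain f g where f: "hom_of_deg V L w f" "f \<notin> I" and g: "hom_of_deg V L (- w) g" "g \<notin> I"
    by (auto simp: deg_nonzero_def)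
  then have "f \<noteq> 0" "g \<noteq> 0" using I_simps by auto
  then obtain \<mu> \<nu> where "\<mu> \<in> ks f" "\<nu> \<in> ks g" by (metis all_not_in_conv keys_eq_empty)
  then have 1: "expvec \<mu> - w \<in> L" and 2: "expvec \<nu> - (- w) \<in> L" using f g by (auto simp: hom_of_deg_def)
  have "expvec \<mu> + expvec \<nu> \<in> L" using L_add[OF 1 2] by simp
  then have "expvec \<mu> + expvec \<nu> = 0" by (rule L_nonneg) (simp add: expvec_def)
  then have s: "expvec \<mu> v + expvec \<nu> v = 0" for v by (metis plus_fun_apply zero_fun_apply)
  have "expvec \<mu> v = 0" for v using s[of v] by (simp add: expvec_def)
  then have "expvec \<mu> = 0" by (simp add: fun_eq_iff)
  then have "w \<in> L" using L_uminus[OF 1] by simp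
  then show "K_torsion L w" unfolding K_torsion_def by (intro exI[of _ 1]) simp
next
  fix f assume f: "hom_of_deg V L 0 f"
  have "\<mu> = 0" if "\<mu> \<in> ks f" for \<mu>
  proof -
    have "expvec \<mu> \<in> L" using f that by (auto simp: hom_of_deg_def)
    then have "expvec \<mu> = 0" by (rule L_nonneg) (simp add: expvec_def)
    then show ?thesis by (simp add: expvec_eq_0)
  qed
  then have "lk f \<mu> = 0" if "\<mu> \<noteq> 0" for \<mu> using that by (auto simp: in_keys_iff)
  then have "f = const (lk f 0)"
    by (intro poly_mapping_eqI) (auto simp: const_def lookup_single when_def)
  then show "\<exists>a. f - const a \<in> I" using I_simps by (metis diff_self)
qed

lemma lat_sum: "(\<Sum>b\<in>B. (\<lambda>v. x b * lat (z b) v)) = lat (\<lambda>i. \<Sum>b\<in>B. x b * z b i)"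
proof
  fix v
  show "(\<Sum>b\<in>B. (\<lambda>v. x b * lat (z b) v)) v = lat (\<lambda>i. \<Sum>b\<in>B. x b * z b i) v"
    unfolding sum_fun by (cases v) (auto simp: lat_def sum_distrib_right mult.assoc)
qed

text \<open>\<open>L\<close> consists of the vectors \<open>lat z\<close> with the
  \<open>z i\<close> summing to 0. The \<open>r\<close> differences of a unit vector and the one at
  0 are independent, as the variables \<open>T k 1\<close> show. For more than \<open>r\<close>
  vectors the blocks 1 to \<open>r\<close> give a nontrivial solution, and block 0 follows from the
  sum condition.\<close>

lemma K_rank_I: "K_rank V L = card V - r"
proof -
  have "(GREATEST k. \<exists>B. B \<subseteq> L \<and> Z_indep B \<and> card B = k) = r"
  proof (rule Greatest_equality)
    define \<delta> where "\<delta> = (\<lambda>i a :: nat. (if a = i then 1 else 0) - (if a = 0 then 1 else 0) :: int)"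
    define b where "b = (\<lambda>i. lat (\<delta> i))"
    have bL: "b i \<in> L" if "i \<in> {1..r}" for i
    proof -
      have "(\<Sum>a\<le>r. \<delta> i a) = 0" using that by (simp add: \<delta>_def sum_subtractf)
      then show ?thesis unfolding L_eq b_def by blast
    qed
    have bv: "b i (T k 1) = (if k = i then int (l i 1) else 0)" if "i \<in> {1..r}" "k \<in> {1..r}" for i k
      using that n_pos[of k] by (auto simp: b_def lat_def \<delta>_def Suc_le_eq)
    have lp: "0 < l i 1" if "i \<in> {1..r}" for i using that n_pos[of i] l_pos[of i 1] by (simp add: Suc_le_eq)
    have inj: "inj_on b {1..r}"
    proof (rule inj_onI)
      fix i k assume ik: "i \<in> {1..r}" "k \<in> {1..r}" "b i = b k"
      then have "int (l i 1) = (if i = k then int (l k 1) else 0)" using bv[of i i] bv[of k i] by metis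
      then show "i = k" using lp[OF ik(1)] by (auto split: if_splits)
    qed
    have "Z_indep (b ` {1..r})"
      unfolding Z_indep_def
    proof (intro conjI allI impI ballI)
      fix z w assume s: "(\<Sum>w\<in>b ` {1..r}. (\<lambda>v. z w * w v)) = 0" and "w \<in> b ` {1..r}"
      then obtain k where k: "k \<in> {1..r}" "w = b k" by blast
      have "0 = (\<Sum>w\<in>b ` {1..r}. (\<lambda>v. z w * w v)) (T k 1)" unfolding s by simp
      also have "\<dots> = (\<Sum>i\<in>{1..r}. z (b i) * b i (T k 1))"
        unfolding sum_fun by (subst sum.reindex[OF inj]) simp
      also have "\<dots> = (\<Sum>i\<in>{1..r}. if i = k then z (b k) * int (l k 1) else 0)"
      proof (rule sum.cong)
        fix i assume i: "i \<in> {1..r}"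
        show "z (b i) * b i (T k 1) = (if i = k then z (b k) * int (l k 1) else 0)"
          unfolding bv[OF i k(1)] by auto
      qed simp
      finally show "z w = 0" using k lp[OF k(1)] by simp
    qed simp
    moreover have "card (b ` {1..r}) = r" using card_image[OF inj] by simp
    ultimately show "\<exists>B. B \<subseteq> L \<and> Z_indep B \<and> card B = r"
      using bL by (intro exI[of _ "b ` {1..r}"]) blast
  next
    fix k assume "\<exists>B. B \<subseteq> L \<and> Z_indep B \<and> card B = k"
    then obtain B where B: "B \<subseteq> L" "Z_indep B" "card B = k" by blast
    then have finB: "finite B" by (simp add: Z_indep_def)
    have "\<forall>b\<in>B. \<exists>z. b = lat z \<and> (\<Sum>i\<le>r. z i) = 0" using B(1) unfolding L_eq by blast
    then obtain z where z: "\<And>b. b \<in> B \<Longrightarrow> b = lat (z b)" "\<And>b. b \<in> B \<Longrightarrow> (\<Sum>i\<le>r. z b i) = 0" by metis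
    show "k \<le> r"
    proof (rule ccontr)
      assume "\<not> k \<le> r"
      then have "card {1..r} < card B" using B by simp
      then obtain x where x: "\<exists>b\<in>B. x b \<noteq> 0" "\<forall>i\<in>{1..r}. (\<Sum>b\<in>B. z b i * x b) = 0"
        using homogeneous_system[OF subring_UNIV _ finB, of "{1..r}" "\<lambda>i b. z b i"] by auto
      have s: "(\<Sum>i\<le>r. \<Sum>b\<in>B. x b * z b i) = 0"
        by (subst sum.swap) (simp add: z(2) flip: sum_distrib_left)
      have "(\<Sum>i\<le>r. \<Sum>b\<in>B. x b * z b i) = (\<Sum>i\<in>{0}. \<Sum>b\<in>B. x b * z b i)"
        by (rule sum.mono_neutral_right) (use x(2) in \<open>auto simp: mult.commute\<close>)
      then have "(\<Sum>b\<in>B. x b * z b i) = 0" if "i \<le> r" for i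
        using s x(2) that by (cases "i = 0") (auto simp: mult.commute)
      then have "lat (\<lambda>i. \<Sum>b\<in>B. x b * z b i) = 0" by (auto simp: lat_def fun_eq_iff split: var.splits)
      moreover have "(\<Sum>b\<in>B. (\<lambda>v. x b * b v)) = (\<Sum>b\<in>B. (\<lambda>v. x b * lat (z b) v))"
        by (intro sum.cong) (use z(1) in auto)
      ultimately have "(\<Sum>b\<in>B. (\<lambda>v. x b * b v)) = 0" unfolding lat_sum by simp
      then show False using B(2) x(1) unfolding Z_indep_def by blast
    qed
  qed
  then show ?thesis by (simp add: K_rank_def)
qed

lemma complexity_I: "grading_complexity V L I = int (card Jc) - 1"
  unfolding grading_complexity_def krull_dim_I K_rank_I using card_V_ge by simp

text \<open>A positive grading for which all \<open>T\<^sub>i\<^bsup>l\<^sub>i\<^esup>\<close> have the same weight.\<close>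

definition omega :: "var \<Rightarrow> nat" where
  "omega v = (case v of T i j \<Rightarrow> if i \<le> r \<and> 1 \<le> j \<and> j \<le> n i
      then \<Prod>(a, b)\<in>(SIGMA a:{..r}. {1..n a}) - {(i, j)}. n a * l a b else 1 | S k \<Rightarrow> 1)"

lemma omega_pos: "0 < omega v"
proof -
  have "0 < (\<Prod>(a, b)\<in>(SIGMA a:{..r}. {1..n a}) - {(i, j)}. n a * l a b)" for i j
  proof (intro prod_pos ballI)
    fix x assume "x \<in> (SIGMA a:{..r}. {1..n a}) - {(i, j)}"
    then obtain a b where "x = (a, b)" "a \<le> r" "b \<in> {1..n a}" by blast
    then show "0 < (case x of (a, b) \<Rightarrow> n a * l a b)" using n_pos[of a] l_pos[of a b] by simp
  qed
  note q = this
  show ?thesis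
  proof (cases v)
    case (T i j)
    show ?thesis
    proof (cases "i \<le> r \<and> 1 \<le> j \<and> j \<le> n i")
      case True
      show ?thesis unfolding omega_def T var.case if_P[OF True] by (rule q)
    qed (auto simp: omega_def T)
  qed (simp add: omega_def)
qed

text \<open>\<open>omega (T i j)\<close> is the product \<open>?N\<close> of all
  \<open>n a * l a b\<close> divided by its own factor \<open>n i * l i j\<close>. Hence each of the
  \<open>n i\<close> variables of the block contributes \<open>?N\<close> divided by
  \<open>n i\<close>.\<close>

lemma wt_Tmon: assumes "i \<le> r" shows "wt omega (Tmon n l i) = (\<Prod>(a, b)\<in>(SIGMA a:{..r}. {1..n a}). n a * l a b)"
proof -
  let ?P = "SIGMA a:{..r}. {1..n a}"
  let ?N = "\<Prod>(a, b)\<in>?P. n a * l a b"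
  have p: "n i * (l i j * omega (T i j)) = ?N" if "j \<in> {1..n i}" for j
    using prod.remove[of ?P "(i, j)" "\<lambda>(a, b). n a * l a b"] assms that by (simp add: omega_def)
  have "wt omega (Tmon n l i) = (\<Sum>j\<in>{1..n i}. l i j * omega (T i j))"
  proof -
    have "wt omega (sum F A) = (\<Sum>x\<in>A. wt omega (F x))" if "finite A" for F and A :: "nat set"
      using that by (induction A rule: finite_induct) (simp_all add: wt_add)
    then show ?thesis by (simp add: Tmon_def)
  qed
  then have "n i * wt omega (Tmon n l i) = (\<Sum>j\<in>{1..n i}. ?N)"
    using p by (simp add: sum_distrib_left)
  then show ?thesis using n_pos[OF assms] by simp
qed

lemma coeff_hm_rs: "coeff (hm \<omega> f) k = rs (\<lambda>\<mu>. wt \<omega> \<mu> = k) f"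
  by (rule poly_mapping_eqI) (simp add: lk_coeff_hm lk_rs)

lemma coeff_hm_I: "f \<in> I \<Longrightarrow> coeff (hm omega f) k \<in> I"
  unfolding coeff_hm_rs
proof (rule rs_I[of "wt omega"])
  show "wt omega (Tmon n l i) = wt omega (Tmon n l 0)" if "i \<le> r" for i
    using wt_Tmon[OF that] wt_Tmon[of 0] by simp
qed (simp_all add: wt_add)

lemma top_component:
  assumes f: "f \<in> Pring V" "f \<notin> I"
  shows "\<exists>p. coeff (hm omega f) p \<notin> I \<and> (\<forall>k>p. coeff (hm omega f) k \<in> I)"
proof -
  have fs: "f = (\<Sum>k\<le>Polynomial.degree (hm omega f). coeff (hm omega f) k)"
    using poly_hm_1[of omega f] by (simp add: poly_altdef)
  have "\<exists>k\<le>Polynomial.degree (hm omega f). coeff (hm omega f) k \<notin> I"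
  proof (rule ccontr)
    assume "\<not> ?thesis"
    then have "f \<in> I" by (subst fs) (intro ideal_sum[OF ideal_I], auto)
    then show False using f by simp
  qed
  then obtain k0 where k0: "coeff (hm omega f) k0 \<notin> I" by blast
  let ?P = "\<lambda>k. coeff (hm omega f) k \<notin> I"
  have bd: "\<forall>y. ?P y \<longrightarrow> y \<le> Polynomial.degree (hm omega f)"
    using I_simps by (metis le_degree)
  have "?P (Greatest ?P)" using GreatestI_nat[of ?P k0 "Polynomial.degree (hm omega f)"] k0 bd by blast
  moreover have "\<forall>k>Greatest ?P. \<not> ?P k"
    using Greatest_le_nat[of ?P _ "Polynomial.degree (hm omega f)"] bd by (meson not_less)
  ultimately show ?thesis by blast
qed

text \<open>Let \<open>p\<close> and \<open>q\<close> be the highest weights of components outside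
  \<open>I\<close>. Modulo \<open>I\<close> the component of \<open>f * g\<close> in weight
  \<open>p + q\<close> is the product of the two top components, which is not in \<open>I\<close> by
  primality. Since \<open>f * g\<close> is congruent to 1, this forces \<open>p = 0\<close>, and
  positivity of \<open>omega\<close> leaves only constants in weight 0.\<close>

lemma units_I: "units_are_constants V I"
  unfolding units_are_constants_def
proof (intro ballI iffI)
  fix f assume f: "f \<in> Pring V" and "quot_unit V I f"
  then obtain g where g: "g \<in> Pring V" "f * g - 1 \<in> I" by (auto simp: quot_unit_def)
  have 1: "1 \<notin> I" using prime_1[OF prime_I] .
  have fI: "f \<notin> I"
  proof
    assume "f \<in> I"
    then have "f * g - (f * g - 1) \<in> I" using g by (blast intro: I_intros)
    then show False using 1 by simp
  qed
  have gI: "g \<notin> I"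
  proof
    assume "g \<in> I"
    then have "f * g - (f * g - 1) \<in> I" using g f by (blast intro: I_intros)
    then show False using 1 by simp
  qed
  obtain p where p: "coeff (hm omega f) p \<notin> I" "\<And>k. k > p \<Longrightarrow> coeff (hm omega f) k \<in> I"
    using top_component[OF f fI] by blast
  obtain q where q: "coeff (hm omega g) q \<notin> I" "\<And>k. k > q \<Longrightarrow> coeff (hm omega g) k \<in> I"
    using top_component[OF g(1) gI] by blast
  have cV: "coeff (hm omega h) k \<in> Pring V" if "h \<in> Pring V" for h k
    unfolding coeff_hm_rs using that by (rule rs_Pring)
  have p0: "p = 0"
  proof (rule ccontr)
    assume "p \<noteq> 0"
    define R where "R = (\<Sum>k\<in>{..p + q} - {p}. coeff (hm omega f) k * coeff (hm omega g) (p + q - k))"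
    have "coeff (hm omega (f * g)) (p + q) = (\<Sum>k\<le>p + q. coeff (hm omega f) k * coeff (hm omega g) (p + q - k))"
      by (simp add: ring_map_mult[OF ring_map_hm] coeff_mult)
    also have "\<dots> = coeff (hm omega f) p * coeff (hm omega g) (p + q - p) + R"
      unfolding R_def by (rule sum.remove) auto
    finally have e: "coeff (hm omega (f * g)) (p + q) = coeff (hm omega f) p * coeff (hm omega g) q + R" by simp
    have RI: "R \<in> I"
      unfolding R_def
    proof (rule ideal_sum[OF ideal_I])
      fix k assume k: "k \<in> {..p + q} - {p}"
      show "coeff (hm omega f) k * coeff (hm omega g) (p + q - k) \<in> I"
      proof (cases "k > p")
        case True
        then show ?thesis using p(2) cV[OF g(1)] ideal_mult'[OF ideal_I] by blast
      next
        case False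
        then have "p + q - k > q" using k by auto
        then show ?thesis using q(2) cV[OF f] ideal_mult[OF ideal_I] by blast
      qed
    qed
    have "coeff (hm omega (f * g - 1)) (p + q) \<in> I" using g(2) by (rule coeff_hm_I)
    then have "coeff (hm omega (f * g)) (p + q) \<in> I"
      using \<open>p \<noteq> 0\<close> by (simp add: ring_map_diff[OF ring_map_hm] ring_map_1[OF ring_map_hm])
    then have "coeff (hm omega f) p * coeff (hm omega g) q \<in> I"
      unfolding e using ideal_diff[OF ideal_I _ RI] by fastforce
    then show False using prime_cases[OF prime_I cV[OF f] cV[OF g(1)]] p(1) q(1) by blast
  qed
  define c where "c = coeff (hm omega f) 0"
  have "lk c \<mu> = 0" if "\<mu> \<noteq> 0" for \<mu>
    using wt_eq_0[of \<mu> omega] omega_pos that by (auto simp: c_def lk_coeff_hm)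
  then have cc: "c = const (lk c 0)"
    by (intro poly_mapping_eqI) (auto simp: const_def lookup_single when_def)
  have "f = (\<Sum>k\<le>Polynomial.degree (hm omega f). coeff (hm omega f) k)"
    using poly_hm_1[of omega f] by (simp add: poly_altdef)
  also have "\<dots> = c + (\<Sum>k\<in>{..Polynomial.degree (hm omega f)} - {0}. coeff (hm omega f) k)"
    unfolding c_def by (rule sum.remove) auto
  finally have "f - c = (\<Sum>k\<in>{..Polynomial.degree (hm omega f)} - {0}. coeff (hm omega f) k)"
    by (simp add: algebra_simps)
  also have "\<dots> \<in> I" using p(2) p0 by (intro ideal_sum[OF ideal_I]) auto
  finally have "f - const (lk c 0) \<in> I" using cc by simp
  moreover have "lk c 0 \<noteq> 0" using cc p(1) p0 I_simps by (auto simp: c_def)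
  ultimately show "\<exists>a. a \<noteq> 0 \<and> f - const a \<in> I" by blast
next
  fix f assume f: "f \<in> Pring V" and "\<exists>a. a \<noteq> 0 \<and> f - const a \<in> I"
  then obtain a where a: "a \<noteq> 0" "f - const a \<in> I" by blast
  have "(f - const a) * const (inverse a) \<in> I" using a by (intro ideal_mult'[OF ideal_I]) auto
  moreover have "const a * const (inverse a) = 1" using a by (simp flip: const_hom(2))
  ultimately have "f * const (inverse a) - 1 \<in> I" by (simp add: left_diff_distrib)
  then show "quot_unit V I f" unfolding quot_unit_def using f Pring_const by blast
qed

end

section \<open>Factoriality of the grading\<close>

text \<open>In \<open>t\<close> the product is a single power, so its degree equals its order at 0.
  Both are additive and the order never exceeds the degree, so they agree for each factor.\<close>

lemma homogeneous_factor:
  assumes "homogeneous d (f * g)" "f * g \<noteq> 0"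
  shows "\<exists>e. homogeneous e f"
proof -
  define p q where "p = hm (\<lambda>_. 1) f" and "q = hm (\<lambda>_. 1) g"
  have nz: "p \<noteq> 0" "q \<noteq> 0" using assms by (auto simp: p_def q_def)
  have pq: "p * q = monom (f * g) d"
    using assms by (simp add: p_def q_def homogeneous_def ring_map_mult[OF ring_map_hm])
  have "Polynomial.degree p + Polynomial.degree q = d"
    using degree_mult_eq[OF nz] assms(2) unfolding pq by (simp add: degree_monom_eq)
  moreover have "order 0 p + order 0 q = d"
    using order_mult[of p q 0] assms(2) nz unfolding pq by (simp add: order_0_monom)
  moreover have "order 0 p \<le> Polynomial.degree p" "order 0 q \<le> Polynomial.degree q"
    using nz by (simp_all add: order_degree)
  ultimately have o: "order 0 p = Polynomial.degree p" by linarith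
  define e where "e = Polynomial.degree p"
  have "monom 1 e dvd p" using o nz by (simp add: monom_1_dvd_iff e_def)
  then have low: "\<forall>k<e. coeff p k = 0" by (simp add: monom_1_dvd_iff')
  have "p = monom (coeff p e) e"
  proof (rule poly_eqI)
    fix k
    show "coeff p k = coeff (monom (coeff p e) e) k"
      using low coeff_eq_0[of p k] by (cases k e rule: linorder_cases) (auto simp: e_def)
  qed
  moreover from this have "coeff p e = f"
    using poly_hm_1[of "\<lambda>_. 1" f] unfolding p_def[symmetric] by (metis poly_monom mult_1_right power_one)
  ultimately show ?thesis unfolding homogeneous_def p_def[symmetric] by auto
qed

lemma prime_elem_dvd_prodD:
  assumes "prime_elem p" "p dvd prod F A" shows "\<exists>x\<in>A. p dvd F x"
  using assms(2)
proof (induction A rule: infinite_finite_induct)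
  case (insert x A)
  then show ?case using assms(1) by (auto dest: prime_elem_dvd_multD)
qed (use assms(1) in \<open>auto simp: prime_elem_def\<close>)

lemma homogeneous_keys: "homogeneous d h \<Longrightarrow> \<mu> \<in> ks h \<Longrightarrow> wt (\<lambda>_. 1) \<mu> = d"
  using lk_coeff_hm[of "\<lambda>_. 1" h "wt (\<lambda>_. 1) \<mu>" \<mu>]
  by (auto simp: homogeneous_def in_keys_iff split: if_splits)

lemma homogeneous_tdeg: "homogeneous d h \<Longrightarrow> h \<noteq> 0 \<Longrightarrow> tdeg h = d"
  by (simp add: homogeneous_def tdeg_def degree_monom_eq)

lemma mon_dvd_diff:
  fixes d :: "'b::comm_ring_1"
  assumes "\<And>v. d dvd x v - y v"
  shows "d dvd mon x \<mu> - mon y \<mu>"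
proof -
  have "ks \<mu> \<subseteq> UNIV" by simp
  then show ?thesis
  proof (induction \<mu> rule: monomial_induct)
    case (add v \<nu>)
    have "mon x (sg v 1 + \<nu>) - mon y (sg v 1 + \<nu>) = (x v - y v) * mon x \<nu> + y v * (mon x \<nu> - mon y \<nu>)"
      by (simp add: mon_add algebra_simps)
    then show ?case using add assms by (simp add: dvd_add dvd_mult dvd_mult2)
  qed simp
qed

lemma ev_dvd_diff:
  assumes "\<And>v. d dvd x v - y v"
  shows "d dvd ev c x f - ev c y f"
proof -
  have "ev c x f - ev c y f = (\<Sum>\<mu>\<in>ks f. c (lk f \<mu>) * (mon x \<mu> - mon y \<mu>))"
    by (simp add: ev_def right_diff_distrib sum_subtractf)
  then show ?thesis using mon_dvd_diff[OF assms] by (simp add: dvd_sum dvd_mult)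
qed

lemma evc_0: "evc (\<lambda>_. 0) h = lk h 0"
proof -
  have z: "mon (\<lambda>_. 0 :: complex) \<mu> = (if \<mu> = 0 then 1 else 0)" for \<mu>
  proof (cases "\<mu> = 0")
    case False
    then obtain v where "v \<in> ks \<mu>" by (metis all_not_in_conv keys_eq_empty)
    then show ?thesis using False unfolding mon_def
      by (simp add: prod_zero_iff in_keys_iff) (metis in_keys_iff neq0_conv)
  qed simp
  have "evc (\<lambda>_. 0) h = (\<Sum>\<mu>\<in>ks h. if \<mu> = 0 then lk h 0 else 0)"
    unfolding ev_def z by (intro sum.cong) auto
  then show ?thesis by (auto simp: in_keys_iff)
qed

context arrangement
begin

lemma irreducible_ell: assumes "i \<le> r" shows "irreducible (ell i)"
proof (rule irreducibleI)
  show nz: "ell i \<noteq> 0" using ell_nonzero[OF assms] .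
  have t: "tdeg (ell i) = 1" using homogeneous_tdeg[OF homogeneous_ell nz] .
  show "\<not> ell i dvd 1" using t tdeg_eq_0_iff[of "ell i"] by (auto simp: mpoly_unit_iff)
  fix a b assume ab: "ell i = a * b"
  then have nz': "a \<noteq> 0" "b \<noteq> 0" using nz by auto
  then have "tdeg a + tdeg b = 1" using t ab tdeg_mult by metis
  then have "tdeg a = 0 \<or> tdeg b = 0" by linarith
  then show "a dvd 1 \<or> b dvd 1" using nz' by (auto simp: tdeg_eq_0_iff mpoly_unit_iff)
qed

lemma prime_ell: "i \<le> r \<Longrightarrow> prime_elem (ell i)"
  by (intro irreducible_imp_prime irreducible_ell)

lemma ell_not_dvd:
  assumes "i \<le> r" "k \<le> r" "i \<noteq> k" shows "\<not> ell i dvd ell k"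
proof
  assume "ell i dvd ell k"
  then obtain q where q: "ell k = ell i * q" by (metis dvd_def)
  have nz: "q \<noteq> 0" using q ell_nonzero[OF assms(2)] by auto
  have "tdeg (ell i) = 1" "tdeg (ell k) = 1"
    using homogeneous_tdeg[OF homogeneous_ell ell_nonzero] assms by auto
  then have "tdeg q = 0" using tdeg_mult[OF ell_nonzero[OF assms(1)] nz] q by simp
  then obtain a where "q = const a" by (auto simp: tdeg_eq_0_iff)
  then have "const (- a) * ell i + const 1 * ell k = 0" using q by (simp add: const_hom mult.commute)
  then show False using ell_comb_nonzero[OF assms, of "- a" 1] by simp
qed

text \<open>The substitution \<open>y\<close> projects to the hyperplane \<open>ell i = 0\<close>
  and is the identity modulo \<open>ell i\<close>. So \<open>h\<close> is congruent to its
  restriction to the hyperplane, which is 0.\<close>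

lemma ell_dvdI:
  assumes i: "i \<le> r" and v: "\<And>z. elv i z = 0 \<Longrightarrow> evc z h = 0"
  shows "ell i dvd h"
proof -
  obtain j0 where j0: "j0 \<in> Jc" "lam i j0 \<noteq> 0" using lam_nonzero[OF i] by blast
  define y where "y = (\<lambda>v. if v = T j0 0 then Xv v - const (1 / lam i j0) * ell i else Xv v)"
  have "ev const y h = 0"
  proof (rule mpoly_eq_0I)
    fix z
    define z' where "z' = (\<lambda>v. if v = T j0 0 then z v - elv i z / lam i j0 else z v)"
    have "elv i z' = (\<Sum>j\<in>Jc. lam i j * z (T j 0) - (if j = j0 then elv i z else 0))"
      unfolding elv_def[of i z'] using j0 by (intro sum.cong) (auto simp: z'_def algebra_simps)
    also have "\<dots> = 0" using j0 finite_Jc by (simp add: sum_subtractf elv_def)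
    finally have "evc z' h = 0" by (rule v)
    moreover have "evc z (ev const y h) = evc z' h"
    proof -
      have "(\<lambda>v. evc z (y v)) = z'" by (auto simp: y_def z'_def evc_hom evc_ell)
      then show ?thesis
        by (subst ring_map_ev_comp[OF ring_map_ev[OF ring_map_id] ring_map_const]) (simp add: ring_map_id)
    qed
    ultimately show "evc z (ev const y h) = 0" by simp
  qed
  moreover have "ell i dvd ev const Xv h - ev const y h"
    by (rule ev_dvd_diff) (simp add: y_def)
  ultimately show ?thesis by simp
qed

text \<open>Supplies points over every \<open>z\<close>, including those where some
  \<open>ell i\<close> vanishes, which the chart avoids. The selected variable of each block carries
  a root of the form, the other variables \<open>T i j\<close> are 1.\<close>

lemma ex_point:
  assumes J: "\<And>i. i \<le> r \<Longrightarrow> 1 \<le> J i \<and> J i \<le> n i"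
  shows "\<exists>x. (\<forall>i\<le>r. mon x (Tmon n l i) = elv i z) \<and>
    (\<forall>i j. j \<noteq> J i \<longrightarrow> x (T i j) = 1) \<and> (\<forall>k. x (S k) = s k) \<and>
    (\<forall>i. x (T i (J i)) = 0 \<longleftrightarrow> elv i z = 0)"
proof -
  define x where "x = (\<lambda>v. case v of T i j \<Rightarrow> if j = J i
      then (if elv i z = 0 then 0 else exp (Ln (elv i z) / of_nat (l i (J i)))) else 1 | S k \<Rightarrow> s k)"
  have "mon x (Tmon n l i) = elv i z" if i: "i \<le> r" for i
  proof -
    have e: "0 < l i (J i)" using J[OF i] l_pos[OF i] by simp
    have "mon x (Tmon n l i) = x (T i (J i)) ^ l i (J i) * (\<Prod>j\<in>{1..n i} - {J i}. x (T i j) ^ l i j)"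
      unfolding mon_Tmon using J[OF i] by (intro prod.remove) auto
    also have "(\<Prod>j\<in>{1..n i} - {J i}. x (T i j) ^ l i j) = 1"
      by (intro prod.neutral) (auto simp: x_def)
    also have "x (T i (J i)) ^ l i (J i) = elv i z"
      using e by (auto simp: x_def simp flip: exp_of_nat_mult)
    finally show ?thesis by simp
  qed
  then show ?thesis by (intro exI[of _ x]) (auto simp: x_def)
qed

lemma evc_eps_point:
  assumes "\<forall>i\<le>r. mon x (Tmon n l i) = elv i z" "h \<in> Pring W"
  shows "evc x (eps h) = evc z h"
  by (rule evc_eps_onX[of _ _ _ "{}"]) (use assms in auto)

lemma evc_mon: "evc x (mon Xv \<mu>) = mon x \<mu>"
  by (simp add: ring_map_mon[OF ring_map_ev[OF ring_map_id]] evc_hom)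

lemma quot_dvd_cg:
  assumes "quot_dvd V I f g" "cg g g'" shows "quot_dvd V I f g'"
proof -
  obtain q where q: "q \<in> Pring V" "g - q * f \<in> I" using assms by (auto simp: quot_dvd_def)
  have "g - g' \<in> I" using assms by (simp add: cg_def)
  from ideal_diff[OF ideal_I q(2) this] have "(g - q * f) - (g - g') \<in> I" .
  moreover have "(g - q * f) - (g - g') = g' - q * f" by simp
  ultimately have "g' - q * f \<in> I" by (simp only:)
  then show ?thesis unfolding quot_dvd_def using q(1) by blast
qed

lemma quot_dvdI: "q \<in> Pring V \<Longrightarrow> cg g (q * f) \<Longrightarrow> quot_dvd V I f g"
  by (auto simp: quot_dvd_def cg_def)

lemma quot_dvd_onX:
  assumes "quot_dvd V I f g" "onX x" "evc x f = 0" shows "evc x g = 0"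
proof -
  obtain q where "g - q * f \<in> I" using assms by (auto simp: quot_dvd_def)
  then have "evc x (g - q * f) = 0" using evc_I assms by blast
  then show ?thesis using assms by (simp add: evc_hom)
qed

lemma onX_0: "onX (\<lambda>_. 0)"
  unfolding onX_def
proof (intro exI[of _ "\<lambda>_. 0"] allI impI)
  fix i assume i: "i \<le> r"
  have "mon (\<lambda>_. 0) (Tmon n l i) = (0::complex)"
    unfolding mon_Tmon using n_pos[OF i] l_pos[OF i, of 1]
    by (intro prod_zero) (auto intro!: bexI[of _ 1] simp: Suc_le_eq)
  then show "mon (\<lambda>_. 0) (Tmon n l i) = elv i (\<lambda>_. 0)" by (simp add: elv_def)
qed

lemma nonunit:
  assumes "evc (\<lambda>_. 0) f = 0" shows "\<not> quot_unit V I f"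
proof
  assume "quot_unit V I f"
  then obtain g where "f * g - 1 \<in> I" by (auto simp: quot_unit_def)
  then have "evc (\<lambda>_. 0) (f * g - 1) = 0" using evc_I[OF onX_0] by blast
  then show False using assms by (simp add: evc_hom)
qed

lemma mon_V: "ks \<mu> \<subseteq> V \<Longrightarrow> mon Xv \<mu> \<in> Pring V"
  by (intro Pring_mon) auto

lemma Xv_dvd_mon:
  assumes "v \<in> ks \<mu>" "ks \<mu> \<subseteq> V" "f \<in> Pring V"
  shows "quot_dvd V I (Xv v) (mon Xv \<mu> * f)"
proof -
  have "lk \<mu> v > 0" using assms by (simp add: in_keys_iff)
  then have \<mu>: "\<mu> = (\<mu> - sg v 1) + sg v 1"
    by (intro poly_mapping_eqI) (auto simp: lookup_add lookup_minus lookup_single when_def)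
  have "mon Xv \<mu> = mon Xv (\<mu> - sg v 1) * Xv v" by (subst \<mu>) (simp add: mon_add)
  then have e: "mon Xv \<mu> * f = (mon Xv (\<mu> - sg v 1) * f) * Xv v" by (simp add: mult_ac)
  have "ks (\<mu> - sg v 1) \<subseteq> V" using assms(2) by (auto simp: in_keys_iff lookup_minus)
  then have "mon Xv (\<mu> - sg v 1) * f \<in> Pring V" using assms(3) mon_V by blast
  then show ?thesis unfolding quot_dvd_def e using I_simps by (intro bexI[of _ "mon Xv (\<mu> - sg v 1) * f"]) auto
qed

lemma T_dvd_eps:
  assumes v: "T i j \<in> V" and d: "ell i dvd h" and h: "h \<in> Pring W" and f: "f \<in> Pring V"
  shows "quot_dvd V I (Xv (T i j)) (f * eps h)"
proof (cases "h = 0")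
  case True
  then show ?thesis unfolding quot_dvd_def using I_simps by (intro bexI[of _ 0]) (auto simp: eps_hom)
next
  case False
  obtain k where k: "h = ell i * k" using d by (metis dvd_def)
  have kW: "k \<in> Pring W" using Pring_factor[of k "ell i" W] h False k by (simp add: mult.commute)
  have i: "i \<le> r" and j: "j \<in> {1..n i}" using v by auto
  define R where "R = Xv (T i j) ^ (l i j - 1) * (\<Prod>b\<in>{1..n i} - {j}. Xv (T i b) ^ l i b)"
  have RV: "R \<in> Pring V" unfolding R_def using v by (intro Pring_mult Pring_prod Pring_power) auto
  have "Tp i = Xv (T i j) ^ l i j * (\<Prod>b\<in>{1..n i} - {j}. Xv (T i b) ^ l i b)"
    unfolding Tp_def mon_Tmon using j by (intro prod.remove) auto
  also have "Xv (T i j) ^ l i j = Xv (T i j) ^ (l i j - 1) * Xv (T i j)"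
    using power_minus_mult[of "l i j" "Xv (T i j)"] l_pos[OF i, of j] j by simp
  finally have Tp: "Tp i = R * Xv (T i j)" by (simp add: R_def mult_ac)
  have "cg (f * (eps (ell i) * eps k)) (f * (Tp i * eps k))"
    using i f kW by (intro cg_mult cg_refl cg_sym[OF cg_Tp] W_V)
  then have "cg (f * eps h) ((f * R * eps k) * Xv (T i j))"
    unfolding k Tp by (simp add: eps_hom mult_ac)
  then show ?thesis using f RV W_V[OF kW] by (intro quot_dvdI[of "f * R * eps k"]) auto
qed

lemma prod_ell_nonzero: "(\<Prod>i\<in>A. ell i) \<noteq> 0" if "A \<subseteq> {..r}"
  using that ell_nonzero finite_subset[OF that] by auto

text \<open>Test at points where \<open>ell i\<close> vanishes, the other forms do not, and
  \<open>T i j\<close> carries the root. There \<open>T i j\<close> vanishes but the monomial does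
  not, so \<open>h\<close> does. The product of the other forms covers the remaining points of the
  hyperplane and is removed again because \<open>ell i\<close> is prime.\<close>

lemma T_dvdD:
  assumes v: "T i j \<in> V" and \<mu>: "ks \<mu> \<subseteq> V" "T i j \<notin> ks \<mu>" and h: "h \<in> Pring W"
    and d: "quot_dvd V I (Xv (T i j)) (mon Xv \<mu> * eps h)"
  shows "ell i dvd h"
proof -
  have i: "i \<le> r" using v by simp
  define J where "J = (\<lambda>k. if k = i then j else 1)"
  have J: "1 \<le> J k \<and> J k \<le> n k" if "k \<le> r" for k
    using v n_pos[OF that] by (auto simp: J_def Suc_le_eq)
  have "ell i dvd h * (\<Prod>k\<in>{..r} - {i}. ell k)"
  proof (rule ell_dvdI[OF i])
    fix z assume z: "elv i z = 0"
    show "evc z (h * (\<Prod>k\<in>{..r} - {i}. ell k)) = 0"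
    proof (cases "\<exists>k\<in>{..r} - {i}. elv k z = 0")
      case True
      then have "(\<Prod>k\<in>{..r} - {i}. elv k z) = 0" by (intro prod_zero) auto
      then show ?thesis by (simp add: evc_hom evc_ell)
    next
      case False
      obtain x where x: "\<forall>i\<le>r. mon x (Tmon n l i) = elv i z" "\<forall>i j. j \<noteq> J i \<longrightarrow> x (T i j) = 1"
        "\<forall>k. x (S k) = 1" "\<forall>i. x (T i (J i)) = 0 \<longleftrightarrow> elv i z = 0"
        using ex_point[OF J, where z = z and s = "\<lambda>_. 1"] by blast
      have onx: "onX x" using x(1) unfolding onX_def by blast
      have "x (T i j) = 0" using x(4) z by (metis J_def)
      then have "evc x (mon Xv \<mu> * eps h) = 0" using quot_dvd_onX[OF d onx] by (simp add: evc_hom)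
      then have "mon x \<mu> * evc z h = 0" by (simp add: evc_hom evc_mon evc_eps_point[OF x(1) h])
      moreover have "x v \<noteq> 0" if "v \<in> ks \<mu>" for v
      proof (cases v)
        case (T a b)
        show ?thesis
        proof (cases "b = J a")
          case True
          have "a \<le> r" using that \<mu>(1) T by auto
          moreover have "a \<noteq> i" using that \<mu>(2) T True by (auto simp: J_def)
          ultimately show ?thesis using x(4) False T True by auto
        next
          case False
          then show ?thesis using x(2) T by simp
        qed
      next
        case (S k)
        then show ?thesis using x(3) by simp
      qed
      then have "mon x \<mu> \<noteq> 0" by (simp add: mon_def)
      ultimately show ?thesis by (simp add: evc_hom)
    qed
  qed
  then have "ell i dvd h \<or> ell i dvd (\<Prod>k\<in>{..r} - {i}. ell k)"
    using prime_ell[OF i] by (rule prime_elem_dvd_multD[rotated])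
  moreover have "\<not> ell i dvd (\<Prod>k\<in>{..r} - {i}. ell k)"
  proof
    assume "ell i dvd (\<Prod>k\<in>{..r} - {i}. ell k)"
    then obtain k where "k \<in> {..r} - {i}" "ell i dvd ell k"
      using prime_elem_dvd_prodD[OF prime_ell[OF i]] by blast
    then show False using ell_not_dvd[of i k] i by auto
  qed
  ultimately show ?thesis by blast
qed

lemma S_dvdD:
  assumes k: "S k \<notin> ks \<mu>" and \<mu>: "ks \<mu> \<subseteq> V" and h: "h \<in> Pring W"
    and d: "quot_dvd V I (Xv (S k)) (mon Xv \<mu> * eps h)"
  shows "h = 0"
proof -
  have "h * (\<Prod>i\<le>r. ell i) = 0"
  proof (rule mpoly_eq_0I)
    fix z
    show "evc z (h * (\<Prod>i\<le>r. ell i)) = 0"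
    proof (cases "\<exists>k\<in>{..r}. elv k z = 0")
      case True
      then have "(\<Prod>k\<le>r. elv k z) = 0" by (intro prod_zero) auto
      then show ?thesis by (simp add: evc_hom evc_ell)
    next
      case False
      obtain x where x: "\<forall>i\<le>r. mon x (Tmon n l i) = elv i z" "\<forall>i j. j \<noteq> 1 \<longrightarrow> x (T i j) = 1"
        "\<forall>q. x (S q) = (if q = k then 0 else 1)" "\<forall>i. x (T i 1) = 0 \<longleftrightarrow> elv i z = 0"
        using ex_point[of "\<lambda>_. 1" z "\<lambda>q. if q = k then 0 else 1"] n_pos by (auto simp: Suc_le_eq)
      have onx: "onX x" using x(1) unfolding onX_def by blast
      have "evc x (mon Xv \<mu> * eps h) = 0" using quot_dvd_onX[OF d onx] x(3) by (simp add: evc_hom)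
      then have "mon x \<mu> * evc z h = 0" by (simp add: evc_hom evc_mon evc_eps_point[OF x(1) h])
      moreover have "x v \<noteq> 0" if "v \<in> ks \<mu>" for v
      proof (cases v)
        case (T a b)
        then have "a \<le> r" using that \<mu> by auto
        then show ?thesis using T x(2,4) False by (cases "b = 1") auto
      next
        case (S q)
        then show ?thesis using x(3) that k by auto
      qed
      then have "mon x \<mu> \<noteq> 0" by (simp add: mon_def)
      ultimately show ?thesis by (simp add: evc_hom)
    qed
  qed
  then show ?thesis using prod_ell_nonzero[of "{..r}"] by simp
qed

lemma homog_form:
  assumes "homog V L f"
  shows "\<exists>\<rho> h d. ks \<rho> \<subseteq> V \<and> h \<in> Pring W \<and> homogeneous d h \<and> cg f (mon Xv \<rho> * eps h)"
proof (cases "f = 0")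
  case True
  have "homogeneous 0 0" by (simp add: homogeneous_def)
  then show ?thesis unfolding True using cg_refl[of 0]
    by (intro exI[of _ 0] exI[of _ "0::mpoly"]) (simp add: eps_hom)
next
  case False
  obtain w where w: "f \<in> Pring V" "\<forall>\<mu>\<in>ks f. expvec \<mu> - w \<in> L"
    using assms by (auto simp: homog_def hom_of_deg_def)
  show ?thesis using homogeneous_form[OF w(1) False, of w] w(2) by blast
qed

lemma homog_product_form:
  assumes g: "cg g (mon Xv \<mu> * eps a)" and h: "cg h (mon Xv \<nu> * eps b)"
  shows "cg (g * h) (mon Xv (\<mu> + \<nu>) * eps (a * b))"
  using cg_mult[OF g h] by (simp add: mon_add eps_hom mult_ac)

lemma hom_of_deg_Xv: "v \<in> V \<Longrightarrow> homog V L (Xv v)"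
  unfolding homog_def hom_of_deg_def using L_0
  by (intro bexI[of _ "expvec (sg v 1)"]) (auto simp: Xv_def ZV_def expvec_def lookup_single when_def)

text \<open>The product of two homogeneous elements is a monomial times \<open>eps (a * b)\<close>.
  If the variable does not occur in the monomial, divisibility by \<open>T i j\<close> means that
  the prime \<open>ell i\<close> divides \<open>a * b\<close>, while divisibility by
  \<open>S k\<close> forces \<open>a * b = 0\<close>.\<close>

lemma K_prime_Xv:
  assumes v: "v \<in> V" shows "K_prime V L I (Xv v)"
  unfolding K_prime_def
proof (intro conjI allI impI)
  show "homog V L (Xv v)" "Xv v \<notin> I" using v hom_of_deg_Xv Xv_not_I by auto
  show "\<not> quot_unit V I (Xv v)" by (rule nonunit) (simp add: evc_hom)
  fix g h assume gh: "homog V L g \<and> homog V L h \<and> quot_dvd V I (Xv v) (g * h)"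
  then have hg: "homog V L g" and hh: "homog V L h" by auto
  from homog_form[OF hg] obtain \<mu> a d where g: "ks \<mu> \<subseteq> V" "a \<in> Pring W"
    "cg g (mon Xv \<mu> * eps a)" by (elim exE conjE)
  from homog_form[OF hh] obtain \<nu> b d' where h: "ks \<nu> \<subseteq> V" "b \<in> Pring W"
    "cg h (mon Xv \<nu> * eps b)" by (elim exE conjE)
  have d: "quot_dvd V I (Xv v) (mon Xv (\<mu> + \<nu>) * eps (a * b))"
    using gh quot_dvd_cg homog_product_form[OF g(3) h(3)] by blast
  have ks: "ks (\<mu> + \<nu>) \<subseteq> V" using keys_add[of \<mu> \<nu>] g h by blast
  have abW: "a * b \<in> Pring W" using g h by auto
  have bk: "quot_dvd V I (Xv v) g" if "quot_dvd V I (Xv v) (mon Xv \<mu> * eps a)"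
    using quot_dvd_cg[OF that cg_sym[OF g(3)]] .
  have bk': "quot_dvd V I (Xv v) h" if "quot_dvd V I (Xv v) (mon Xv \<nu> * eps b)"
    using quot_dvd_cg[OF that cg_sym[OF h(3)]] .
  show "quot_dvd V I (Xv v) g \<or> quot_dvd V I (Xv v) h"
  proof (cases "v \<in> ks \<mu> \<or> v \<in> ks \<nu>")
    case True
    then show ?thesis using Xv_dvd_mon g h bk bk' W_V by blast
  next
    case False
    then have nk: "v \<notin> ks (\<mu> + \<nu>)" using keys_add[of \<mu> \<nu>] by blast
    show ?thesis
    proof (cases v)
      case (T i j)
      have vV: "T i j \<in> V" using v T by simp
      have "ell i dvd a * b" using T_dvdD[OF vV ks _ abW] nk d T by simp
      moreover have "prime_elem (ell i)" using vV by (intro prime_ell) simp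
      ultimately have "ell i dvd a \<or> ell i dvd b" using prime_elem_dvd_multD by blast
      then show ?thesis
        using T_dvd_eps[OF vV _ g(2) mon_V[OF g(1)]] T_dvd_eps[OF vV _ h(2) mon_V[OF h(1)]] bk bk' T by blast
    next
      case (S k)
      have "a * b = 0" using S_dvdD[OF _ ks abW] nk d S by simp
      then have "a = 0 \<or> b = 0" by simp
      moreover have z: "quot_dvd V I (Xv v) 0"
        unfolding quot_dvd_def using I_simps by (intro bexI[of _ 0]) auto
      ultimately show ?thesis using bk bk' by (auto simp: eps_hom)
    qed
  qed
qed

lemma eps_keys:
  assumes h: "h \<in> Pring W" "homogeneous d h" and \<nu>: "\<nu> \<in> ks (eps h)"
  shows "expvec \<nu> - expvec (kt (\<lambda>i. if i = 0 then d else 0)) \<in> L"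
proof -
  define k where "k = (\<lambda>(\<mu> :: var \<Rightarrow>\<^sub>0 nat) i. if i \<in> Jc then lk \<mu> (T i 0) else 0)"
  have eh: "eps h = (\<Sum>\<mu>\<in>ks h. const (lk h \<mu>) * mon Xv (kt (k \<mu>)))"
    unfolding eps_def ev_def
  proof (rule sum.cong)
    fix \<mu> assume "\<mu> \<in> ks h"
    then have W: "ks \<mu> \<subseteq> (\<lambda>j. T j 0) ` Jc" using h(1) by (auto simp: Pring_def W_def)
    have "mon (\<lambda>v. case v of T i j \<Rightarrow> if j = 0 then Tp i else Xv v | S k \<Rightarrow> Xv v) \<mu> =
        (\<Prod>v\<in>(\<lambda>j. T j 0) ` Jc. (case v of T i j \<Rightarrow> if j = 0 then Tp i else Xv v | S k \<Rightarrow> Xv v) ^ lk \<mu> v)"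
      using W finite_Jc by (intro mon_superset) auto
    also have "\<dots> = (\<Prod>j\<in>Jc. Tp j ^ lk \<mu> (T j 0))"
      by (subst prod.reindex) (auto simp: inj_on_def)
    also have "\<dots> = (\<Prod>i\<le>r. Tp i ^ k \<mu> i)"
      using Jc by (intro prod.mono_neutral_cong_left) (auto simp: k_def)
    also have "\<dots> = mon Xv (kt (k \<mu>))" by (simp add: mon_kt Tp_def)
    finally show "const (lk h \<mu>) * mon (\<lambda>v. case v of T i j \<Rightarrow> if j = 0 then Tp i else Xv v | S k \<Rightarrow> Xv v) \<mu> =
        const (lk h \<mu>) * mon Xv (kt (k \<mu>))" by simp
  qed simp
  have "ks (eps h) \<subseteq> (\<Union>\<mu>\<in>ks h. ks (const (lk h \<mu>) * mon Xv (kt (k \<mu>))))"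
    unfolding eh by (rule keys_sum)
  then obtain \<mu> where \<mu>: "\<mu> \<in> ks h" "\<nu> \<in> ks (const (lk h \<mu>) * mon Xv (kt (k \<mu>)))" using \<nu> by blast
  then have \<nu>k: "\<nu> = kt (k \<mu>)" by (auto simp: single_eq[symmetric] split: if_splits)
  have W: "ks \<mu> \<subseteq> (\<lambda>j. T j 0) ` Jc" using h(1) \<mu>(1) by (auto simp: Pring_def W_def)
  have "d = wt (\<lambda>_. 1) \<mu>" using homogeneous_keys[OF h(2) \<mu>(1)] by simp
  also have "\<dots> = (\<Sum>v\<in>(\<lambda>j. T j 0) ` Jc. lk \<mu> v)" using W finite_Jc
    by (subst wt_superset[of "(\<lambda>j. T j 0) ` Jc"]) auto
  also have "\<dots> = (\<Sum>j\<in>Jc. lk \<mu> (T j 0))" by (subst sum.reindex) (auto simp: inj_on_def)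
  also have "\<dots> = (\<Sum>i\<le>r. k \<mu> i)" using Jc by (intro sum.mono_neutral_cong_left) (auto simp: k_def)
  finally have s: "(\<Sum>i\<le>r. k \<mu> i) = d" by simp
  define z where "z = (\<lambda>i. int (k \<mu> i) - (if i = 0 then int d else 0))"
  have "(\<Sum>i\<le>r. z i) = int (\<Sum>i\<le>r. k \<mu> i) - int d" by (simp add: z_def sum_subtractf)
  then have "(\<Sum>i\<le>r. z i) = 0" using s by simp
  moreover have "expvec \<nu> - expvec (kt (\<lambda>i. if i = 0 then d else 0)) = lat z"
    unfolding \<nu>k by (auto simp: fun_eq_iff expvec_def lk_kt lat_def z_def algebra_simps split: var.splits)
  ultimately show ?thesis unfolding L_eq by blast
qed

lemma ks_kt: "ks (kt k) \<subseteq> V"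
  by (auto simp: in_keys_iff lk_kt vars_def split: var.splits if_splits)

lemma homog_eps:
  assumes "h \<in> Pring W" "homogeneous d h" shows "homog V L (eps h)"
  unfolding homog_def hom_of_deg_def
proof (intro bexI conjI ballI)
  show "eps h \<in> Pring V" using assms W_V by blast
  show "expvec (kt (\<lambda>i. if i = 0 then d else 0)) \<in> ZV V"
    using ks_kt[of "\<lambda>i. if i = 0 then d else 0"] by (auto simp: ZV_def expvec_def in_keys_iff)
qed (rule eps_keys[OF assms])

lemma rs_kc_mult:
  assumes "\<And>\<nu>. \<nu> \<in> ks p \<Longrightarrow> kc \<nu> = kc \<beta>"
  shows "rs (\<lambda>\<mu>. kc \<mu> = \<kappa>) (q * p) = rs (\<lambda>\<mu>. kc (\<beta> + \<mu>) = \<kappa>) q * p"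
proof -
  have "q * p = (\<Sum>\<nu>\<in>ks p. sg \<nu> (lk p \<nu>)) * q" by (simp add: sum_single_lk mult.commute)
  also have "\<dots> = (\<Sum>\<nu>\<in>ks p. sg \<nu> (lk p \<nu>) * q)" by (rule sum_distrib_right)
  finally have "rs (\<lambda>\<mu>. kc \<mu> = \<kappa>) (q * p) = (\<Sum>\<nu>\<in>ks p. rs (\<lambda>\<mu>. kc \<mu> = \<kappa>) (sg \<nu> (lk p \<nu>) * q))"
    by (simp only: rs_sum)
  also have "\<dots> = (\<Sum>\<nu>\<in>ks p. sg \<nu> (lk p \<nu>) * rs (\<lambda>\<mu>. kc (\<beta> + \<mu>) = \<kappa>) q)"
  proof (rule sum.cong)
    fix \<nu> assume "\<nu> \<in> ks p"
    then have "kc (\<beta> + \<mu>) = kc (\<nu> + \<mu>)" for \<mu>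
      using kc_add[of \<mu> \<nu> \<beta>] assms by (simp add: add.commute)
    then show "rs (\<lambda>\<mu>. kc \<mu> = \<kappa>) (sg \<nu> (lk p \<nu>) * q) = sg \<nu> (lk p \<nu>) * rs (\<lambda>\<mu>. kc (\<beta> + \<mu>) = \<kappa>) q"
      by (intro rs_shift) simp
  qed simp
  also have "\<dots> = (\<Sum>\<nu>\<in>ks p. sg \<nu> (lk p \<nu>)) * rs (\<lambda>\<mu>. kc (\<beta> + \<mu>) = \<kappa>) q"
    by (rule sum_distrib_right[symmetric])
  also have "\<dots> = rs (\<lambda>\<mu>. kc (\<beta> + \<mu>) = \<kappa>) q * p"
    by (simp add: sum_single_lk mult.commute)
  finally show ?thesis .
qed

text \<open>Reduces divisibility modulo \<open>I\<close> to divisibility of forms. With a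
  homogeneous cofactor, both sides are monomials times forms. At points where only the first
  variable of each block differs from 1, the \<open>N\<close>-th power of a monomial is a product of
  powers of the \<open>ell i\<close>. The resulting identity of polynomials lets \<open>p\<close>
  divide only \<open>c ^ N\<close>.\<close>

lemma eps_dvdD:
  assumes p: "p \<in> Pring W" "homogeneous e p" "irreducible p"
    and nd: "\<And>i. i \<le> r \<Longrightarrow> \<not> p dvd ell i"
    and \<mu>: "ks \<mu> \<subseteq> V" and c: "c \<in> Pring W" "homogeneous d c"
    and dv: "quot_dvd V I (eps p) (mon Xv \<mu> * eps c)"
  shows "p dvd c"
proof -
  obtain q where q: "q \<in> Pring V" "mon Xv \<mu> * eps c - q * eps p \<in> I" using dv by (auto simp: quot_dvd_def)
  define \<beta> where "\<beta> = kt (\<lambda>i. if i = 0 then e else 0)"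
  define \<gamma> where "\<gamma> = kt (\<lambda>i. if i = 0 then d else 0)"
  have kp: "kc \<nu> = kc \<beta>" if "\<nu> \<in> ks (eps p)" for \<nu> unfolding \<beta>_def kc_eq by (rule eps_keys[OF p(1,2) that])
  have kk: "kc \<nu> = kc \<gamma>" if "\<nu> \<in> ks (eps c)" for \<nu> unfolding \<gamma>_def kc_eq by (rule eps_keys[OF c that])
  \<comment> \<open>The component of the cofactor in the degree for which \<open>q' * eps p\<close>
    has the degree of the left side.\<close>
  define q' where "q' = rs (\<lambda>\<nu>. kc (\<beta> + \<nu>) = kc (\<gamma> + \<mu>)) q"
  have "rs (\<lambda>\<nu>. kc \<nu> = kc (\<gamma> + \<mu>)) (mon Xv \<mu> * eps c) = mon Xv \<mu> * eps c"
  proof -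
    have "rs (\<lambda>\<nu>. kc \<nu> = kc (\<gamma> + \<mu>)) (mon Xv \<mu> * eps c) =
        rs (\<lambda>\<nu>. kc (\<gamma> + \<nu>) = kc (\<gamma> + \<mu>)) (mon Xv \<mu>) * eps c"
      by (rule rs_kc_mult) (rule kk)
    then show ?thesis by (simp add: mon_Xv rs_single)
  qed
  then have "mon Xv \<mu> * eps c - q' * eps p = rs (\<lambda>\<nu>. kc \<nu> = kc (\<gamma> + \<mu>)) (mon Xv \<mu> * eps c - q * eps p)"
  proof -
    have "rs (\<lambda>\<nu>. kc \<nu> = kc (\<gamma> + \<mu>)) (q * eps p) = q' * eps p"
      unfolding q'_def by (rule rs_kc_mult) (rule kp)
    then show ?thesis using \<open>rs _ (mon Xv \<mu> * eps c) = mon Xv \<mu> * eps c\<close> by (simp add: rs_diff)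
  qed
  then have q'I: "mon Xv \<mu> * eps c - q' * eps p \<in> I" using rs_kc_I[OF q(2)] by metis
  obtain \<rho> k where k: "ks \<rho> \<subseteq> V" "k \<in> Pring W" "cg q' (mon Xv \<rho> * eps k)"
  proof (cases "q' = 0")
    case True
    show ?thesis using that[of 0 0] cg_refl[of 0] True by (simp add: eps_hom)
  next
    case False
    then obtain \<nu> where \<nu>: "\<nu> \<in> ks q'" by (metis all_not_in_conv keys_eq_empty)
    have "kc \<nu>' = kc \<nu>" if "\<nu>' \<in> ks q'" for \<nu>'
      using that \<nu> kc_add[of \<beta> \<nu>' \<nu>] by (auto simp: q'_def ks_rs)
    then have "expvec \<nu>' - expvec \<nu> \<in> L" if "\<nu>' \<in> ks q'" for \<nu>' using that by (simp add: kc_eq)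
    moreover have "q' \<in> Pring V" unfolding q'_def using q(1) by (rule rs_Pring)
    ultimately show ?thesis using homogeneous_form[of q' "expvec \<nu>"] False that by blast
  qed
  have "cg (q' * eps p) (mon Xv \<rho> * eps k * eps p)" by (intro cg_mult cg_refl k W_V p)
  then have "(mon Xv \<mu> * eps c - q' * eps p) + (q' * eps p - mon Xv \<rho> * eps k * eps p) \<in> I"
    using q'I by (intro ideal_add[OF ideal_I]) (simp_all add: cg_def)
  then have rel: "mon Xv \<mu> * eps c - mon Xv \<rho> * eps (k * p) \<in> I" by (simp add: eps_hom mult.assoc)
  \<comment> \<open>A common multiple of the \<open>l i 1\<close>: the \<open>N\<close>-th power of
    a coordinate \<open>T i 1\<close> is then a power of \<open>elv i z\<close>, free of
    roots.\<close>
  define N where "N = (\<Prod>i\<le>r. l i 1)"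
  have lp: "0 < l i 1" if "i \<le> r" for i using that n_pos[of i] l_pos[of i 1] by (simp add: Suc_le_eq)
  have Npos: "0 < N" unfolding N_def using lp by (intro prod_pos) auto
  have Ni: "N = l i 1 * (N div l i 1)" if "i \<le> r" for i
    unfolding N_def using that by (intro dvd_mult_div_cancel[symmetric] dvd_prodI) auto
  define E where "E = (\<lambda>\<mu>. \<Prod>i\<le>r. ell i ^ (lk \<mu> (T i 1) * (N div l i 1)))"
  have "c ^ N * E \<mu> * (\<Prod>i\<le>r. ell i) - (k * p) ^ N * E \<rho> * (\<Prod>i\<le>r. ell i) = 0"
  proof (rule mpoly_eq_0I)
    fix z
    show "evc z (c ^ N * E \<mu> * (\<Prod>i\<le>r. ell i) - (k * p) ^ N * E \<rho> * (\<Prod>i\<le>r. ell i)) = 0"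
    proof (cases "\<exists>i\<in>{..r}. elv i z = 0")
      case True
      then have "(\<Prod>k\<le>r. elv k z) = 0" by (intro prod_zero) auto
      then show ?thesis by (simp add: evc_hom evc_ell)
    next
      case False
      obtain x where x: "\<forall>i\<le>r. mon x (Tmon n l i) = elv i z" "\<forall>i j. j \<noteq> 1 \<longrightarrow> x (T i j) = 1"
        "\<forall>q. x (S q) = 1"
        using ex_point[of "\<lambda>_. 1" z "\<lambda>_. 1"] n_pos by (auto simp: Suc_le_eq)
      have onx: "onX x" using x(1) unfolding onX_def by blast
      have x1: "x (T i 1) ^ l i 1 = elv i z" if i: "i \<le> r" for i
      proof -
        have "elv i z = (\<Prod>j\<in>{1..n i}. x (T i j) ^ l i j)" using x(1) i by (simp add: mon_Tmon)
        also have "\<dots> = x (T i 1) ^ l i 1 * (\<Prod>j\<in>{1..n i} - {1}. x (T i j) ^ l i j)"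
          using n_pos[OF i] by (intro prod.remove) (auto simp: Suc_le_eq)
        also have "(\<Prod>j\<in>{1..n i} - {1}. x (T i j) ^ l i j) = 1" using x(2) by (intro prod.neutral) auto
        finally show ?thesis by simp
      qed
      have m: "mon x \<sigma> ^ N = evc z (E \<sigma>)" if \<sigma>: "ks \<sigma> \<subseteq> V" for \<sigma>
      proof -
        let ?B = "(\<lambda>i. T i 1) ` {..r}"
        have "mon x \<sigma> = (\<Prod>v\<in>ks \<sigma> \<union> ?B. x v ^ lk \<sigma> v)" by (intro mon_superset) auto
        also have "\<dots> = (\<Prod>v\<in>?B. x v ^ lk \<sigma> v)"
        proof (rule prod.mono_neutral_right)
          show "\<forall>v\<in>ks \<sigma> \<union> ?B - ?B. x v ^ lk \<sigma> v = 1"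
          proof
            fix v assume v: "v \<in> ks \<sigma> \<union> ?B - ?B"
            then have "v \<in> V" using \<sigma> by blast
            show "x v ^ lk \<sigma> v = 1"
            proof (cases v)
              case (T a b)
              then have "b \<noteq> 1" using v \<open>v \<in> V\<close> by auto
              then show ?thesis using x(2) T by simp
            next
              case (S q)
              then show ?thesis using x(3) by simp
            qed
          qed
        qed auto
        also have "\<dots> = (\<Prod>i\<le>r. x (T i 1) ^ lk \<sigma> (T i 1))"
          by (subst prod.reindex) (auto simp: inj_on_def)
        finally have "mon x \<sigma> ^ N = (\<Prod>i\<le>r. (x (T i 1) ^ lk \<sigma> (T i 1)) ^ N)"
          by (simp add: prod_power_distrib)
        also have "\<dots> = (\<Prod>i\<le>r. elv i z ^ (lk \<sigma> (T i 1) * (N div l i 1)))"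
        proof (rule prod.cong)
          fix i assume "i \<in> {..r}"
          then have i: "i \<le> r" by simp
          have "(x (T i 1) ^ lk \<sigma> (T i 1)) ^ N = (x (T i 1) ^ l i 1) ^ (lk \<sigma> (T i 1) * (N div l i 1))"
            unfolding power_mult[symmetric] by (subst Ni[OF i]) (simp add: mult_ac)
          then show "(x (T i 1) ^ lk \<sigma> (T i 1)) ^ N = elv i z ^ (lk \<sigma> (T i 1) * (N div l i 1))"
            unfolding x1[OF i] .
        qed simp
        finally show ?thesis by (simp add: E_def evc_hom evc_ell)
      qed
      have "evc x (mon Xv \<mu> * eps c - mon Xv \<rho> * eps (k * p)) = 0" using evc_I[OF onx rel] .
      then have "mon x \<mu> * evc z c = mon x \<rho> * evc z (k * p)"
        using evc_eps_point[OF x(1) c(1)] evc_eps_point[OF x(1), of "k * p"] k p by (simp add: evc_hom evc_mon Pring_mult)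
      then have "(mon x \<mu> * evc z c) ^ N = (mon x \<rho> * evc z (k * p)) ^ N" by simp
      then have "evc z (E \<mu>) * evc z c ^ N = evc z (E \<rho>) * evc z (k * p) ^ N"
        unfolding power_mult_distrib m[OF \<mu>] m[OF k(1)] .
      then show ?thesis by (simp add: evc_hom mult_ac)
    qed
  qed
  then have "c ^ N * E \<mu> * (\<Prod>i\<le>r. ell i) = (k * p) ^ N * E \<rho> * (\<Prod>i\<le>r. ell i)" by simp
  also have "(k * p) ^ N = p * (p ^ (N - 1) * k ^ N)"
    using power_minus_mult[OF Npos, of p] by (simp add: power_mult_distrib mult_ac)
  also have "\<dots> * E \<rho> * (\<Prod>i\<le>r. ell i) = p * (p ^ (N - 1) * k ^ N * E \<rho> * (\<Prod>i\<le>r. ell i))"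
    by (simp only: mult.assoc)
  finally have "c ^ N * E \<mu> * (\<Prod>i\<le>r. ell i) = p * (p ^ (N - 1) * k ^ N * E \<rho> * (\<Prod>i\<le>r. ell i))" .
  then have "p dvd c ^ N * E \<mu> * (\<Prod>i\<le>r. ell i)" by (metis dvdI)
  moreover have pp: "prime_elem p" using irreducible_imp_prime p(3) .
  moreover have "\<not> p dvd (\<Prod>i\<le>r. ell i)" using nd prime_elem_dvd_prodD[OF pp] by blast
  moreover have "\<not> p dvd E \<mu>"
    unfolding E_def using nd prime_elem_dvd_power[OF pp] prime_elem_dvd_prodD[OF pp] by blast
  ultimately have "p dvd c ^ N" using prime_elem_dvd_multD by blast
  then show ?thesis by (rule prime_elem_dvd_power[OF pp])
qed

lemma K_prime_eps:
  assumes p: "p \<in> Pring W" "homogeneous e p" "irreducible p"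
    and nd: "\<And>i. i \<le> r \<Longrightarrow> \<not> p dvd ell i"
  shows "K_prime V L I (eps p)"
  unfolding K_prime_def
proof (intro conjI allI impI)
  have p0: "p \<noteq> 0" using p by (auto simp: irreducible_def)
  show "homog V L (eps p)" using homog_eps p by blast
  show "eps p \<notin> I" using mon_eps_in_I[of 0 p] p p0 by auto
  have "e \<noteq> 0"
  proof
    assume "e = 0"
    then have "tdeg p = 0" using homogeneous_tdeg[OF p(2) p0] by simp
    then show False using p(3) p0 unfolding irreducible_def mpoly_unit_iff tdeg_eq_0_iff by auto
  qed
  then have "lk p 0 = 0" using homogeneous_keys[OF p(2), of 0] by (auto simp: in_keys_iff)
  moreover have "evc (\<lambda>_. 0) (eps p) = evc (\<lambda>_. 0) p"
    using evc_eps_point[of "\<lambda>_. 0" "\<lambda>_. 0" p] p(1) n_pos l_pos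
    by (auto simp: mon_Tmon elv_def intro!: prod_zero bexI[of _ 1] simp: Suc_le_eq)
  ultimately show "\<not> quot_unit V I (eps p)" by (intro nonunit) (simp add: evc_0)
  fix g h assume gh: "homog V L g \<and> homog V L h \<and> quot_dvd V I (eps p) (g * h)"
  then have hg: "homog V L g" and hh: "homog V L h" by auto
  from homog_form[OF hg] obtain \<mu> a d where g: "ks \<mu> \<subseteq> V" "a \<in> Pring W" "homogeneous d a"
    "cg g (mon Xv \<mu> * eps a)" by (elim exE conjE)
  from homog_form[OF hh] obtain \<nu> b d' where h: "ks \<nu> \<subseteq> V" "b \<in> Pring W" "homogeneous d' b"
    "cg h (mon Xv \<nu> * eps b)" by (elim exE conjE)
  have "quot_dvd V I (eps p) (g * h)" using gh by blast
  from quot_dvd_cg[OF this homog_product_form[OF g(4) h(4)]]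
  have "quot_dvd V I (eps p) (mon Xv (\<mu> + \<nu>) * eps (a * b))" .
  moreover have "ks (\<mu> + \<nu>) \<subseteq> V" using keys_add[of \<mu> \<nu>] g h by blast
  ultimately have "p dvd a * b"
    using eps_dvdD[OF p nd _ Pring_mult[OF g(2) h(2)] homogeneous_mult[OF g(3) h(3)]] by blast
  then have "p dvd a \<or> p dvd b" using irreducible_imp_prime[OF p(3)] prime_elem_dvd_multD by blast
  moreover have "quot_dvd V I (eps p) f" if "p dvd a" "a \<in> Pring W" "ks \<mu> \<subseteq> V" "cg f (mon Xv \<mu> * eps a)" for f a \<mu>
  proof -
    from that(1) obtain k where "a = p * k" by (rule dvdE)
    then have k: "a = k * p" by (simp only: mult.commute)
    define k' where "k' = (if a = 0 then 0 else k)"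
    have k': "a = k' * p" "k' \<in> Pring W" using k Pring_factor[of k p W] that(2) by (auto simp: k'_def)
    have "cg f (mon Xv \<mu> * eps k' * eps p)" using that(4) by (simp add: k' eps_hom mult.assoc)
    moreover have "mon Xv \<mu> * eps k' \<in> Pring V" by (intro Pring_mult mon_V W_V that(3) k'(2))
    ultimately show ?thesis by (intro quot_dvdI)
  qed
  ultimately show "quot_dvd V I (eps p) g \<or> quot_dvd V I (eps p) h"
    using g(1,2,4) h(1,2,4) by blast
qed

lemma K_prime_cmult:
  assumes a: "a \<noteq> 0" and p: "K_prime V L I p" shows "K_prime V L I (const a * p)"
proof -
  have inv: "const (inverse a) * const a = 1" using a by (simp flip: const_hom(2))
  have pV: "p \<in> Pring V" using p by (auto simp: K_prime_def homog_def hom_of_deg_def)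
  have "homog V L p" using p by (simp add: K_prime_def)
  then have 1: "homog V L (const a * p)" using pV a by (auto simp: homog_def hom_of_deg_def keys_cmult)
  have eq: "const (inverse a) * (const a * p) = p" using inv by (simp flip: mult.assoc)
  have 2: "const a * p \<notin> I"
  proof
    assume "const a * p \<in> I"
    from ideal_mult[OF ideal_I this Pring_const[of "inverse a"]] have "p \<in> I" unfolding eq .
    then show False using p by (simp add: K_prime_def)
  qed
  have 3: "\<not> quot_unit V I (const a * p)"
  proof
    assume "quot_unit V I (const a * p)"
    then obtain g where g: "g \<in> Pring V" "const a * p * g - 1 \<in> I" by (auto simp: quot_unit_def)
    then have "p * (const a * g) - 1 \<in> I" by (simp add: mult_ac)
    moreover have "const a * g \<in> Pring V" using g(1) by auto
    ultimately have "quot_unit V I p" unfolding quot_unit_def using pV by blast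
    then show False using p by (simp add: K_prime_def)
  qed
  have d1: "quot_dvd V I p g" if dd: "quot_dvd V I (const a * p) g" for g
  proof -
    obtain q where q: "q \<in> Pring V" "g - q * (const a * p) \<in> I" using dd by (auto simp: quot_dvd_def)
    then have "g - (q * const a) * p \<in> I" by (simp add: mult.assoc)
    moreover have "q * const a \<in> Pring V" using q by auto
    ultimately show ?thesis unfolding quot_dvd_def by blast
  qed
  have d2: "quot_dvd V I (const a * p) g" if dd: "quot_dvd V I p g" for g
  proof -
    obtain q where q: "q \<in> Pring V" "g - q * p \<in> I" using dd by (auto simp: quot_dvd_def)
    have "(q * const (inverse a)) * (const a * p) = q * (const (inverse a) * (const a * p))" by (simp only: mult.assoc)
    also have "\<dots> = q * p" unfolding eq ..
    finally have "g - (q * const (inverse a)) * (const a * p) \<in> I" using q(2) by (simp only:)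
    moreover have "q * const (inverse a) \<in> Pring V" using q by auto
    ultimately show ?thesis unfolding quot_dvd_def by blast
  qed
  show ?thesis unfolding K_prime_def
  proof (intro conjI allI impI 1 2 3)
    fix g h assume "homog V L g \<and> homog V L h \<and> quot_dvd V I (const a * p) (g * h)"
    then have "quot_dvd V I p g \<or> quot_dvd V I p h" using p d1 unfolding K_prime_def by blast
    then show "quot_dvd V I (const a * p) g \<or> quot_dvd V I (const a * p) h" using d2 by blast
  qed
qed

text \<open>The constant is kept apart, so that constants are covered by the empty list and
  factorizations can be concatenated; it is absorbed into a prime only at the end.\<close>

definition factorable :: "mpoly \<Rightarrow> bool" where
  "factorable f \<longleftrightarrow> (\<exists>a ps. a \<noteq> 0 \<and> (\<forall>p\<in>set ps. K_prime V L I p) \<and> cg f (const a * prod_list ps))"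

lemma factorable_const: "a \<noteq> 0 \<Longrightarrow> factorable (const a)"
  unfolding factorable_def by (intro exI[of _ a] exI[of _ "[]"]) (simp add: cg_refl)

lemma factorable_K_prime: assumes "K_prime V L I p" shows "factorable p"
proof -
  have "p \<in> Pring V" using assms by (auto simp: K_prime_def homog_def hom_of_deg_def)
  then show ?thesis unfolding factorable_def using assms
    by (intro exI[of _ 1] exI[of _ "[p]"]) (simp add: cg_refl)
qed

lemma factorable_mult: assumes "factorable f" "factorable g" shows "factorable (f * g)"
proof -
  obtain a ps b qs where "a \<noteq> 0" "\<forall>p\<in>set ps. K_prime V L I p" "cg f (const a * prod_list ps)"
    "b \<noteq> 0" "\<forall>p\<in>set qs. K_prime V L I p" "cg g (const b * prod_list qs)"
    using assms unfolding factorable_def by blast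
  moreover from this have "cg (f * g) (const (a * b) * prod_list (ps @ qs))"
    using cg_mult[of f "const a * prod_list ps" g "const b * prod_list qs"] by (simp add: const_hom mult_ac)
  ultimately show ?thesis unfolding factorable_def
    by (intro exI[of _ "a * b"] exI[of _ "ps @ qs"]) auto
qed

lemma factorable_cg: "factorable f \<Longrightarrow> cg g f \<Longrightarrow> factorable g"
  unfolding factorable_def using cg_trans by blast

lemma factorable_mon: "ks \<mu> \<subseteq> V \<Longrightarrow> factorable (mon Xv \<mu>)"
proof (induction \<mu> rule: monomial_induct)
  case zero
  show ?case using factorable_const[of 1] by simp
next
  case (add v \<nu>)
  then show ?case by (simp add: mon_add factorable_mult factorable_K_prime K_prime_Xv)
qed

lemma ks_Tmon: "i \<le> r \<Longrightarrow> ks (Tmon n l i) \<subseteq> V"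
  by (auto simp: in_keys_iff lk_Tmon vars_def split: var.splits if_splits)

text \<open>The irreducible forms not covered by \<open>K_prime_eps\<close> are constant multiples
  of some \<open>ell i\<close>, and \<open>eps (ell i)\<close> is congruent to \<open>Tp i\<close>,
  a product of variables.\<close>

lemma factorable_eps:
  assumes p: "p \<in> Pring W" "homogeneous e p" "irreducible p"
  shows "factorable (eps p)"
proof (cases "\<exists>i\<le>r. p dvd ell i")
  case False
  then show ?thesis using K_prime_eps[OF p] factorable_K_prime by blast
next
  case True
  then obtain i q where i: "i \<le> r" "ell i = p * q" by (metis dvd_def)
  then have "q dvd 1" using irreducible_ell[OF i(1)] p(3) by (auto simp: irreducible_def)
  then obtain a where a: "a \<noteq> 0" "q = const a" by (auto simp: mpoly_unit_iff)
  have "const a * const (inverse a) = 1" using a by (simp flip: const_hom(2))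
  then have "p = const (inverse a) * ell i" unfolding i(2) a(2) by (simp add: mult_ac)
  then have "eps p = const (inverse a) * eps (ell i)" by (simp add: eps_hom)
  moreover have "factorable (eps (ell i))"
    using factorable_mon[OF ks_Tmon[OF i(1)]] cg_sym[OF cg_Tp[OF i(1)]] unfolding Tp_def by (rule factorable_cg)
  ultimately show ?thesis using factorable_mult[OF factorable_const] a by simp
qed

lemma factorial_I: "K_factorial V L I"
  unfolding K_factorial_def
proof (intro conjI allI impI)
  show "K_integral V L I"
    unfolding K_integral_def using prime_1[OF prime_I] prime_cases[OF prime_I]
    by (auto simp: homog_def hom_of_deg_def)
  fix f assume f: "homog V L f \<and> f \<notin> I \<and> \<not> quot_unit V I f"
  then have fV: "f \<in> Pring V" by (auto simp: homog_def hom_of_deg_def)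
  obtain \<rho> h d where h: "ks \<rho> \<subseteq> V" "h \<in> Pring W" "homogeneous d h" "cg f (mon Xv \<rho> * eps h)"
    using homog_form f by blast
  have h0: "h \<noteq> 0" using h(4) f fV by (auto simp: eps_hom cg_0_iff)
  obtain a qs where qs: "a \<noteq> 0" "\<forall>p\<in>set qs. irreducible p" "h = const a * prod_list qs"
    using irreducible_factorization[OF h0] by blast
  have "factorable (eps (prod_list qs'))" if "set qs' \<subseteq> set qs" for qs'
    using that
  proof (induction qs')
    case Nil
    show ?case using factorable_const[of 1] by (simp add: eps_hom)
  next
    case (Cons q qs')
    obtain ys zs where "qs = ys @ q # zs" using Cons.prems split_list[of q qs] by auto
    then have hq: "h = q * (const a * prod_list ys * prod_list zs)" using qs(3) by (simp add: mult_ac)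
    have "q \<in> Pring W" using Pring_factor[of q] h(2) h0 hq by metis
    moreover obtain e where "homogeneous e q" using homogeneous_factor h(3) h0 hq by metis
    ultimately have "factorable (eps q)" using factorable_eps qs(2) Cons.prems by simp
    then show ?case using Cons by (simp add: eps_hom factorable_mult)
  qed
  then have "factorable (eps (prod_list qs))" by simp
  then have "factorable (mon Xv \<rho> * eps h)"
    unfolding qs(3) eps_hom eps_const by (intro factorable_mult factorable_mon factorable_const h qs)
  then have "factorable f" using h(4) by (rule factorable_cg)
  then obtain b ps where ps: "b \<noteq> 0" "\<forall>p\<in>set ps. K_prime V L I p" "cg f (const b * prod_list ps)"
    unfolding factorable_def by blast
  show "\<exists>ps. (\<forall>p\<in>set ps. K_prime V L I p) \<and> f - prod_list ps \<in> I"
  proof (cases ps)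
    case Nil
    then have "f - const b \<in> I" using ps by (simp add: cg_def)
    then have "quot_unit V I f" using units_I fV ps(1) unfolding units_are_constants_def by blast
    then show ?thesis using f by blast
  next
    case (Cons p ps')
    then have "f - prod_list ((const b * p) # ps') \<in> I" using ps(3) by (simp add: cg_def mult.assoc)
    moreover have "\<forall>p\<in>set ((const b * p) # ps'). K_prime V L I p"
      using ps(1,2) Cons K_prime_cmult by auto
    ultimately show ?thesis by blast
  qed
qed

end

section \<open>Almost integral elements\<close>

lemma tdeg_dvd: "f dvd g \<Longrightarrow> g \<noteq> 0 \<Longrightarrow> tdeg f \<le> tdeg g"
  by (auto simp: dvd_def tdeg_mult)

lemma tdeg_power: "f \<noteq> 0 \<Longrightarrow> tdeg (f ^ k) = k * tdeg f"
proof (induction k)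
  case 0
  show ?case unfolding power_0 mult_0 tdeg_eq_0_iff by (metis const_simps(1))
qed (simp add: tdeg_mult)

lemma irreducible_tdeg: assumes "irreducible p" shows "0 < tdeg p"
proof (rule ccontr)
  assume "\<not> 0 < tdeg p"
  then obtain a where "p = const a" using tdeg_eq_0_iff[of p] by auto
  then show False using assms unfolding irreducible_def mpoly_unit_iff by auto
qed

lemma irreducible_power_not_dvd:
  assumes "irreducible p" "f \<noteq> 0" "tdeg f < k" shows "\<not> p ^ k dvd f"
proof
  assume "p ^ k dvd f"
  then have "tdeg (p ^ k) \<le> tdeg f" by (rule tdeg_dvd[OF _ assms(2)])
  moreover have "p \<noteq> 0" using assms(1) by (auto simp: irreducible_def)
  ultimately have "k * tdeg p \<le> tdeg f" using tdeg_power by metis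
  moreover have "k \<le> k * tdeg p" using irreducible_tdeg[OF assms(1)] by simp
  ultimately show False using assms(3) by linarith
qed

lemma prime_power_dvd_cancel:
  fixes p :: "'a::idom"
  assumes p: "prime_elem p" "\<not> p dvd x" and d: "p ^ k dvd x * y"
  shows "p ^ k dvd y"
  using d
proof (induction k arbitrary: y)
  case (Suc k)
  have "p dvd x * y" using Suc.prems dvd_mult_left[of p "p ^ k"] by simp
  then have "p dvd y" using prime_elem_dvd_multD[OF p(1)] p(2) by blast
  then obtain z where z: "y = p * z" by (rule dvdE)
  have "p * p ^ k dvd p * (x * z)" using Suc.prems by (simp add: z mult_ac)
  moreover have "p \<noteq> 0" using p(1) by (rule prime_elem_not_zeroI)
  ultimately have "p ^ k dvd x * z" by (simp only: dvd_mult_cancel_left) simp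
  from Suc.IH[OF this] have "p * p ^ k dvd p * z" by (rule mult_dvd_mono[OF dvd_refl])
  then show ?case by (simp add: z)
qed simp

text \<open>The valuation argument: a prime \<open>p\<close> not dividing \<open>D\<close> occurs in \<open>g\<close> at most as often as in
  \<open>h\<close>, since the factors \<open>L i\<close> contribute less than a full power.\<close>

lemma dvd_of_power_relations:
  fixes g :: mpoly and L :: "'i \<Rightarrow> mpoly"
  assumes R: "finite R" and d: "d \<noteq> 0"
    and e: "\<And>i. i \<in> R \<Longrightarrow> \<kappa> i < e i"
    and L: "\<And>i. i \<in> R \<Longrightarrow> irreducible (L i)"
    and LL: "\<And>i k. i \<in> R \<Longrightarrow> k \<in> R \<Longrightarrow> i \<noteq> k \<Longrightarrow> \<not> L i dvd L k"
    and E: "E = (\<Prod>i\<in>R. e i)"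
  shows "\<forall>p\<in>set ps. irreducible p \<Longrightarrow>
    (\<And>N. \<exists>K q. D ^ K * d * h ^ (E * N) * (\<Prod>i\<in>R. L i ^ (\<kappa> i * (E div e i) * N)) = q * prod_list ps ^ (E * N)) \<Longrightarrow>
    \<exists>M. prod_list ps dvd D ^ M * h"
proof (induction ps arbitrary: h)
  case (Cons p ps)
  have p: "irreducible p" "prime_elem p" using Cons.prems(1) irreducible_imp_prime by auto
  have p0: "p \<noteq> 0" using p(1) by (auto simp: irreducible_def)
  have ps: "\<forall>p\<in>set ps. irreducible p" using Cons.prems(1) by simp
  show ?case
  proof (cases "p dvd D")
    case True
    then obtain x where x: "D = p * x" by (rule dvdE)
    have "\<exists>K q. D ^ K * d * h ^ (E * N) * (\<Prod>i\<in>R. L i ^ (\<kappa> i * (E div e i) * N)) = q * prod_list ps ^ (E * N)" for N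
    proof -
      obtain K q where "D ^ K * d * h ^ (E * N) * (\<Prod>i\<in>R. L i ^ (\<kappa> i * (E div e i) * N)) = q * prod_list (p # ps) ^ (E * N)"
        using Cons.prems(2) by blast
      then show ?thesis
        by (intro exI[of _ K] exI[of _ "q * p ^ (E * N)"]) (simp add: power_mult_distrib mult_ac)
    qed
    from Cons.IH[OF ps this] obtain M where "prod_list ps dvd D ^ M * h" by blast
    then have "p * prod_list ps dvd D * (D ^ M * h)" using True by (intro mult_dvd_mono)
    then show ?thesis by (intro exI[of _ "Suc M"]) (simp add: mult_ac)
  next
    case nD: False
    have "p dvd h"
    proof (rule ccontr)
      assume nh: "\<not> p dvd h"
      define P where "P = (\<lambda>N. \<Prod>i\<in>R. L i ^ (\<kappa> i * (E div e i) * N))"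
      have dv: "p ^ (E * N) dvd d * P N" for N
      proof -
        obtain K q where K: "D ^ K * d * h ^ (E * N) * P N = q * prod_list (p # ps) ^ (E * N)"
          using Cons.prems(2) unfolding P_def by blast
        have "p ^ (E * N) dvd q * prod_list (p # ps) ^ (E * N)"
          by (simp add: power_mult_distrib)
        then have "p ^ (E * N) dvd (D ^ K * h ^ (E * N)) * (d * P N)"
          unfolding K[symmetric] by (simp only: mult_ac)
        moreover have "\<not> p dvd D ^ K * h ^ (E * N)"
          using nD nh prime_elem_dvd_multD[OF p(2)] prime_elem_dvd_power[OF p(2)] by blast
        ultimately show ?thesis by (rule prime_power_dvd_cancel[OF p(2), rotated])
      qed
      show False
      proof (cases "\<exists>i\<in>R. p dvd L i")
        case False
        then have "\<not> p dvd P N" for N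
          unfolding P_def using prime_elem_dvd_prodD[OF p(2)] prime_elem_dvd_power[OF p(2)] by blast
        then have d2: "p ^ (E * N) dvd d" for N
          using prime_power_dvd_cancel[OF p(2), of "P N" "E * N" d] dv[of N] by (simp add: mult.commute)
        have "0 < E" unfolding E using e by (intro prod_pos) force
        then have "tdeg d < E * Suc (tdeg d)" by (cases E) auto
        then show False using irreducible_power_not_dvd[OF p(1) d] d2 by blast
      next
        case True
        then obtain i where i: "i \<in> R" "p dvd L i" by blast
        then obtain u where u: "L i = p * u" by (meson dvdE)
        have "u dvd 1" using irreducibleD[OF L[OF i(1)] u] p(1) by (auto simp: irreducible_def)
        then obtain u' where u': "u * u' = 1" by (metis dvdE)
        define Q where "Q = (\<lambda>N. \<Prod>k\<in>R - {i}. L k ^ (\<kappa> k * (E div e k) * N))"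
        define c where "c = (\<lambda>N. \<kappa> i * (E div e i) * N)"
        have PQ: "P N = L i ^ c N * Q N" for N
          unfolding P_def Q_def c_def using R i(1) by (rule prod.remove)
        have "\<not> p dvd L k" if "k \<in> R - {i}" for k
        proof
          assume "p dvd L k"
          then obtain w where "L k = p * w" by (rule dvdE)
          moreover have "L i * (u' * w) = (u * u') * (p * w)" by (simp only: u mult_ac)
          ultimately have "L k = L i * (u' * w)" by (simp only: u' mult_1_left)
          then have "L i dvd L k" by (rule dvdI)
          then show False using LL[of i k] that i(1) by auto
        qed
        then have nQ: "\<not> p dvd Q N" for N
          unfolding Q_def using prime_elem_dvd_prodD[OF p(2)] prime_elem_dvd_power[OF p(2)] by blast
        \<comment> \<open>The fixed factor \<open>d\<close> cannot contain a power of
          \<open>p\<close> beyond its own degree.\<close>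
        define N where "N = Suc (tdeg d)"
        have "p ^ (E * N) dvd Q N * (d * L i ^ c N)" using dv[of N] by (simp add: PQ mult_ac)
        from prime_power_dvd_cancel[OF p(2) nQ this] have 1: "p ^ (E * N) dvd p ^ c N * (u ^ c N * d)"
          by (simp add: u power_mult_distrib mult_ac)
        have ei: "0 < e i" using e[OF i(1)] by simp
        have "e i dvd E" unfolding E using R i(1) by (rule dvd_prodI)
        then have Ee: "E = e i * (E div e i)" by simp
        have "0 < E" unfolding E using e by (intro prod_pos) force
        then have q1: "1 \<le> E div e i" using Ee by (metis less_one linorder_not_less mult_0_right neq0_conv)
        \<comment> \<open>Because \<open>\<kappa> i < e i\<close>, the power of \<open>p\<close>
          coming from \<open>L i\<close> falls short of \<open>E * N\<close> by at least
          \<open>N\<close>, and \<open>d\<close> would have to supply the rest.\<close>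
        have "(\<kappa> i + 1) * (E div e i) \<le> e i * (E div e i)" using e[OF i(1)] by (intro mult_le_mono1) simp
        then have "\<kappa> i * (E div e i) + 1 \<le> E" using Ee q1 by (simp add: algebra_simps)
        then have "(\<kappa> i * (E div e i) + 1) * N \<le> E * N" by (rule mult_le_mono1)
        then have cN: "c N + N \<le> E * N" by (simp add: c_def algebra_simps)
        have "p ^ (c N + N) dvd p ^ (E * N)" using cN by (rule le_imp_power_dvd)
        from dvd_trans[OF this 1] have "p ^ c N * p ^ N dvd p ^ c N * (u ^ c N * d)" by (simp only: power_add)
        then have "p ^ N dvd u ^ c N * d" using p0 by (simp only: dvd_mult_cancel_left) simp
        then have "p ^ N dvd u' ^ c N * (u ^ c N * d)" by (rule dvd_mult)
        moreover have "u' ^ c N * (u ^ c N * d) = d"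
        proof -
          have "u' ^ c N * (u ^ c N * d) = (u * u') ^ c N * d" by (simp only: power_mult_distrib mult_ac)
          then show ?thesis by (simp add: u')
        qed
        ultimately have "p ^ N dvd d" by simp
        then show False using irreducible_power_not_dvd[OF p(1) d, of N] by (simp add: N_def del: power_Suc)
      qed
    qed
    then obtain h' where h': "h = p * h'" by (rule dvdE)
    have "\<exists>K q. D ^ K * d * h' ^ (E * N) * (\<Prod>i\<in>R. L i ^ (\<kappa> i * (E div e i) * N)) = q * prod_list ps ^ (E * N)" for N
    proof -
      obtain K q where K: "D ^ K * d * h ^ (E * N) * (\<Prod>i\<in>R. L i ^ (\<kappa> i * (E div e i) * N)) = q * prod_list (p # ps) ^ (E * N)"
        using Cons.prems(2) by blast
      then have "p ^ (E * N) * (D ^ K * d * h' ^ (E * N) * (\<Prod>i\<in>R. L i ^ (\<kappa> i * (E div e i) * N))) =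
          p ^ (E * N) * (q * prod_list ps ^ (E * N))"
        by (simp add: h' power_mult_distrib mult_ac)
      moreover have "p ^ (E * N) \<noteq> 0" using p0 by simp
      ultimately show ?thesis using mult_left_cancel by blast
    qed
    from Cons.IH[OF ps this] obtain M where "prod_list ps dvd D ^ M * h'" by blast
    then have "p * prod_list ps dvd p * (D ^ M * h')" by (rule mult_dvd_mono[OF dvd_refl])
    then show ?thesis by (intro exI[of _ M]) (simp add: h' mult_ac)
  qed
qed simp

section \<open>Averaging over roots of unity\<close>

definition scale :: "var \<Rightarrow> complex \<Rightarrow> mpoly \<Rightarrow> mpoly" where
  "scale v \<zeta> = ev const (\<lambda>u. if u = v then const \<zeta> * Xv u else Xv u)"

lemma ring_map_scale: "ring_map (scale v \<zeta>)"
  unfolding scale_def by (intro ring_map_ev ring_map_const)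

lemma scale_single: "scale v \<zeta> (sg \<mu> a) = sg \<mu> (\<zeta> ^ lk \<mu> v * a)"
proof -
  have "mon (\<lambda>u. if u = v then const \<zeta> * Xv u else Xv u) \<mu> = mon (\<lambda>u. if u = v then const \<zeta> else 1) \<mu> * mon Xv \<mu>"
    unfolding mon_mult_fun[symmetric] by (intro mon_cong) auto
  also have "mon (\<lambda>u. if u = v then const \<zeta> else 1) \<mu> = (\<Prod>u\<in>insert v (ks \<mu>). (if u = v then const \<zeta> else 1) ^ lk \<mu> u)"
    by (intro mon_superset) auto
  also have "\<dots> = const \<zeta> ^ lk \<mu> v * (\<Prod>u\<in>insert v (ks \<mu>) - {v}. (if u = v then const \<zeta> else 1) ^ lk \<mu> u)"
    by (subst prod.remove[of _ v]) auto
  also have "(\<Prod>u\<in>insert v (ks \<mu>) - {v}. (if u = v then const \<zeta> else 1) ^ lk \<mu> u) = (1::mpoly)"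
    by (intro prod.neutral) auto
  finally have m: "mon (\<lambda>u. if u = v then const \<zeta> * Xv u else Xv u) \<mu> = const \<zeta> ^ lk \<mu> v * 1 * mon Xv \<mu>" .
  show ?thesis
    unfolding scale_def ev_single[OF ring_map_const] m by (simp add: single_eq const_hom mult_ac)
qed

lemma lk_scale: "lk (scale v \<zeta> f) \<mu> = \<zeta> ^ lk \<mu> v * lk f \<mu>"
proof (induction f rule: mpoly_induct)
  case (single \<nu> a)
  then show ?case by (simp add: scale_single lookup_single when_def)
qed (simp add: ring_map_add[OF ring_map_scale] lookup_add distrib_left)

lemma scale_Pring: "f \<in> Pring V \<Longrightarrow> scale v \<zeta> f \<in> Pring V"
  by (auto simp: Pring_def in_keys_iff lk_scale)

text \<open>Orthogonality of the characters of the group of \<open>e\<close>-th roots of unity; the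
  exponent \<open>e - k\<close> plays the role of \<open>- k\<close>.\<close>

lemma roots_of_unity_average:
  fixes e :: nat
  assumes e: "0 < e"
  shows "\<exists>\<zeta>::complex. \<zeta> ^ e = 1 \<and> (\<forall>k<e. \<forall>x. (\<Sum>a<e. (\<zeta> ^ a) ^ (e - k) * (\<zeta> ^ a) ^ x) = (if x mod e = k then of_nat e else 0))"
proof -
  define \<zeta> :: complex where "\<zeta> = exp (2 * of_real pi * \<i> * of_nat 1 / of_nat e)"
  have pw: "\<zeta> ^ j = exp (2 * of_real pi * \<i> * of_nat j / of_nat e)" for j
    unfolding \<zeta>_def by (simp add: mult_ac flip: exp_of_nat_mult)
  have \<zeta>1: "\<zeta> ^ e = 1" unfolding pw using e by (subst complex_root_unity_eq_1) auto
  have "(\<Sum>a<e. (\<zeta> ^ a) ^ (e - k) * (\<zeta> ^ a) ^ x) = (if x mod e = k then of_nat e else 0)" if k: "k < e" for k x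
  proof -
  define t where "t = \<zeta> ^ (e - k + x)"
  have "t ^ e = (\<zeta> ^ e) ^ (e - k + x)" by (simp add: t_def mult.commute flip: power_mult)
  then have te: "t ^ e = 1" using \<zeta>1 by simp
  have s: "(\<Sum>a<e. (\<zeta> ^ a) ^ (e - k) * (\<zeta> ^ a) ^ x) = (\<Sum>a<e. t ^ a)"
  proof (rule sum.cong)
    fix a
    have "(\<zeta> ^ a) ^ (e - k) * (\<zeta> ^ a) ^ x = (\<zeta> ^ a) ^ (e - k + x)" by (rule power_add[symmetric])
    also have "\<dots> = t ^ a" unfolding t_def by (simp only: mult.commute flip: power_mult)
    finally show "(\<zeta> ^ a) ^ (e - k) * (\<zeta> ^ a) ^ x = t ^ a" .
  qed simp
  have "t = 1 \<longleftrightarrow> e dvd (e - k + x)"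
    unfolding t_def pw using e by (subst complex_root_unity_eq_1) auto
  also have "\<dots> \<longleftrightarrow> x mod e = k"
  proof
    assume "e dvd e - k + x"
    then have "(e - k + x + k) mod e = k mod e" by (metis add.commute mod_add_self2 mod_mod_trivial dvd_eq_mod_eq_0 mod_add_left_eq add_0)
    then show "x mod e = k" using k by (simp add: add.commute)
  next
    assume x: "x mod e = k"
    have "(e - k + x) mod e = (e - k + x mod e) mod e" by (simp add: mod_add_right_eq)
    then show "e dvd e - k + x" using k x by (simp add: dvd_eq_mod_eq_0)
  qed
  finally have t1: "t = 1 \<longleftrightarrow> x mod e = k" .
  show ?thesis
  proof (cases "t = 1")
    case True
    then show ?thesis unfolding s using t1 by simp
  next
    case False
    then have "(\<Sum>a<e. t ^ a) = 0" using te by (simp add: geometric_sum)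
    then show ?thesis unfolding s using t1 False by simp
  qed
  qed
  then show ?thesis using \<zeta>1 by blast
qed

context arrangement
begin

text \<open>\<open>a / b\<close> is almost integral over the quotient ring; unlike integrality this is visibly closed
  under sums.\<close>

definition almost_integral :: "mpoly \<Rightarrow> mpoly \<Rightarrow> bool" where
  "almost_integral b a \<longleftrightarrow> b \<in> Pring V \<and> a \<in> Pring V \<and>
    (\<exists>\<delta>\<in>Pring V. \<delta> \<notin> I \<and> (\<forall>N. \<exists>q\<in>Pring V. cg (\<delta> * a ^ N) (q * b ^ N)))"

text \<open>The multiplier \<open>b ^ d\<close> clears the powers of \<open>a / b\<close> below
  \<open>d\<close> directly; the monic relation reduces every higher power to lower ones.\<close>

lemma almost_integral_integral:
  assumes a: "a \<in> Pring V" and b: "b \<in> Pring V" "b \<notin> I"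
    and cs: "\<And>i. i < d \<Longrightarrow> cs i \<in> Pring V" and rel: "a ^ d + (\<Sum>i<d. cs i * a ^ i * b ^ (d - i)) \<in> I"
  shows "almost_integral b a"
proof -
  have "\<exists>q\<in>Pring V. cg (b ^ d * a ^ N) (q * b ^ N)" for N
  proof (induction N rule: less_induct)
    case (less N)
    show ?case
    proof (cases "N < d")
      case True
      then have "b ^ d = b ^ (d - N) * b ^ N" by (simp flip: power_add)
      then have "b ^ d * a ^ N = (b ^ (d - N) * a ^ N) * b ^ N" by (simp add: mult_ac)
      moreover have "b ^ (d - N) * a ^ N \<in> Pring V" using a b by auto
      moreover have "(b ^ (d - N) * a ^ N) * b ^ N \<in> Pring V" using a b by auto
      ultimately show ?thesis using cg_refl by metis
    next
      case False
      have "\<forall>i. i < d \<longrightarrow> (\<exists>q\<in>Pring V. cg (b ^ d * a ^ (N - d + i)) (q * b ^ (N - d + i)))"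
        using less False by auto
      then obtain q where q: "\<And>i. i < d \<Longrightarrow> q i \<in> Pring V"
        "\<And>i. i < d \<Longrightarrow> cg (b ^ d * a ^ (N - d + i)) (q i * b ^ (N - d + i))" by metis
      have c1: "cg (a ^ d) (- (\<Sum>i<d. cs i * a ^ i * b ^ (d - i)))"
      proof -
        have "(\<Sum>i<d. cs i * a ^ i * b ^ (d - i)) \<in> Pring V" using a b cs by (intro Pring_sum Pring_mult Pring_power) auto
        then show ?thesis using rel a by (auto simp: cg_def)
      qed
      have "cg (b ^ d * a ^ (N - d) * a ^ d) (b ^ d * a ^ (N - d) * (- (\<Sum>i<d. cs i * a ^ i * b ^ (d - i))))"
        using a b by (intro cg_mult[OF cg_refl c1]) auto
      also have "b ^ d * a ^ (N - d) * a ^ d = b ^ d * a ^ N"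
        using False by (simp add: mult.assoc flip: power_add)
      also have "b ^ d * a ^ (N - d) * (- (\<Sum>i<d. cs i * a ^ i * b ^ (d - i))) =
          (\<Sum>i<d. (- cs i * b ^ (d - i)) * (b ^ d * a ^ (N - d + i)))"
        by (simp add: sum_distrib_left sum_negf power_add mult_ac)
      finally have "cg (b ^ d * a ^ N) (\<Sum>i<d. (- cs i * b ^ (d - i)) * (b ^ d * a ^ (N - d + i)))" .
      also have "cg (\<Sum>i<d. (- cs i * b ^ (d - i)) * (b ^ d * a ^ (N - d + i))) (\<Sum>i<d. (- cs i * b ^ (d - i)) * (q i * b ^ (N - d + i)))"
      proof (rule cg_sum)
        fix i assume "i \<in> {..<d}"
        then have i: "i < d" by simp
        have "- cs i * b ^ (d - i) \<in> Pring V" using cs[OF i] b by auto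
        then show "cg ((- cs i * b ^ (d - i)) * (b ^ d * a ^ (N - d + i))) ((- cs i * b ^ (d - i)) * (q i * b ^ (N - d + i)))"
          by (rule cg_mult[OF cg_refl q(2)[OF i]])
      qed
      finally (cg_trans) have c2: "cg (b ^ d * a ^ N) (\<Sum>i<d. (- cs i * b ^ (d - i)) * (q i * b ^ (N - d + i)))" .
      have "(\<Sum>i<d. (- cs i * b ^ (d - i)) * (q i * b ^ (N - d + i))) = (\<Sum>i<d. - cs i * q i) * b ^ N"
        unfolding sum_distrib_right
      proof (rule sum.cong)
        fix i assume "i \<in> {..<d}"
        then have "b ^ N = b ^ (d - i) * b ^ (N - d + i)" using False by (simp flip: power_add)
        then show "(- cs i * b ^ (d - i)) * (q i * b ^ (N - d + i)) = - cs i * q i * b ^ N" by (simp add: mult_ac)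
      qed simp
      moreover have "(\<Sum>i<d. - cs i * q i) \<in> Pring V" using cs q by (intro Pring_sum Pring_mult) auto
      ultimately show ?thesis using c2 by metis
    qed
  qed
  moreover have "b ^ d \<notin> I" using prime_power[OF prime_I b(1)] b(2) by blast
  moreover have "b ^ d \<in> Pring V" using b by auto
  ultimately show ?thesis unfolding almost_integral_def using a b by blast
qed

lemma prod_not_I: "a \<in> Pring V \<Longrightarrow> b \<in> Pring V \<Longrightarrow> a \<notin> I \<Longrightarrow> b \<notin> I \<Longrightarrow> a * b \<notin> I"
  using prime_cases[OF prime_I] by blast

text \<open>In the binomial expansion the product of the two multipliers clears every term.\<close>

lemma almost_integral_add:
  assumes "almost_integral b x" "almost_integral b y" shows "almost_integral b (x + y)"
proof -
  obtain \<delta> where d: "\<delta> \<in> Pring V" "\<delta> \<notin> I" "\<forall>N. \<exists>q\<in>Pring V. cg (\<delta> * x ^ N) (q * b ^ N)"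
    using assms(1) unfolding almost_integral_def by blast
  obtain \<delta>' where d': "\<delta>' \<in> Pring V" "\<delta>' \<notin> I" "\<forall>N. \<exists>q\<in>Pring V. cg (\<delta>' * y ^ N) (q * b ^ N)"
    using assms(2) unfolding almost_integral_def by blast
  have V: "b \<in> Pring V" "x \<in> Pring V" "y \<in> Pring V" using assms by (auto simp: almost_integral_def)
  obtain q where q: "\<And>N. q N \<in> Pring V" "\<And>N. cg (\<delta> * x ^ N) (q N * b ^ N)" using d(3) by metis
  obtain q' where q': "\<And>N. q' N \<in> Pring V" "\<And>N. cg (\<delta>' * y ^ N) (q' N * b ^ N)" using d'(3) by metis
  have nat_V: "(of_nat k :: mpoly) \<in> Pring V" for k by (induction k) auto
  have "\<exists>Q\<in>Pring V. cg (\<delta> * \<delta>' * (x + y) ^ N) (Q * b ^ N)" for N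
  proof -
    have "\<delta> * \<delta>' * (x + y) ^ N = (\<Sum>k\<le>N. of_nat (N choose k) * ((\<delta> * x ^ k) * (\<delta>' * y ^ (N - k))))"
      unfolding binomial_ring sum_distrib_left by (intro sum.cong) (simp_all add: mult_ac)
    also have "cg (\<Sum>k\<le>N. of_nat (N choose k) * ((\<delta> * x ^ k) * (\<delta>' * y ^ (N - k))))
        (\<Sum>k\<le>N. of_nat (N choose k) * ((q k * b ^ k) * (q' (N - k) * b ^ (N - k))))"
      by (intro cg_sum cg_mult[OF cg_refl] cg_mult q q' nat_V)
    also have "(\<Sum>k\<le>N. of_nat (N choose k) * ((q k * b ^ k) * (q' (N - k) * b ^ (N - k)))) =
        (\<Sum>k\<le>N. of_nat (N choose k) * q k * q' (N - k)) * b ^ N"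
      unfolding sum_distrib_right
    proof (rule sum.cong)
      fix k assume "k \<in> {..N}"
      then have "b ^ N = b ^ k * b ^ (N - k)" by (simp flip: power_add)
      then show "of_nat (N choose k) * ((q k * b ^ k) * (q' (N - k) * b ^ (N - k))) = of_nat (N choose k) * q k * q' (N - k) * b ^ N"
        by (simp add: mult_ac)
    qed simp
    finally show ?thesis
      using q q' nat_V by (intro bexI[of _ "\<Sum>k\<le>N. of_nat (N choose k) * q k * q' (N - k)"] Pring_sum Pring_mult)
  qed
  moreover have "\<delta> * \<delta>' \<notin> I" using prod_not_I d d' by blast
  moreover have "\<delta> * \<delta>' \<in> Pring V" using d d' by auto
  ultimately show ?thesis unfolding almost_integral_def using V by blast
qed

lemma almost_integral_mult:
  assumes s: "s \<in> Pring V" and x: "almost_integral b x" shows "almost_integral b (s * x)"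
proof -
  obtain \<delta> where d: "\<delta> \<in> Pring V" "\<delta> \<notin> I" "\<And>N. \<exists>q\<in>Pring V. cg (\<delta> * x ^ N) (q * b ^ N)"
    using x unfolding almost_integral_def by blast
  have "\<exists>q\<in>Pring V. cg (\<delta> * (s * x) ^ N) (q * b ^ N)" for N
  proof -
    obtain q where q: "q \<in> Pring V" "cg (\<delta> * x ^ N) (q * b ^ N)" using d(3) by blast
    have "cg (s ^ N * (\<delta> * x ^ N)) (s ^ N * (q * b ^ N))" using s by (intro cg_mult[OF cg_refl q(2)]) auto
    then have "cg (\<delta> * (s * x) ^ N) ((s ^ N * q) * b ^ N)" by (simp add: power_mult_distrib mult_ac)
    moreover have "s ^ N * q \<in> Pring V" using s q by auto
    ultimately show ?thesis by blast
  qed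
  moreover have "s * x \<in> Pring V" "b \<in> Pring V" using s x by (auto simp: almost_integral_def)
  ultimately show ?thesis unfolding almost_integral_def using d(1,2) by blast
qed

lemma almost_integral_sum:
  assumes "finite A" "b \<in> Pring V" "\<And>x. x \<in> A \<Longrightarrow> almost_integral b (F x)" shows "almost_integral b (sum F A)"
  using assms(1,3)
proof (induction A rule: finite_induct)
  case empty
  have "\<exists>q\<in>Pring V. cg (1 * 0 ^ N) (q * b ^ N)" for N
    using cg_refl[of 0] cg_refl[of 1]
    by (intro bexI[of _ "if N = 0 then 1 else 0"]) (auto simp: power_0_left)
  then show ?case unfolding almost_integral_def using assms(2) prime_1[OF prime_I]
    by (intro conjI bexI[of _ 1]) auto
qed (simp add: almost_integral_add)

lemma almost_integral_cg:
  assumes "almost_integral b x" "cg x y" shows "almost_integral b y"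
proof -
  obtain \<delta> where d: "\<delta> \<in> Pring V" "\<delta> \<notin> I" "\<And>N. \<exists>q\<in>Pring V. cg (\<delta> * x ^ N) (q * b ^ N)"
    using assms(1) unfolding almost_integral_def by blast
  have "\<exists>q\<in>Pring V. cg (\<delta> * y ^ N) (q * b ^ N)" for N
  proof -
    obtain q where q: "q \<in> Pring V" "cg (\<delta> * x ^ N) (q * b ^ N)" using d(3) by blast
    have "cg (\<delta> * y ^ N) (\<delta> * x ^ N)" by (intro cg_mult[OF cg_refl[OF d(1)]] cg_power cg_sym[OF assms(2)])
    then show ?thesis using q cg_trans by blast
  qed
  moreover have "y \<in> Pring V" "b \<in> Pring V" using assms by (auto simp: almost_integral_def cg_def)
  ultimately show ?thesis unfolding almost_integral_def using d(1,2) by blast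
qed

lemma cg_cancel:
  assumes "f \<in> Pring V" "f \<notin> I" "x \<in> Pring V" "y \<in> Pring V" "cg (f * x) (f * y)" shows "cg x y"
proof -
  have "f * (x - y) \<in> I" using assms(5) by (simp add: cg_def right_diff_distrib)
  moreover have "x - y \<in> Pring V" using assms by auto
  ultimately have "x - y \<in> I" using prime_cases[OF prime_I assms(1)] assms(2) by blast
  then show ?thesis using assms by (simp add: cg_def)
qed

end

section \<open>Almost integral elements on a chart\<close>

lemma rs_rs: "rs P (rs Q f) = rs (\<lambda>\<mu>. P \<mu> \<and> Q \<mu>) f"
  by (rule poly_mapping_eqI) (simp add: lk_rs)

lemma rs_none: "(\<And>\<mu>. \<mu> \<in> ks f \<Longrightarrow> \<not> P \<mu>) \<Longrightarrow> rs P f = 0"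
  by (rule poly_mapping_eqI) (auto simp: lk_rs in_keys_iff)

lemma scale_const: "scale v \<zeta> (const a) = const a"
  by (simp add: scale_def ring_map_const)

lemma scale_scale: "scale v \<zeta> (scale v \<xi> f) = scale v (\<zeta> * \<xi>) f"
  by (rule poly_mapping_eqI) (simp add: lk_scale power_mult_distrib)

lemma scale_1: "scale v 1 f = f"
  by (rule poly_mapping_eqI) (simp add: lk_scale)

context arrangement
begin

text \<open>\<open>T i j\<close> occurs in the monomials of a generator only with exponent 0 or
  \<open>l i j\<close>, so the substitution fixes all generators.\<close>

lemma scale_I:
  assumes \<zeta>: "\<zeta> ^ l i j = 1" and f: "f \<in> I" shows "scale (T i j) \<zeta> f \<in> I"
proof -
  let ?P = "{f \<in> Pring V. scale (T i j) \<zeta> f \<in> I}"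
  have "is_ideal V ?P"
    unfolding is_ideal_def
    by (auto simp: ring_map_0[OF ring_map_scale] ring_map_add[OF ring_map_scale] ring_map_mult[OF ring_map_scale] I_simps
        intro: ideal_add[OF ideal_I] ideal_mult[OF ideal_I] scale_Pring)
  moreover have "{Defs.gpoly r n l v | v. v \<in> kerL} \<subseteq> ?P"
  proof
    fix g assume "g \<in> {Defs.gpoly r n l v | v. v \<in> kerL}"
    then obtain v where v: "v \<in> kerL" "g = Defs.gpoly r n l v" by blast
    have gI: "g \<in> I" unfolding I_def using v by (intro ideal_gen_base) blast
    have "scale (T i j) \<zeta> g = g"
      unfolding v(2) Defs.gpoly_def ring_map_sum[OF ring_map_scale] scale_single
      by (intro sum.cong) (auto simp: lk_Tmon \<zeta>)
    then show "g \<in> ?P" using gI ideal_sub[OF ideal_I gI] by simp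
  qed
  ultimately have "I \<subseteq> ?P" unfolding I_def by (rule ideal_gen_minimal)
  then show ?thesis using f by blast
qed

lemma scale_cg: "\<zeta> ^ l i j = 1 \<Longrightarrow> cg x y \<Longrightarrow> cg (scale (T i j) \<zeta> x) (scale (T i j) \<zeta> y)"
  unfolding cg_def using scale_I[of \<zeta> i j "x - y"] by (simp add: scale_Pring ring_map_diff[OF ring_map_scale])

lemma almost_integral_scale:
  assumes \<zeta>: "\<zeta> ^ l i j = 1" "0 < l i j" and b: "scale (T i j) \<zeta> b = b" and a: "almost_integral b a"
  shows "almost_integral b (scale (T i j) \<zeta> a)"
proof -
  let ?s = "scale (T i j) \<zeta>"
  obtain \<delta> where d: "\<delta> \<in> Pring V" "\<delta> \<notin> I" "\<And>N. \<exists>q\<in>Pring V. cg (\<delta> * a ^ N) (q * b ^ N)"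
    using a unfolding almost_integral_def by blast
  have V: "a \<in> Pring V" "b \<in> Pring V" using a by (auto simp: almost_integral_def)
  have "\<zeta> \<noteq> 0" using \<zeta> by (metis power_0_left less_numeral_extra(3) zero_neq_one)
  then have inv: "inverse \<zeta> ^ l i j = 1" "inverse \<zeta> * \<zeta> = 1" using \<zeta>(1) by (simp_all add: power_inverse)
  have "?s \<delta> \<notin> I"
  proof
    assume "?s \<delta> \<in> I"
    then have "scale (T i j) (inverse \<zeta>) (?s \<delta>) \<in> I" by (rule scale_I[OF inv(1)])
    then show False using d(2) by (simp add: scale_scale inv(2) scale_1)
  qed
  moreover have "\<exists>q\<in>Pring V. cg (?s \<delta> * ?s a ^ N) (q * b ^ N)" for N
  proof -
    obtain q where q: "q \<in> Pring V" "cg (\<delta> * a ^ N) (q * b ^ N)" using d(3) by blast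
    have "cg (?s (\<delta> * a ^ N)) (?s (q * b ^ N))" by (rule scale_cg[OF \<zeta>(1) q(2)])
    then have "cg (?s \<delta> * ?s a ^ N) (?s q * b ^ N)"
      by (simp only: ring_map_mult[OF ring_map_scale] ring_map_power[OF ring_map_scale] b)
    then show ?thesis using scale_Pring[OF q(1)] by blast
  qed
  ultimately show ?thesis unfolding almost_integral_def using scale_Pring V d(1) by blast
qed

text \<open>Averaging over the roots of unity acting on one variable extracts the part of \<open>a\<close> in a
  residue class of exponents.\<close>

lemma almost_integral_part:
  assumes e: "0 < l i j" and k: "k < l i j"
    and b: "\<And>\<zeta>. \<zeta> ^ l i j = 1 \<Longrightarrow> scale (T i j) \<zeta> b = b" and a: "almost_integral b a"
  shows "almost_integral b (rs (\<lambda>\<mu>. lk \<mu> (T i j) mod l i j = k) a)"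
proof -
  obtain \<zeta> :: complex where \<zeta>: "\<zeta> ^ l i j = 1"
    "\<And>k x. k < l i j \<Longrightarrow> (\<Sum>t<l i j. (\<zeta> ^ t) ^ (l i j - k) * (\<zeta> ^ t) ^ x) = (if x mod l i j = k then of_nat (l i j) else 0)"
    using roots_of_unity_average[OF e] by blast
  have t: "(\<zeta> ^ t) ^ l i j = 1" for t
  proof -
    have "(\<zeta> ^ t) ^ l i j = (\<zeta> ^ l i j) ^ t" by (simp only: mult.commute flip: power_mult)
    then show ?thesis by (simp add: \<zeta>(1))
  qed
  have eq: "rs (\<lambda>\<mu>. lk \<mu> (T i j) mod l i j = k) a =
      const (1 / of_nat (l i j)) * (\<Sum>t<l i j. const ((\<zeta> ^ t) ^ (l i j - k)) * scale (T i j) (\<zeta> ^ t) a)" (is "_ = ?R")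
  proof (rule poly_mapping_eqI)
    fix \<mu>
    have "lk ?R \<mu> = 1 / of_nat (l i j) * ((\<Sum>t<l i j. (\<zeta> ^ t) ^ (l i j - k) * (\<zeta> ^ t) ^ lk \<mu> (T i j)) * lk a \<mu>)"
      unfolding lk_cmult lookup_sum lk_scale sum_distrib_right by (simp only: mult.assoc)
    then show "lk (rs (\<lambda>\<mu>. lk \<mu> (T i j) mod l i j = k) a) \<mu> = lk ?R \<mu>"
      unfolding \<zeta>(2)[OF k] using e by (simp add: lk_rs)
  qed
  have bV: "b \<in> Pring V" using a by (simp add: almost_integral_def)
  show ?thesis unfolding eq
    by (intro almost_integral_mult almost_integral_sum bV almost_integral_scale t e b a Pring_const) auto
qed

lemma almost_integral_parts:
  assumes R: "finite R" "\<And>i. i \<in> R \<Longrightarrow> 0 < l i (j i) \<and> k i < l i (j i)"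
    and b: "\<And>i \<zeta>. i \<in> R \<Longrightarrow> \<zeta> ^ l i (j i) = 1 \<Longrightarrow> scale (T i (j i)) \<zeta> b = b" and a: "almost_integral b a"
  shows "almost_integral b (rs (\<lambda>\<mu>. \<forall>i\<in>R. lk \<mu> (T i (j i)) mod l i (j i) = k i) a)"
  using R b
proof (induction R rule: finite_induct)
  case empty
  have "rs (\<lambda>\<mu>. \<forall>i\<in>{}. lk \<mu> (T i (j i)) mod l i (j i) = k i) a = a" by (rule rs_all) simp
  then show ?case using a by simp
next
  case (insert i R)
  have "almost_integral b (rs (\<lambda>\<mu>. lk \<mu> (T i (j i)) mod l i (j i) = k i) (rs (\<lambda>\<mu>. \<forall>i\<in>R. lk \<mu> (T i (j i)) mod l i (j i) = k i) a))"
    by (intro almost_integral_part insert.IH) (use insert.prems in auto)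
  then show ?case by (simp add: rs_rs)
qed

end

context selection
begin

lemma scale_eps:
  assumes \<zeta>: "\<zeta> ^ e i = 1" and g: "g \<in> Pring EJ"
  shows "scale (T i (J i)) \<zeta> (eps g) = eps g"
  using g
proof (induction g rule: Pring_induct)
  case (const a)
  then show ?case by (simp add: scale_const)
next
  case (add f g)
  then show ?case by (simp add: eps_hom ring_map_add[OF ring_map_scale])
next
  case (Xv v f)
  have "scale (T i (J i)) \<zeta> (eps (Xv v)) = eps (Xv v)"
  proof (cases "v \<in> W")
    case True
    then obtain k where v: "v = T k 0" by (auto simp: W_def)
    show ?thesis
      unfolding v eps_Xv using \<zeta> by (auto simp: Tp_def mon_Xv scale_single lk_Tmon e_def)
  next
    case False
    then have "v \<in> V" "v \<noteq> T i (J i)" using Xv by (auto simp: EJ_def)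
    then show ?thesis
      unfolding eps_Xv_V[OF \<open>v \<in> V\<close>] unfolding Xv_def scale_single by (simp add: lookup_single when_def)
  qed
  then show ?case using Xv by (simp add: eps_hom ring_map_mult[OF ring_map_scale])
qed

text \<open>A selected variable enters \<open>eps g\<close> only through its block monomial. This is
  extracted from the invariance of \<open>eps g\<close> under all \<open>e i\<close>-th roots of
  unity.\<close>

lemma eps_EJ_keys:
  assumes g: "g \<in> Pring EJ" and i: "i \<le> r" and \<nu>: "\<nu> \<in> ks (eps g)"
  shows "lk \<nu> (T i (J i)) mod e i = 0"
proof -
  obtain \<zeta> :: complex where \<zeta>: "\<zeta> ^ e i = 1"
    "\<And>k x. k < e i \<Longrightarrow> (\<Sum>t<e i. (\<zeta> ^ t) ^ (e i - k) * (\<zeta> ^ t) ^ x) = (if x mod e i = k then of_nat (e i) else 0)"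
    using roots_of_unity_average[OF e_pos[OF i]] by blast
  have t: "(\<zeta> ^ t) ^ e i = 1" for t
  proof -
    have "(\<zeta> ^ t) ^ e i = (\<zeta> ^ e i) ^ t" by (simp only: mult.commute flip: power_mult)
    then show ?thesis by (simp add: \<zeta>(1))
  qed
  have "(\<zeta> ^ t) ^ lk \<nu> (T i (J i)) = 1" for t
  proof -
    have "(\<zeta> ^ t) ^ lk \<nu> (T i (J i)) * lk (eps g) \<nu> = lk (eps g) \<nu>"
      using scale_eps[OF t g] lk_scale by metis
    then show ?thesis using \<nu> by (simp add: in_keys_iff)
  qed
  then have "(\<Sum>t<e i. (\<zeta> ^ t) ^ (e i - 0) * (\<zeta> ^ t) ^ lk \<nu> (T i (J i))) = of_nat (e i)" by (simp add: t)
  then show ?thesis using \<zeta>(2)[OF e_pos[OF i], of "lk \<nu> (T i (J i))"] e_pos[OF i] by (auto split: if_splits)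
qed

definition tj :: "(nat \<Rightarrow> nat) \<Rightarrow> (var \<Rightarrow>\<^sub>0 nat)" where
  "tj \<kappa> = (\<Sum>i\<le>r. sg (T i (J i)) (\<kappa> i))"

lemma TJ_eq: "TJ \<kappa> = sg (tj \<kappa>) 1"
  unfolding mon_Xv[symmetric] tj_def TJ_def by (simp add: mon_sum)

lemma lk_tj: "i \<le> r \<Longrightarrow> lk (tj \<kappa>) (T i (J i)) = \<kappa> i"
proof -
  assume i: "i \<le> r"
  have "lk (tj \<kappa>) (T i (J i)) = (\<Sum>k\<le>r. if k = i then \<kappa> i else 0)"
    unfolding tj_def lookup_sum by (intro sum.cong) (auto simp: lookup_single when_def)
  then show ?thesis using i by simp
qed

text \<open>By \<open>eps_EJ_keys\<close> the exponents of the selected variables in the term for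
  \<open>\<tau>\<close> are \<open>\<tau>\<close> modulo the \<open>e i\<close>, so residue classes
  separate the basis terms.\<close>

lemma part_TJ:
  assumes h: "\<And>\<kappa>. \<kappa> \<in> Box \<Longrightarrow> h \<kappa> \<in> Pring EJ" and \<kappa>: "\<kappa> \<in> Box"
  shows "rs (\<lambda>\<mu>. \<forall>i\<in>{..r}. lk \<mu> (T i (J i)) mod l i (J i) = \<kappa> i) (\<Sum>\<tau>\<in>Box. eps (h \<tau>) * TJ \<tau>) = eps (h \<kappa>) * TJ \<kappa>"
proof -
  let ?Q = "\<lambda>\<mu>. \<forall>i\<in>{..r}. lk \<mu> (T i (J i)) mod l i (J i) = \<kappa> i"
  have md: "lk (tj \<tau> + \<nu>) (T i (J i)) mod l i (J i) = \<tau> i" if "\<tau> \<in> Box" "\<nu> \<in> ks (eps (h \<tau>))" "i \<le> r" for \<tau> \<nu> i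
  proof -
    have "lk (tj \<tau> + \<nu>) (T i (J i)) mod e i = \<tau> i mod e i"
      using eps_EJ_keys[OF h[OF that(1)] that(3,2)] that(3) by (simp add: lookup_add lk_tj mod_add_right_eq[symmetric])
    also have "\<tau> i < e i" using that(1,3) unfolding Box_def by (auto dest: PiE_mem)
    then have "\<tau> i mod e i = \<tau> i" by simp
    finally show ?thesis by (simp add: e_def)
  qed
  have "rs ?Q (eps (h \<tau>) * TJ \<tau>) = (if \<tau> = \<kappa> then eps (h \<kappa>) * TJ \<kappa> else 0)" if \<tau>: "\<tau> \<in> Box" for \<tau>
  proof -
    have c: "eps (h \<tau>) * TJ \<tau> = sg (tj \<tau>) 1 * eps (h \<tau>)" by (simp add: TJ_eq mult.commute)
    have s: "rs ?Q (sg (tj \<tau>) 1 * eps (h \<tau>)) = sg (tj \<tau>) 1 * rs (\<lambda>\<mu>. ?Q (tj \<tau> + \<mu>)) (eps (h \<tau>))"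
      by (rule rs_shift) simp
    show ?thesis
    proof (cases "\<tau> = \<kappa>")
      case True
      have "rs (\<lambda>\<mu>. ?Q (tj \<tau> + \<mu>)) (eps (h \<tau>)) = eps (h \<tau>)"
        by (rule rs_all) (use md[OF \<tau>] True in simp)
      then show ?thesis unfolding c s using True by (simp add: TJ_eq mult.commute)
    next
      case False
      then have "\<exists>i\<le>r. \<tau> i \<noteq> \<kappa> i" using \<tau> \<kappa> unfolding Box_def by (metis PiE_ext atMost_iff)
      then obtain i where i: "i \<le> r" "\<tau> i \<noteq> \<kappa> i" by blast
      have "rs (\<lambda>\<mu>. ?Q (tj \<tau> + \<mu>)) (eps (h \<tau>)) = 0"
        by (rule rs_none) (use md[OF \<tau>] i in auto)
      then show ?thesis unfolding c s using False by simp
    qed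
  qed
  then have "rs ?Q (\<Sum>\<tau>\<in>Box. eps (h \<tau>) * TJ \<tau>) = (\<Sum>\<tau>\<in>Box. if \<tau> = \<kappa> then eps (h \<kappa>) * TJ \<kappa> else 0)"
    unfolding rs_sum by (intro sum.cong) auto
  then show ?thesis using \<kappa> finite_Box by simp
qed

definition zero_box :: "nat \<Rightarrow> nat" where
  "zero_box = restrict (\<lambda>_. 0) {..r}"

lemma zero_box_Box: "zero_box \<in> Box"
  unfolding zero_box_def by (auto simp only: Box_def restrict_PiE_iff lessThan_iff atMost_iff e_pos)

lemma TJ_zero_box: "TJ zero_box = 1"
  by (simp add: TJ_def zero_box_def)

text \<open>Coordinates with respect to the basis products are unique, and \<open>zero_box\<close>
  indexes the product 1. Congruences thereby become equations in the polynomial ring of the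
  chart.\<close>

lemma compare_zero_box:
  assumes g: "g \<in> Pring EJ" and h: "\<And>\<kappa>. \<kappa> \<in> Box \<Longrightarrow> h \<kappa> \<in> Pring EJ"
    and c: "cg (eps g) (\<Sum>\<kappa>\<in>Box. eps (h \<kappa>) * TJ \<kappa>)"
  shows "g = h zero_box"
proof -
  define h' where "h' = (\<lambda>\<kappa>. (if \<kappa> = zero_box then g else 0) - h \<kappa>)"
  have "(\<Sum>\<kappa>\<in>Box. eps (h' \<kappa>) * TJ \<kappa>) = (\<Sum>\<kappa>\<in>Box. if \<kappa> = zero_box then eps g else 0) - (\<Sum>\<kappa>\<in>Box. eps (h \<kappa>) * TJ \<kappa>)"
    unfolding sum_subtractf[symmetric] by (intro sum.cong) (auto simp: h'_def eps_hom TJ_zero_box left_diff_distrib)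
  then have "(\<Sum>\<kappa>\<in>Box. eps (h' \<kappa>) * TJ \<kappa>) = eps g - (\<Sum>\<kappa>\<in>Box. eps (h \<kappa>) * TJ \<kappa>)"
    using zero_box_Box finite_Box by simp
  then have "(\<Sum>\<kappa>\<in>Box. eps (h' \<kappa>) * TJ \<kappa>) \<in> slice_ideal UNIV"
    using c I_eq_slice by (simp add: cg_def)
  moreover have "h' \<kappa> \<in> Pring EJ" if "\<kappa> \<in> Box" for \<kappa> unfolding h'_def using g h[OF that] by (intro Pring_diff) auto
  ultimately have "\<forall>\<kappa>\<in>Box. h' \<kappa> = 0" by (intro independence)
  then have "h' zero_box = 0" using zero_box_Box by blast
  then show ?thesis by (simp add: h'_def)
qed

lemma eps_not_I: assumes "g \<in> Pring EJ" "g \<noteq> 0" shows "eps g \<notin> I"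
proof
  assume "eps g \<in> I"
  then have "cg (eps g) (\<Sum>\<kappa>\<in>Box. eps 0 * TJ \<kappa>)" using cg_0_iff eps_EJ[OF assms(1)] by (simp add: eps_hom)
  then show False using compare_zero_box[OF assms(1), of "\<lambda>_. 0"] assms(2) by simp
qed

text \<open>Moves denominators into the polynomial ring of the chart, where factorization is
  unique.\<close>

lemma ex_multiple:
  assumes "f \<in> Pring V" "f \<notin> I"
  shows "\<exists>g\<in>Pring EJ. g \<noteq> 0 \<and> (\<exists>f'\<in>Pring V. cg (f * f') (eps g))"
proof -
  have D0: "mon Xv DJ \<noteq> 0" by (metis mon_Xv keys_single keys_zero insert_not_empty zero_neq_one)
  obtain a f' where a: "a \<in> A" "a \<noteq> 0" "f' \<in> Pring V" "f * f' - a \<in> I"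
    using algebraic_multiple[OF prime_I subring_A A_V A_const A_DJ D0 spn_one spn_step finite_Box TJ_V assms] by blast
  obtain g where g: "g \<in> Pring EJ" "a = eps g" using a(1) unfolding A_def by blast
  have "g \<noteq> 0" using a(2) g(2) by (auto simp: eps_hom)
  moreover have "cg (f * f') (eps g)" using a(3,4) g assms(1) eps_EJ[OF g(1)] by (auto simp: cg_def)
  ultimately show ?thesis using g(1) a(3) by blast
qed

lemma almost_integral_multiple:
  assumes "almost_integral (eps g) a"
  shows "\<exists>d\<in>Pring EJ. d \<noteq> 0 \<and> (\<forall>N. \<exists>q\<in>Pring V. cg (eps d * a ^ N) (q * eps g ^ N))"
proof -
  obtain \<delta> where d: "\<delta> \<in> Pring V" "\<delta> \<notin> I" "\<And>N. \<exists>q\<in>Pring V. cg (\<delta> * a ^ N) (q * eps g ^ N)"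
    using assms unfolding almost_integral_def by blast
  have aV: "a \<in> Pring V" using assms by (simp add: almost_integral_def)
  obtain d0 f' where d0: "d0 \<in> Pring EJ" "d0 \<noteq> 0" "f' \<in> Pring V" "cg (\<delta> * f') (eps d0)"
    using ex_multiple[OF d(1,2)] by blast
  have "\<exists>q\<in>Pring V. cg (eps d0 * a ^ N) (q * eps g ^ N)" for N
  proof -
    obtain q where q: "q \<in> Pring V" "cg (\<delta> * a ^ N) (q * eps g ^ N)" using d(3) by blast
    have 1: "cg (eps d0 * a ^ N) (\<delta> * f' * a ^ N)" using aV by (intro cg_mult[OF cg_sym[OF d0(4)]] cg_refl) auto
    have 2: "cg (f' * (\<delta> * a ^ N)) (f' * (q * eps g ^ N))" by (intro cg_mult cg_refl d0(3) q(2))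
    have "cg (eps d0 * a ^ N) ((f' * q) * eps g ^ N)"
      by (rule cg_trans[OF 1]) (use 2 in \<open>simp only: mult_ac\<close>)
    moreover have "f' * q \<in> Pring V" using d0(3) q(1) by auto
    ultimately show ?thesis by blast
  qed
  then show ?thesis using d0(1,2) by blast
qed

definition Di :: "nat \<Rightarrow> mpoly" where
  "Di i = (\<Prod>j\<in>{1..n i} - {J i}. Xv (T i j) ^ l i j)"

lemma Di_EJ: "i \<le> r \<Longrightarrow> Di i \<in> Pring EJ"
  unfolding Di_def by (intro Pring_prod Pring_power) (auto simp: EJ_def)

lemma eps_Di: "eps (Di i) = Di i"
  unfolding Di_def eps_hom by (intro prod.cong) (auto simp: eps_Xv)

lemma Tp_Di: "i \<le> r \<Longrightarrow> Tp i = Xv (T i (J i)) ^ e i * Di i"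
  unfolding Tp_def mon_Tmon Di_def e_def using J by (intro prod.remove) auto

lemma ell_EJ: "ell i \<in> Pring EJ"
  using Pring_mono[OF ell_Pring] by (simp add: EJ_def)

text \<open>Powers with exponent \<open>E * N\<close>, where all \<open>e i\<close> divide
  \<open>E\<close>, turn the roots in \<open>TJ \<kappa>\<close> into powers of the
  \<open>ell i\<close>. Comparing coordinates at 1 gives, for every \<open>N\<close>, an identity in
  the polynomial ring of the chart, to which the valuation argument of
  \<open>dvd_of_power_relations\<close> applies.\<close>

lemma almost_integral_component:
  assumes g: "g \<in> Pring EJ" "g \<noteq> 0" and h: "h \<in> Pring EJ" and \<kappa>: "\<kappa> \<in> Box"
    and ai: "almost_integral (eps g) (eps h * TJ \<kappa>)"
  shows "\<exists>M. \<exists>q\<in>Pring EJ. mon Xv DJ ^ M * h = q * g"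
proof -
  obtain c ps where c: "c \<noteq> 0" "\<forall>p\<in>set ps. irreducible p" "g = const c * prod_list ps"
    using irreducible_factorization[OF g(2)] by blast
  obtain d where d: "d \<in> Pring EJ" "d \<noteq> 0" "\<And>N. \<exists>q\<in>Pring V. cg (eps d * (eps h * TJ \<kappa>) ^ N) (q * eps g ^ N)"
    using almost_integral_multiple[OF ai] by blast
  define E where "E = (\<Prod>i\<le>r. e i)"
  have ki: "\<kappa> i < e i" if "i \<le> r" for i using \<kappa> that unfolding Box_def by (auto dest: PiE_mem)
  have Ee: "e i * (E div e i) = E" if "i \<le> r" for i
  proof -
    have "e i dvd E" unfolding E_def using that by (intro dvd_prodI) auto
    then show ?thesis by simp
  qed
  have rel: "\<exists>K q. mon Xv DJ ^ K * d * h ^ (E * N) * (\<Prod>i\<in>{..r}. ell i ^ (\<kappa> i * (E div e i) * N)) = q * prod_list ps ^ (E * N)" for N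
  proof -
    define s where "s = (\<lambda>i. \<kappa> i * (E div e i) * N)"
    \<comment> \<open>The unselected variables that complete the powers of the selected ones to full
      block monomials \<open>Tp i\<close>.\<close>
    define C where "C = (\<Prod>i\<le>r. Di i ^ s i)"
    define L where "L = (\<Prod>i\<le>r. ell i ^ s i)"
    have CE: "C \<in> Pring EJ" unfolding C_def by (intro Pring_prod Pring_power Di_EJ) simp
    have LE: "L \<in> Pring EJ" unfolding L_def by (intro Pring_prod Pring_power ell_EJ)
    have eC: "eps C = C" unfolding C_def eps_hom by (simp add: eps_Di)
    have CV: "C \<in> Pring V" using eps_EJ[OF CE] eC by simp
    have "TJ \<kappa> ^ (E * N) = (\<Prod>i\<le>r. (Xv (T i (J i)) ^ e i) ^ s i)"
      unfolding TJ_def prod_power_distrib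
    proof (rule prod.cong)
      fix i assume "i \<in> {..r}"
      then have "\<kappa> i * (E * N) = e i * s i" using Ee[of i] unfolding s_def by (metis atMost_iff mult.assoc mult.commute)
      then show "(Xv (T i (J i)) ^ \<kappa> i) ^ (E * N) = (Xv (T i (J i)) ^ e i) ^ s i" by (simp only: flip: power_mult)
    qed simp
    then have "C * TJ \<kappa> ^ (E * N) = (\<Prod>i\<le>r. Tp i ^ s i)"
      unfolding C_def by (simp add: Tp_Di power_mult_distrib prod.distrib mult.commute)
    moreover have "cg (\<Prod>i\<le>r. Tp i ^ s i) (eps L)" unfolding L_def eps_hom by (intro cg_prod cg_power cg_Tp) simp
    ultimately have 1: "cg (C * TJ \<kappa> ^ (E * N)) (eps L)" by (simp only:)
    obtain q0 where q0: "q0 \<in> Pring V" "cg (eps d * (eps h * TJ \<kappa>) ^ (E * N)) (q0 * eps g ^ (E * N))" using d(3) by blast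
    obtain K hh where hh: "\<And>\<tau>. \<tau> \<in> Box \<Longrightarrow> hh \<tau> \<in> Pring EJ" "cg (mon Xv DJ ^ K * (C * q0)) (\<Sum>\<tau>\<in>Box. eps (hh \<tau>) * TJ \<tau>)"
      using decomposition[of "C * q0"] CV q0(1) by blast
    have DE: "mon Xv DJ ^ K \<in> Pring EJ" "eps (mon Xv DJ ^ K) = mon Xv DJ ^ K"
      using mon_DJ_EJ by (auto simp: eps_hom eps_mon ks_DJ)
    have DV: "mon Xv DJ ^ K \<in> Pring V" using eps_EJ[OF DE(1)] DE(2) by simp
    let ?g = "mon Xv DJ ^ K * d * h ^ (E * N) * L"
    have gE: "?g \<in> Pring EJ" using DE d(1) h LE by auto
    have gN: "eps g ^ (E * N) \<in> Pring V" using eps_EJ[OF g(1)] by auto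
    have b1: "eps ?g = (mon Xv DJ ^ K * eps d * eps h ^ (E * N)) * eps L" by (simp only: eps_hom(4) eps_hom(9) DE(2)[unfolded eps_hom(9)])
    have b2: "cg ((mon Xv DJ ^ K * eps d * eps h ^ (E * N)) * eps L) ((mon Xv DJ ^ K * eps d * eps h ^ (E * N)) * (C * TJ \<kappa> ^ (E * N)))"
      using DV eps_EJ[OF d(1)] eps_EJ[OF h] by (intro cg_mult[OF cg_refl cg_sym[OF 1]]) auto
    have b3: "(mon Xv DJ ^ K * eps d * eps h ^ (E * N)) * (C * TJ \<kappa> ^ (E * N)) = (mon Xv DJ ^ K * C) * (eps d * (eps h * TJ \<kappa>) ^ (E * N))"
      by (simp only: power_mult_distrib mult_ac)
    have a1: "cg (eps ?g) ((mon Xv DJ ^ K * C) * (eps d * (eps h * TJ \<kappa>) ^ (E * N)))"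
      unfolding b1 b3[symmetric] by (rule b2)
    have a2: "cg ((mon Xv DJ ^ K * C) * (eps d * (eps h * TJ \<kappa>) ^ (E * N))) ((mon Xv DJ ^ K * C) * (q0 * eps g ^ (E * N)))"
      using DV CV by (intro cg_mult[OF cg_refl q0(2)]) auto
    have a3: "cg ((mon Xv DJ ^ K * (C * q0)) * eps g ^ (E * N)) ((\<Sum>\<tau>\<in>Box. eps (hh \<tau>) * TJ \<tau>) * eps g ^ (E * N))"
      by (intro cg_mult[OF hh(2)] cg_refl gN)
    have a4: "(\<Sum>\<tau>\<in>Box. eps (hh \<tau>) * TJ \<tau>) * eps g ^ (E * N) = (\<Sum>\<tau>\<in>Box. eps (hh \<tau> * g ^ (E * N)) * TJ \<tau>)"
      unfolding sum_distrib_right by (intro sum.cong) (simp_all only: eps_hom mult_ac)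
    have a5: "(mon Xv DJ ^ K * (C * q0)) * eps g ^ (E * N) = (mon Xv DJ ^ K * C) * (q0 * eps g ^ (E * N))"
      by (simp only: mult_ac)
    from cg_trans[OF cg_trans[OF a1 a2] a3[unfolded a5 a4]]
    have "?g = hh zero_box * g ^ (E * N)"
      by (intro compare_zero_box[OF gE]) (use hh(1) g(1) in auto)
    also have "\<dots> = (hh zero_box * const c ^ (E * N)) * prod_list ps ^ (E * N)"
      unfolding c(3) by (simp only: power_mult_distrib mult_ac)
    finally show ?thesis unfolding L_def s_def by blast
  qed
  have "\<exists>M. prod_list ps dvd mon Xv DJ ^ M * h"
    by (rule dvd_of_power_relations[OF finite_atMost d(2) _ _ _ E_def c(2) rel])
       (use ki irreducible_ell ell_not_dvd in auto)
  then obtain M q where "mon Xv DJ ^ M * h = prod_list ps * q" by (auto simp: dvd_def)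
  then have "mon Xv DJ ^ M * h = (const (inverse c) * q) * (const c * prod_list ps)" using c(1)
    by (simp add: mult_ac) (simp flip: mult.assoc const_hom)
  then have eq: "mon Xv DJ ^ M * h = (const (inverse c) * q) * g" by (simp only: c(3))
  show ?thesis
  proof (cases "h = 0")
    case True
    then show ?thesis by (intro exI[of _ 0] bexI[of _ 0]) simp_all
  next
    case False
    have "mon Xv DJ \<noteq> 0" by (metis mon_Xv keys_single keys_zero insert_not_empty zero_neq_one)
    then have "(const (inverse c) * q) * g \<noteq> 0" using False by (simp flip: eq)
    moreover have "(const (inverse c) * q) * g \<in> Pring EJ" unfolding eq[symmetric] using mon_DJ_EJ h by auto
    ultimately have "const (inverse c) * q \<in> Pring EJ" using Pring_factor by blast
    then show ?thesis using eq by blast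
  qed
qed

text \<open>Averaging shows that each basis component of \<open>a\<close> is almost integral over
  the same denominator. The finitely many powers of \<open>mon Xv DJ\<close> needed for the
  components have a common bound.\<close>

lemma almost_integral_DJ_eps:
  assumes g: "g \<in> Pring EJ" "g \<noteq> 0" and ai: "almost_integral (eps g) a"
  shows "\<exists>M. \<exists>q\<in>Pring V. cg (mon Xv DJ ^ M * a) (q * eps g)"
proof -
  have aV: "a \<in> Pring V" using ai by (simp add: almost_integral_def)
  have DV: "mon Xv DJ \<in> Pring V" using A_DJ A_V by blast
  obtain K h where h: "\<And>\<kappa>. \<kappa> \<in> Box \<Longrightarrow> h \<kappa> \<in> Pring EJ" "cg (mon Xv DJ ^ K * a) (\<Sum>\<kappa>\<in>Box. eps (h \<kappa>) * TJ \<kappa>)"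
    using decomposition[OF aV] by blast
  have ai': "almost_integral (eps g) (\<Sum>\<kappa>\<in>Box. eps (h \<kappa>) * TJ \<kappa>)"
    by (rule almost_integral_cg[OF almost_integral_mult[OF Pring_power[OF DV] ai] h(2)])
  have "almost_integral (eps g) (eps (h \<kappa>) * TJ \<kappa>)" if \<kappa>: "\<kappa> \<in> Box" for \<kappa>
  proof -
    have "almost_integral (eps g) (rs (\<lambda>\<mu>. \<forall>i\<in>{..r}. lk \<mu> (T i (J i)) mod l i (J i) = \<kappa> i) (\<Sum>\<kappa>\<in>Box. eps (h \<kappa>) * TJ \<kappa>))"
    proof (rule almost_integral_parts[OF _ _ _ ai'])
      fix i assume "i \<in> {..r}"
      then show "0 < l i (J i) \<and> \<kappa> i < l i (J i)" using \<kappa> e_pos unfolding Box_def e_def by (auto dest: PiE_mem)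
    next
      fix i and \<zeta> :: complex assume "\<zeta> ^ l i (J i) = 1"
      then show "scale (T i (J i)) \<zeta> (eps g) = eps g" using scale_eps[OF _ g(1)] by (simp add: e_def)
    qed simp
    moreover have "rs (\<lambda>\<mu>. \<forall>i\<in>{..r}. lk \<mu> (T i (J i)) mod l i (J i) = \<kappa> i) (\<Sum>\<kappa>\<in>Box. eps (h \<kappa>) * TJ \<kappa>) = eps (h \<kappa>) * TJ \<kappa>"
      by (intro part_TJ h(1) \<kappa>)
    ultimately show ?thesis by (simp only:)
  qed
  then have "\<exists>M. \<exists>q\<in>Pring EJ. mon Xv DJ ^ M * h \<kappa> = q * g" if "\<kappa> \<in> Box" for \<kappa>
    using almost_integral_component[OF g h(1)] that by blast
  then obtain M q where Mq: "\<And>\<kappa>. \<kappa> \<in> Box \<Longrightarrow> q \<kappa> \<in> Pring EJ" "\<And>\<kappa>. \<kappa> \<in> Box \<Longrightarrow> mon Xv DJ ^ M \<kappa> * h \<kappa> = q \<kappa> * g" by metis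
  define S where "S = (\<Sum>\<kappa>\<in>Box. M \<kappa>)"
  define Q where "Q = (\<Sum>\<kappa>\<in>Box. eps (mon Xv DJ ^ (S - M \<kappa>) * q \<kappa>) * TJ \<kappa>)"
  have QV: "Q \<in> Pring V" unfolding Q_def using Mq(1) mon_DJ_EJ by (intro Pring_sum Pring_mult eps_EJ TJ_V) auto
  have eD: "eps (mon Xv DJ ^ k) = mon Xv DJ ^ k" for k by (simp add: eps_hom eps_mon ks_DJ)
  have "mon Xv DJ ^ S * (\<Sum>\<kappa>\<in>Box. eps (h \<kappa>) * TJ \<kappa>) = Q * eps g"
    unfolding Q_def sum_distrib_left sum_distrib_right
  proof (rule sum.cong)
    fix \<kappa> assume \<kappa>: "\<kappa> \<in> Box"
    then have "M \<kappa> \<le> S" unfolding S_def using finite_Box by (intro member_le_sum) auto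
    then have "mon Xv DJ ^ S = mon Xv DJ ^ (S - M \<kappa>) * mon Xv DJ ^ M \<kappa>" by (simp flip: power_add)
    then have "mon Xv DJ ^ S * h \<kappa> = (mon Xv DJ ^ (S - M \<kappa>) * q \<kappa>) * g" using Mq(2)[OF \<kappa>] by (simp only: mult.assoc)
    then have "eps (mon Xv DJ ^ S * h \<kappa>) = eps ((mon Xv DJ ^ (S - M \<kappa>) * q \<kappa>) * g)" by (rule arg_cong)
    then have eq: "mon Xv DJ ^ S * eps (h \<kappa>) = eps (mon Xv DJ ^ (S - M \<kappa>) * q \<kappa>) * eps g"
      by (simp only: eps_hom(4) eD)
    have "mon Xv DJ ^ S * (eps (h \<kappa>) * TJ \<kappa>) = (mon Xv DJ ^ S * eps (h \<kappa>)) * TJ \<kappa>" by (simp only: mult.assoc)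
    also have "\<dots> = eps (mon Xv DJ ^ (S - M \<kappa>) * q \<kappa>) * TJ \<kappa> * eps g" unfolding eq by (simp only: mult_ac)
    finally show "mon Xv DJ ^ S * (eps (h \<kappa>) * TJ \<kappa>) = eps (mon Xv DJ ^ (S - M \<kappa>) * q \<kappa>) * TJ \<kappa> * eps g" .
  qed simp
  moreover have "cg (mon Xv DJ ^ S * (mon Xv DJ ^ K * a)) (mon Xv DJ ^ S * (\<Sum>\<kappa>\<in>Box. eps (h \<kappa>) * TJ \<kappa>))"
    by (intro cg_mult[OF cg_refl h(2)] Pring_power DV)
  ultimately have "cg (mon Xv DJ ^ (S + K) * a) (Q * eps g)" by (simp only: power_add mult.assoc)
  then show ?thesis using QV by blast
qed

text \<open>Extends the fraction by a cofactor \<open>f'\<close> that brings the denominator into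
  the ring of the chart; \<open>f'\<close> is cancelled at the end.\<close>

lemma almost_integral_DJ:
  assumes b: "b \<notin> I" and ai: "almost_integral b a"
  shows "\<exists>M. \<exists>q\<in>Pring V. cg (mon Xv DJ ^ M * a) (q * b)"
proof -
  obtain \<delta> where d: "\<delta> \<in> Pring V" "\<delta> \<notin> I" "\<And>N. \<exists>q\<in>Pring V. cg (\<delta> * a ^ N) (q * b ^ N)"
    using ai unfolding almost_integral_def by blast
  have V: "a \<in> Pring V" "b \<in> Pring V" using ai by (auto simp: almost_integral_def)
  obtain g f' where g: "g \<in> Pring EJ" "g \<noteq> 0" "f' \<in> Pring V" "cg (b * f') (eps g)"
    using ex_multiple[OF V(2) b] by blast
  have "\<exists>q\<in>Pring V. cg (\<delta> * (a * f') ^ N) (q * eps g ^ N)" for N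
  proof -
    obtain q where q: "q \<in> Pring V" "cg (\<delta> * a ^ N) (q * b ^ N)" using d(3) by blast
    have 1: "cg ((\<delta> * a ^ N) * f' ^ N) ((q * b ^ N) * f' ^ N)" using g(3) by (intro cg_mult[OF q(2) cg_refl]) auto
    have 2: "cg (q * (b * f') ^ N) (q * eps g ^ N)" by (intro cg_mult cg_refl q(1) cg_power g(4))
    have "cg (\<delta> * (a * f') ^ N) (q * eps g ^ N)"
      by (rule cg_trans[OF _ 2]) (use 1 in \<open>simp only: power_mult_distrib mult_ac\<close>)
    then show ?thesis using q(1) by blast
  qed
  moreover have "a * f' \<in> Pring V" "eps g \<in> Pring V" using V(1) g eps_EJ by auto
  ultimately have "almost_integral (eps g) (a * f')" unfolding almost_integral_def using d(1,2) by blast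
  from almost_integral_DJ_eps[OF g(1,2) this] obtain M q where q: "q \<in> Pring V" "cg (mon Xv DJ ^ M * (a * f')) (q * eps g)" by blast
  have DV: "mon Xv DJ ^ M \<in> Pring V" using A_DJ A_V by blast
  have f'I: "f' \<notin> I"
  proof
    assume "f' \<in> I"
    then have "b * f' \<in> I" by (rule ideal_mult[OF ideal_I _ V(2)])
    then show False using cg_in_I[OF g(4)] eps_not_I[OF g(1,2)] by blast
  qed
  have "cg (mon Xv DJ ^ M * (a * f')) (q * (b * f'))"
    by (rule cg_trans[OF q(2)]) (intro cg_mult cg_refl q(1) cg_sym[OF g(4)])
  then have "cg (f' * (mon Xv DJ ^ M * a)) (f' * (q * b))" by (simp only: mult_ac)
  then have "cg (mon Xv DJ ^ M * a) (q * b)"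
    by (rule cg_cancel[OF g(3) f'I, rotated -1]) (use DV V q(1) in auto)
  then show ?thesis using q(1) by blast
qed

end

section \<open>Normality\<close>

context arrangement
begin

lemma homog_component: "f \<in> Pring V \<Longrightarrow> homog V L (rs (\<lambda>\<mu>. kc \<mu> = kc \<mu>0) f)" if \<mu>0: "ks \<mu>0 \<subseteq> V"
  unfolding homog_def hom_of_deg_def
  by (intro bexI[of _ "expvec \<mu>0"] conjI rs_Pring)
     (use \<mu>0 in \<open>auto simp: ks_rs kc_eq ZV_def expvec_def in_keys_iff\<close>)

lemma homog_mon: "ks \<beta> \<subseteq> V \<Longrightarrow> homog V L (mon Xv \<beta>)"
  unfolding homog_def hom_of_deg_def mon_Xv
  by (intro bexI[of _ "expvec \<beta>"]) (auto simp: ZV_def expvec_def in_keys_iff L_0)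

lemma Xv_not_dvd_mon:
  assumes t: "t \<in> V" "t \<notin> ks \<beta>" and \<beta>: "ks \<beta> \<subseteq> V" shows "\<not> quot_dvd V I (Xv t) (mon Xv \<beta>)"
proof
  assume "quot_dvd V I (Xv t) (mon Xv \<beta>)"
  then have d: "quot_dvd V I (Xv t) (mon Xv \<beta> * eps 1)" by (simp add: eps_hom)
  show False
  proof (cases t)
    case (T i j)
    then have i: "i \<le> r" using t by simp
    have "ell i dvd 1" by (rule T_dvdD[of i j \<beta> 1]) (use t \<beta> d T in auto)
    then show False using irreducible_ell[OF i] by (auto simp: irreducible_def)
  next
    case (S k)
    have "(1::mpoly) = 0" by (rule S_dvdD[of k \<beta> 1]) (use t \<beta> d S in auto)
    then show False by simp
  qed
qed

text \<open>A variable is so far known to be prime only for homogeneous elements, so the cofactor is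
  projected along and primality is applied to each component of \<open>u\<close>.\<close>

lemma Xv_dvd_cancel:
  assumes t: "t \<in> V" "t \<notin> ks \<beta>" and \<beta>: "ks \<beta> \<subseteq> V" and u: "u \<in> Pring V"
    and d: "quot_dvd V I (Xv t) (mon Xv \<beta> * u)"
  shows "quot_dvd V I (Xv t) u"
proof -
  obtain q where q: "q \<in> Pring V" "mon Xv \<beta> * u - q * Xv t \<in> I" using d by (auto simp: quot_dvd_def)
  have comp: "\<exists>q\<in>Pring V. cg (rs (\<lambda>\<mu>. kc \<mu> = \<kappa>) u) (q * Xv t)" if "\<kappa> \<in> kc ` ks u" for \<kappa>
  proof -
    obtain \<mu>0 where \<mu>0: "\<mu>0 \<in> ks u" "\<kappa> = kc \<mu>0" using \<open>\<kappa> \<in> kc ` ks u\<close> by blast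
    have \<mu>V: "ks \<mu>0 \<subseteq> V" using \<mu>0(1) u by (auto simp: Pring_def)
    let ?u = "rs (\<lambda>\<mu>. kc \<mu> = kc \<mu>0) u"
    let ?q = "rs (\<lambda>\<mu>. kc (sg t 1 + \<mu>) = kc (\<beta> + \<mu>0)) q"
    have 1: "rs (\<lambda>\<mu>. kc \<mu> = kc (\<beta> + \<mu>0)) (sg \<beta> 1 * u) = sg \<beta> 1 * ?u"
      by (rule rs_shift) (simp add: kc_add)
    have 2: "rs (\<lambda>\<mu>. kc \<mu> = kc (\<beta> + \<mu>0)) (sg (sg t 1) 1 * q) = sg (sg t 1) 1 * ?q"
      by (rule rs_shift) simp
    have "rs (\<lambda>\<mu>. kc \<mu> = kc (\<beta> + \<mu>0)) (mon Xv \<beta> * u - q * Xv t) = mon Xv \<beta> * ?u - ?q * Xv t"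
      unfolding rs_diff mult.commute[of q] mon_Xv Xv_def 1 2 by (simp only: mult.commute)
    then have "mon Xv \<beta> * ?u - ?q * Xv t \<in> I" using rs_kc_I[OF q(2), of "kc (\<beta> + \<mu>0)"] by (simp only:)
    then have "quot_dvd V I (Xv t) (mon Xv \<beta> * ?u)" unfolding quot_dvd_def using rs_Pring[OF q(1)] by blast
    then have "quot_dvd V I (Xv t) ?u"
      using K_prime_Xv[OF t(1)] homog_mon[OF \<beta>] homog_component[OF \<mu>V u] Xv_not_dvd_mon[OF t \<beta>]
      unfolding K_prime_def by blast
    then obtain q' where "q' \<in> Pring V" "?u - q' * Xv t \<in> I" by (auto simp: quot_dvd_def)
    moreover from this(1) have "q' * Xv t \<in> Pring V" using t(1) by (intro Pring_mult) simp_all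
    ultimately show ?thesis using rs_Pring[OF u] unfolding cg_def \<mu>0(2) by blast
  qed
  then obtain Q where Q: "\<And>\<kappa>. \<kappa> \<in> kc ` ks u \<Longrightarrow> Q \<kappa> \<in> Pring V"
    "\<And>\<kappa>. \<kappa> \<in> kc ` ks u \<Longrightarrow> cg (rs (\<lambda>\<mu>. kc \<mu> = \<kappa>) u) (Q \<kappa> * Xv t)" by metis
  have "cg (\<Sum>\<kappa>\<in>kc ` ks u. rs (\<lambda>\<mu>. kc \<mu> = \<kappa>) u) (\<Sum>\<kappa>\<in>kc ` ks u. Q \<kappa> * Xv t)" by (intro cg_sum Q(2))
  then have "cg u ((\<Sum>\<kappa>\<in>kc ` ks u. Q \<kappa>) * Xv t)" by (simp only: sum_rs_classes sum_distrib_right)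
  moreover have "(\<Sum>\<kappa>\<in>kc ` ks u. Q \<kappa>) \<in> Pring V" by (intro Pring_sum Q(1))
  ultimately show ?thesis by (rule quot_dvdI[rotated])
qed

text \<open>The regular sequence property for monomials without common variable, obtained by
  stripping one variable of \<open>\<alpha>\<close> at a time.\<close>

lemma mon_dvd_cancel:
  assumes \<alpha>: "ks \<alpha> \<subseteq> V - ks \<beta>" and \<beta>: "ks \<beta> \<subseteq> V"
  shows "\<forall>u\<in>Pring V. quot_dvd V I (mon Xv \<alpha>) (mon Xv \<beta> * u) \<longrightarrow> quot_dvd V I (mon Xv \<alpha>) u"
  using \<alpha>
proof (induction \<alpha> rule: monomial_induct)
  case zero
  show ?case
    by (intro ballI impI, rule quot_dvdI) (auto simp: cg_refl)
next
  case (add v \<nu>)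
  show ?case
  proof (intro ballI impI)
    fix u assume u: "u \<in> Pring V" and d: "quot_dvd V I (mon Xv (sg v 1 + \<nu>)) (mon Xv \<beta> * u)"
    have V: "v \<in> V" "v \<notin> ks \<beta>" "ks \<nu> \<subseteq> V" using add by auto
    have XV: "Xv v \<in> Pring V" "mon Xv \<nu> \<in> Pring V" "mon Xv \<beta> \<in> Pring V" using V mon_V[OF \<beta>] mon_V[OF V(3)] by auto
    have me: "mon Xv (sg v 1 + \<nu>) = Xv v * mon Xv \<nu>" by (simp add: mon_add)
    obtain q where q: "q \<in> Pring V" "mon Xv \<beta> * u - q * (Xv v * mon Xv \<nu>) \<in> I"
      using d unfolding quot_dvd_def me by blast
    have c1: "cg (mon Xv \<beta> * u) (q * (Xv v * mon Xv \<nu>))" using q XV u by (auto simp: cg_def intro!: Pring_mult)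
    have "quot_dvd V I (Xv v) (mon Xv \<beta> * u)"
      by (rule quot_dvdI[of "q * mon Xv \<nu>"]) (use q XV c1 in \<open>auto simp: mult_ac\<close>)
    then have "quot_dvd V I (Xv v) u" by (rule Xv_dvd_cancel[OF V(1,2) \<beta> u])
    then obtain u' where u': "u' \<in> Pring V" "u - u' * Xv v \<in> I" by (auto simp: quot_dvd_def)
    have c2: "cg u (u' * Xv v)" using u' u XV by (auto simp: cg_def)
    have "cg (mon Xv \<beta> * (u' * Xv v)) (mon Xv \<beta> * u)" by (intro cg_mult[OF cg_refl cg_sym[OF c2]] XV)
    from cg_trans[OF this c1] have "cg (Xv v * (mon Xv \<beta> * u')) (Xv v * (q * mon Xv \<nu>))" by (simp only: mult_ac)
    then have "cg (mon Xv \<beta> * u') (q * mon Xv \<nu>)"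
      by (rule cg_cancel[OF XV(1) Xv_not_I[OF V(1)], rotated -1]) (use XV u' q in auto)
    from quot_dvdI[OF q(1) this] have "quot_dvd V I (mon Xv \<nu>) u'" using add u'(1) by blast
    then obtain q' where q': "q' \<in> Pring V" "u' - q' * mon Xv \<nu> \<in> I" by (auto simp: quot_dvd_def)
    then have "cg u' (q' * mon Xv \<nu>)" using u' XV by (auto simp: cg_def)
    from cg_trans[OF c2 cg_mult[OF this cg_refl[OF XV(1)]]]
    have "cg u (q' * (Xv v * mon Xv \<nu>))" by (simp only: mult_ac)
    then show "quot_dvd V I (mon Xv (sg v 1 + \<nu>)) u" unfolding me by (rule quot_dvdI[OF q'(1)])
  qed
qed

lemma mon_not_I: assumes "ks \<mu> \<subseteq> V" shows "mon Xv \<mu> \<notin> I"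
proof
  assume "mon Xv \<mu> \<in> I"
  then have "mon Xv \<mu> * eps 1 \<in> I" by (simp add: eps_hom)
  from mon_eps_in_I[OF assms _ this] show False by simp
qed

definition mon_denominator :: "mpoly \<Rightarrow> mpoly \<Rightarrow> (var \<Rightarrow>\<^sub>0 nat) \<Rightarrow> bool" where
  "mon_denominator a b \<mu> \<longleftrightarrow> ks \<mu> \<subseteq> V \<and> (\<exists>q\<in>Pring V. cg (mon Xv \<mu> * a) (q * b))"

text \<open>Comparing the two fractions gives \<open>mon Xv \<beta> * q\<close> congruent to
  \<open>q' * mon Xv \<alpha>\<close>. As the two monomials share no variable,
  \<open>mon Xv \<alpha>\<close> divides \<open>q\<close> and can be cancelled.\<close>

lemma mon_denominator_gcd:
  assumes a: "a \<in> Pring V" and b: "b \<in> Pring V" "b \<notin> I"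
    and \<mu>: "mon_denominator a b (\<gamma> + \<alpha>)" and \<nu>: "mon_denominator a b (\<gamma> + \<beta>)" and dis: "ks \<alpha> \<inter> ks \<beta> = {}"
  shows "mon_denominator a b \<gamma>"
proof -
  obtain q where q: "q \<in> Pring V" "cg (mon Xv (\<gamma> + \<alpha>) * a) (q * b)" using \<mu> by (auto simp: mon_denominator_def)
  obtain q' where q': "q' \<in> Pring V" "cg (mon Xv (\<gamma> + \<beta>) * a) (q' * b)" using \<nu> by (auto simp: mon_denominator_def)
  have sub: "ks \<gamma> \<subseteq> V" "ks \<alpha> \<subseteq> V" "ks \<beta> \<subseteq> V"
    using \<mu> \<nu> by (auto simp: mon_denominator_def in_keys_iff lookup_add subset_eq)
  note mV = mon_V[OF sub(1)] mon_V[OF sub(2)] mon_V[OF sub(3)]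
  have 1: "cg (mon Xv \<beta> * (mon Xv (\<gamma> + \<alpha>) * a)) (mon Xv \<beta> * (q * b))" by (intro cg_mult cg_refl mV q)
  have 2: "cg (mon Xv \<alpha> * (mon Xv (\<gamma> + \<beta>) * a)) (mon Xv \<alpha> * (q' * b))" by (intro cg_mult cg_refl mV q')
  have e: "mon Xv \<beta> * (mon Xv (\<gamma> + \<alpha>) * a) = mon Xv \<alpha> * (mon Xv (\<gamma> + \<beta>) * a)" by (simp only: mon_add mult_ac)
  have "cg (mon Xv \<beta> * (q * b)) (mon Xv \<alpha> * (q' * b))"
    by (rule cg_trans[OF cg_sym[OF 1]]) (use 2 in \<open>simp only: e\<close>)
  then have "cg (b * (mon Xv \<beta> * q)) (b * (q' * mon Xv \<alpha>))" by (simp only: mult_ac)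
  then have "cg (mon Xv \<beta> * q) (q' * mon Xv \<alpha>)"
    by (rule cg_cancel[OF b, rotated -1]) (use mV q q' in auto)
  from quot_dvdI[OF q'(1) this] have "quot_dvd V I (mon Xv \<alpha>) q"
    using mon_dvd_cancel[of \<alpha> \<beta>] sub dis q(1) by blast
  then obtain p where p: "p \<in> Pring V" "q - p * mon Xv \<alpha> \<in> I" by (auto simp: quot_dvd_def)
  have "cg q (p * mon Xv \<alpha>)" using p q mV by (auto simp: cg_def)
  from cg_trans[OF q(2) cg_mult[OF this cg_refl[OF b(1)]]]
  have "cg (mon Xv \<alpha> * (mon Xv \<gamma> * a)) (mon Xv \<alpha> * (p * b))" by (simp only: mon_add mult_ac)
  then have "cg (mon Xv \<gamma> * a) (p * b)"
    by (rule cg_cancel[OF mV(2) mon_not_I[OF sub(2)], rotated -1]) (use mV a b p in auto)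
  then show ?thesis unfolding mon_denominator_def using sub p by blast
qed

lemma mon_denominator_avoiding:
  assumes b: "b \<notin> I" and ai: "almost_integral b a"
  shows "\<exists>\<nu>. mon_denominator a b \<nu> \<and> v \<notin> ks \<nu>"
proof -
  \<comment> \<open>If \<open>v\<close> belongs to a block it is made the selected variable, and
    \<open>DJ\<close> contains no selected variable; any other \<open>v\<close> is absent from
    \<open>DJ\<close> anyway.\<close>
  define J where "J = (\<lambda>i. case v of T k j \<Rightarrow> if i = k \<and> 1 \<le> j \<and> j \<le> n i then j else 1 | S k \<Rightarrow> 1)"
  interpret sel: selection r m n l Jc lam J
    by unfold_locales (use n_pos in \<open>auto simp: J_def Suc_le_eq split: var.splits\<close>)
  obtain M q where q: "q \<in> Pring V" "cg (mon Xv sel.DJ ^ M * a) (q * b)" using sel.almost_integral_DJ[OF b ai] by blast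
  define \<nu> where "\<nu> = (\<Sum>k<M. sel.DJ)"
  have lkn: "lk \<nu> u = M * lk sel.DJ u" for u by (simp add: \<nu>_def lookup_sum)
  then have "ks \<nu> \<subseteq> V" using sel.ks_DJ by (auto simp: in_keys_iff subset_eq)
  moreover have "mon Xv \<nu> = mon Xv sel.DJ ^ M" unfolding \<nu>_def by (simp add: mon_sum)
  moreover have "lk sel.DJ v = 0"
    unfolding sel.DJ_def lookup_sum
    by (intro sum.neutral ballI) (auto simp: lookup_single when_def J_def split: var.splits)
  then have "v \<notin> ks \<nu>" by (simp add: in_keys_iff lkn)
  ultimately show ?thesis unfolding mon_denominator_def using q by metis
qed

text \<open>Take a monomial denominator of \<open>a / b\<close> of least degree. If a variable
  occurred in it, its greatest common divisor with a denominator avoiding that variable would be a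
  smaller one.\<close>

lemma normal_I: "quot_normal V I"
  unfolding quot_normal_def
proof (intro ballI impI)
  fix a b assume a: "a \<in> Pring V" and b: "b \<in> Pring V" "b \<notin> I"
    and "\<exists>d cs. 0 < d \<and> (\<forall>i<d. cs i \<in> Pring V) \<and> a ^ d + (\<Sum>i<d. cs i * a ^ i * b ^ (d - i)) \<in> I"
  then obtain d cs where "\<And>i. i < d \<Longrightarrow> cs i \<in> Pring V" "a ^ d + (\<Sum>i<d. cs i * a ^ i * b ^ (d - i)) \<in> I" by blast
  then have ai: "almost_integral b a" by (intro almost_integral_integral[OF a b])
  obtain \<mu>0 where "mon_denominator a b \<mu>0" using mon_denominator_avoiding[OF b(2) ai] by blast
  then obtain \<mu> where \<mu>: "mon_denominator a b \<mu>" "\<And>\<nu>. mon_denominator a b \<nu> \<Longrightarrow> wt (\<lambda>_. 1) \<mu> \<le> wt (\<lambda>_. 1) \<nu>"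
    using ex_has_least_nat[of "mon_denominator a b" \<mu>0 "wt (\<lambda>_. 1)"] by blast
  have "\<mu> = 0"
  proof (rule ccontr)
    assume "\<mu> \<noteq> 0"
    then obtain v where v: "v \<in> ks \<mu>" by (metis all_not_in_conv keys_eq_empty)
    obtain \<nu> where \<nu>: "mon_denominator a b \<nu>" "v \<notin> ks \<nu>" using mon_denominator_avoiding[OF b(2) ai] by blast
    \<comment> \<open>Subtraction of exponents is truncated, so this is the componentwise minimum of
      \<open>\<mu>\<close> and \<open>\<nu>\<close>.\<close>
    define \<gamma> where "\<gamma> = \<mu> - (\<mu> - \<nu>)"
    have e1: "\<mu> = \<gamma> + (\<mu> - \<nu>)" and e2: "\<nu> = \<gamma> + (\<nu> - \<mu>)"
      by (auto intro!: poly_mapping_eqI simp: \<gamma>_def lookup_add lookup_minus)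
    have "mon_denominator a b \<gamma>"
      by (rule mon_denominator_gcd[OF a b, of _ "\<mu> - \<nu>" "\<nu> - \<mu>"])
         (use \<mu>(1) \<nu>(1) e1 e2 in \<open>auto simp: in_keys_iff lookup_minus\<close>)
    then have "wt (\<lambda>_. 1) (\<gamma> + (\<mu> - \<nu>)) \<le> wt (\<lambda>_. 1) \<gamma>" using \<mu>(2) e1 by metis
    then have "wt (\<lambda>_. 1) (\<mu> - \<nu>) = 0" by (simp add: wt_add)
    then have "\<mu> - \<nu> = 0" by (intro wt_eq_0[of _ "\<lambda>_. 1"]) auto
    then have "lk \<mu> v \<le> lk \<nu> v" by (metis diff_is_0_eq lookup_minus lookup_zero)
    then show False using v \<nu>(2) by (simp add: in_keys_iff)
  qed
  then obtain q where "q \<in> Pring V" "cg a (q * b)" using \<mu>(1) by (auto simp: mon_denominator_def)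
  then show "\<exists>q\<in>Pring V. a - q * b \<in> I" by (auto simp: cg_def)
qed

end

section \<open>From the matrix to the arrangement\<close>

text \<open>\<open>Jc\<close> is a smallest set of columns on which the rows stay independent.
  Dropping column \<open>j\<close> leaves a nonzero combination of rows vanishing on the other
  chosen columns, which after normalization is the dual vector \<open>U j\<close>. Counting unknowns
  gives the cardinality and the joint injectivity of the \<open>U j\<close>.\<close>

lemma dual_basis:
  fixes A :: "nat \<Rightarrow> nat \<Rightarrow> complex"
  assumes fr: "\<forall>u :: nat \<Rightarrow> complex. (\<forall>j\<le>r. (\<Sum>i\<le>c. u i * A i j) = 0) \<longrightarrow> (\<forall>i\<le>c. u i = 0)"
  shows "\<exists>Jc U. Jc \<subseteq> {..r} \<and> card Jc = Suc c \<and>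
    (\<forall>j\<in>Jc. \<forall>k\<in>Jc. (\<Sum>a\<le>c. U j a * A a k) = (if k = j then 1 else 0)) \<and>
    (\<forall>w. (\<forall>j\<in>Jc. (\<Sum>a\<le>c. U j a * w a) = 0) \<longrightarrow> (\<forall>a\<le>c. w a = 0))"
proof -
  define G where "G = (\<lambda>X. \<forall>u :: nat \<Rightarrow> complex. (\<forall>j\<in>X. (\<Sum>i\<le>c. u i * A i j) = 0) \<longrightarrow> (\<forall>i\<le>c. u i = 0))"
  have "{..r} \<subseteq> {..r} \<and> G {..r}" using fr by (auto simp: G_def)
  then obtain Jc where Jc: "Jc \<subseteq> {..r}" "G Jc" "\<And>X. X \<subseteq> {..r} \<Longrightarrow> G X \<Longrightarrow> card Jc \<le> card X"
    using ex_has_least_nat[of "\<lambda>X. X \<subseteq> {..r} \<and> G X" "{..r}" card] by blast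
  have fJ: "finite Jc" using Jc(1) finite_subset by blast
  have "\<exists>u. \<forall>k\<in>Jc. (\<Sum>a\<le>c. u a * A a k) = (if k = j then 1 else 0)" if j: "j \<in> Jc" for j
  proof -
    have "card (Jc - {j}) < card Jc" using j fJ by (rule card_Diff1_less[rotated])
    then have "\<not> G (Jc - {j})" using Jc(1) Jc(3)[of "Jc - {j}"] by auto
    then obtain u i where u: "\<forall>k\<in>Jc - {j}. (\<Sum>i\<le>c. u i * A i k) = 0" "i \<le> c" "u i \<noteq> 0"
      unfolding G_def by blast
    define s where "s = (\<Sum>i\<le>c. u i * A i j)"
    have "s \<noteq> 0"
    proof
      assume "s = 0"
      then have "\<forall>k\<in>Jc. (\<Sum>i\<le>c. u i * A i k) = 0" using u(1) unfolding s_def by blast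
      then show False using Jc(2) u unfolding G_def by blast
    qed
    have "(\<Sum>a\<le>c. u a / s * A a k) = (if k = j then 1 else 0)" if "k \<in> Jc" for k
    proof -
      have "(\<Sum>a\<le>c. u a / s * A a k) = (\<Sum>i\<le>c. u i * A i k) / s" by (simp add: sum_divide_distrib)
      then show ?thesis using u(1) that \<open>s \<noteq> 0\<close> by (auto simp: s_def)
    qed
    then show ?thesis by (intro exI[of _ "\<lambda>a. u a / s"] ballI)
  qed
  then have "\<forall>j. \<exists>u. j \<in> Jc \<longrightarrow> (\<forall>k\<in>Jc. (\<Sum>a\<le>c. u a * A a k) = (if k = j then 1 else 0))" by blast
  then obtain U where "\<forall>j. j \<in> Jc \<longrightarrow> (\<forall>k\<in>Jc. (\<Sum>a\<le>c. U j a * A a k) = (if k = j then 1 else 0))"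
    by (rule choice[THEN exE])
  then have U: "\<And>j k. j \<in> Jc \<Longrightarrow> k \<in> Jc \<Longrightarrow> (\<Sum>a\<le>c. U j a * A a k) = (if k = j then 1 else 0)" by blast
  have dual: "(\<Sum>a\<le>c. U j a * (\<Sum>k\<in>Jc. A a k * x k)) = x j" if j: "j \<in> Jc" for j x
  proof -
    have "(\<Sum>a\<le>c. U j a * (\<Sum>k\<in>Jc. A a k * x k)) = (\<Sum>k\<in>Jc. (\<Sum>a\<le>c. U j a * A a k) * x k)"
      unfolding sum_distrib_left sum_distrib_right by (subst sum.swap) (simp only: mult.assoc)
    also have "\<dots> = (\<Sum>k\<in>Jc. if k = j then x j else 0)" by (intro sum.cong) (auto simp: U j)
    finally show ?thesis using j fJ by simp
  qed
  have "\<not> card Jc < card {..c}"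
  proof
    assume "card Jc < card {..c}"
    from homogeneous_system[OF subring_UNIV fJ finite_atMost this, of "\<lambda>j a. A a j"]
    obtain x where "\<exists>a\<le>c. x a \<noteq> 0" "\<forall>j\<in>Jc. (\<Sum>a\<le>c. A a j * x a) = 0" by auto
    then show False using Jc(2) unfolding G_def by (auto simp: mult.commute)
  qed
  moreover have "\<not> card {..c} < card Jc"
  proof
    assume "card {..c} < card Jc"
    from homogeneous_system[OF subring_UNIV finite_atMost fJ this, of A]
    obtain x where x: "\<exists>k\<in>Jc. x k \<noteq> 0" "\<forall>a\<le>c. (\<Sum>k\<in>Jc. A a k * x k) = 0" by auto
    have "x j = 0" if "j \<in> Jc" for j using dual[OF that, of x] x(2) by simp
    then show False using x(1) by blast
  qed
  ultimately have cJ: "card Jc = Suc c" by simp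
  have "\<forall>a\<le>c. w a = 0" if w: "\<forall>j\<in>Jc. (\<Sum>a\<le>c. U j a * w a) = 0" for w
  proof -
    \<comment> \<open>\<open>Suc r\<close> is a fresh index under which \<open>w\<close> is appended
      as a further column; \<open>c + 2\<close> columns of length \<open>c + 1\<close> are
      dependent.\<close>
    have nin: "Suc r \<notin> Jc" using Jc(1) by auto
    then have "card {..c} < card (insert (Suc r) Jc)" using cJ fJ by simp
    from homogeneous_system[OF subring_UNIV finite_atMost finite.insertI[OF fJ] this, of "\<lambda>a k. if k = Suc r then w a else A a k"]
    obtain x where x: "\<exists>k\<in>insert (Suc r) Jc. x k \<noteq> 0"
      "\<forall>a\<le>c. (\<Sum>k\<in>insert (Suc r) Jc. (if k = Suc r then w a else A a k) * x k) = 0" by auto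
    have eq: "w a * x (Suc r) + (\<Sum>k\<in>Jc. A a k * x k) = 0" if "a \<le> c" for a
    proof -
      have "(\<Sum>k\<in>Jc. (if k = Suc r then w a else A a k) * x k) = (\<Sum>k\<in>Jc. A a k * x k)"
        using nin by (intro sum.cong) auto
      then show ?thesis using x(2) that fJ nin by (auto simp: sum.insert)
    qed
    have "x j = 0" if j: "j \<in> Jc" for j
    proof -
      have "0 = (\<Sum>a\<le>c. U j a * (w a * x (Suc r) + (\<Sum>k\<in>Jc. A a k * x k)))" by (simp add: eq)
      also have "\<dots> = (\<Sum>a\<le>c. U j a * w a) * x (Suc r) + (\<Sum>a\<le>c. U j a * (\<Sum>k\<in>Jc. A a k * x k))"
        by (simp only: distrib_left sum.distrib sum_distrib_right mult.assoc)
      finally show ?thesis using w j dual[OF j, of x] by simp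
    qed
    then have "x (Suc r) \<noteq> 0" "\<And>a. a \<le> c \<Longrightarrow> w a * x (Suc r) = 0" using x(1) eq by auto
    then show ?thesis by simp
  qed
  then show ?thesis using Jc(1) cJ U by blast
qed

theorem theorem2p6:
  fixes r c m :: nat and n :: "nat \<Rightarrow> nat" and l :: "nat \<Rightarrow> nat \<Rightarrow> nat"
    and A :: "nat \<Rightarrow> nat \<Rightarrow> complex"
  assumes "0 < c" and "c \<le> r"
    and "\<forall>i\<le>r. 0 < n i"
    and "\<forall>i\<le>r. \<forall>j. 1 \<le> j \<and> j \<le> n i \<longrightarrow> 0 < l i j"
    and full_rank: "\<forall>u :: nat \<Rightarrow> complex. (\<forall>j\<le>r. (\<Sum>i\<le>c. u i * A i j) = 0) \<longrightarrow> (\<forall>i\<le>c. u i = 0)"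
    and pairwise_indep: "\<forall>j\<le>r. \<forall>k\<le>r. j \<noteq> k \<longrightarrow>
           (\<forall>\<alpha> \<beta> :: complex. (\<forall>i\<le>c. \<alpha> * A i j + \<beta> * A i k = 0) \<longrightarrow> \<alpha> = 0 \<and> \<beta> = 0)"
  shows "quot_integral (vars r n m) (IAP c r n m l A)
       \<and> quot_normal (vars r n m) (IAP c r n m l A)
       \<and> quot_complete_intersection (vars r n m) (IAP c r n m l A)
       \<and> krull_dim (vars r n m) (IAP c r n m l A) = (\<Sum>i\<le>r. n i) + m - r + c
       \<and> units_are_constants (vars r n m) (IAP c r n m l A)
       \<and> grading_effective (vars r n m) (imP0 r n l) (IAP c r n m l A)
       \<and> grading_pointed (vars r n m) (imP0 r n l) (IAP c r n m l A)
       \<and> K_factorial (vars r n m) (imP0 r n l) (IAP c r n m l A)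
       \<and> grading_complexity (vars r n m) (imP0 r n l) (IAP c r n m l A) = int c"
proof -
  obtain Jc U where Jc: "Jc \<subseteq> {..r}" "card Jc = Suc c"
    and U: "\<forall>j\<in>Jc. \<forall>k\<in>Jc. (\<Sum>a\<le>c. U j a * A a k) = (if k = j then 1 else 0)"
    and Uinj: "\<And>w. (\<forall>j\<in>Jc. (\<Sum>a\<le>c. U j a * w a) = 0) \<Longrightarrow> \<forall>a\<le>c. w a = 0"
    using dual_basis[OF full_rank] by blast
  \<comment> \<open>The dual vectors read off the coordinates of each column in the basis
    \<open>Jc\<close>.\<close>
  define lam where "lam = (\<lambda>i j. \<Sum>a\<le>c. U j a * A a i)"
  interpret X: arrangement r m n l Jc lam
  proof
    show "Jc \<subseteq> {..r}" "2 \<le> card Jc" using Jc assms(1) by auto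
    show "0 < n i" if "i \<le> r" for i using assms(3) that by blast
    show "0 < l i j" if "i \<le> r" "1 \<le> j" "j \<le> n i" for i j using assms(4) that by blast
    show "lam i j = (if i = j then 1 else 0)" if "i \<in> Jc" "j \<in> Jc" for i j
      using U that unfolding lam_def by blast
    fix i k \<alpha> \<beta> assume ik: "i \<le> r" "k \<le> r" "i \<noteq> k" and lc: "\<forall>j\<in>Jc. \<alpha> * lam i j + \<beta> * lam k j = 0"
    have "\<forall>j\<in>Jc. (\<Sum>a\<le>c. U j a * (\<alpha> * A a i + \<beta> * A a k)) = 0"
    proof
      fix j assume "j \<in> Jc"
      have "(\<Sum>a\<le>c. U j a * (\<alpha> * A a i + \<beta> * A a k)) = \<alpha> * lam i j + \<beta> * lam k j"
        unfolding lam_def sum_distrib_left sum.distrib[symmetric] by (intro sum.cong) (simp_all add: algebra_simps)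
      then show "(\<Sum>a\<le>c. U j a * (\<alpha> * A a i + \<beta> * A a k)) = 0" using lc \<open>j \<in> Jc\<close> by simp
    qed
    from Uinj[OF this] show "\<alpha> = 0 \<and> \<beta> = 0" using pairwise_indep ik by blast
  qed
  have lv: "(\<Sum>i\<le>r. v i * lam i j) = (\<Sum>a\<le>c. U j a * (\<Sum>i\<le>r. A a i * v i))" for v j
    unfolding lam_def sum_distrib_left by (subst sum.swap) (simp only: mult_ac)
  \<comment> \<open>Joint injectivity of the \<open>U j\<close> makes the equations in coordinates
    equivalent to those given by the rows of \<open>A\<close>.\<close>
  have ker: "kerA c r A = X.kerL"
    unfolding kerA_def X.kerL_def lv using Uinj[of "\<lambda>a. \<Sum>i\<le>r. A a i * _ i"] by (auto simp del: mult_eq_0_iff)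
  have I: "IAP c r n m l A = X.I"
    unfolding IAP_def X.I_def ker ..
  show ?thesis
    unfolding I quot_integral_def
    using X.prime_I X.normal_I X.complete_intersection_I X.krull_dim_I X.units_I X.effective_I
      X.pointed_I X.factorial_I X.complexity_I X.card_V_ge
    by (simp add: Jc X.card_V)
qed

end
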